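(* Let $\mathbb{K}$ be an algebraically closed field. (i) For every integer $n\ge 3$, the Schubert problem $a_\bullet=(1^n,n-2)$ (that is, $n$ entries equal to $1$ followed by one entry $n-2$) in $\mathbb{G}(1,\mathbb{P}^n)$ has Galois group $\mathcal{G}(a_\bullet)$ equal to the full symmetric group on its set of solutions. (ii) For every integer $a\ge 2$, the Schubert problem $a_\bullet=((a-1)^4)=(a-1,a-1,a-1,a-1)$ in $\mathbb{G}(1,\mathbb{P}^{2a-1})$ has Galois group $\mathcal{G}(a_\bullet)$ equal to the full symmetric group on its set of solutions.
   Context: $\mathbb{G}(1,\mathbb{P}^n)=\mathbb{G}(1,n)$ is the Grassmannian of lines in $\mathbb{P}^n$. For a linear subspace $L\subset\mathbb{P}^n$ put $\Omega_L:=\{\ell\in\mathbb{G}(1,n)\mid \ell\cap L\ne\emptyset\}$. A Schubert problem $a_\bullet=(a_1,\dots,a_m)$ is a list of positive integers with even sum; put $n=n(a_\bullet):=\frac12(a_1+\cdots+a_m+2)$; it is valid if $a_i\le n(a_\bullet)-1$ for all $i$. Let $X$ be the set of tuples $(L_1,\dots,L_m)$ of linear subspaces of $\mathbb{P}^n$ with $\dim L_i=n-1-a_i$ (a product of Grassmannians), let $W:=\{(\ell,L_1,\dots,L_m)\in\mathbb{G}(1,n)\times X\mid \ell\cap L_i\ne\emptyset,\ i=1,\dots,m\}$, and let $\mathrm{pr}\colon W\to X$ be the projection. Its fiber over $(L_1,\dots,L_m)$ is $\Omega_{L_1}\cap\cdots\cap\Omega_{L_m}$, the set of solutions, and for general $(L_1,\dots,L_m)$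 it consists of $d=K(a_\bullet)$ points. The Galois group $\mathcal{G}(a_\bullet)=\mathcal{G}_{W\to X}$: let $W^{(d)}$ be the $d$-fold fiber product $W\times_X\cdots\times_X W$ minus its big diagonal (the locus where two coordinates agree), and let $x\in X$ be a point such that $\mathrm{pr}^{-1}(x)$ consists of $d$ distinct points $w_1,\dots,w_d$. Then $\mathcal{G}_{W\to X}$ is the group of permutations $\sigma\in\mathcal{S}_d$ for which $(w_1,\dots,w_d)$ and $(w_{\sigma(1)},\dots,w_{\sigma(d)})$ lie in the same component of $W^{(d)}$. *)

theory Defs
  imports
    "HOL-Analysis.Abstract_Topology"
    "HOL-Library.Function_Algebras"
    "HOL-Library.Poly_Mapping"
    "HOL-Combinatorics.Permutations"
    "HOL-Computational_Algebra.Polynomial"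
    "Jordan_Normal_Form.Determinant"
begin

section \<open>Linear subspaces of projective space\<close>

text \<open>
  Vectors are functions on the natural numbers, so that the dimension can vary inside a formula;
  the space with homogeneous coordinates \<open>x\<^sub>0, \<dots>, x\<^sub>n\<close> consists of the functions
  vanishing beyond \<open>n\<close>.
\<close>

definition vscale :: "'k::field \<Rightarrow> (nat \<Rightarrow> 'k) \<Rightarrow> nat \<Rightarrow> 'k" where
  "vscale c v = (\<lambda>i. c * v i)"

interpretation kvec: vector_space "vscale :: 'k::field \<Rightarrow> (nat \<Rightarrow> 'k) \<Rightarrow> nat \<Rightarrow> 'k"
  by unfold_locales (auto simp: vscale_def fun_eq_iff algebra_simps)

definition coord_space :: "nat \<Rightarrow> (nat \<Rightarrow> 'k::field) set" where
  "coord_space n = {v. \<forall>i>n. v i = 0}"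

text \<open>
  A linear subspace of \<open>P\<^sup>n\<close> is identified with the vector subspace over it, so projective
  dimension \<open>k\<close> is vector space dimension \<open>k + 1\<close>, and two linear subspaces have a point in
  common iff the vector subspaces share a nonzero vector.
\<close>

definition grassmannian :: "nat \<Rightarrow> nat \<Rightarrow> (nat \<Rightarrow> 'k::field) set set" where
  "grassmannian k n = {V. kvec.subspace V \<and> V \<subseteq> coord_space n \<and> kvec.dim V = k + 1}"

definition meets :: "(nat \<Rightarrow> 'k::field) set \<Rightarrow> (nat \<Rightarrow> 'k) set \<Rightarrow> bool" where
  "meets U V \<longleftrightarrow> (\<exists>v. v \<noteq> 0 \<and> v \<in> U \<and> v \<in> V)"


section \<open>Products of Grassmannians and their Zariski topology\<close>

definition multi_grassmannian :: "nat \<Rightarrow> nat list \<Rightarrow> (nat \<Rightarrow> 'k::field) set list set" where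
  "multi_grassmannian n ks = {Vs. list_all2 (\<lambda>V k. V \<in> grassmannian k n) Vs ks}"

definition ordered_basis :: "(nat \<Rightarrow> 'k::field) list \<Rightarrow> (nat \<Rightarrow> 'k) set \<Rightarrow> bool" where
  "ordered_basis bs V \<longleftrightarrow> distinct bs \<and> kvec.independent (set bs) \<and> kvec.span (set bs) = V"

definition pluecker :: "(nat \<Rightarrow> 'k::field) list \<Rightarrow> nat list \<Rightarrow> 'k" where
  "pluecker bs I = det (mat (length bs) (length bs) (\<lambda>(r, c). (bs ! r) (I ! c)))"

text \<open>
  Polynomials in the Pluecker coordinates: the variable \<open>(i, I)\<close> stands for the coordinate with
  index \<open>I = [c\<^sub>0 < \<dots> < c\<^sub>k]\<close> on the \<open>i\<close>-th factor.
\<close>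

type_synonym 'k pluecker_poly = "((nat \<times> nat list) \<Rightarrow>\<^sub>0 nat) \<Rightarrow>\<^sub>0 'k"

definition pluecker_vars :: "nat \<Rightarrow> nat list \<Rightarrow> (nat \<times> nat list) set" where
  "pluecker_vars n ks =
     {(i, I). i < length ks \<and> length I = ks ! i + 1 \<and> sorted_wrt (<) I \<and> set I \<subseteq> {..n}}"

definition poly_eval :: "(nat \<times> nat list \<Rightarrow> 'k::field) \<Rightarrow> 'k pluecker_poly \<Rightarrow> 'k" where
  "poly_eval x F =
     (\<Sum>m\<in>Poly_Mapping.keys F. Poly_Mapping.lookup F m *
        (\<Prod>v\<in>Poly_Mapping.keys m. x v ^ Poly_Mapping.lookup m v))"

definition multihomogeneous :: "nat \<Rightarrow> nat list \<Rightarrow> 'k::field pluecker_poly \<Rightarrow> bool" where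
  "multihomogeneous n ks F \<longleftrightarrow>
     (\<forall>m\<in>Poly_Mapping.keys F. Poly_Mapping.keys m \<subseteq> pluecker_vars n ks) \<and>
     (\<exists>e :: nat \<Rightarrow> nat. \<forall>m\<in>Poly_Mapping.keys F. \<forall>i<length ks.
        (\<Sum>v\<in>{v \<in> Poly_Mapping.keys m. fst v = i}. Poly_Mapping.lookup m v) = e i)"

text \<open>
  Changing the bases \<open>bss\<close> rescales the Pluecker coordinates of each factor by a nonzero constant,
  so for multihomogeneous \<open>F\<close> the choice of bases is immaterial.
\<close>

definition nonvanishing_locus ::
    "nat \<Rightarrow> nat list \<Rightarrow> 'k::field pluecker_poly \<Rightarrow> (nat \<Rightarrow> 'k) set list set" where
  "nonvanishing_locus n ks F =
     {Vs \<in> multi_grassmannian n ks.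
        \<exists>bss. list_all2 ordered_basis bss Vs \<and> poly_eval (\<lambda>(i, I). pluecker (bss ! i) I) F \<noteq> 0}"

text \<open>
  The closed sets are the common zero loci of families of multihomogeneous polynomials. This is the
  Zariski topology of the product variety, not the product of the Zariski topologies.
\<close>

definition zariski :: "nat \<Rightarrow> nat list \<Rightarrow> (nat \<Rightarrow> 'k::field) set list topology" where
  "zariski n ks = topology_generated_by (nonvanishing_locus n ks ` {F. multihomogeneous n ks F})"

definition irreducible_in :: "'a topology \<Rightarrow> 'a set \<Rightarrow> bool" where
  "irreducible_in T S \<longleftrightarrow> S \<subseteq> topspace T \<and> S \<noteq> {} \<and>
     (\<forall>A B. closedin T A \<and> closedin T B \<and> S \<subseteq> A \<union> B \<longrightarrow> S \<subseteq> A \<or> S \<subseteq> B)"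

definition irreducible_component :: "'a topology \<Rightarrow> 'a set \<Rightarrow> bool" where
  "irreducible_component T C \<longleftrightarrow>
     irreducible_in T C \<and> (\<forall>S. irreducible_in T S \<and> C \<subseteq> S \<longrightarrow> S = C)"


section \<open>Schubert problems on Grassmannians of lines\<close>

definition schubert_problem :: "nat list \<Rightarrow> bool" where
  "schubert_problem a \<longleftrightarrow> (\<forall>x\<in>set a. 0 < x) \<and> even (sum_list a)"

definition ambient_dim :: "nat list \<Rightarrow> nat" where
  "ambient_dim a = (sum_list a + 2) div 2"

definition valid_problem :: "nat list \<Rightarrow> bool" where
  "valid_problem a \<longleftrightarrow> schubert_problem a \<and> (\<forall>x\<in>set a. x \<le> ambient_dim a - 1)"

definition condition_dims :: "nat list \<Rightarrow> nat list" where
  "condition_dims a = map (\<lambda>x. ambient_dim a - 1 - x) a"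

definition schubert_X :: "nat list \<Rightarrow> (nat \<Rightarrow> 'k::field) set list set" where
  "schubert_X a = multi_grassmannian (ambient_dim a) (condition_dims a)"

definition schubert_W :: "nat list \<Rightarrow> ((nat \<Rightarrow> 'k::field) set \<times> (nat \<Rightarrow> 'k) set list) set" where
  "schubert_W a = {(l, Ls). l \<in> grassmannian 1 (ambient_dim a) \<and> Ls \<in> schubert_X a \<and>
                            (\<forall>L\<in>set Ls. meets l L)}"

definition solutions :: "nat list \<Rightarrow> (nat \<Rightarrow> 'k::field) set list \<Rightarrow> (nat \<Rightarrow> 'k) set set" where
  "solutions a Ls = {l. (l, Ls) \<in> schubert_W a}"

text \<open>\<open>d\<close> is the number \<open>K(a)\<close>: over a nonempty Zariski open set, all fibres have \<open>d\<close> points.\<close>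

definition general_solution_count :: "'k::field itself \<Rightarrow> nat list \<Rightarrow> nat \<Rightarrow> bool" where
  "general_solution_count K a d \<longleftrightarrow>
     (\<exists>U. openin (zariski (ambient_dim a) (condition_dims a)) U \<and> U \<noteq> {} \<and>
          (\<forall>Ls\<in>U. finite (solutions a Ls :: (nat \<Rightarrow> 'k) set set) \<and> card (solutions a Ls) = d))"

text \<open>
  A point \<open>((l\<^sub>1, Ls), \<dots>, (l\<^sub>d, Ls))\<close> of the fibre product over \<open>X\<close> is written as the
  concatenated list \<open>[l\<^sub>1, \<dots>, l\<^sub>d] @ Ls\<close>. The locus where two coordinates agree is removed
  by \<open>distinct\<close>.
\<close>

definition fiber_power :: "nat list \<Rightarrow> nat \<Rightarrow> (nat \<Rightarrow> 'k::field) set list set" where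
  "fiber_power a d = {ls @ Ls | ls Ls. length ls = d \<and> distinct ls \<and> Ls \<in> schubert_X a \<and>
                                       (\<forall>l\<in>set ls. (l, Ls) \<in> schubert_W a)}"

definition fiber_power_space :: "nat list \<Rightarrow> nat \<Rightarrow> (nat \<Rightarrow> 'k::field) set list topology" where
  "fiber_power_space a d =
     subtopology (zariski (ambient_dim a) (replicate d 1 @ condition_dims a)) (fiber_power a d)"

definition enumerates_fiber ::
    "nat list \<Rightarrow> nat \<Rightarrow> (nat \<Rightarrow> 'k::field) set list \<Rightarrow> (nat \<Rightarrow> 'k) set list \<Rightarrow> bool" where
  "enumerates_fiber a d Ls ws \<longleftrightarrow>
     Ls \<in> schubert_X a \<and> length ws = d \<and> distinct ws \<and> set ws = solutions a Ls"

text \<open>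
  The Galois group computed at the point \<open>Ls\<close> of \<open>X\<close>, with its fibre enumerated as \<open>ws\<close>. Elements of
  the symmetric group are permutations of \<open>{..<d}\<close>; components are irreducible components.
\<close>

definition galois_group ::
    "nat list \<Rightarrow> (nat \<Rightarrow> 'k::field) set list \<Rightarrow> (nat \<Rightarrow> 'k) set list \<Rightarrow> (nat \<Rightarrow> nat) set" where
  "galois_group a Ls ws =
     {\<sigma>. \<sigma> permutes {..<length ws} \<and>
          (\<exists>C. irreducible_component (fiber_power_space a (length ws)) C \<and>
               ws @ Ls \<in> C \<and> permute_list \<sigma> ws @ Ls \<in> C)}"

text \<open>
  The number \<open>d\<close> of solutions to the general instance exists, and the Galois group is the full
  symmetric group whichever point of \<open>X\<close> with \<open>d\<close> solutions and whichever enumeration of them is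
  used to compute it.
\<close>

definition full_symmetric_galois_group :: "'k::field itself \<Rightarrow> nat list \<Rightarrow> bool" where
  "full_symmetric_galois_group K a \<longleftrightarrow>
     (\<exists>d. general_solution_count K a d \<and>
          (\<forall>(Ls :: (nat \<Rightarrow> 'k) set list) ws. enumerates_fiber a d Ls ws \<longrightarrow>
             galois_group a Ls ws = {\<sigma>. \<sigma> permutes {..<d}}))"

end

theory Submission imports Defs begin

text \<open>
  The Galois group is full as soon as all enumerations of all fibres with \<open>d\<close> points lie in one
  irreducible subset of the fibre product: such a subset is contained in a single component
  (\<open>irreducible_imp_component\<close>), and permuting an enumeration of a fibre gives another one.

  The irreducible set is \<open>Conf\<close>. In both families the number \<open>d\<close> of solutions equals the vector space
  dimension of every condition subspace, except for the condition line \<open>M\<close> in the first family.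
  So one may choose the \<open>d\<close> lines first, in the first family through \<open>d\<close> points of \<open>M\<close>, then a point
  on each of them for each condition subspace, and take the subspaces spanned by these points. All
  choices have free parameters, so two configurations of this kind are joined by a rational curve of
  such configurations, and \<open>Conf\<close> is irreducible (\<open>Conf_irreducible\<close>).

  It remains to show that every fibre with exactly \<open>d\<close> points arises in this way, that is, the points
  in which the \<open>d\<close> solutions meet a condition subspace are linearly independent. Both families use the
  same idea: a dependency can be moved along the solutions, and so produces infinitely many of them.
  In the first family, solutions through \<open>p = f + s e\<close> on \<open>M\<close> are spanned by \<open>p\<close> and a vector \<open>u\<close>
  subject to equations that are linear in \<open>u\<close> and in \<open>s\<close>. A relation \<open>\<Sum> c\<^sub>k u\<^sub>k \<in> M\<close> among the solutions
  at the points \<open>s\<^sub>k\<close> is turned by the coefficients \<open>c\<^sub>k / (s - s\<^sub>k)\<close> into a solution through the point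
  with parameter \<open>s\<close>, for every other \<open>s\<close> (\<open>indep_mod_M\<close>). In the second family the cross ratio of the
  four points on a solution takes the role of \<open>s\<close>. It is injective on the solutions
  (\<open>cross_injective\<close>), and a relation is moved to the solutions of cross ratio \<open>c\<close> for almost every \<open>c\<close>
  (\<open>move_relation\<close>).

  Finally, a general fibre does have \<open>d\<close> points. On a chart of the product of Grassmannians the
  solutions correspond to the eigenlines of a pencil of \<open>d \<times> d\<close> matrices with polynomial entries
  (\<open>count_first\<close>, \<open>count_second\<close>). Where the discriminant of its characteristic polynomial does not
  vanish there are \<open>d\<close> of them, and diagonal pencils show that this open set is not empty.
\<close>

section \<open>Families of vectors\<close>

lemma vscale_apply [simp]: "vscale c v x = c * v x"
  by (simp add: vscale_def)

lemma uminus_fun_apply' [simp]: "(- f) x = - (f x :: 'a :: ab_group_add)"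
  by (simp add: fun_Compl_def)

lemma minus_fun_apply' [simp]: "(f - g) x = f x - (g x :: 'a :: ab_group_add)"
  by (simp add: fun_diff_def)

lemma sum_fun_apply': "(\<Sum>i\<in>A. f i) x = (\<Sum>i\<in>A. f i x :: 'a :: comm_monoid_add)"
  by (induction A rule: infinite_finite_induct) auto

definition lcomb :: "nat \<Rightarrow> (nat \<Rightarrow> 'k) \<Rightarrow> (nat \<Rightarrow> nat \<Rightarrow> 'k::field) \<Rightarrow> nat \<Rightarrow> 'k" where
  "lcomb m c v = (\<lambda>x. \<Sum>k<m. c k * v k x)"

definition fam_indep :: "nat \<Rightarrow> (nat \<Rightarrow> nat \<Rightarrow> 'k::field) \<Rightarrow> bool" where
  "fam_indep m v \<longleftrightarrow> (\<forall>c. lcomb m c v = 0 \<longrightarrow> (\<forall>k<m. c k = 0))"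

lemma lcomb_eq_sum: "lcomb m c v = (\<Sum>k<m. vscale (c k) (v k))"
  by (simp add: lcomb_def fun_eq_iff sum_fun_apply')

lemma fam_indepD: "fam_indep m v \<Longrightarrow> lcomb m c v = 0 \<Longrightarrow> k < m \<Longrightarrow> c k = 0"
  by (auto simp: fam_indep_def)

lemma fam_indep_inj: assumes "fam_indep m v" shows "inj_on v {..<m}"
proof (rule inj_onI)
  fix i j assume ij: "i \<in> {..<m}" "j \<in> {..<m}" "v i = v j"
  show "i = j"
  proof (rule ccontr)
    assume ne: "i \<noteq> j"
    let ?c = "\<lambda>k. if k = i then 1 else if k = j then - 1 else 0 :: 'a"
    have "lcomb m ?c v = 0"
    proof (rule ext)
      fix x
      have "lcomb m ?c v x = (\<Sum>k<m. (if k = i then v i x else 0) + (if k = j then - v j x else 0))"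
        unfolding lcomb_def using ne by (intro sum.cong) auto
      also have "\<dots> = v i x - v j x"
        using ij by (simp add: sum.distrib)
      finally show "lcomb m ?c v x = 0 x" using ij by simp
    qed
    from fam_indepD[OF assms this, of i] ij show False by simp
  qed
qed

lemma fam_indep_iff:
  "fam_indep m v \<longleftrightarrow> inj_on v {..<m} \<and> kvec.independent (v ` {..<m})"
proof
  assume a: "fam_indep m v"
  have inj: "inj_on v {..<m}" by (rule fam_indep_inj[OF a])
  have "kvec.independent (v ` {..<m})"
  proof (rule kvec.independent_if_scalars_zero)
    fix f x assume s: "(\<Sum>x\<in>v ` {..<m}. vscale (f x) x) = 0" and x: "x \<in> v ` {..<m}"
    have "lcomb m (f \<circ> v) v = 0"
      using s by (simp add: lcomb_eq_sum sum.reindex[OF inj] o_def)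
    from fam_indepD[OF a this] x show "f x = 0" by auto
  qed auto
  with inj show "inj_on v {..<m} \<and> kvec.independent (v ` {..<m})" by simp
next
  assume a: "inj_on v {..<m} \<and> kvec.independent (v ` {..<m})"
  show "fam_indep m v" unfolding fam_indep_def
  proof safe
    fix c k assume c: "lcomb m c v = 0" and k: "k < m"
    define u where "u = c \<circ> the_inv_into {..<m} v"
    have u: "u (v k) = c k" if "k < m" for k
      using the_inv_into_f_f[of v "{..<m}" k] a that by (simp add: u_def)
    have "(\<Sum>x\<in>v ` {..<m}. vscale (u x) x) = 0"
      using a c by (simp add: sum.reindex lcomb_eq_sum u)
    moreover have "finite (v ` {..<m})" by simp
    ultimately have "\<forall>x\<in>v ` {..<m}. u x = 0"
      using a kvec.dependent_finite[of "v ` {..<m}"] by blast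
    with u k show "c k = 0" by auto
  qed
qed

lemma lcomb_in_subspace:
  assumes "kvec.subspace V" "\<And>k. k < m \<Longrightarrow> v k \<in> V"
  shows "lcomb m c v \<in> V"
  unfolding lcomb_eq_sum using assms by (intro kvec.subspace_sum kvec.subspace_scale) auto

lemma span_family: "kvec.span (v ` {..<m}) = {lcomb m c v | c. True}"
proof (intro Set.set_eqI iffI)
  fix x assume "x \<in> kvec.span (v ` {..<m})"
  then show "x \<in> {lcomb m c v | c. True}"
  proof (induction rule: kvec.span_induct_alt)
    case base
    have "lcomb m (\<lambda>_. 0) v = 0" by (simp add: lcomb_def fun_eq_iff)
    then show ?case unfolding mem_Collect_eq by (intro exI[of _ "\<lambda>_. 0"]) simp
  next
    case (step c x y)
    then obtain k d where k: "k < m" "x = v k" and y: "y = lcomb m d v" by auto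
    have "vscale c x + y = lcomb m (\<lambda>i. d i + (if i = k then c else 0)) v"
    proof (rule ext)
      fix z
      have "lcomb m (\<lambda>i. d i + (if i = k then c else 0)) v z
        = (\<Sum>i<m. d i * v i z + (if i = k then c * v k z else 0))"
        unfolding lcomb_def by (intro sum.cong) (auto simp: algebra_simps)
      then show "(vscale c x + y) z = lcomb m (\<lambda>i. d i + (if i = k then c else 0)) v z"
        using k y by (simp add: sum.distrib lcomb_def)
    qed
    then show ?case by blast
  qed
next
  fix x assume "x \<in> {lcomb m c v | c. True}"
  then obtain c where "x = lcomb m c v" by auto
  then show "x \<in> kvec.span (v ` {..<m})"
    using lcomb_in_subspace[of "kvec.span (v ` {..<m})" m v c] by (simp add: kvec.subspace_span kvec.span_base)
qed

lemma dim_family: "fam_indep m v \<Longrightarrow> kvec.dim (kvec.span (v ` {..<m})) = m"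
  using kvec.dim_span_eq_card_independent[of "v ` {..<m}"] by (simp add: fam_indep_iff card_image del: kvec.dim_span)

lemma subspace_coord_space: "kvec.subspace (coord_space n)"
  by (auto simp: kvec.subspace_def coord_space_def)

lemma span_family_grassmannian:
  assumes "fam_indep (Suc m) v" "\<And>k. k < Suc m \<Longrightarrow> v k \<in> coord_space n"
  shows "kvec.span (v ` {..<Suc m}) \<in> grassmannian m n"
  unfolding grassmannian_def
  using assms dim_family[OF assms(1)] kvec.span_minimal[OF _ subspace_coord_space, of "v ` {..<Suc m}" n]
  by auto

lemma grassmannian_basis:
  assumes "V \<in> grassmannian m n"
  obtains v where "fam_indep (Suc m) v" "kvec.span (v ` {..<Suc m}) = V"
proof -
  from assms have sub: "kvec.subspace V" and dim: "kvec.dim V = Suc m" by (auto simp: grassmannian_def)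
  obtain B where B: "B \<subseteq> V" "kvec.independent B" "V \<subseteq> kvec.span B" "card B = kvec.dim V"
    using kvec.basis_exists[of V] by blast
  have fin: "finite B" using B(4) dim by (metis card.infinite nat.distinct(1))
  have "card B = Suc m" using B dim by simp
  then obtain v where v: "bij_betw v {..<Suc m} B"
    using ex_bij_betw_nat_finite[OF fin] by (auto simp: atLeast0LessThan)
  have im: "v ` {..<Suc m} = B" using v by (simp add: bij_betw_def)
  have "fam_indep (Suc m) v"
    using v B im by (simp add: fam_indep_iff bij_betw_def)
  moreover have "kvec.span (v ` {..<Suc m}) = V"
    unfolding im using B kvec.span_minimal[OF B(1) sub] by auto
  ultimately show ?thesis using that by blast
qed

lemma grassmannian_indep_le:
  assumes "V \<in> grassmannian k n" "fam_indep m v" "\<And>i. i < m \<Longrightarrow> v i \<in> V"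
  shows "m \<le> Suc k"
proof -
  obtain b where b: "fam_indep (Suc k) b" "kvec.span (b ` {..<Suc k}) = V"
    using grassmannian_basis[OF assms(1)] by blast
  have "card (v ` {..<m}) \<le> card (b ` {..<Suc k})"
    using kvec.independent_span_bound[of "b ` {..<Suc k}" "v ` {..<m}"] assms(2,3) b
    by (auto simp: fam_indep_iff)
  also have "card (b ` {..<Suc k}) = Suc k"
    using b by (simp add: card_image fam_indep_iff)
  also have "card (v ` {..<m}) = m"
    using assms by (simp add: card_image fam_indep_iff)
  finally show ?thesis .
qed

lemma grassmannian_span_eq:
  assumes "V \<in> grassmannian m n" "fam_indep (Suc m) v" "\<And>i. i < Suc m \<Longrightarrow> v i \<in> V"
  shows "kvec.span (v ` {..<Suc m}) = V"
proof -
  have sub: "kvec.subspace V" using assms by (simp add: grassmannian_def)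
  have 1: "kvec.span (v ` {..<Suc m}) \<subseteq> V"
    using assms sub by (intro kvec.span_minimal) auto
  have "x \<in> kvec.span (v ` {..<Suc m})" if x: "x \<in> V" for x
  proof (rule ccontr)
    assume n: "x \<notin> kvec.span (v ` {..<Suc m})"
    define w where "w = v(Suc m := x)"
    have im: "w ` {..<Suc (Suc m)} = insert x (v ` {..<Suc m})"
      by (auto simp: w_def lessThan_Suc)
    have wv: "w ` {..<Suc m} = v ` {..<Suc m}" by (auto simp: w_def)
    have "inj_on w {..<Suc (Suc m)}"
    proof -
      have "inj_on w {..<Suc m}" using assms(2) by (auto simp: fam_indep_iff w_def inj_on_def)
      moreover have "w (Suc m) \<notin> w ` {..<Suc m}"
        unfolding wv using n kvec.span_base[of x "v ` {..<Suc m}"] by (auto simp: w_def)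
      ultimately show ?thesis by (simp add: lessThan_Suc[of "Suc m"])
    qed
    moreover have "kvec.independent (w ` {..<Suc (Suc m)})"
      unfolding im using assms(2) n using kvec.independent_insertI by (auto simp: fam_indep_iff)
    ultimately have "fam_indep (Suc (Suc m)) w" by (simp add: fam_indep_iff)
    moreover have "w i \<in> V" if "i < Suc (Suc m)" for i
      using that assms x by (auto simp: w_def less_Suc_eq)
    ultimately have "Suc (Suc m) \<le> Suc m" by (rule grassmannian_indep_le[OF assms(1)])
    then show False by simp
  qed
  with 1 show ?thesis by auto
qed

lemma set_conv_image_nth: "set xs = (\<lambda>k. xs ! k) ` {..<length xs}"
  by (auto simp: set_conv_nth)

lemma ordered_basis_iff:
  "ordered_basis bs V \<longleftrightarrow>
     fam_indep (length bs) (\<lambda>k. bs ! k) \<and> kvec.span ((\<lambda>k. bs ! k) ` {..<length bs}) = V"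
  unfolding ordered_basis_def fam_indep_iff set_conv_image_nth[symmetric]
  by (auto simp: distinct_conv_nth inj_on_def)

lemma ordered_basis_map:
  "ordered_basis (map v [0..<m]) V \<longleftrightarrow> fam_indep m v \<and> kvec.span (v ` {..<m}) = V"
proof -
  have "lcomb m c (\<lambda>k. map v [0..<m] ! k) = lcomb m c v" for c
    by (simp add: lcomb_def)
  then show ?thesis
    by (auto simp: ordered_basis_iff fam_indep_def)
qed

lemma multi_grassmannian_bases:
  assumes "Vs \<in> multi_grassmannian n ks"
  obtains bss where "list_all2 ordered_basis bss Vs"
proof -
  have "\<exists>b. ordered_basis b V" if V: "V \<in> set Vs" for V
  proof -
    obtain i where "i < length Vs" "V = Vs ! i" using V by (auto simp: in_set_conv_nth)
    then obtain k where "V \<in> grassmannian k n"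
      using assms unfolding multi_grassmannian_def list_all2_conv_all_nth by blast
    then obtain v where "fam_indep (Suc k) v" "kvec.span (v ` {..<Suc k}) = V"
      by (rule grassmannian_basis)
    then have "ordered_basis (map v [0..<Suc k]) V" by (simp only: ordered_basis_map)
    then show ?thesis ..
  qed
  then obtain f where "\<And>V. V \<in> set Vs \<Longrightarrow> ordered_basis (f V) V" by metis
  then have "list_all2 ordered_basis (map f Vs) Vs"
    by (simp add: list_all2_conv_all_nth)
  then show ?thesis using that by blast
qed

definition unitv :: "nat \<Rightarrow> nat \<Rightarrow> 'k::field" where
  "unitv i = (\<lambda>x. if x = i then 1 else 0)"

lemma lcomb_unitv: "lcomb m c unitv = (\<lambda>x. if x < m then c x else 0)"
proof (rule ext)
  fix x
  have "lcomb m c unitv x = (\<Sum>k<m. if k = x then c k else 0)"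
    unfolding lcomb_def unitv_def by (intro sum.cong) auto
  then show "lcomb m c unitv x = (if x < m then c x else 0)" by simp
qed

lemma fam_indep_unitv: "fam_indep m unitv"
  by (auto simp: fam_indep_def lcomb_unitv fun_eq_iff split: if_splits)

lemma coord_space_grassmannian: "(coord_space n :: (nat \<Rightarrow> 'k::field) set) \<in> grassmannian n n"
proof -
  have "(coord_space n :: (nat \<Rightarrow> 'k) set) = kvec.span (unitv ` {..<Suc n})"
  proof (intro Set.set_eqI iffI)
    fix v :: "nat \<Rightarrow> 'k" assume "v \<in> coord_space n"
    then have "v = lcomb (Suc n) v unitv"
      by (auto simp: lcomb_unitv fun_eq_iff coord_space_def)
    then show "v \<in> kvec.span (unitv ` {..<Suc n})" by (auto simp: span_family)
  next
    fix v :: "nat \<Rightarrow> 'k" assume "v \<in> kvec.span (unitv ` {..<Suc n})"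
    then show "v \<in> coord_space n"
      by (auto simp: lcomb_unitv span_family coord_space_def)
  qed
  then show ?thesis
    using span_family_grassmannian[OF fam_indep_unitv, of n n]
    by (auto simp: coord_space_def unitv_def)
qed

section \<open>Polynomial functions and minors\<close>

text \<open>
  With \<open>G\<close> the identity of the field these are the polynomial functions of one variable, and with
  \<open>G\<close> the set of entries of a tuple of bases they are the regular functions on a chart.
\<close>

inductive pfun :: "('a \<Rightarrow> 'k::field) set \<Rightarrow> ('a \<Rightarrow> 'k) \<Rightarrow> bool" for G where
  const: "pfun G (\<lambda>_. c)"
| gen: "g \<in> G \<Longrightarrow> pfun G g"
| add: "pfun G f \<Longrightarrow> pfun G h \<Longrightarrow> pfun G (\<lambda>x. f x + h x)"
| mult: "pfun G f \<Longrightarrow> pfun G h \<Longrightarrow> pfun G (\<lambda>x. f x * h x)"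

lemma pfun_uminus: "pfun G f \<Longrightarrow> pfun G (\<lambda>x. - f x)"
  using pfun.mult[OF pfun.const[of G "- 1"], of f] by simp

lemma pfun_diff: "pfun G f \<Longrightarrow> pfun G h \<Longrightarrow> pfun G (\<lambda>x. f x - h x)"
  using pfun.add[OF _ pfun_uminus, of G f h] by simp

lemma pfun_sum: "(\<And>i. i \<in> A \<Longrightarrow> pfun G (\<lambda>x. f x i)) \<Longrightarrow> pfun G (\<lambda>x. \<Sum>i\<in>A. f x i)"
  by (induction A rule: infinite_finite_induct) (auto intro: pfun.const pfun.add)

lemma pfun_prod: "(\<And>i. i \<in> A \<Longrightarrow> pfun G (\<lambda>x. f x i)) \<Longrightarrow> pfun G (\<lambda>x. \<Prod>i\<in>A. f x i)"
  by (induction A rule: infinite_finite_induct) (auto intro: pfun.const pfun.mult)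

lemma pfun_power: "pfun G f \<Longrightarrow> pfun G (\<lambda>x. f x ^ k)"
  by (induction k) (auto intro: pfun.const pfun.mult)

lemma pfun_det:
  assumes "\<And>i j. i < n \<Longrightarrow> j < n \<Longrightarrow> pfun G (\<lambda>x. f x i j)"
  shows "pfun G (\<lambda>x. det (mat n n (\<lambda>(i, j). f x i j)))"
proof -
  have "det (mat n n (\<lambda>(i, j). f x i j)) =
      (\<Sum>p\<in>{p. p permutes {0..<n}}. signof p * (\<Prod>i = 0..<n. f x i (p i)))" for x
    by (subst det_def'[of _ n])
       (auto intro!: sum.cong prod.cong arg_cong2[where f = "(*)"] simp: permutes_in_image)
  moreover have "pfun G (\<lambda>x. \<Sum>p\<in>{p. p permutes {0..<n}}. signof p * (\<Prod>i = 0..<n. f x i (p i)))"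
    by (intro pfun_sum pfun.mult pfun_prod pfun.const assms) (auto simp: permutes_in_image)
  ultimately show ?thesis by presburger
qed

lemma pfun_line_poly:
  assumes "pfun {\<lambda>t. t} f" shows "\<exists>p. \<forall>t. f t = poly p (t :: 'k::field)"
  using assms
proof (induction rule: pfun.induct)
  case (const c)
  have "\<forall>t. c = poly [:c:] t" by simp
  then show ?case ..
next
  case (gen g)
  then have "\<forall>t. g t = poly [:0, 1:] t" by simp
  then show ?case ..
next
  case (add f h)
  from add.IH obtain p q where "\<forall>t. f t = poly p t" "\<forall>t. h t = poly q t" by (elim exE)
  then have "\<forall>t. f t + h t = poly (p + q) t" by simp
  then show ?case ..
next
  case (mult f h)
  from mult.IH obtain p q where "\<forall>t. f t = poly p t" "\<forall>t. h t = poly q t" by (elim exE)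
  then have "\<forall>t. f t * h t = poly (p * q) t" by simp
  then show ?case ..
qed

lemma pfun_line_finite_zeros:
  assumes "pfun {\<lambda>t. t} f" "f t0 \<noteq> (0 :: 'k::field)" shows "finite {t. f t = 0}"
proof -
  obtain p where p: "\<And>t. f t = poly p t" using pfun_line_poly[OF assms(1)] by auto
  then have "p \<noteq> 0" using assms(2) by auto
  then show ?thesis using poly_roots_finite[of p] by (simp add: p)
qed

lemma infinite_UNIV_alg_closed: "infinite (UNIV :: 'k::alg_closed_field set)"
proof
  assume fin: "finite (UNIV :: 'k set)"
  define p :: "'k poly" where "p = (\<Prod>a\<in>UNIV. [:- a, 1:]) + 1"
  have "degree (\<Prod>a\<in>(UNIV :: 'k set). [:- a, 1:]) = (\<Sum>a\<in>(UNIV :: 'k set). degree [:- a, 1:])"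
    by (rule degree_prod_eq_sum_degree) auto
  then have d: "degree (\<Prod>a\<in>(UNIV :: 'k set). [:- a, 1:]) > 0"
    using fin by (simp add: card_gt_0_iff)
  then have "degree p > 0" unfolding p_def by (subst degree_add_eq_left) auto
  then obtain x where "poly p x = 0" using alg_closed_imp_poly_has_root by blast
  moreover have "poly (\<Prod>a\<in>(UNIV :: 'k set). [:- a, 1:]) x = 0"
    using fin by (auto simp: poly_prod)
  ultimately show False by (simp add: p_def)
qed

lemma minor_imp_indep:
  assumes "det (mat m m (\<lambda>(r, c). v r (I ! c))) \<noteq> (0 :: 'k::field)"
  shows "fam_indep m v"
  unfolding fam_indep_def
proof safe
  fix c k assume c: "lcomb m c v = 0" and k: "k < m"
  let ?A = "mat m m (\<lambda>(r, c). v r (I ! c))"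
  have A: "?A \<in> carrier_mat m m" by simp
  show "c k = 0"
  proof (rule ccontr)
    assume ck: "c k \<noteq> 0"
    have "transpose_mat ?A *\<^sub>v vec m c = 0\<^sub>v m"
    proof (rule eq_vecI)
      fix i assume i: "i < dim_vec (0\<^sub>v m :: 'k vec)"
      then have "(transpose_mat ?A *\<^sub>v vec m c) $ i = lcomb m c v (I ! i)"
        by (auto simp: scalar_prod_def lcomb_def atLeast0LessThan mult.commute intro!: sum.cong)
      then show "(transpose_mat ?A *\<^sub>v vec m c) $ i = 0\<^sub>v m $ i" using c i by simp
    qed simp
    moreover have "vec m c \<noteq> 0\<^sub>v m" using ck k by (metis index_vec index_zero_vec(1))
    ultimately have "det (transpose_mat ?A) = 0"
      using det_0_iff_vec_prod_zero_field[of "transpose_mat ?A" m] by (metis A transpose_carrier_mat vec_carrier)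
    with assms det_transpose[OF A] show False by simp
  qed
qed

lemma fam_indep_mono: assumes "fam_indep m v" "l \<le> m" shows "fam_indep l v"
  using assms kvec.independent_mono[of "v ` {..<m}" "v ` {..<l}"] image_mono[of "{..<l}" "{..<m}" v]
  by (auto simp: fam_indep_iff intro: inj_on_subset)

text \<open>
  If the matrix with one more row had no nonzero minor of full size, the Laplace expansions along the
  additional column would express a relation among the rows, with a nonzero minor as last coefficient.
\<close>

lemma exists_minor:
  "fam_indep m v \<Longrightarrow> \<exists>I. length I = m \<and> det (mat m m (\<lambda>(r, c). v r (I ! c))) \<noteq> (0 :: 'k::field)"
proof (induction m)
  case 0
  have "det (mat 0 0 (\<lambda>(r, c). v r ([] ! c))) = 1" by (intro det_dim_zero) simp
  then show ?case by (intro exI[of _ "[]"]) simp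
next
  case (Suc m)
  then obtain I where I: "length I = m" "det (mat m m (\<lambda>(r, c). v r (I ! c))) \<noteq> 0"
    using fam_indep_mono[of "Suc m" v m] by auto
  define A where "A c = mat (Suc m) (Suc m) (\<lambda>(r, j). v r ((I @ [c]) ! j))" for c
  define C where "C r = (- 1) ^ (r + m) * det (mat m m (\<lambda>(i, j). v (insert_index r i) (I ! j)))" for r
  have A: "A c \<in> carrier_mat (Suc m) (Suc m)" for c by (simp add: A_def)
  show ?case
  proof (rule ccontr)
    assume no: "\<not> ?thesis"
    have 0: "det (A c) = 0" for c
      using no I(1) unfolding A_def by (metis length_append_singleton)
    have "cofactor (A c) r m = C r" if "r < Suc m" for c r
      unfolding cofactor_def C_def mat_delete_def
      by (rule arg_cong2[where f = "(*)"], simp, rule arg_cong[where f = det], rule eq_matI)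
         (use I that in \<open>auto simp: A_def nth_append insert_index_def\<close>)
    then have "lcomb (Suc m) C v c = det (A c)" for c
      using laplace_expansion_column[OF A, of m c] I
      by (auto simp: lcomb_def A_def nth_append mult.commute intro!: sum.cong)
    then have "lcomb (Suc m) C v = 0" using 0 by auto
    from fam_indepD[OF Suc.prems this, of m] have "C m = 0" by simp
    moreover have "mat m m (\<lambda>(i, j). v (insert_index m i) (I ! j)) = mat m m (\<lambda>(r, c). v r (I ! c))"
      by (rule eq_matI) (auto simp: insert_index_def)
    ultimately show False using I by (simp add: C_def)
  qed
qed

text \<open>
  Independence at one parameter gives a nonvanishing minor, which is a polynomial in the parameter.
\<close>

lemma cofinite_indep:
  assumes "\<And>k x. k < m \<Longrightarrow> pfun {\<lambda>t. t} (\<lambda>t. v t k x)" "fam_indep m (v t0)"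
  shows "finite {t. \<not> fam_indep m (v t)}"
proof -
  obtain I where I: "det (mat m m (\<lambda>(r, c). v t0 r (I ! c))) \<noteq> 0"
    using exists_minor[OF assms(2)] by auto
  have "pfun {\<lambda>t. t} (\<lambda>t. det (mat m m (\<lambda>(r, c). v t r (I ! c))))"
    by (intro pfun_det assms)
  from pfun_line_finite_zeros[OF this I]
  show ?thesis by (rule finite_subset[rotated]) (auto dest: minor_imp_indep)
qed

lemma pluecker_change_basis:
  assumes "ordered_basis bs V" "ordered_basis bs' V"
  shows "length bs' = length bs" "\<exists>c. \<forall>I. length I = length bs \<longrightarrow> pluecker bs' I = c * pluecker bs I"
proof -
  let ?m = "length bs"
  have b: "fam_indep ?m (\<lambda>k. bs ! k)" "kvec.span ((\<lambda>k. bs ! k) ` {..<?m}) = V"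
    and b': "fam_indep (length bs') (\<lambda>k. bs' ! k)" "kvec.span ((\<lambda>k. bs' ! k) ` {..<length bs'}) = V"
    using assms by (auto simp: ordered_basis_iff)
  show len: "length bs' = length bs" using dim_family[OF b(1)] dim_family[OF b'(1)] b(2) b'(2) by simp
  have "\<exists>g. bs' ! r = lcomb ?m g (\<lambda>k. bs ! k)" if "r < ?m" for r
  proof -
    have "bs' ! r \<in> V" 
      using kvec.span_base[of "bs' ! r" "(\<lambda>k. bs' ! k) ` {..<length bs'}"] that b'(2) len by auto
    then show ?thesis unfolding b(2)[symmetric] span_family by simp
  qed
  then obtain g where g: "\<And>r. r < ?m \<Longrightarrow> bs' ! r = lcomb ?m (g r) (\<lambda>k. bs ! k)" by metis
  have "pluecker bs' I = det (mat ?m ?m (\<lambda>(r, k). g r k)) * pluecker bs I" if "length I = ?m" for I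
  proof -
    have "mat ?m ?m (\<lambda>(r, c). (bs' ! r) (I ! c)) =
        mat ?m ?m (\<lambda>(r, k). g r k) * mat ?m ?m (\<lambda>(r, c). (bs ! r) (I ! c))"
      by (rule eq_matI) (auto simp: g lcomb_def scalar_prod_def atLeast0LessThan)
    then show ?thesis unfolding pluecker_def len by (simp add: det_mult[of _ ?m])
  qed
  then show "\<exists>c. \<forall>I. length I = length bs \<longrightarrow> pluecker bs' I = c * pluecker bs I" by blast
qed

section \<open>Forms in the Pluecker coordinates\<close>

definition monom_eval :: "('v \<Rightarrow> 'k::field) \<Rightarrow> ('v \<Rightarrow>\<^sub>0 nat) \<Rightarrow> 'k" where
  "monom_eval x m = (\<Prod>v\<in>Poly_Mapping.keys m. x v ^ Poly_Mapping.lookup m v)"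

definition factor_degree :: "nat \<Rightarrow> (nat \<times> nat list \<Rightarrow>\<^sub>0 nat) \<Rightarrow> nat" where
  "factor_degree i m = (\<Sum>v\<in>{v \<in> Poly_Mapping.keys m. fst v = i}. Poly_Mapping.lookup m v)"

text \<open>The multidegree is a parameter here: only forms of equal multidegree can be added.\<close>

definition multihom :: "nat \<Rightarrow> nat list \<Rightarrow> (nat \<Rightarrow> nat) \<Rightarrow> 'k::field pluecker_poly \<Rightarrow> bool" where
  "multihom n ks e F \<longleftrightarrow> (\<forall>m\<in>Poly_Mapping.keys F. Poly_Mapping.keys m \<subseteq> pluecker_vars n ks \<and>
     (\<forall>i<length ks. factor_degree i m = e i))"

lemma multihomogeneous_iff: "multihomogeneous n ks F \<longleftrightarrow> (\<exists>e. multihom n ks e F)"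
  unfolding multihomogeneous_def multihom_def factor_degree_def by blast

lemma poly_eval_alt: "poly_eval x F = (\<Sum>m\<in>Poly_Mapping.keys F. Poly_Mapping.lookup F m * monom_eval x m)"
  by (simp add: poly_eval_def monom_eval_def)

lemma monom_eval_superset:
  assumes "finite A" "Poly_Mapping.keys m \<subseteq> A"
  shows "monom_eval x m = (\<Prod>v\<in>A. x v ^ Poly_Mapping.lookup m v)"
  unfolding monom_eval_def using assms by (intro prod.mono_neutral_left) (auto simp: in_keys_iff)

lemma monom_eval_add: "monom_eval x (m + m') = monom_eval x m * monom_eval x m'"
proof -
  let ?A = "Poly_Mapping.keys m \<union> Poly_Mapping.keys m'"
  have "Poly_Mapping.keys (m + m') \<subseteq> ?A" by (rule Poly_Mapping.keys_add)
  then show ?thesis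
    by (simp add: monom_eval_superset[of ?A] lookup_add power_add prod.distrib)
qed

lemma factor_degree_superset:
  assumes "finite A" "Poly_Mapping.keys m \<subseteq> A"
  shows "factor_degree i m = (\<Sum>v\<in>{v \<in> A. fst v = i}. Poly_Mapping.lookup m v)"
  unfolding factor_degree_def using assms by (intro sum.mono_neutral_left) (auto simp: in_keys_iff)

lemma factor_degree_add: "factor_degree i (m + m') = factor_degree i m + factor_degree i m'"
proof -
  let ?A = "Poly_Mapping.keys m \<union> Poly_Mapping.keys m'"
  have "Poly_Mapping.keys (m + m') \<subseteq> ?A" by (rule Poly_Mapping.keys_add)
  then show ?thesis
    by (simp add: factor_degree_superset[of ?A] lookup_add sum.distrib)
qed

lemma poly_eval_superset:
  assumes "finite A" "Poly_Mapping.keys F \<subseteq> A"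
  shows "poly_eval x F = (\<Sum>m\<in>A. Poly_Mapping.lookup F m * monom_eval x m)"
  unfolding poly_eval_alt using assms by (intro sum.mono_neutral_left) (auto simp: in_keys_iff)

lemma poly_eval_add: "poly_eval x (F + G) = poly_eval x F + poly_eval x G"
proof -
  let ?A = "Poly_Mapping.keys F \<union> Poly_Mapping.keys G"
  have "Poly_Mapping.keys (F + G) \<subseteq> ?A" by (rule Poly_Mapping.keys_add)
  then show ?thesis
    by (simp add: poly_eval_superset[of ?A] lookup_add sum.distrib algebra_simps)
qed

lemma poly_eval_zero [simp]: "poly_eval x 0 = 0"
  by (simp add: poly_eval_def)

lemma poly_eval_sum: "poly_eval x (\<Sum>i\<in>A. f i) = (\<Sum>i\<in>A. poly_eval x (f i))"
  by (induction A rule: infinite_finite_induct) (auto simp: poly_eval_add)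

lemma poly_eval_single: "poly_eval x (Poly_Mapping.single m c) = c * monom_eval x m"
  by (cases "c = 0") (auto simp: poly_eval_alt)

lemma multihom_add: "multihom n ks e F \<Longrightarrow> multihom n ks e G \<Longrightarrow> multihom n ks e (F + G)"
  unfolding multihom_def using Poly_Mapping.keys_add[of F G] by blast

lemma multihom_zero: "multihom n ks e 0" by (simp add: multihom_def)

lemma multihom_sum: "(\<And>i. i \<in> A \<Longrightarrow> multihom n ks e (f i)) \<Longrightarrow> multihom n ks e (\<Sum>i\<in>A. f i)"
  by (induction A rule: infinite_finite_induct) (auto simp: multihom_add multihom_zero)

lemma multihom_single:
  "Poly_Mapping.keys m \<subseteq> pluecker_vars n ks \<Longrightarrow> (\<And>i. i < length ks \<Longrightarrow> factor_degree i m = e i)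
    \<Longrightarrow> multihom n ks e (Poly_Mapping.single m c)"
  by (cases "c = 0") (auto simp: multihom_def)

text \<open>The double sum shows the degrees and the value of each term.\<close>

definition poly_times :: "'k::field pluecker_poly \<Rightarrow> 'k pluecker_poly \<Rightarrow> 'k pluecker_poly" where
  "poly_times F G = (\<Sum>m\<in>Poly_Mapping.keys F. \<Sum>m'\<in>Poly_Mapping.keys G.
     Poly_Mapping.single (m + m') (Poly_Mapping.lookup F m * Poly_Mapping.lookup G m'))"

lemma poly_eval_times: "poly_eval x (poly_times F G) = poly_eval x F * poly_eval x G"
  unfolding poly_times_def poly_eval_sum poly_eval_single monom_eval_add
  unfolding poly_eval_alt sum_product by (intro sum.cong refl) (simp add: algebra_simps)

lemma multihom_times:
  assumes "multihom n ks e F" "multihom n ks e' G"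
  shows "multihom n ks (\<lambda>i. e i + e' i) (poly_times F G)"
  unfolding poly_times_def
proof (intro multihom_sum multihom_single)
  fix m m' assume m: "m \<in> Poly_Mapping.keys F" "m' \<in> Poly_Mapping.keys G"
  show "Poly_Mapping.keys (m + m') \<subseteq> pluecker_vars n ks"
    using assms m Poly_Mapping.keys_add[of m m'] unfolding multihom_def by blast
  show "factor_degree i (m + m') = e i + e' i" if "i < length ks" for i
    using assms m that unfolding multihom_def factor_degree_add by simp
qed

lemma poly_eval_rescale:
  assumes F: "multihom n ks e F"
    and y: "\<And>i I. (i, I) \<in> pluecker_vars n ks \<Longrightarrow> y (i, I) = c i * x (i, I)"
  shows "poly_eval y F = (\<Prod>i<length ks. c i ^ e i) * poly_eval x F"
proof -
  have "monom_eval y m = (\<Prod>i<length ks. c i ^ e i) * monom_eval x m"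
    if m: "m \<in> Poly_Mapping.keys F" for m
  proof -
    have k: "Poly_Mapping.keys m \<subseteq> pluecker_vars n ks" and d: "\<And>i. i < length ks \<Longrightarrow> factor_degree i m = e i"
      using F m by (auto simp: multihom_def)
    let ?l = "Poly_Mapping.lookup m"
    have "monom_eval y m = (\<Prod>v\<in>Poly_Mapping.keys m. c (fst v) ^ ?l v * x v ^ ?l v)"
      unfolding monom_eval_def using k y by (intro prod.cong) (auto simp: power_mult_distrib)
    also have "\<dots> = (\<Prod>v\<in>Poly_Mapping.keys m. c (fst v) ^ ?l v) * monom_eval x m"
      by (simp add: prod.distrib monom_eval_def)
    also have "(\<Prod>v\<in>Poly_Mapping.keys m. c (fst v) ^ ?l v)
        = (\<Prod>i<length ks. \<Prod>v\<in>{v \<in> Poly_Mapping.keys m. fst v = i}. c (fst v) ^ ?l v)"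
      using k by (intro prod.group[symmetric]) (auto simp: pluecker_vars_def)
    also have "\<dots> = (\<Prod>i<length ks. c i ^ e i)"
    proof (rule prod.cong)
      fix i assume "i \<in> {..<length ks}"
      have "(\<Prod>v\<in>{v \<in> Poly_Mapping.keys m. fst v = i}. c (fst v) ^ ?l v)
          = (\<Prod>v\<in>{v \<in> Poly_Mapping.keys m. fst v = i}. c i ^ ?l v)"
        by (intro prod.cong) auto
      also have "\<dots> = c i ^ factor_degree i m"
        by (simp add: power_sum factor_degree_def)
      finally show "(\<Prod>v\<in>{v \<in> Poly_Mapping.keys m. fst v = i}. c (fst v) ^ ?l v) = c i ^ e i"
        using d \<open>i \<in> {..<length ks}\<close> by simp
    qed simp
    finally show ?thesis .
  qed
  then show ?thesis
    unfolding poly_eval_alt sum_distrib_left by (intro sum.cong refl) (simp add: mult.assoc mult.left_commute)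
qed

abbreviation coords :: "(nat \<Rightarrow> 'k::field) list list \<Rightarrow> nat \<times> nat list \<Rightarrow> 'k" where
  "coords bss \<equiv> (\<lambda>(i, I). pluecker (bss ! i) I)"

lemma multi_grassmannian_lengths:
  assumes "Vs \<in> multi_grassmannian n ks" "list_all2 ordered_basis bss Vs"
  shows "length bss = length ks" "\<And>i. i < length ks \<Longrightarrow> length (bss ! i) = ks ! i + 1"
proof -
  show l: "length bss = length ks"
    using assms by (auto simp: multi_grassmannian_def list_all2_conv_all_nth)
  fix i assume i: "i < length ks"
  have "Vs ! i \<in> grassmannian (ks ! i) n" "ordered_basis (bss ! i) (Vs ! i)"
    using assms i l by (auto simp: multi_grassmannian_def list_all2_conv_all_nth)
  then show "length (bss ! i) = ks ! i + 1"
    using dim_family[of "length (bss ! i)" "\<lambda>k. bss ! i ! k"] unfolding ordered_basis_iff grassmannian_def by auto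
qed

text \<open>
  Two bases of the same factor have proportional Pluecker coordinates, so the values of a form of
  multidegree \<open>e\<close> differ by a product of powers of the nonzero factors.
\<close>

lemma nonvanishing_locus_any_basis:
  assumes "Vs \<in> nonvanishing_locus n ks F" "multihomogeneous n ks F" "list_all2 ordered_basis bss Vs"
  shows "poly_eval (coords bss) F \<noteq> 0"
proof -
  obtain bss' where V: "Vs \<in> multi_grassmannian n ks" and b': "list_all2 ordered_basis bss' Vs"
    and ne: "poly_eval (coords bss') F \<noteq> 0"
    using assms(1) by (auto simp: nonvanishing_locus_def)
  obtain e where e: "multihom n ks e F" using assms(2) by (auto simp: multihomogeneous_iff)
  note l = multi_grassmannian_lengths[OF V assms(3)] and l' = multi_grassmannian_lengths[OF V b']
  have "\<exists>c. \<forall>I. length I = ks ! i + 1 \<longrightarrow> pluecker (bss' ! i) I = c * pluecker (bss ! i) I"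
    if i: "i < length ks" for i
  proof -
    have "ordered_basis (bss ! i) (Vs ! i)" "ordered_basis (bss' ! i) (Vs ! i)"
      using assms(3) b' i l(1) l'(1) by (auto simp: list_all2_conv_all_nth)
    from pluecker_change_basis(2)[OF this] l(2)[OF i] show ?thesis by simp
  qed
  then obtain c where c: "\<And>i I. i < length ks \<Longrightarrow> length I = ks ! i + 1 \<Longrightarrow>
      pluecker (bss' ! i) I = c i * pluecker (bss ! i) I" by metis
  have "poly_eval (coords bss') F = (\<Prod>i<length ks. c i ^ e i) * poly_eval (coords bss) F"
    by (rule poly_eval_rescale[OF e]) (auto simp: pluecker_vars_def c)
  with ne show ?thesis by auto
qed

section \<open>Irreducible sets and rational curves\<close>

text \<open>
  A set is irreducible if any two nonempty open parts meet. Points \<open>x\<close> and \<open>y\<close> of the two parts are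
  joined by a curve that leaves the set, or either part, only for finitely many of the infinitely many
  parameters. This property passes from a generating set of the topology to finite intersections and to
  unions, so it is enough to verify it for the generators.
\<close>

lemma irreducible_by_curves:
  fixes \<gamma> :: "'a \<Rightarrow> 'a \<Rightarrow> 'k \<Rightarrow> 'a"
  assumes inf: "infinite (UNIV :: 'k set)"
    and S: "S \<subseteq> W" "S \<subseteq> \<Union>B" "S \<noteq> {}"
    and stay: "\<And>x y. x \<in> S \<Longrightarrow> y \<in> S \<Longrightarrow> finite {t. \<gamma> x y t \<notin> S}"
    and near: "\<And>x y U. x \<in> S \<Longrightarrow> y \<in> S \<Longrightarrow> U \<in> B \<Longrightarrow> x \<in> U \<or> y \<in> U \<Longrightarrow> finite {t. \<gamma> x y t \<in> S \<and> \<gamma> x y t \<notin> U}"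
  shows "irreducible_in (subtopology (topology_generated_by B) W) S"
proof -
  let ?T = "subtopology (topology_generated_by B) W"
  have open_near: "finite {t. \<gamma> x y t \<in> S \<and> \<gamma> x y t \<notin> U}"
    if "generate_topology_on B U" "x \<in> S" "y \<in> S" "x \<in> U \<or> y \<in> U" for x y U
    using that
  proof (induction rule: generate_topology_on.induct)
    case Empty
    then show ?case by simp
  next
    case (Int U V)
    then have "finite {t. \<gamma> x y t \<in> S \<and> \<gamma> x y t \<notin> U}" "finite {t. \<gamma> x y t \<in> S \<and> \<gamma> x y t \<notin> V}" by auto
    then have "finite ({t. \<gamma> x y t \<in> S \<and> \<gamma> x y t \<notin> U} \<union> {t. \<gamma> x y t \<in> S \<and> \<gamma> x y t \<notin> V})" by simp
    then show ?case by (rule finite_subset[rotated]) auto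
  next
    case (UN K)
    then obtain U where "U \<in> K" "x \<in> U \<or> y \<in> U" by auto
    with UN have "finite {t. \<gamma> x y t \<in> S \<and> \<gamma> x y t \<notin> U}" by auto
    then show ?case by (rule finite_subset[rotated]) (use \<open>U \<in> K\<close> in auto)
  next
    case (Basis U)
    then show ?case using near by blast
  qed
  have top: "topspace ?T = W \<inter> \<Union>B" by (auto simp: topology_generated_by_topspace)
  show ?thesis unfolding irreducible_in_def
  proof (intro conjI allI impI)
    show "S \<subseteq> topspace ?T" using S top by auto
    show "S \<noteq> {}" by fact
    fix A C assume AC: "closedin ?T A \<and> closedin ?T C \<and> S \<subseteq> A \<union> C"
    show "S \<subseteq> A \<or> S \<subseteq> C"
    proof (rule ccontr)
      assume "\<not> ?thesis"
      then obtain x y where x: "x \<in> S" "x \<notin> A" and y: "y \<in> S" "y \<notin> C" by auto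
      obtain U V where U: "generate_topology_on B U" "topspace ?T - A = U \<inter> W"
        and V: "generate_topology_on B V" "topspace ?T - C = V \<inter> W"
        using AC unfolding closedin_def openin_subtopology openin_topology_generated_by_iff by auto
      have xy: "x \<in> U" "y \<in> V" using x y U V S top by blast+
      have "finite ({t. \<gamma> x y t \<notin> S} \<union> {t. \<gamma> x y t \<in> S \<and> \<gamma> x y t \<notin> U} \<union> {t. \<gamma> x y t \<in> S \<and> \<gamma> x y t \<notin> V})"
        using stay[OF x(1) y(1)] open_near[OF U(1) x(1) y(1)] open_near[OF V(1) x(1) y(1)] xy by simp
      from ex_new_if_finite[OF inf this] obtain t where "\<gamma> x y t \<in> S" "\<gamma> x y t \<in> U" "\<gamma> x y t \<in> V" by auto
      then show False using U V AC S by blast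
    qed
  qed
qed

text \<open>The union of a chain of irreducible sets is irreducible, so Zorn's lemma applies.\<close>

lemma irreducible_imp_component:
  assumes "irreducible_in T S" shows "\<exists>C. irreducible_component T C \<and> S \<subseteq> C"
proof -
  let ?A = "{C. irreducible_in T C \<and> S \<subseteq> C}"
  have "\<exists>M\<in>?A. \<forall>X\<in>?A. M \<subseteq> X \<longrightarrow> X = M"
  proof (rule subset_Zorn_nonempty)
    show "?A \<noteq> {}" using assms by auto
    fix K assume ne: "K \<noteq> {}" and ch: "subset.chain ?A K"
    then have K: "\<And>X. X \<in> K \<Longrightarrow> irreducible_in T X \<and> S \<subseteq> X"
      and lin: "\<And>X Y. X \<in> K \<Longrightarrow> Y \<in> K \<Longrightarrow> X \<subseteq> Y \<or> Y \<subseteq> X"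
      by (auto simp: subset_chain_def)
    have "irreducible_in T (\<Union>K)" unfolding irreducible_in_def
    proof (intro conjI allI impI)
      show "\<Union>K \<subseteq> topspace T" using K unfolding irreducible_in_def by (meson Sup_least)
      show "\<Union>K \<noteq> {}" using K ne assms by (fastforce simp: irreducible_in_def)
      fix A B assume AB: "closedin T A \<and> closedin T B \<and> \<Union>K \<subseteq> A \<union> B"
      show "\<Union>K \<subseteq> A \<or> \<Union>K \<subseteq> B"
      proof (rule ccontr)
        assume "\<not> ?thesis"
        then obtain X Y where XY: "X \<in> K" "\<not> X \<subseteq> A" "Y \<in> K" "\<not> Y \<subseteq> B" by auto
        then obtain Z where Z: "Z \<in> K" "\<not> Z \<subseteq> A" "\<not> Z \<subseteq> B" using lin[of X Y] by blast
        with AB K[OF Z(1)] show False unfolding irreducible_in_def by (meson Sup_upper subset_trans)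
      qed
    qed
    then show "\<Union>K \<in> ?A" using K ne by auto
  qed
  then obtain M where M: "irreducible_in T M" "S \<subseteq> M"
    "\<And>X. irreducible_in T X \<Longrightarrow> S \<subseteq> X \<Longrightarrow> M \<subseteq> X \<Longrightarrow> X = M" by auto
  then have "irreducible_component T M" unfolding irreducible_component_def by (meson subset_trans)
  with M show ?thesis by auto
qed

text \<open>A permutation of an enumeration of a fibre is again an enumeration of it.\<close>

lemma galois_group_full:
  assumes irr: "irreducible_in (fiber_power_space a d) S"
    and mem: "\<And>ws. enumerates_fiber a d Ls ws \<Longrightarrow> ws @ Ls \<in> S"
    and ws: "enumerates_fiber a d Ls ws"
  shows "galois_group a Ls ws = {\<sigma>. \<sigma> permutes {..<d}}"
proof -
  have len: "length ws = d" using ws by (simp add: enumerates_fiber_def)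
  obtain C where C: "irreducible_component (fiber_power_space a d) C" "S \<subseteq> C"
    using irreducible_imp_component[OF irr] by auto
  have "permute_list \<sigma> ws @ Ls \<in> S" if \<sigma>: "\<sigma> permutes {..<d}" for \<sigma>
    using mem[of "permute_list \<sigma> ws"] ws \<sigma> len
    by (simp add: enumerates_fiber_def set_permute_list)
  then show ?thesis using C mem[OF ws] len unfolding galois_group_def by auto
qed

text \<open>
  Along a curve of bases with polynomial entries, a form in the Pluecker coordinates becomes a
  polynomial in the parameter.
\<close>

lemma curve_locus_cofinite:
  fixes bss :: "'k::field \<Rightarrow> (nat \<Rightarrow> 'k) list list"
  assumes poly: "\<And>i r x. i < length ks \<Longrightarrow> r < ks ! i + 1 \<Longrightarrow> pfun {\<lambda>t. t} (\<lambda>t. (bss t ! i ! r) x)"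
    and len: "\<And>t i. i < length ks \<Longrightarrow> length (bss t ! i) = ks ! i + 1"
    and F: "multihomogeneous n ks F"
    and t0: "list_all2 ordered_basis (bss t0) Vs" "Vs \<in> nonvanishing_locus n ks F"
  shows "finite {t. poly_eval (coords (bss t)) F = 0}"
proof (rule pfun_line_finite_zeros[of _ t0])
  show "poly_eval (coords (bss t0)) F \<noteq> 0"
    by (rule nonvanishing_locus_any_basis[OF t0(2) F t0(1)])
  have "pfun {\<lambda>t. t} (\<lambda>t. coords (bss t) v)" if v: "v \<in> pluecker_vars n ks" for v
  proof -
    obtain i I where v': "v = (i, I)" "i < length ks" "length I = ks ! i + 1"
      using v by (auto simp: pluecker_vars_def)
    have "pfun {\<lambda>t. t} (\<lambda>t. det (mat (ks ! i + 1) (ks ! i + 1) (\<lambda>(r, c). (bss t ! i ! r) (I ! c))))"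
      by (intro pfun_det poly v') auto
    then show ?thesis by (simp add: v' pluecker_def len)
  qed
  then show "pfun {\<lambda>t. t} (\<lambda>t. poly_eval (coords (bss t)) F)"
    using F unfolding poly_eval_def multihomogeneous_def
    by (intro pfun_sum pfun.mult pfun.const pfun_prod pfun_power) auto
qed

text \<open>
  The form \<open>1\<close> shows that the whole product variety is one of the generating open sets.
\<close>

lemma nonvanishing_locus_one: "nonvanishing_locus n ks 1 = multi_grassmannian n ks"
proof -
  have "poly_eval x 1 = 1" for x :: "nat \<times> nat list \<Rightarrow> 'a"
    using poly_eval_single[of x 0 1] by (simp add: monom_eval_def)
  moreover have "\<exists>bss. list_all2 ordered_basis bss Vs" if "Vs \<in> multi_grassmannian n ks"
    for Vs :: "(nat \<Rightarrow> 'a) set list"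
    using multi_grassmannian_bases[OF that] by blast
  ultimately show ?thesis unfolding nonvanishing_locus_def by auto
qed

lemma multihomogeneous_one: "multihomogeneous n ks (1 :: 'k::field pluecker_poly)"
  unfolding multihomogeneous_iff multihom_def
  by (intro exI[of _ "\<lambda>_. 0"]) (auto simp: factor_degree_def)

lemma fiber_power_subset: "fiber_power a d \<subseteq> multi_grassmannian (ambient_dim a) (replicate d 1 @ condition_dims a)"
proof
  fix x assume "x \<in> fiber_power a d"
  then obtain ls Ls where x: "x = ls @ Ls" "length ls = d" "Ls \<in> schubert_X a" "\<forall>l\<in>set ls. (l, Ls) \<in> schubert_W a"
    by (auto simp: fiber_power_def)
  have "list_all2 (\<lambda>V k. V \<in> grassmannian k (ambient_dim a)) ls (replicate d 1)"
    using x by (auto simp: list_all2_conv_all_nth schubert_W_def)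
  then show "x \<in> multi_grassmannian (ambient_dim a) (replicate d 1 @ condition_dims a)"
    using x unfolding multi_grassmannian_def schubert_X_def by (auto intro: list_all2_appendI)
qed

lemma irreducible_in_fiber_power:
  fixes a :: "nat list" and d :: nat and S :: "(nat \<Rightarrow> 'k::alg_closed_field) set list set"
    and bss :: "(nat \<Rightarrow> 'k) set list \<Rightarrow> (nat \<Rightarrow> 'k) set list \<Rightarrow> 'k \<Rightarrow> (nat \<Rightarrow> 'k) list list"
  defines "ks \<equiv> replicate d 1 @ condition_dims a"
  defines "\<gamma> \<equiv> \<lambda>x y t. map (\<lambda>bs. kvec.span (set bs)) (bss x y t)"
  assumes S: "S \<subseteq> fiber_power a d" "S \<noteq> {}"
    and len: "\<And>x y t. x \<in> S \<Longrightarrow> y \<in> S \<Longrightarrow> length (bss x y t) = length ks"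
      "\<And>x y t i. x \<in> S \<Longrightarrow> y \<in> S \<Longrightarrow> i < length ks \<Longrightarrow> length (bss x y t ! i) = ks ! i + 1"
    and poly: "\<And>x y i r z. x \<in> S \<Longrightarrow> y \<in> S \<Longrightarrow> i < length ks \<Longrightarrow> r < ks ! i + 1 \<Longrightarrow>
        pfun {\<lambda>t. t} (\<lambda>t. (bss x y t ! i ! r) z)"
    and ends: "\<And>x y. x \<in> S \<Longrightarrow> y \<in> S \<Longrightarrow> list_all2 ordered_basis (bss x y 0) x"
      "\<And>x y. x \<in> S \<Longrightarrow> y \<in> S \<Longrightarrow> list_all2 ordered_basis (bss x y 1) y"
    and stay: "\<And>x y. x \<in> S \<Longrightarrow> y \<in> S \<Longrightarrow> finite {t. \<gamma> x y t \<notin> S}"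
  shows "irreducible_in (fiber_power_space a d) S"
  unfolding fiber_power_space_def zariski_def ks_def[symmetric]
proof (rule irreducible_by_curves[where \<gamma> = \<gamma>])
  let ?n = "ambient_dim a"
  have mg: "S \<subseteq> multi_grassmannian ?n ks" using S fiber_power_subset unfolding ks_def by blast
  show "infinite (UNIV :: 'k set)" by (rule infinite_UNIV_alg_closed)
  show "S \<subseteq> fiber_power a d" "S \<noteq> {}" by fact+
  show "S \<subseteq> \<Union> (nonvanishing_locus ?n ks ` {F. multihomogeneous ?n ks F})"
    using mg multihomogeneous_one[of ?n ks] nonvanishing_locus_one[of ?n ks] by blast
  show "finite {t. \<gamma> x y t \<notin> S}" if "x \<in> S" "y \<in> S" for x y by (rule stay[OF that])
  fix x y U assume x: "x \<in> S" and y: "y \<in> S"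
    and U: "U \<in> nonvanishing_locus ?n ks ` {F. multihomogeneous ?n ks F}" and xyU: "x \<in> U \<or> y \<in> U"
  obtain F where F: "multihomogeneous ?n ks F" "U = nonvanishing_locus ?n ks F" using U by auto
  have "finite {t. poly_eval (coords (bss x y t)) F = 0}"
    using xyU
  proof
    assume "x \<in> U"
    then show ?thesis using curve_locus_cofinite[OF poly[OF x y] len(2)[OF x y] F(1) ends(1)[OF x y]] F(2) by simp
  next
    assume "y \<in> U"
    then show ?thesis using curve_locus_cofinite[OF poly[OF x y] len(2)[OF x y] F(1) ends(2)[OF x y]] F(2) by simp
  qed
  moreover have "\<gamma> x y t \<in> U" if t: "\<gamma> x y t \<in> S" "poly_eval (coords (bss x y t)) F \<noteq> 0" for t
  proof -
    have G: "\<gamma> x y t \<in> multi_grassmannian ?n ks" using t mg by auto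
    have "ordered_basis (bss x y t ! i) (\<gamma> x y t ! i)" if i: "i < length ks" for i
    proof -
      have l: "length (bss x y t) = length ks" "length (bss x y t ! i) = ks ! i + 1"
        using len x y i by auto
      have g: "\<gamma> x y t ! i = kvec.span (set (bss x y t ! i))" using i l by (simp add: \<gamma>_def)
      have "\<gamma> x y t ! i \<in> grassmannian (ks ! i) ?n"
        using G i by (auto simp: multi_grassmannian_def list_all2_conv_all_nth)
      then have dim: "kvec.dim (set (bss x y t ! i)) = length (bss x y t ! i)"
        unfolding grassmannian_def g l by auto
      then have c: "card (set (bss x y t ! i)) = length (bss x y t ! i)"
        using kvec.dim_le_card'[of "set (bss x y t ! i)"] card_length[of "bss x y t ! i"] by simp
      then have "distinct (bss x y t ! i)" by (rule card_distinct)
      moreover have "kvec.independent (set (bss x y t ! i))"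
      proof -
        obtain B where B: "B \<subseteq> set (bss x y t ! i)" "kvec.independent B" "set (bss x y t ! i) \<subseteq> kvec.span B"
          "card B = kvec.dim (set (bss x y t ! i))" using kvec.basis_exists[of "set (bss x y t ! i)"] by blast
        then have "B = set (bss x y t ! i)" using dim c by (intro card_subset_eq) auto
        with B show ?thesis by simp
      qed
      ultimately show ?thesis unfolding ordered_basis_def g by simp
    qed
    then have "list_all2 ordered_basis (bss x y t) (\<gamma> x y t)"
      using len x y by (auto simp: list_all2_conv_all_nth \<gamma>_def)
    with G t F show ?thesis unfolding nonvanishing_locus_def by blast
  qed
  ultimately show "finite {t. \<gamma> x y t \<in> S \<and> \<gamma> x y t \<notin> U}"
    by (elim finite_subset[rotated]) auto
qed

section \<open>Charts of products of Grassmannians\<close>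

text \<open>
  The bases whose minors with the columns \<open>Is i\<close> are identity matrices. Their remaining entries are
  the affine coordinates on the chart where these minors do not vanish.
\<close>

definition normalized :: "nat list \<Rightarrow> (nat \<Rightarrow> nat list) \<Rightarrow> (nat \<Rightarrow> 'k::field) list list \<Rightarrow> bool" where
  "normalized ks Is bss \<longleftrightarrow>
     (\<forall>i<length ks. \<forall>r\<le>ks ! i. \<forall>c\<le>ks ! i. (bss ! i ! r) (Is i ! c) = (if r = c then 1 else 0))"

definition entries :: "nat \<Rightarrow> nat list \<Rightarrow> ((nat \<Rightarrow> 'k::field) list list \<Rightarrow> 'k) set" where
  "entries n ks = {(\<lambda>bss. (bss ! i ! r) x) | i r x. i < length ks \<and> r \<le> ks ! i \<and> x \<le> n}"

definition chart_locus ::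
  "nat \<Rightarrow> nat list \<Rightarrow> (nat \<Rightarrow> nat list) \<Rightarrow> ((nat \<Rightarrow> 'k::field) list list \<Rightarrow> 'k) \<Rightarrow> (nat \<Rightarrow> 'k) set list set" where
  "chart_locus n ks Is f = {Vs \<in> multi_grassmannian n ks.
     \<exists>bss. list_all2 ordered_basis bss Vs \<and> normalized ks Is bss \<and> f bss \<noteq> 0}"

text \<open>
  Replacing a column of a chart by another one leads to index lists that are no longer increasing,
  whereas the variables of the forms carry increasing lists.
\<close>

lemma pluecker_sort:
  assumes "distinct J"
  shows "\<exists>\<epsilon>. \<forall>bs :: (nat \<Rightarrow> 'k::field) list. length bs = length J \<longrightarrow> pluecker bs J = \<epsilon> * pluecker bs (sort J)"
proof -
  let ?m = "length J"
  obtain p where p: "p permutes {..<?m}" "permute_list p (sort J) = J"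
    using mset_eq_permutation[of J "sort J"] by auto
  have Jp: "J ! c = sort J ! (p c)" if "c < ?m" for c
    using permute_list_nth[of p "sort J" c] p that by simp
  have "pluecker bs J = signof p * pluecker bs (sort J)" if len: "length bs = ?m" for bs :: "(nat \<Rightarrow> 'k) list"
  proof -
    let ?A = "mat ?m ?m (\<lambda>(c, r). (bs ! r) (sort J ! c))"
    have A: "?A \<in> carrier_mat ?m ?m" by simp
    have B: "mat ?m ?m (\<lambda>(i, j). ?A $$ (p i, j)) \<in> carrier_mat ?m ?m" by simp
    have "pluecker bs (sort J) = det ?A"
      unfolding det_transpose[OF A, symmetric] pluecker_def len
      by (intro arg_cong[where f = det] eq_matI) auto
    moreover have "pluecker bs J = det (mat ?m ?m (\<lambda>(i, j). ?A $$ (p i, j)))"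
      unfolding det_transpose[OF B, symmetric] pluecker_def len
      using permutes_in_image[OF p(1)]
      by (intro arg_cong[where f = det] eq_matI) (auto simp: Jp)
    moreover have "det (mat ?m ?m (\<lambda>(i, j). ?A $$ (p i, j))) = signof p * det ?A"
      using p(1) by (intro det_permute_rows[OF A]) (simp add: atLeast0LessThan)
    ultimately show ?thesis by simp
  qed
  then show ?thesis by blast
qed

lemma pluecker_replace:
  assumes "\<And>r c. r < m \<Longrightarrow> c < m \<Longrightarrow> (bs ! r) (I ! c) = (if r = c then 1 else 0 :: 'k::field)"
    and "length bs = m" "length I = m" "r < m"
  shows "pluecker bs (I[r := x]) = (bs ! r) x"
proof -
  let ?b = "vec m (\<lambda>i. (bs ! i) x)"
  have "mat m m (\<lambda>(i, c). (bs ! i) (I[r := x] ! c)) = replace_col (1\<^sub>m m) (1\<^sub>m m *\<^sub>v ?b) r"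
    using assms by (intro eq_matI) (auto simp: replace_col_def)
  then have "pluecker bs (I[r := x]) = det (replace_col (1\<^sub>m m) (1\<^sub>m m *\<^sub>v ?b) r)"
    unfolding pluecker_def assms(2) by (rule arg_cong)
  also have "\<dots> = (bs ! r) x"
    using cramer_lemma_mat[of "1\<^sub>m m" m ?b r] assms by simp
  finally show ?thesis .
qed

lemma pluecker_normalized:
  assumes "\<And>r c. r < m \<Longrightarrow> c < m \<Longrightarrow> (bs ! r) (I ! c) = (if r = c then 1 else 0 :: 'k::field)" "length bs = m"
  shows "pluecker bs I = 1"
proof -
  have "mat m m (\<lambda>(r, c). (bs ! r) (I ! c)) = 1\<^sub>m m" using assms by (intro eq_matI) auto
  then show ?thesis using assms(2) by (simp add: pluecker_def)
qed

lemma normalize_basis: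
  fixes bs :: "(nat \<Rightarrow> 'k::field) list"
  assumes V: "V \<in> grassmannian k n" and b: "ordered_basis bs V" and m: "length bs = Suc k" and ne: "pluecker bs I \<noteq> 0"
  shows "\<exists>bs'. ordered_basis bs' V \<and> (\<forall>r\<le>k. \<forall>c\<le>k. (bs' ! r) (I ! c) = (if r = c then 1 else 0))"
proof -
  let ?m = "Suc k"
  let ?A = "mat ?m ?m (\<lambda>(r, c). (bs ! r) (I ! c))"
  have A: "?A \<in> carrier_mat ?m ?m" by simp
  have d: "det ?A \<noteq> 0" using ne m by (simp add: pluecker_def)
  obtain B where B: "B \<in> carrier_mat ?m ?m" "B * ?A = 1\<^sub>m ?m"
    using det_non_zero_imp_unit[OF A d, of "undefined"] by (auto simp: Units_def ring_mat_def)
  define v where "v r = lcomb ?m (\<lambda>j. B $$ (r, j)) (\<lambda>j. bs ! j)" for r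
  have norm: "v r (I ! c) = (if r = c then 1 else 0)" if "r < ?m" "c < ?m" for r c
  proof -
    have "v r (I ! c) = (B * ?A) $$ (r, c)"
      using that B(1) by (auto simp: v_def lcomb_def scalar_prod_def atLeast0LessThan intro!: sum.cong)
    then show ?thesis using B(2) that by simp
  qed
  have "det (mat ?m ?m (\<lambda>(r, c). v r (I ! c))) = det (1\<^sub>m ?m)"
    by (intro arg_cong[where f = det] eq_matI) (auto simp: norm)
  then have ind: "fam_indep ?m v" by (intro minor_imp_indep[where I = I]) simp
  have sub: "kvec.subspace V" using V by (simp add: grassmannian_def)
  have "bs ! j \<in> V" if "j < ?m" for j
    using b m that kvec.span_base[of "bs ! j" "(\<lambda>k. bs ! k) ` {..<?m}"] unfolding ordered_basis_iff by auto
  then have "v r \<in> V" for r unfolding v_def by (intro lcomb_in_subspace sub)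
  then have "kvec.span (v ` {..<?m}) = V" by (intro grassmannian_span_eq[OF V ind])
  with ind have "ordered_basis (map v [0..<?m]) V" by (simp only: ordered_basis_map)
  moreover have "map v [0..<?m] ! r = v r" if "r < ?m" for r using that by (simp del: upt_Suc)
  ultimately show ?thesis using norm by (intro exI[of _ "map v [0..<?m]"]) (simp del: upt_Suc)
qed

context
  fixes n :: nat and ks :: "nat list" and Is :: "nat \<Rightarrow> nat list"
  assumes Is: "\<And>i. i < length ks \<Longrightarrow> length (Is i) = ks ! i + 1 \<and> sorted_wrt (<) (Is i) \<and> set (Is i) \<subseteq> {..n}"
begin

text \<open>
  The product of powers of the chart coordinates, which takes the value \<open>1\<close> on normalized bases.
\<close>

definition pad :: "(nat \<Rightarrow> nat) \<Rightarrow> (nat \<times> nat list \<Rightarrow>\<^sub>0 nat)" where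
  "pad e = (\<Sum>i<length ks. Poly_Mapping.single (i, Is i) (e i))"

lemma chart_vars: "i < length ks \<Longrightarrow> (i, Is i) \<in> pluecker_vars n ks"
  using Is[of i] by (auto simp: pluecker_vars_def)

lemma lookup_pad: "Poly_Mapping.lookup (pad e) (i, J) = (if i < length ks \<and> J = Is i then e i else 0)"
proof -
  have "Poly_Mapping.lookup (pad e) (i, J) = (\<Sum>j<length ks. if j = i then (if J = Is i then e i else 0) else 0)"
    unfolding pad_def lookup_sum lookup_single by (intro sum.cong) (auto simp: when_def)
  then show ?thesis by simp
qed

lemma keys_pad: "Poly_Mapping.keys (pad e) \<subseteq> (\<lambda>i. (i, Is i)) ` {..<length ks}"
  by (auto simp: in_keys_iff lookup_pad split: if_splits)

lemma factor_degree_pad: "i < length ks \<Longrightarrow> factor_degree i (pad e) = e i"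
proof -
  assume i: "i < length ks"
  have "{v \<in> (\<lambda>i. (i, Is i)) ` {..<length ks}. fst v = i} = {(i, Is i)}" using i by auto
  then show ?thesis
    using factor_degree_superset[OF _ keys_pad, of i e] i by (simp add: lookup_pad)
qed

lemma monom_eval_pad: "monom_eval x (pad e) = (\<Prod>i<length ks. x (i, Is i) ^ e i)"
proof -
  have "monom_eval x (pad e) = (\<Prod>v\<in>(\<lambda>i. (i, Is i)) ` {..<length ks}. x v ^ Poly_Mapping.lookup (pad e) v)"
    by (intro monom_eval_superset keys_pad) auto
  also have "\<dots> = (\<Prod>i<length ks. x (i, Is i) ^ e i)"
    by (subst prod.reindex) (auto simp: inj_on_def lookup_pad)
  finally show ?thesis .
qed

lemma multihom_pad: "multihom n ks e (Poly_Mapping.single (pad e) c)"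
  using keys_pad chart_vars by (intro multihom_single) (auto simp: factor_degree_pad)

text \<open>
  A polynomial in the entries of a normalized basis is the value of a multihomogeneous form: the
  entry in row \<open>r\<close> and column \<open>x\<close> is, up to sign, the Pluecker coordinate with the pivot of row
  \<open>r\<close> replaced by \<open>x\<close>, and the Pluecker coordinate of the chart is \<open>1\<close>, so that summands of
  different degrees can be padded to a common degree.
\<close>

lemma pfun_entries_form:
  assumes "pfun (entries n ks) f"
  shows "\<exists>F e. multihom n ks e F \<and>
    (\<forall>bss :: (nat \<Rightarrow> 'k::field) list list. (\<forall>i<length ks. length (bss ! i) = ks ! i + 1) \<longrightarrow>
       normalized ks Is bss \<longrightarrow> poly_eval (coords bss) F = f bss)"
  using assms
proof (induction rule: pfun.induct)
  case (const c)
  have "multihom n ks (\<lambda>_. 0) (Poly_Mapping.single 0 c)"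
    by (intro multihom_single) (auto simp: factor_degree_def)
  then show ?case
    by (intro exI[of _ "Poly_Mapping.single 0 c"] exI[of _ "\<lambda>_. 0"]) (simp add: poly_eval_single monom_eval_def)
next
  case (gen g)
  then obtain i r x where g: "g = (\<lambda>bss. (bss ! i ! r) x)" and i: "i < length ks" and r: "r \<le> ks ! i" and x: "x \<le> n"
    by (auto simp: entries_def)
  have dI: "distinct (Is i)" using Is[OF i] strict_sorted_iff by auto
  show ?case
  proof (cases "x \<in> set (Is i)")
    case True
    then obtain c where c: "c \<le> ks ! i" "x = Is i ! c" using Is[OF i] by (auto simp: in_set_conv_nth less_Suc_eq_le)
    have "multihom n ks (\<lambda>_. 0) (Poly_Mapping.single 0 (if r = c then 1 else 0 :: 'k))"
      by (intro multihom_single) (auto simp: factor_degree_def)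
    then show ?thesis
      using i r c by (intro exI[of _ "Poly_Mapping.single 0 (if r = c then 1 else 0)"] exI[of _ "\<lambda>_. 0"])
        (auto simp: poly_eval_single[of _ 0 1, simplified] monom_eval_def normalized_def g)
  next
    case False
    let ?J = "(Is i)[r := x]"
    have J: "length ?J = ks ! i + 1" "distinct ?J" "set ?J \<subseteq> {..n}"
      using Is[OF i] False dI x set_update_subset_insert[of "Is i" r x] by (auto simp: distinct_list_update)
    then have v: "(i, sort ?J) \<in> pluecker_vars n ks"
      using i by (auto simp: pluecker_vars_def strict_sorted_iff)
    obtain \<epsilon> where \<epsilon>: "\<And>bs :: (nat \<Rightarrow> 'k) list. length bs = length ?J \<Longrightarrow> pluecker bs ?J = \<epsilon> * pluecker bs (sort ?J)"
      using pluecker_sort[OF J(2)] by blast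
    let ?m = "Poly_Mapping.single (i, sort ?J) (1::nat)"
    have "multihom n ks (\<lambda>j. factor_degree j ?m) (Poly_Mapping.single ?m \<epsilon>)"
      using v by (intro multihom_single) auto
    moreover have "poly_eval (coords bss) (Poly_Mapping.single ?m \<epsilon>) = g bss"
      if l: "\<forall>i<length ks. length (bss ! i) = ks ! i + 1" and nm: "normalized ks Is bss" for bss
    proof -
      have "poly_eval (coords bss) (Poly_Mapping.single ?m \<epsilon>) = \<epsilon> * pluecker (bss ! i) (sort ?J)"
        by (simp add: poly_eval_single monom_eval_def)
      also have "\<dots> = pluecker (bss ! i) ?J" using \<epsilon>[of "bss ! i"] J(1) l i by simp
      also have "\<dots> = (bss ! i ! r) x"
        using nm i r l Is[OF i] by (intro pluecker_replace[of "ks ! i + 1"]) (auto simp: normalized_def)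
      finally show ?thesis by (simp add: g)
    qed
    ultimately show ?thesis by blast
  qed
next
  case (add f h)
  then obtain F e G e' where F: "multihom n ks e F" "multihom n ks e' G"
    "\<And>bss. \<forall>i<length ks. length (bss ! i) = ks ! i + 1 \<Longrightarrow> normalized ks Is bss \<Longrightarrow> poly_eval (coords bss) F = f bss"
    "\<And>bss. \<forall>i<length ks. length (bss ! i) = ks ! i + 1 \<Longrightarrow> normalized ks Is bss \<Longrightarrow> poly_eval (coords bss) G = h bss"
    by metis
  let ?H = "poly_times F (Poly_Mapping.single (pad e') 1) + poly_times (Poly_Mapping.single (pad e) 1) G"
  have "multihom n ks (\<lambda>i. e i + e' i) ?H"
    by (intro multihom_add multihom_times multihom_pad F)
  moreover have "poly_eval (coords bss) ?H = f bss + h bss"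
    if l: "\<forall>i<length ks. length (bss ! i) = ks ! i + 1" and nm: "normalized ks Is bss" for bss
  proof -
    have "pluecker (bss ! i) (Is i) = 1" if "i < length ks" for i
      using that nm l by (intro pluecker_normalized[of "ks ! i + 1"]) (auto simp: normalized_def)
    then have "monom_eval (coords bss) (pad e) = 1" for e by (simp add: monom_eval_pad)
    then show ?thesis using F(3,4)[OF l nm] by (simp add: poly_eval_add poly_eval_times poly_eval_single)
  qed
  ultimately show ?case by blast
next
  case (mult f h)
  then obtain F e G e' where F: "multihom n ks e F" "multihom n ks e' G"
    "\<And>bss. \<forall>i<length ks. length (bss ! i) = ks ! i + 1 \<Longrightarrow> normalized ks Is bss \<Longrightarrow> poly_eval (coords bss) F = f bss"
    "\<And>bss. \<forall>i<length ks. length (bss ! i) = ks ! i + 1 \<Longrightarrow> normalized ks Is bss \<Longrightarrow> poly_eval (coords bss) G = h bss"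
    by metis
  have "multihom n ks (\<lambda>i. e i + e' i) (poly_times F G)" by (intro multihom_times F)
  moreover have "poly_eval (coords bss) (poly_times F G) = f bss * h bss"
    if "\<forall>i<length ks. length (bss ! i) = ks ! i + 1" "normalized ks Is bss" for bss
    using F(3,4)[OF that] by (simp add: poly_eval_times)
  ultimately show ?case by blast
qed

text \<open>
  Multiplying the form by all chart coordinates confines its nonvanishing locus to the chart.
\<close>

lemma openin_chart_locus:
  assumes "pfun (entries n ks) f"
  shows "openin (zariski n ks) (chart_locus n ks Is (f :: (nat \<Rightarrow> 'k::field) list list \<Rightarrow> 'k))"
proof -
  obtain F e where F: "multihom n ks e F"
    "\<And>bss :: (nat \<Rightarrow> 'k) list list. \<forall>i<length ks. length (bss ! i) = ks ! i + 1 \<Longrightarrow> normalized ks Is bss \<Longrightarrow>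
       poly_eval (coords bss) F = f bss"
    using pfun_entries_form[OF assms] by blast
  define G where "G = poly_times F (Poly_Mapping.single (pad (\<lambda>_. 1)) 1)"
  have hom: "multihomogeneous n ks G"
    unfolding multihomogeneous_iff G_def using multihom_times[OF F(1) multihom_pad] by blast
  have G: "poly_eval x G = poly_eval x F * (\<Prod>i<length ks. x (i, Is i))" for x
    by (simp add: G_def poly_eval_times poly_eval_single monom_eval_pad)
  have "chart_locus n ks Is f = nonvanishing_locus n ks G"
  proof (intro equalityI subsetI)
    fix Vs assume "Vs \<in> chart_locus n ks Is f"
    then obtain bss where V: "Vs \<in> multi_grassmannian n ks" and b: "list_all2 ordered_basis bss Vs"
      and nm: "normalized ks Is bss" and ne: "f bss \<noteq> 0" by (auto simp: chart_locus_def)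
    note l = multi_grassmannian_lengths[OF V b]
    have "pluecker (bss ! i) (Is i) = 1" if "i < length ks" for i
      using that nm l by (intro pluecker_normalized[of "ks ! i + 1"]) (auto simp: normalized_def)
    then have "poly_eval (coords bss) G = f bss" using F(2)[OF _ nm] l by (simp add: G)
    with V b ne show "Vs \<in> nonvanishing_locus n ks G" unfolding nonvanishing_locus_def by auto
  next
    fix Vs assume Vs: "Vs \<in> nonvanishing_locus n ks G"
    then obtain bss where V: "Vs \<in> multi_grassmannian n ks" and b: "list_all2 ordered_basis bss Vs"
      and ne: "poly_eval (coords bss) G \<noteq> 0" by (auto simp: nonvanishing_locus_def)
    note l = multi_grassmannian_lengths[OF V b]
    have "\<exists>bs'. ordered_basis bs' (Vs ! i) \<and> (\<forall>r\<le>ks ! i. \<forall>c\<le>ks ! i. (bs' ! r) (Is i ! c) = (if r = c then 1 else 0))"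
      if i: "i < length ks" for i
    proof (rule normalize_basis)
      show "Vs ! i \<in> grassmannian (ks ! i) n" using V i by (auto simp: multi_grassmannian_def list_all2_conv_all_nth)
      show "ordered_basis (bss ! i) (Vs ! i)" using b i l by (auto simp: list_all2_conv_all_nth)
      show "length (bss ! i) = Suc (ks ! i)" using l i by simp
      show "pluecker (bss ! i) (Is i) \<noteq> 0" using ne i by (auto simp: G)
    qed
    then obtain f' where f': "\<And>i. i < length ks \<Longrightarrow> ordered_basis (f' i) (Vs ! i)"
      "\<And>i r c. i < length ks \<Longrightarrow> r \<le> ks ! i \<Longrightarrow> c \<le> ks ! i \<Longrightarrow> (f' i ! r) (Is i ! c) = (if r = c then 1 else 0)"
      by metis
    define bss' where "bss' = map f' [0..<length ks]"
    have lV: "length Vs = length ks" using V by (auto simp: multi_grassmannian_def list_all2_conv_all_nth)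
    have b': "list_all2 ordered_basis bss' Vs" using f' lV by (auto simp: bss'_def list_all2_conv_all_nth)
    have nm: "normalized ks Is bss'" using f' by (auto simp: bss'_def normalized_def)
    have "poly_eval (coords bss') G \<noteq> 0" by (rule nonvanishing_locus_any_basis[OF Vs hom b'])
    then have "f bss' \<noteq> 0" using F(2)[OF _ nm] multi_grassmannian_lengths[OF V b'] by (auto simp: G)
    with V b' nm show "Vs \<in> chart_locus n ks Is f" unfolding chart_locus_def by blast
  qed
  then show ?thesis
    unfolding zariski_def using hom by (auto intro!: topology_generated_by_Basis)
qed

end

section \<open>Matrix pencils and discriminants\<close>

lemma det_zero_iff_kernel:
  "det (mat d d (\<lambda>(i, j). A i j)) = (0 :: 'k::field) \<longleftrightarrow>
     (\<exists>w. (\<exists>i<d. w i \<noteq> 0) \<and> (\<forall>i<d. (\<Sum>j<d. A i j * w j) = 0))"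
proof -
  let ?A = "mat d d (\<lambda>(i, j). A i j)"
  have mv: "(?A *\<^sub>v v) $ i = (\<Sum>j<d. A i j * v $ j)" if "i < d" "v \<in> carrier_vec d" for v i
    using that by (auto simp: scalar_prod_def atLeast0LessThan)
  show ?thesis
  proof
    assume "det ?A = 0"
    then obtain v where v: "v \<in> carrier_vec d" "v \<noteq> 0\<^sub>v d" "?A *\<^sub>v v = 0\<^sub>v d"
      using det_0_iff_vec_prod_zero_field[of ?A d] by auto
    have "\<exists>i<d. v $ i \<noteq> 0" using v(1,2) by (metis carrier_vecD eq_vecI index_zero_vec)
    moreover have "\<forall>i<d. (\<Sum>j<d. A i j * v $ j) = 0" using mv[OF _ v(1)] v(3) by simp
    ultimately show "\<exists>w. (\<exists>i<d. w i \<noteq> 0) \<and> (\<forall>i<d. (\<Sum>j<d. A i j * w j) = 0)"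
      by (intro exI[of _ "\<lambda>i. v $ i"]) simp
  next
    assume "\<exists>w. (\<exists>i<d. w i \<noteq> 0) \<and> (\<forall>i<d. (\<Sum>j<d. A i j * w j) = 0)"
    then obtain w i where w: "i < d" "w i \<noteq> 0" "\<forall>i<d. (\<Sum>j<d. A i j * w j) = 0" by auto
    have "vec d w \<noteq> 0\<^sub>v d" using w(1,2) by (metis index_vec index_zero_vec(1))
    moreover have "?A *\<^sub>v vec d w = 0\<^sub>v d"
      using w(3) mv[of _ "vec d w"] by (intro eq_vecI) (auto simp del: index_mult_mat_vec)
    moreover have A: "?A \<in> carrier_mat d d" by simp
    ultimately show "det ?A = 0"
      unfolding det_0_iff_vec_prod_zero_field[OF A] using vec_carrier by blast
  qed
qed

text \<open>
  The pencil \<open>Q - s R\<close> has an invertible leading matrix \<open>R\<close>, and its characteristic polynomial has the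
  \<open>d\<close> distinct roots \<open>s k\<close>.
\<close>

definition simple_pencil ::
  "nat \<Rightarrow> (nat \<Rightarrow> nat \<Rightarrow> 'k::field) \<Rightarrow> (nat \<Rightarrow> nat \<Rightarrow> 'k) \<Rightarrow> (nat \<Rightarrow> 'k) \<Rightarrow> (nat \<Rightarrow> nat \<Rightarrow> 'k) \<Rightarrow> bool" where
  "simple_pencil d Q R s v \<longleftrightarrow>
     (\<forall>w. (\<forall>i<d. (\<Sum>j<d. R i j * w j) = 0) \<longrightarrow> (\<forall>i<d. w i = 0)) \<and> inj_on s {..<d} \<and>
     (\<forall>k<d. (\<exists>i<d. v k i \<noteq> 0) \<and> (\<forall>i<d. (\<Sum>j<d. Q i j * v k j) = s k * (\<Sum>j<d. R i j * v k j)))"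

text \<open>
  By induction on \<open>J\<close>: applying \<open>Q\<close> to a relation and cancelling the injective \<open>R\<close> gives a second
  relation, weighted by the eigenvalues, and one summand is eliminated between the two.
\<close>

lemma pencil_eigen_indep:
  fixes Q R :: "nat \<Rightarrow> nat \<Rightarrow> 'k::field"
  assumes R: "\<And>w. (\<And>i. i < d \<Longrightarrow> (\<Sum>j<d. R i j * w j) = 0) \<Longrightarrow> (\<And>i. i < d \<Longrightarrow> w i = 0)"
    and "finite J" "inj_on \<mu> J"
    and "\<And>m i. m \<in> J \<Longrightarrow> i < d \<Longrightarrow> (\<Sum>j<d. Q i j * z m j) = \<mu> m * (\<Sum>j<d. R i j * z m j)"
    and "\<And>i. i < d \<Longrightarrow> (\<Sum>m\<in>J. z m i) = 0"
    and "m \<in> J" "i < d"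
  shows "z m i = 0"
  using assms(2-)
proof (induction J arbitrary: z m i rule: finite_induct)
  case empty
  then show ?case by simp
next
  case (insert r J)
  have eig: "(\<Sum>j<d. Q i j * z m j) = \<mu> m * (\<Sum>j<d. R i j * z m j)" if "m \<in> insert r J" "i < d" for m i
    using insert.prems(2) that by blast
  have "(\<Sum>m\<in>insert r J. \<mu> m * z m i) = 0" if "i < d" for i
  proof (rule R[where w = "\<lambda>i. \<Sum>m\<in>insert r J. \<mu> m * z m i"])
    fix i assume i: "i < d"
    have "(\<Sum>j<d. R i j * (\<Sum>m\<in>insert r J. \<mu> m * z m j)) = (\<Sum>m\<in>insert r J. \<mu> m * (\<Sum>j<d. R i j * z m j))"
      unfolding sum_distrib_left by (subst sum.swap) (simp add: mult.left_commute)
    also have "\<dots> = (\<Sum>m\<in>insert r J. \<Sum>j<d. Q i j * z m j)"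
      using eig i by (intro sum.cong) auto
    also have "\<dots> = (\<Sum>j<d. Q i j * (\<Sum>m\<in>insert r J. z m j))"
      unfolding sum_distrib_left by (rule sum.swap)
    also have "\<dots> = 0" using insert.prems(3) by (intro sum.neutral) auto
    finally show "(\<Sum>j<d. R i j * (\<Sum>m\<in>insert r J. \<mu> m * z m j)) = 0" .
  qed fact
  then have "(\<Sum>m\<in>insert r J. (\<mu> m - \<mu> r) * z m i) = 0" if "i < d" for i
    using that insert.prems(3)[OF that] by (simp add: left_diff_distrib sum_subtractf sum_distrib_left[symmetric] del: sum.insert)
  then have s0: "(\<Sum>m\<in>J. (\<mu> m - \<mu> r) * z m i) = 0" if "i < d" for i
    using that insert.hyps by simp
  have ze: "(\<mu> m - \<mu> r) * z m i = 0" if "m \<in> J" "i < d" for m i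
  proof (rule insert.IH[where z = "\<lambda>m i. (\<mu> m - \<mu> r) * z m i"])
    show "inj_on \<mu> J" using insert.prems(1) by simp
    show "(\<Sum>j<d. Q i j * ((\<mu> m - \<mu> r) * z m j)) = \<mu> m * (\<Sum>j<d. R i j * ((\<mu> m - \<mu> r) * z m j))"
      if "m \<in> J" "i < d" for m i
    proof -
      have "(\<Sum>j<d. Q i j * ((\<mu> m - \<mu> r) * z m j)) = (\<mu> m - \<mu> r) * (\<Sum>j<d. Q i j * z m j)"
        by (simp add: sum_distrib_left mult.left_commute)
      also have "\<dots> = (\<mu> m - \<mu> r) * (\<mu> m * (\<Sum>j<d. R i j * z m j))" using eig that by simp
      also have "\<dots> = \<mu> m * (\<Sum>j<d. R i j * ((\<mu> m - \<mu> r) * z m j))"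
        by (simp add: sum_distrib_left mult.left_commute)
      finally show ?thesis .
    qed
  qed (use s0 that in auto)
  have zJ: "z m i = 0" if "m \<in> J" "i < d" for m i
  proof -
    have "\<mu> m \<noteq> \<mu> r" using insert.prems(1) insert.hyps that by (auto simp: inj_on_def)
    then show ?thesis using ze[OF that] by simp
  qed
  moreover have "z r i = 0" if "i < d" for i
    using insert.prems(3)[OF that] insert.hyps zJ that by simp
  ultimately show ?case using insert.prems(4,5) by auto
qed

text \<open>
  Together with the \<open>d\<close> given eigenvectors a further one would be linearly dependent, and a relation
  among eigenvectors for distinct eigenvalues is trivial.
\<close>

lemma simple_pencil_unique:
  fixes Q R :: "nat \<Rightarrow> nat \<Rightarrow> 'k::field"
  assumes P: "simple_pencil d Q R s v" and w: "\<exists>i<d. w i \<noteq> 0"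
    and eig: "\<And>i. i < d \<Longrightarrow> (\<Sum>j<d. Q i j * w j) = lam * (\<Sum>j<d. R i j * w j)"
  shows "\<exists>k<d. lam = s k \<and> (\<exists>c. c \<noteq> 0 \<and> (\<forall>i<d. w i = c * v k i))"
proof -
  have R: "\<And>i. i < d \<Longrightarrow> w i = 0" if "\<And>i. i < d \<Longrightarrow> (\<Sum>j<d. R i j * w j) = 0" for w
    using P that unfolding simple_pencil_def by blast
  have s: "inj_on s {..<d}" using P unfolding simple_pencil_def by blast
  have v: "\<exists>i<d. v k i \<noteq> 0" "\<And>i. i < d \<Longrightarrow> (\<Sum>j<d. Q i j * v k j) = s k * (\<Sum>j<d. R i j * v k j)"
    if "k < d" for k using P that unfolding simple_pencil_def by blast+
  have d: "d > 0" using w by auto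
  define u where "u k = (\<lambda>x. if x < d then (if k < d then v k x else w x) else 0)" for k
  have "\<not> fam_indep (Suc d) u"
  proof
    assume "fam_indep (Suc d) u"
    moreover have "u k \<in> coord_space (d - 1)" for k using d by (auto simp: u_def coord_space_def)
    ultimately have "Suc d \<le> Suc (d - 1)"
      by (intro grassmannian_indep_le[OF coord_space_grassmannian]) auto
    with d show False by simp
  qed
  then obtain c k where c: "lcomb (Suc d) c u = 0" and k: "k < Suc d" "c k \<noteq> 0"
    unfolding fam_indep_def by auto
  have rel: "(\<Sum>k<d. c k * v k i) + c d * w i = 0" if "i < d" for i
    using fun_cong[OF c, of i] that by (simp add: lcomb_def u_def)
  show ?thesis
  proof (cases "\<exists>k0<d. lam = s k0")
    case True
    then obtain k0 where k0: "k0 < d" "lam = s k0" by auto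
    define z where "z k i = c k * v k i + (if k = k0 then c d * w i else 0)" for k i
    have z0: "z k i = 0" if "k < d" "i < d" for k i
    proof (rule pencil_eigen_indep[of d R "{..<d}" s Q])
      fix m i assume mi: "m \<in> {..<d}" "i < d"
      have "(\<Sum>j<d. Q i j * z m j) = c m * (\<Sum>j<d. Q i j * v m j) + (if m = k0 then c d * (\<Sum>j<d. Q i j * w j) else 0)"
        by (auto simp: z_def sum_distrib_left sum.distrib algebra_simps)
      also have "\<dots> = s m * (c m * (\<Sum>j<d. R i j * v m j) + (if m = k0 then c d * (\<Sum>j<d. R i j * w j) else 0))"
        using v(2) eig mi k0 by (auto simp: algebra_simps)
      also have "\<dots> = s m * (\<Sum>j<d. R i j * z m j)"
        by (auto simp: z_def sum_distrib_left sum.distrib algebra_simps)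
      finally show "(\<Sum>j<d. Q i j * z m j) = s m * (\<Sum>j<d. R i j * z m j)" .
    next
      fix i assume "i < d"
      then show "(\<Sum>m<d. z m i) = 0" using rel[of i] k0 by (simp add: z_def sum.distrib)
    qed (use R s that in auto)
    have ck: "c m = 0" if "m < d" "m \<noteq> k0" for m
      using v(1)[OF that(1)] z0[OF that(1)] that by (auto simp: z_def)
    have r0: "c k0 * v k0 i + c d * w i = 0" if "i < d" for i using z0[OF k0(1) that] by (simp add: z_def)
    have cd: "c d \<noteq> 0"
    proof
      assume cd: "c d = 0"
      then have "c k0 = 0" using v(1)[OF k0(1)] r0 by auto
      then show False using ck cd k by (metis less_antisym)
    qed
    have weq: "w i = (- c k0 / c d) * v k0 i" if "i < d" for i
      using r0[OF that] cd by (simp add: field_simps eq_neg_iff_add_eq_0)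
    moreover have "- c k0 / c d \<noteq> 0" using w weq by auto
    ultimately show ?thesis using k0 by blast
  next
    case False
    define z where "z k i = (if k < d then c k * v k i else c d * w i)" for k i
    define \<mu> where "\<mu> k = (if k < d then s k else lam)" for k
    have z0: "z k i = 0" if "k < Suc d" "i < d" for k i
    proof (rule pencil_eigen_indep[of d R "{..<Suc d}" \<mu> Q])
      show "inj_on \<mu> {..<Suc d}" using s False by (auto simp: inj_on_def \<mu>_def less_Suc_eq)
      fix m i assume mi: "m \<in> {..<Suc d}" "i < d"
      show "(\<Sum>j<d. Q i j * z m j) = \<mu> m * (\<Sum>j<d. R i j * z m j)"
      proof (cases "m < d")
        case True
        have "(\<Sum>j<d. Q i j * z m j) = c m * (\<Sum>j<d. Q i j * v m j)"
          using True by (simp add: z_def sum_distrib_left algebra_simps)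
        also have "\<dots> = \<mu> m * (\<Sum>j<d. R i j * z m j)"
          using True v(2)[OF True mi(2)] by (simp add: z_def \<mu>_def sum_distrib_left algebra_simps)
        finally show ?thesis .
      next
        case m: False
        have "(\<Sum>j<d. Q i j * z m j) = c d * (\<Sum>j<d. Q i j * w j)"
          using m by (simp add: z_def sum_distrib_left algebra_simps)
        also have "\<dots> = \<mu> m * (\<Sum>j<d. R i j * z m j)"
          using m eig[OF mi(2)] by (simp add: z_def \<mu>_def sum_distrib_left algebra_simps)
        finally show ?thesis .
      qed
    next
      fix i assume "i < d"
      then show "(\<Sum>m<Suc d. z m i) = 0" using rel[of i] by (simp add: z_def)
    qed (use R that in auto)
    have "c m = 0" if "m < d" for m using v(1)[OF that] z0[of m] that by (auto simp: z_def)
    moreover have "c d = 0" using w z0[of d] by (auto simp: z_def)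
    ultimately show ?thesis using k by (metis less_antisym)
  qed
qed

definition pencil_poly :: "nat \<Rightarrow> (nat \<Rightarrow> nat \<Rightarrow> 'k::field) \<Rightarrow> (nat \<Rightarrow> nat \<Rightarrow> 'k) \<Rightarrow> 'k poly" where
  "pencil_poly d Q R = det (mat d d (\<lambda>(i, j). [:Q i j, - R i j:]))"

lemma pencil_poly_Leibniz:
  "pencil_poly d Q R = (\<Sum>p\<in>{p. p permutes {0..<d}}. signof p * (\<Prod>i = 0..<d. [:Q i (p i), - R i (p i):]))"
  unfolding pencil_poly_def
  by (subst det_def'[of _ d])
     (auto intro!: sum.cong prod.cong arg_cong2[where f = "(*)"] simp: permutes_in_image)

lemma signof_poly: "(signof p :: 'k::field poly) = [:signof p:]"
  by (simp add: sign_def one_pCons)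

lemma poly_pencil_poly: "poly (pencil_poly d Q R) x = det (mat d d (\<lambda>(i, j). Q i j - x * R i j))"
  unfolding pencil_poly_Leibniz
  by (subst det_def'[of _ d])
     (auto intro!: sum.cong prod.cong arg_cong2[where f = "(*)"] simp: permutes_in_image poly_sum poly_prod signof_poly)

lemma coeff_prod_linear:
  "coeff (\<Prod>i = 0..<d. [:a i, b i:]) d = (\<Prod>i = 0..<d. b i :: 'k::field) \<and> degree (\<Prod>i = 0..<d. [:a i, b i:]) \<le> d"
proof (induction d)
  case (Suc d)
  let ?p = "\<Prod>i = 0..<d. [:a i, b i:]"
  have "coeff ?p (Suc d) = 0" using Suc by (intro coeff_eq_0) simp
  then have "coeff ([:a d, b d:] * ?p) (Suc d) = b d * coeff ?p d" by simp
  moreover have "degree ([:a d, b d:] * ?p) \<le> Suc d"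
    using degree_mult_le[of "[:a d, b d:]" ?p] Suc by (auto split: if_splits)
  ultimately show ?case using Suc by (simp add: mult.commute)
qed simp

lemma degree_pencil_poly: "degree (pencil_poly d Q R) \<le> d"
  unfolding pencil_poly_Leibniz
  by (intro degree_sum_le) (auto simp: finite_permutations signof_poly coeff_prod_linear intro: order_trans[OF degree_smult_le])

lemma coeff_pencil_poly: "coeff (pencil_poly d Q R) d = det (mat d d (\<lambda>(i, j). - R i j))"
  unfolding pencil_poly_Leibniz
  by (subst det_def'[of _ d])
     (auto intro!: sum.cong prod.cong arg_cong2[where f = "(*)"]
       simp: permutes_in_image coeff_sum signof_poly coeff_prod_linear)

text \<open>
  The matrix of \<open>(u, w) \<mapsto> u p + w p'\<close> on polynomials of degree below \<open>d - 1\<close> and \<open>d\<close>; for \<open>p\<close> of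
  degree \<open>d\<close> its determinant is the discriminant of \<open>p\<close> up to a factor.
\<close>

definition disc_col :: "nat \<Rightarrow> 'k::field poly \<Rightarrow> nat \<Rightarrow> 'k poly" where
  "disc_col d p c = (if c < d - 1 then monom 1 c * p else monom 1 (c - (d - 1)) * pderiv p)"

definition disc :: "nat \<Rightarrow> 'k::field poly \<Rightarrow> 'k" where
  "disc d p = det (mat (2 * d - 1) (2 * d - 1) (\<lambda>(r, c). coeff (disc_col d p c) r))"

lemma degree_pderiv_le: "degree (pderiv p) \<le> degree (p :: 'k::field poly) - 1"
  by (intro degree_le) (auto simp: coeff_pderiv coeff_eq_0)

lemma sum_split_add: fixes m d :: nat shows "(\<Sum>c<m + d. f c) = (\<Sum>c<m. f c) + (\<Sum>c<d. f (m + c) :: 'a::comm_monoid_add)"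
  by (induction d) (auto simp: add.assoc)

lemma degree_disc_col:
  fixes p :: "'k::field poly"
  assumes "degree p \<le> d" "0 < d" "c < 2 * d - 1" shows "degree (disc_col d p c) < 2 * d - 1"
proof (cases "c < d - 1")
  case True
  have "degree (monom 1 c * p) \<le> c + d"
    using degree_mult_le[of "monom 1 c" p] degree_monom_le[of "1::'k" c] assms by (meson add_mono order_trans)
  with True show ?thesis by (simp add: disc_col_def)
next
  case False
  have "degree (monom 1 (c - (d - 1)) * pderiv p) \<le> (c - (d - 1)) + (d - 1)"
    using degree_mult_le[of "monom 1 (c - (d - 1))" "pderiv p"] degree_monom_le[of "1::'k" "c - (d - 1)"]
      degree_pderiv_le[of p] assms by linarith
  with False assms show ?thesis by (simp add: disc_col_def)
qed

text \<open>
  The powers of a common root of \<open>p\<close> and \<open>p'\<close> form a vector in the left kernel of the matrix.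
\<close>

lemma disc_nonzero_no_common_root:
  assumes "disc d p \<noteq> 0" "degree p \<le> d" "0 < d" "poly p x = 0" shows "poly (pderiv p) x \<noteq> 0"
proof
  assume r: "poly (pderiv p) x = 0"
  let ?N = "2 * d - 1"
  let ?A = "mat ?N ?N (\<lambda>(r, c). coeff (disc_col d p c) r)"
  have "(\<Sum>r<?N. coeff (disc_col d p c) r * x ^ r) = 0" if "c < ?N" for c
  proof -
    have "poly (disc_col d p c) x = (\<Sum>r<?N. coeff (disc_col d p c) r * x ^ r)"
      unfolding poly_altdef using degree_disc_col[OF assms(2,3) that]
      by (intro sum.mono_neutral_left) (auto simp: coeff_eq_0)
    moreover have "poly (disc_col d p c) x = 0" using assms(4) r by (simp add: disc_col_def)
    ultimately show ?thesis by simp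
  qed
  moreover have "\<exists>i<?N. x ^ i \<noteq> 0" using assms(3) by (intro exI[of _ 0]) simp
  ultimately have "det (mat ?N ?N (\<lambda>(c, r). coeff (disc_col d p c) r)) = 0"
    unfolding det_zero_iff_kernel by (intro exI[of _ "\<lambda>r. x ^ r"]) simp
  moreover have "transpose_mat ?A = mat ?N ?N (\<lambda>(c, r). coeff (disc_col d p c) r)"
    by (intro eq_matI) auto
  ultimately have "det ?A = 0" using det_transpose[of ?A ?N] by simp
  with assms(1) show False by (simp add: disc_def)
qed

text \<open>
  A kernel vector is a relation \<open>u p + w p' = 0\<close>. Then \<open>w\<close>, of degree below \<open>d\<close>, vanishes at the \<open>d\<close>
  simple roots, so \<open>w = 0\<close> and \<open>u = 0\<close>.
\<close>

lemma disc_nonzero_if_simple_roots: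
  assumes deg: "degree p \<le> d" "p \<noteq> 0" and d: "0 < d" and s: "inj_on s {..<d}" "\<And>k. k < d \<Longrightarrow> poly p (s k) = 0"
    and simple: "\<And>k. k < d \<Longrightarrow> poly (pderiv p) (s k) \<noteq> 0"
  shows "disc d p \<noteq> 0"
proof
  let ?N = "2 * d - 1"
  assume "disc d p = 0"
  then obtain z where z: "\<exists>i<?N. z i \<noteq> 0" "\<And>r. r < ?N \<Longrightarrow> (\<Sum>c<?N. coeff (disc_col d p c) r * z c) = 0"
    unfolding disc_def det_zero_iff_kernel by auto
  define u where "u = (\<Sum>c<d - 1. monom (z c) c)"
  define w where "w = (\<Sum>c<d. monom (z (d - 1 + c)) c)"
  have "coeff (\<Sum>c<?N. smult (z c) (disc_col d p c)) r = 0" for r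
  proof (cases "r < ?N")
    case True
    then show ?thesis using z(2)[OF True] by (simp add: coeff_sum mult.commute)
  next
    case False
    then have "coeff (disc_col d p c) r = 0" if "c < ?N" for c
      using degree_disc_col[OF deg(1) d that] by (intro coeff_eq_0) simp
    then show ?thesis by (simp add: coeff_sum)
  qed
  then have "(\<Sum>c<?N. smult (z c) (disc_col d p c)) = 0" by (simp add: poly_eq_iff)
  moreover have "(\<Sum>c<?N. smult (z c) (disc_col d p c)) = u * p + w * pderiv p"
  proof -
    have N: "?N = (d - 1) + d" using d by simp
    have "(\<Sum>c<?N. smult (z c) (disc_col d p c)) = (\<Sum>c<d - 1. smult (z c) (disc_col d p c))
        + (\<Sum>c<d. smult (z (d - 1 + c)) (disc_col d p (d - 1 + c)))"
      unfolding N by (rule sum_split_add)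
    also have "\<dots> = u * p + w * pderiv p"
      unfolding u_def w_def sum_distrib_right disc_col_def
      by (intro arg_cong2[where f = "(+)"] sum.cong) (auto simp: smult_monom mult_smult_left[symmetric] simp del: mult_smult_left)
    finally show ?thesis .
  qed
  ultimately have eq: "u * p + w * pderiv p = 0" by simp
  have "poly w (s k) = 0" if "k < d" for k
    using arg_cong[OF eq, of "\<lambda>q. poly q (s k)"] s(2)[OF that] simple[OF that] by simp
  then have sub: "s ` {..<d} \<subseteq> {x. poly w x = 0}" by auto
  have w0: "w = 0"
  proof (rule ccontr)
    assume w: "w \<noteq> 0"
    have "d = card (s ` {..<d})" using s(1) by (simp add: card_image)
    also have "\<dots> \<le> card {x. poly w x = 0}" using sub poly_roots_finite[OF w] by (rule card_mono[rotated])
    also have "\<dots> \<le> degree w" by (rule card_poly_roots_bound[OF w])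
    also have "degree w \<le> d - 1"
      unfolding w_def by (intro degree_sum_le) (auto intro: order_trans[OF degree_monom_le])
    finally show False using d by simp
  qed
  with eq deg have u0: "u = 0" by simp
  have "z c = 0" if "c < d - 1" for c
  proof -
    have "coeff u c = z c" using that by (simp add: u_def coeff_sum)
    then show ?thesis using u0 by simp
  qed
  moreover have "z (d - 1 + c) = 0" if "c < d" for c
  proof -
    have "coeff w c = z (d - 1 + c)" using that by (simp add: w_def coeff_sum)
    then show ?thesis using w0 by simp
  qed
  ultimately have "z i = 0" if "i < ?N" for i
    using that by (cases "i < d - 1") (auto dest: meta_spec[of _ "i - (d - 1)"])
  with z(1) show False by auto
qed

lemma card_roots_squarefree:
  fixes p :: "'k::alg_closed_field poly"
  assumes "p \<noteq> 0" "\<And>x. poly p x = 0 \<Longrightarrow> poly (pderiv p) x \<noteq> 0"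
  shows "card {x. poly p x = 0} = degree p"
proof -
  obtain A where A: "size A = degree p" "p = smult (lead_coeff p) (\<Prod>x\<in>#A. [:-x, 1:])"
    using alg_closed_imp_factorization[OF assms(1)] by blast
  have roots: "{x. poly p x = 0} = set_mset A"
  proof -
    have "poly (\<Prod>x\<in>#A. [:-x, 1:]) y = 0 \<longleftrightarrow> y \<in># A" for y
      by (induction A) auto
    then show ?thesis using assms(1) by (subst A(2)) auto
  qed
  have "count A x = 1" if x: "x \<in># A" for x
  proof (rule ccontr)
    assume "count A x \<noteq> 1"
    then have "x \<in># A - {#x#}" using x by (simp add: in_diff_count Suc_lessI)
    then obtain B where B: "A = add_mset x (add_mset x B)"
      using x by (metis insert_DiffM)
    define q where "q = smult (lead_coeff p) (\<Prod>x\<in>#B. [:-x, 1:])"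
    have p: "p = [:-x, 1:] * ([:-x, 1:] * q)"
      by (subst A(2)) (simp add: B q_def)
    have "poly (pderiv p) x = 0" by (subst p) (simp only: pderiv_mult poly_add poly_mult, simp)
    with assms(2)[of x] p show False by simp
  qed
  then have "size A = card (set_mset A)" by (simp add: size_multiset_overloaded_eq)
  then show ?thesis using roots A by simp
qed

text \<open>
  The leading coefficient of the pencil polynomial is \<open>det (- R)\<close>, so it has degree \<open>d\<close>, and by the
  discriminant all its roots are simple. At each of these \<open>d\<close> roots the matrix \<open>Q - s R\<close> has a kernel.
\<close>

lemma pencil_disc_imp_simple:
  fixes Q R :: "nat \<Rightarrow> nat \<Rightarrow> 'k::alg_closed_field"
  assumes d: "0 < d" and R: "det (mat d d (\<lambda>(i, j). - R i j)) \<noteq> 0" and D: "disc d (pencil_poly d Q R) \<noteq> 0"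
  shows "\<exists>s v. simple_pencil d Q R s v"
proof -
  let ?p = "pencil_poly d Q R"
  have deg: "degree ?p = d" using degree_pencil_poly[of d Q R] R coeff_pencil_poly[of d Q R]
    by (metis le_degree le_antisym)
  have ne: "?p \<noteq> 0" using R coeff_pencil_poly[of d Q R] by auto
  have "card {x. poly ?p x = 0} = d"
    using card_roots_squarefree[OF ne] disc_nonzero_no_common_root[OF D _ d] deg by simp
  then obtain s where s: "bij_betw s {..<d} {x. poly ?p x = 0}"
    using ex_bij_betw_nat_finite[OF poly_roots_finite[OF ne]] by (auto simp: atLeast0LessThan)
  have "\<exists>w. (\<exists>i<d. w i \<noteq> 0) \<and> (\<forall>i<d. (\<Sum>j<d. (Q i j - s k * R i j) * w j) = 0)" if "k < d" for k
  proof -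
    have "poly ?p (s k) = 0" using s that by (auto simp: bij_betw_def)
    then show ?thesis unfolding poly_pencil_poly det_zero_iff_kernel .
  qed
  then obtain v where v: "\<And>k. k < d \<Longrightarrow> \<exists>i<d. v k i \<noteq> 0"
    "\<And>k i. k < d \<Longrightarrow> i < d \<Longrightarrow> (\<Sum>j<d. (Q i j - s k * R i j) * v k j) = 0" by metis
  have "simple_pencil d Q R s v" unfolding simple_pencil_def
  proof (intro conjI allI impI)
    show "inj_on s {..<d}" using s by (simp add: bij_betw_def)
    fix w i assume w: "\<forall>i<d. (\<Sum>j<d. R i j * w j) = 0" and i: "i < d"
    show "w i = 0"
    proof (rule ccontr)
      assume "w i \<noteq> 0"
      with i w have "det (mat d d (\<lambda>(i, j). - R i j)) = 0"
        unfolding det_zero_iff_kernel by (intro exI[of _ w]) (auto simp: sum_negf)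
      with R show False by simp
    qed
  next
    fix k assume "k < d"
    then show "\<exists>i<d. v k i \<noteq> 0" by (rule v(1))
    fix i assume "i < d"
    then show "(\<Sum>j<d. Q i j * v k j) = s k * (\<Sum>j<d. R i j * v k j)"
      using v(2)[OF \<open>k < d\<close>] by (simp add: left_diff_distrib sum_subtractf sum_distrib_left mult.assoc)
  qed
  then show ?thesis by blast
qed

text \<open>
  The \<open>d\<close> eigenvalues are distinct roots of a polynomial of degree at most \<open>d\<close>, hence simple roots.
\<close>

lemma simple_pencil_imp_disc:
  fixes Q R :: "nat \<Rightarrow> nat \<Rightarrow> 'k::field"
  assumes d: "0 < d" and P: "simple_pencil d Q R s v"
  shows "det (mat d d (\<lambda>(i, j). - R i j)) \<noteq> 0" "disc d (pencil_poly d Q R) \<noteq> 0"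
proof -
  let ?p = "pencil_poly d Q R"
  show R: "det (mat d d (\<lambda>(i, j). - R i j)) \<noteq> 0"
    using P unfolding det_zero_iff_kernel simple_pencil_def by (auto simp: sum_negf)
  have ne: "?p \<noteq> 0" using R coeff_pencil_poly[of d Q R] by auto
  have deg: "degree ?p \<le> d" by (rule degree_pencil_poly)
  have s: "inj_on s {..<d}" using P unfolding simple_pencil_def by blast
  have root: "poly ?p (s k) = 0" if "k < d" for k
  proof -
    have "\<exists>i<d. v k i \<noteq> 0" "\<forall>i<d. (\<Sum>j<d. (Q i j - s k * R i j) * v k j) = 0"
      using P that unfolding simple_pencil_def
      by (auto simp: left_diff_distrib sum_subtractf sum_distrib_left mult.assoc)
    then show ?thesis unfolding poly_pencil_poly det_zero_iff_kernel by blast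
  qed
  have "poly (pderiv ?p) (s k) \<noteq> 0" if k: "k < d" for k
  proof
    assume z: "poly (pderiv ?p) (s k) = 0"
    obtain q where q: "?p = [:- s k, 1:] * q" using root[OF k] by (auto simp: poly_eq_0_iff_dvd elim: dvdE)
    have "poly (pderiv ([:- s k, 1:] * q)) (s k) = poly q (s k)"
      by (simp only: pderiv_mult poly_add poly_mult) (simp add: pderiv_pCons)
    then have "poly q (s k) = 0" using z q by simp
    have sub: "s ` {..<d} \<subseteq> {x. poly q x = 0}"
    proof safe
      fix m assume m: "m < d"
      show "poly q (s m) = 0"
      proof (cases "m = k")
        case True
        then show ?thesis using \<open>poly q (s k) = 0\<close> by simp
      next
        case False
        then have "s m \<noteq> s k" using s m k by (auto simp: inj_on_def)
        then show ?thesis using root[OF m] unfolding q by simp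
      qed
    qed
    have q0: "q \<noteq> 0" using ne q by auto
    have "d = card (s ` {..<d})" using s by (simp add: card_image)
    also have "\<dots> \<le> card {x. poly q x = 0}" using sub poly_roots_finite[OF q0] by (rule card_mono[rotated])
    also have "\<dots> \<le> degree q" by (rule card_poly_roots_bound[OF q0])
    finally have "d \<le> degree q" .
    moreover have "degree ?p = Suc (degree q)" unfolding q using q0 by (subst degree_mult_eq) auto
    ultimately show False using deg by simp
  qed
  with disc_nonzero_if_simple_roots[OF deg ne d s root] show "disc d ?p \<noteq> 0" by blast
qed

lemma pfun_coeff_mult:
  assumes "\<And>i. pfun G (\<lambda>x. coeff (f x) i)" "\<And>i. pfun G (\<lambda>x. coeff (g x) i)"
  shows "pfun G (\<lambda>x. coeff (f x * g x) i)"
  unfolding coeff_mult by (intro pfun_sum pfun.mult assms)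

lemma pfun_coeff_prod:
  assumes "\<And>j i. j \<in> A \<Longrightarrow> pfun G (\<lambda>x. coeff (f x j) i)"
  shows "pfun G (\<lambda>x. coeff (\<Prod>j\<in>A. f x j) i)"
  using assms
proof (induction A arbitrary: i rule: infinite_finite_induct)
  case (insert j A)
  then have "pfun G (\<lambda>x. coeff (f x j * (\<Prod>j\<in>A. f x j)) i)" by (intro pfun_coeff_mult) auto
  with insert show ?case by simp
qed (auto intro: pfun.const)

lemma pfun_pencil:
  assumes "\<And>i j. i < d \<Longrightarrow> j < d \<Longrightarrow> pfun G (\<lambda>x. Q x i j)" "\<And>i j. i < d \<Longrightarrow> j < d \<Longrightarrow> pfun G (\<lambda>x. R x i j)"
  shows "pfun G (\<lambda>x. det (mat d d (\<lambda>(i, j). - R x i j)))" "pfun G (\<lambda>x. disc d (pencil_poly d (Q x) (R x)))"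
proof -
  show "pfun G (\<lambda>x. det (mat d d (\<lambda>(i, j). - R x i j)))"
    by (intro pfun_det pfun_uminus assms)
  have p: "pfun G (\<lambda>x. coeff (pencil_poly d (Q x) (R x)) i)" for i
  proof -
    have "pfun G (\<lambda>x. coeff ([:Q x j (p j), - R x j (p j):]) i)"
      if "p permutes {0..<d}" "j < d" for p i j
    proof -
      have "p j < d" using that by (metis atLeastLessThan_iff permutes_in_image zero_le)
      then show ?thesis using that assms
        by (cases i; cases "i - 1") (auto simp: coeff_pCons intro: pfun_uminus pfun.const)
    qed
    then show ?thesis
      unfolding pencil_poly_Leibniz coeff_sum signof_poly
      by (simp, intro pfun_sum pfun.mult pfun.const pfun_coeff_prod) auto
  qed
  have "pfun G (\<lambda>x. coeff (disc_col d (pencil_poly d (Q x) (R x)) c) r)" for c r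
  proof (cases "c < d - 1")
    case True
    then show ?thesis unfolding disc_col_def by (simp, intro pfun_coeff_mult pfun.const p)
  next
    case False
    have "pfun G (\<lambda>x. coeff (pderiv (pencil_poly d (Q x) (R x))) i)" for i
      unfolding coeff_pderiv by (intro pfun.mult pfun.const p)
    then show ?thesis using False unfolding disc_col_def by (simp, intro pfun_coeff_mult pfun.const)
  qed
  then show "pfun G (\<lambda>x. disc d (pencil_poly d (Q x) (R x)))"
    unfolding disc_def by (intro pfun_det)
qed

section \<open>Lines and the subspaces they meet\<close>

definition line :: "(nat \<Rightarrow> 'k::field) \<Rightarrow> (nat \<Rightarrow> 'k) \<Rightarrow> (nat \<Rightarrow> 'k) set" where
  "line x y = {vscale \<alpha> x + vscale \<beta> y | \<alpha> \<beta>. True}"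

definition indep2 :: "(nat \<Rightarrow> 'k::field) \<Rightarrow> (nat \<Rightarrow> 'k) \<Rightarrow> bool" where
  "indep2 x y \<longleftrightarrow> (\<forall>\<alpha> \<beta>. vscale \<alpha> x + vscale \<beta> y = 0 \<longrightarrow> \<alpha> = 0 \<and> \<beta> = 0)"

definition pair :: "'a \<Rightarrow> 'a \<Rightarrow> nat \<Rightarrow> 'a" where
  "pair x y k = (if k = 0 then x else y)"

lemma pair_in: "x \<in> V \<Longrightarrow> y \<in> V \<Longrightarrow> pair x y k \<in> V"
  by (simp add: pair_def)

lemma lcomb_pair: "lcomb 2 c (pair x y) = vscale (c 0) x + vscale (c 1) y"
  by (simp add: lcomb_def pair_def fun_eq_iff numeral_2_eq_2)

lemma indep2_pair: "fam_indep 2 (pair x y) \<longleftrightarrow> indep2 x y"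
proof
  assume a: "fam_indep 2 (pair x y)"
  show "indep2 x y" unfolding indep2_def
  proof (intro allI impI)
    fix \<alpha> \<beta> assume "vscale \<alpha> x + vscale \<beta> y = 0"
    then have l: "lcomb 2 (pair \<alpha> \<beta>) (pair x y) = 0" unfolding lcomb_pair by (simp add: pair_def)
    show "\<alpha> = 0 \<and> \<beta> = 0" using fam_indepD[OF a l, of 0] fam_indepD[OF a l, of 1] by (simp add: pair_def)
  qed
next
  assume "indep2 x y"
  then show "fam_indep 2 (pair x y)"
    unfolding fam_indep_def indep2_def lcomb_pair by (auto simp: less_2_cases_iff)
qed

lemma span_pair: "kvec.span (pair x y ` {..<2}) = line x y"
proof (intro equalityI subsetI)
  fix z assume "z \<in> kvec.span (pair x y ` {..<2})"
  then show "z \<in> line x y" unfolding span_family line_def lcomb_pair by auto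
next
  fix z assume "z \<in> line x y"
  then obtain \<alpha> \<beta> where "z = lcomb 2 (pair \<alpha> \<beta>) (pair x y)"
    unfolding lcomb_pair line_def by (auto simp: pair_def)
  then show "z \<in> kvec.span (pair x y ` {..<2})" unfolding span_family by blast
qed

lemma in_line_iff: "z \<in> line x y \<longleftrightarrow> (\<exists>\<alpha> \<beta>. z = vscale \<alpha> x + vscale \<beta> y)"
  by (auto simp: line_def)

lemma in_lineI: "z = vscale \<alpha> x + vscale \<beta> y \<Longrightarrow> z \<in> line x y"
  by (auto simp: line_def)

lemma line_ends: "x \<in> line x y" "y \<in> line x y"
  using in_lineI[of x 1 x 0 y] in_lineI[of y 0 x 1 y] by (auto simp: fun_eq_iff)

lemma subspace_line: "kvec.subspace (line x y)"
  unfolding span_pair[symmetric] by (rule kvec.subspace_span)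

lemma subspace_comb:
  assumes "kvec.subspace V" "x \<in> V" "y \<in> V" shows "vscale \<alpha> x + vscale \<beta> y \<in> V"
  using assms by (intro kvec.subspace_add kvec.subspace_scale)

lemma line_subset: "kvec.subspace V \<Longrightarrow> x \<in> V \<Longrightarrow> y \<in> V \<Longrightarrow> line x y \<subseteq> V"
  unfolding line_def by (auto intro: subspace_comb)

lemma subspace_grassmannian: "V \<in> grassmannian k n \<Longrightarrow> kvec.subspace V"
  by (simp add: grassmannian_def)

lemma subspace_comb_cancel:
  assumes "kvec.subspace V" "vscale \<alpha> x + vscale \<beta> y \<in> V" "x \<in> V" "\<beta> \<noteq> 0" shows "y \<in> V"
proof -
  have "y = vscale (1 / \<beta>) (vscale \<alpha> x + vscale \<beta> y) + vscale (- \<alpha> / \<beta>) x"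
    using assms(4) by (auto simp: fun_eq_iff field_simps)
  then show ?thesis using subspace_comb[OF assms(1-3)] by metis
qed

lemma indep2D: "indep2 x y \<Longrightarrow> vscale \<alpha> x + vscale \<beta> y = 0 \<Longrightarrow> \<alpha> = 0 \<and> \<beta> = 0"
  by (simp add: indep2_def)

lemma indep2_nz: assumes "indep2 x y" shows "x \<noteq> 0" "y \<noteq> 0"
  using indep2D[OF assms, of 1 0] indep2D[OF assms, of 0 1] by (auto simp: fun_eq_iff)

lemma indep2_commute: "indep2 x y \<Longrightarrow> indep2 y x"
  unfolding indep2_def by (metis add.commute)

lemma not_indep2:
  assumes "\<not> indep2 x y" "x \<noteq> 0" obtains c where "y = vscale c x"
proof -
  obtain \<alpha> \<beta> where ab: "vscale \<alpha> x + vscale \<beta> y = 0" "\<alpha> \<noteq> 0 \<or> \<beta> \<noteq> 0"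
    using assms(1) unfolding indep2_def by blast
  have "\<beta> \<noteq> 0"
  proof
    assume "\<beta> = 0"
    with ab have "x = 0" by (auto simp: fun_eq_iff)
    with assms(2) show False by simp
  qed
  then have "y = vscale (- \<alpha> / \<beta>) x"
    using ab(1) by (auto simp: fun_eq_iff field_simps eq_neg_iff_add_eq_0 add.commute)
  then show ?thesis by (rule that)
qed

lemma line_grassmannian:
  assumes "indep2 x y" "x \<in> coord_space n" "y \<in> coord_space n" shows "line x y \<in> grassmannian 1 n"
  using span_family_grassmannian[of 1 "pair x y" n, unfolded Suc_1] assms pair_in[of x _ y]
  by (simp add: indep2_pair span_pair)

lemma grassmannian_lineE:
  assumes "l \<in> grassmannian 1 n" obtains x y where "indep2 x y" "l = line x y"
proof -
  obtain v where v: "fam_indep 2 v" "kvec.span (v ` {..<2}) = l"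
    using grassmannian_basis[OF assms] by (auto simp: numeral_2_eq_2)
  have "v ` {..<2} = pair (v 0) (v 1) ` {..<2}"
    by (intro image_cong) (auto simp: pair_def less_2_cases_iff)
  moreover have "fam_indep 2 (pair (v 0) (v 1))"
    using v(1) by (simp add: fam_indep_def lcomb_def pair_def numeral_2_eq_2)
  ultimately show ?thesis using that v by (simp add: indep2_pair span_pair)
qed

lemma line_eqI:
  assumes "l \<in> grassmannian 1 n" "indep2 x y" "x \<in> l" "y \<in> l" shows "l = line x y"
  using grassmannian_span_eq[of l 1 n "pair x y", unfolded Suc_1] assms pair_in[of x _ y]
  by (simp add: indep2_pair span_pair)

lemma line_unique:
  assumes "l \<in> grassmannian 1 n" "l' \<in> grassmannian 1 n" "indep2 x y" "x \<in> l" "y \<in> l" "x \<in> l'" "y \<in> l'"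
  shows "l = l'"
  using line_eqI[OF assms(1,3-5)] line_eqI[OF assms(2,3,6,7)] by simp

lemma line_through:
  assumes "l \<in> grassmannian 1 n" "x \<in> l" "x \<noteq> 0" obtains y where "y \<in> l" "indep2 x y" "l = line x y"
proof -
  obtain g h where gh: "indep2 g h" "l = line g h" using grassmannian_lineE[OF assms(1)] by blast
  have "\<exists>y\<in>l. indep2 x y"
  proof (rule ccontr)
    assume no: "\<not> ?thesis"
    obtain c d where c: "g = vscale c x" "h = vscale d x"
      using no gh line_ends not_indep2 assms(3) by metis
    then have "vscale d g + vscale (- c) h = 0" by (auto simp: fun_eq_iff)
    from indep2D[OF gh(1) this] c indep2_nz[OF gh(1)] show False by (auto simp: fun_eq_iff)
  qed
  then show ?thesis using that line_eqI[OF assms(1) _ assms(2)] by blast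
qed

lemma coord_subspace: "V \<in> grassmannian k n \<Longrightarrow> x \<in> V \<Longrightarrow> x \<in> coord_space n"
  by (auto simp: grassmannian_def)

lemma exists_outside:
  assumes "V \<in> grassmannian k n" "finite B" "card B \<le> k" obtains w where "w \<in> V" "w \<notin> kvec.span B"
proof -
  obtain v where v: "fam_indep (Suc k) v" "kvec.span (v ` {..<Suc k}) = V" using grassmannian_basis[OF assms(1)] by blast
  have "\<not> v ` {..<Suc k} \<subseteq> kvec.span B"
  proof
    assume "v ` {..<Suc k} \<subseteq> kvec.span B"
    then have "card (v ` {..<Suc k}) \<le> card B"
      using kvec.independent_span_bound[OF assms(2)] v(1) by (auto simp: fam_indep_iff)
    then show False using v(1) assms(3) by (simp add: fam_indep_iff card_image)
  qed
  then obtain i where "i < Suc k" "v i \<notin> kvec.span B" by auto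
  moreover from this have "v i \<in> V" using v(2) kvec.span_base[of "v i" "v ` {..<Suc k}"] by simp
  ultimately show ?thesis using that by simp
qed

definition lines_meeting :: "nat \<Rightarrow> (nat \<Rightarrow> 'k::field) set set \<Rightarrow> (nat \<Rightarrow> 'k) set set" where
  "lines_meeting n \<L> = {l \<in> grassmannian 1 n. \<forall>L\<in>\<L>. meets l L}"

lemma lines_meetingI:
  assumes "indep2 x y" "x \<in> coord_space n" "y \<in> coord_space n" "\<And>L. L \<in> \<L> \<Longrightarrow> meets (line x y) L"
  shows "line x y \<in> lines_meeting n \<L>"
  using line_grassmannian[OF assms(1-3)] assms(4) by (simp add: lines_meeting_def)

lemma meetsI: "v \<noteq> 0 \<Longrightarrow> v \<in> l \<Longrightarrow> v \<in> L \<Longrightarrow> meets l L"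
  by (auto simp: meets_def)

text \<open>
  If two solutions \<open>\<langle>v, g\<rangle>\<close> and \<open>\<langle>v, h\<rangle>\<close> have the point \<open>v\<close> in common, then every line
  \<open>\<langle>v, g + c h\<rangle>\<close> of the pencil they span is a solution: a subspace that meets both and does not
  contain \<open>v\<close> contains a line of the plane \<open>\<langle>v, g, h\<rangle>\<close>, and meets every line of that plane.
\<close>

lemma finite_solutions_disjoint:
  fixes n :: nat and \<L> :: "(nat \<Rightarrow> 'k::field) set set"
  assumes inf: "infinite (UNIV :: 'k set)" and fin: "finite (lines_meeting n \<L>)"
    and sub: "\<And>L. L \<in> \<L> \<Longrightarrow> kvec.subspace L"
    and l: "l \<in> lines_meeting n \<L>" and l': "l' \<in> lines_meeting n \<L>" and ne: "l \<noteq> l'"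
    and v: "v \<in> l" "v \<in> l'"
  shows "v = 0"
proof (rule ccontr)
  assume v0: "v \<noteq> 0"
  have lg: "l \<in> grassmannian 1 n" "l' \<in> grassmannian 1 n" using l l' by (auto simp: lines_meeting_def)
  obtain g where g: "g \<in> l" "indep2 v g" "l = line v g" using line_through[OF lg(1) v(1) v0] by blast
  obtain h where h: "h \<in> l'" "indep2 v h" "l' = line v h" using line_through[OF lg(2) v(2) v0] by blast
  have coord: "v \<in> coord_space n" "g \<in> coord_space n" "h \<in> coord_space n"
    using coord_subspace lg v g(1) h(1) by blast+
  let ?m = "\<lambda>c. line v (g + vscale c h)"
  have ind: "indep2 v (g + vscale c h)" for c
    unfolding indep2_def
  proof (intro allI impI)
    fix \<alpha> \<beta> assume z: "vscale \<alpha> v + vscale \<beta> (g + vscale c h) = 0"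
    have "\<beta> = 0"
    proof (rule ccontr)
      assume b: "\<beta> \<noteq> 0"
      have "g = vscale (- \<alpha> / \<beta>) v + vscale (- c) h"
      proof
        fix i
        have "\<beta> * g i + (\<alpha> * v i + \<beta> * c * h i) = 0"
          using fun_cong[OF z, of i] by (simp add: algebra_simps)
        then have "\<beta> * g i = - (\<alpha> * v i + \<beta> * c * h i)"
          by (simp only: eq_neg_iff_add_eq_0)
        then have "g i = - (\<alpha> * v i + \<beta> * c * h i) / \<beta>"
          using b by (metis nonzero_mult_div_cancel_left)
        then show "g i = (vscale (- \<alpha> / \<beta>) v + vscale (- c) h) i"
          using b by (simp add: diff_divide_distrib add_divide_distrib)
      qed
      then have "g \<in> l'" unfolding h(3) by (rule in_lineI)
      with line_unique[OF lg g(2) v(1) g(1) v(2)] ne show False by simp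
    qed
    moreover from this z have "vscale \<alpha> v = 0" by (simp add: fun_eq_iff)
    then have "\<alpha> = 0" using v0 by (auto simp: fun_eq_iff)
    ultimately show "\<alpha> = 0 \<and> \<beta> = 0" by simp
  qed
  have sol: "?m c \<in> lines_meeting n \<L>" for c
  proof (rule lines_meetingI[OF ind coord(1)])
    show "g + vscale c h \<in> coord_space n"
      using subspace_comb[OF subspace_coord_space coord(2,3), of 1 c] by (simp add: vscale_def)
    fix L assume L: "L \<in> \<L>"
    obtain x y where x: "x \<noteq> 0" "x \<in> l" "x \<in> L" and y: "y \<noteq> 0" "y \<in> l'" "y \<in> L"
    proof -
      have "meets l L" "meets l' L" using l l' L by (auto simp: lines_meeting_def)
      then show ?thesis using that unfolding meets_def by blast
    qed
    show "meets (?m c) L"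
    proof (cases "v \<in> L")
      case True
      then show ?thesis using v0 line_ends(1) by (intro meetsI)
    next
      case False
      obtain \<alpha> \<beta> \<gamma> \<delta> where ab: "x = vscale \<alpha> v + vscale \<beta> g" "y = vscale \<gamma> v + vscale \<delta> h"
        using x(2) y(2) unfolding g(3) h(3) in_line_iff by auto
      have nz: "\<beta> \<noteq> 0" "\<delta> \<noteq> 0"
      proof -
        { fix \<mu> z w assume z: "z = vscale \<mu> v + vscale 0 w" "z \<noteq> 0" "z \<in> L"
          have "\<mu> \<noteq> 0" using z by (auto simp: fun_eq_iff)
          then have "v \<in> L" using subspace_comb_cancel[OF sub[OF L], of 0 0 \<mu> v] z kvec.subspace_0[OF sub[OF L]] by (simp add: vscale_def zero_fun_def plus_fun_def) }
        then show "\<beta> \<noteq> 0" "\<delta> \<noteq> 0" using False ab x y by blast+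
      qed
      let ?z = "vscale (1 / \<beta>) x + vscale (c / \<delta>) y"
      have z: "?z = vscale (\<alpha> / \<beta> + c * \<gamma> / \<delta>) v + vscale 1 (g + vscale c h)"
        using nz by (auto simp: ab fun_eq_iff field_simps)
      have "?z \<noteq> 0" unfolding z using indep2D[OF ind[of c]] by fastforce
      moreover have "?z \<in> ?m c" by (rule in_lineI[OF z])
      moreover have "?z \<in> L" by (intro subspace_comb sub L x y)
      ultimately show ?thesis by (rule meetsI)
    qed
  qed
  have "inj ?m"
  proof (rule injI, rule ccontr)
    fix c c' assume eq: "?m c = ?m c'" and cc: "c \<noteq> c'"
    have sm: "kvec.subspace (?m c)" by (rule subspace_line)
    have "g + vscale c h \<in> ?m c" "g + vscale c' h \<in> ?m c" using eq line_ends(2) by metis+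
    then have "vscale (1 / (c - c')) (g + vscale c h) + vscale (- 1 / (c - c')) (g + vscale c' h) \<in> ?m c"
      by (intro subspace_comb[OF sm])
    moreover have "vscale (1 / (c - c')) (g + vscale c h) + vscale (- 1 / (c - c')) (g + vscale c' h) = h"
    proof
      fix i
      have "1 / (c - c') * (g i + c * h i) + - 1 / (c - c') * (g i + c' * h i) = (c - c') * h i / (c - c')"
        by (simp add: field_simps add_divide_distrib[symmetric] diff_divide_distrib[symmetric])
      then show "(vscale (1 / (c - c')) (g + vscale c h) + vscale (- 1 / (c - c')) (g + vscale c' h)) i = h i"
        using cc by simp
    qed
    ultimately have h_in: "h \<in> ?m c" by simp
    then have "vscale 1 (g + vscale c h) + vscale (- c) h \<in> ?m c"
      by (intro subspace_comb[OF sm] line_ends(2))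
    then have "g \<in> ?m c" by (simp add: vscale_def plus_fun_def)
    have "?m c \<in> grassmannian 1 n" using sol by (simp add: lines_meeting_def)
    then have "?m c = l" "?m c = l'"
      using line_unique[OF _ lg(1) g(2) line_ends(1) \<open>g \<in> ?m c\<close> v(1) g(1)]
        line_unique[OF _ lg(2) h(2) line_ends(1) h_in v(2) h(1)] by auto
    with ne show False by simp
  qed
  then have "infinite (range ?m)" using inf by (simp add: finite_image_iff)
  moreover have "range ?m \<subseteq> lines_meeting n \<L>" using sol by auto
  ultimately show False using fin finite_subset by blast
qed

section \<open>Common transversals of four subspaces\<close>

text \<open>
  Four subspaces of vector space dimension \<open>a\<close> in a space of dimension \<open>2 a\<close>. The symmetry in the four
  subspaces is used throughout, by interpreting the locale for permuted arguments.
\<close>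

locale four_subspaces =
  fixes n a :: nat and L1 L2 L3 L4 :: "(nat \<Rightarrow> 'k::alg_closed_field) set"
  assumes a: "2 \<le> a" and n: "n = 2 * a - 1"
    and L1: "L1 \<in> grassmannian (a - 1) n" and L2: "L2 \<in> grassmannian (a - 1) n"
    and L3: "L3 \<in> grassmannian (a - 1) n" and L4: "L4 \<in> grassmannian (a - 1) n"
    and fin: "finite (lines_meeting n {L1, L2, L3, L4})"
begin

abbreviation "Sol \<equiv> lines_meeting n {L1, L2, L3, L4}"

lemma sub: "kvec.subspace L1" "kvec.subspace L2" "kvec.subspace L3" "kvec.subspace L4"
  using L1 L2 L3 L4 by (auto simp: grassmannian_def)

lemma swap12: "four_subspaces n a L2 L1 L3 L4"
  and swap23: "four_subspaces n a L1 L3 L2 L4"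
  and swap34: "four_subspaces n a L1 L2 L4 L3"
  using a n L1 L2 L3 L4 fin by (unfold_locales; simp add: insert_commute)+

lemma Sol_line: "l \<in> Sol \<Longrightarrow> l \<in> grassmannian 1 n"
  by (simp add: lines_meeting_def)

lemma Sol_meets:
  assumes "l \<in> Sol"
  shows "\<exists>v. v \<noteq> 0 \<and> v \<in> l \<and> v \<in> L1" "\<exists>v. v \<noteq> 0 \<and> v \<in> l \<and> v \<in> L2"
    "\<exists>v. v \<noteq> 0 \<and> v \<in> l \<and> v \<in> L3" "\<exists>v. v \<noteq> 0 \<and> v \<in> l \<and> v \<in> L4"
  using assms by (auto simp: lines_meeting_def meets_def)

lemma coordL: "x \<in> L1 \<Longrightarrow> x \<in> coord_space n" "x \<in> L2 \<Longrightarrow> x \<in> coord_space n"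
  "x \<in> L3 \<Longrightarrow> x \<in> coord_space n" "x \<in> L4 \<Longrightarrow> x \<in> coord_space n"
  using coord_subspace[OF L1] coord_subspace[OF L2] coord_subspace[OF L3] coord_subspace[OF L4] by auto

lemma SolI:
  assumes "indep2 x y" "x \<in> coord_space n" "y \<in> coord_space n"
    "z1 \<noteq> 0" "z1 \<in> line x y" "z1 \<in> L1" "z2 \<noteq> 0" "z2 \<in> line x y" "z2 \<in> L2"
    "z3 \<noteq> 0" "z3 \<in> line x y" "z3 \<in> L3" "z4 \<noteq> 0" "z4 \<in> line x y" "z4 \<in> L4"
  shows "line x y \<in> Sol"
  using assms by (intro lines_meetingI) (auto simp: meets_def)

lemma Sol_disjoint: "l \<in> Sol \<Longrightarrow> l' \<in> Sol \<Longrightarrow> v \<in> l \<Longrightarrow> v \<in> l' \<Longrightarrow> v \<noteq> 0 \<Longrightarrow> l = l'"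
  using finite_solutions_disjoint[OF infinite_UNIV_alg_closed fin] sub by blast

text \<open>
  A point \<open>v\<close> in three of the subspaces makes every line joining it to the fourth a solution, and
  two of these lines would be distinct solutions through \<open>v\<close>.
\<close>

lemma triple_zero: assumes v: "v \<in> L1" "v \<in> L2" "v \<in> L3" shows "v = 0"
proof (rule ccontr)
  assume v0: "v \<noteq> 0"
  have sol: "line v w \<in> Sol" if w: "indep2 v w" "w \<in> coord_space n" "v \<in> L4 \<or> w \<in> L4" for w
  proof -
    have "\<exists>z. z \<noteq> 0 \<and> z \<in> line v w \<and> z \<in> L4"
      using w(3)
    proof
      assume "v \<in> L4"
      then show ?thesis using v0 line_ends(1) by (intro exI[of _ v]) simp
    next
      assume "w \<in> L4"
      then show ?thesis using indep2_nz(2)[OF w(1)] line_ends(2) by (intro exI[of _ w]) simp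
    qed
    then obtain z where "z \<noteq> 0" "z \<in> line v w" "z \<in> L4" by (elim exE conjE)
    then show ?thesis
      by (rule SolI[OF w(1) coordL(1)[OF v(1)] w(2) v0 line_ends(1) v(1) v0 line_ends(1) v(2) v0 line_ends(1) v(3)])
  qed
  have "\<exists>w1 w2. indep2 v w1 \<and> w1 \<in> coord_space n \<and> (v \<in> L4 \<or> w1 \<in> L4) \<and>
      indep2 v w2 \<and> w2 \<in> coord_space n \<and> (v \<in> L4 \<or> w2 \<in> L4) \<and> w2 \<notin> line v w1"
  proof (cases "v \<in> L4")
    case True
    obtain w1 where w1: "w1 \<in> coord_space n" "w1 \<notin> kvec.span {v}"
      by (rule exists_outside[OF coord_space_grassmannian[of n], of "{v}"]) (use a n in auto)
    have n2: "card {v, w1} \<le> n" 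
    proof -
      have "2 \<le> n" using a n by linarith
      then show ?thesis by (simp add: card_insert_if)
    qed
    obtain w2 where w2: "w2 \<in> coord_space n" "w2 \<notin> kvec.span {v, w1}"
      by (rule exists_outside[OF coord_space_grassmannian[of n], of "{v, w1}"]) (use n2 in auto)
    have ln: "kvec.span {v, w} = line v w" for w
    proof -
      have "{..<2 :: nat} = {0, 1}" by auto
      then have "pair v w ` {..<2} = {v, w}" by (simp add: pair_def insert_commute)
      then show ?thesis using span_pair[of v w] by simp
    qed
    have "indep2 v w1"
    proof (rule ccontr)
      assume "\<not> indep2 v w1"
      then obtain c where "w1 = vscale c v" using v0 by (rule not_indep2)
      then show False using w1(2) by (simp add: kvec.span_scale kvec.span_base)
    qed
    moreover have "indep2 v w2"
    proof (rule ccontr)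
      assume "\<not> indep2 v w2"
      then obtain c where "w2 = vscale c v" using v0 by (rule not_indep2)
      then show False using w2(2) by (simp add: kvec.span_scale kvec.span_base)
    qed
    ultimately show ?thesis using w1 w2 True unfolding ln by (intro exI[of _ w1] exI[of _ w2]) simp
  next
    case False
    obtain w1 where w1: "w1 \<in> L4" "w1 \<notin> kvec.span {}" by (rule exists_outside[OF L4, of "{}"]) auto
    have w10: "w1 \<noteq> 0" using w1(2) by auto
    obtain w2 where w2: "w2 \<in> L4" "w2 \<notin> kvec.span {w1}" by (rule exists_outside[OF L4, of "{w1}"]) (use a in auto)
    have ind: "indep2 v w" if w: "w \<in> L4" "w \<noteq> 0" for w
    proof (rule ccontr)
      assume "\<not> indep2 v w"
      then have "\<not> indep2 w v" using indep2_commute by blast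
      then obtain c where "v = vscale c w" using w(2) by (rule not_indep2)
      then have "v \<in> L4" using w(1) kvec.subspace_scale[OF sub(4)] by simp
      then show False using False by simp
    qed
    have "w2 \<notin> line v w1"
    proof
      assume "w2 \<in> line v w1"
      then obtain \<alpha> \<beta> where w: "w2 = vscale \<alpha> v + vscale \<beta> w1" unfolding in_line_iff by (elim exE)
      show False
      proof (cases "\<alpha> = 0")
        case True
        then have "w2 = vscale \<beta> w1" using w by (simp add: fun_eq_iff)
        then show False using w2(2) by (simp add: kvec.span_scale kvec.span_base)
      next
        case a0: False
        have "vscale \<beta> w1 + vscale \<alpha> v \<in> L4" using w w2(1) by (simp add: add.commute)
        from subspace_comb_cancel[OF sub(4) this w1(1) a0] False show False by simp
      qed
    qed
    moreover have "w2 \<noteq> 0" using w2(2) kvec.span_zero by blast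
    ultimately show ?thesis using ind w1 w10 w2 coordL(4) by (intro exI[of _ w1] exI[of _ w2]) simp
  qed
  then obtain w1 w2 where w: "line v w1 \<in> Sol" "line v w2 \<in> Sol" "w2 \<notin> line v w1" using sol by meson
  have "line v w1 = line v w2" using Sol_disjoint[OF w(1,2) line_ends(1) line_ends(1) v0] .
  with w(3) line_ends(2)[of w2 v] show False by simp
qed

lemma triples_zero:
  "v \<in> L1 \<Longrightarrow> v \<in> L2 \<Longrightarrow> v \<in> L4 \<Longrightarrow> v = 0" "v \<in> L1 \<Longrightarrow> v \<in> L3 \<Longrightarrow> v \<in> L4 \<Longrightarrow> v = 0"
  "v \<in> L2 \<Longrightarrow> v \<in> L3 \<Longrightarrow> v \<in> L4 \<Longrightarrow> v = 0"
proof -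
  interpret s: four_subspaces n a L1 L2 L4 L3 by (rule swap34)
  interpret t: four_subspaces n a L1 L4 L2 L3 by (rule s.swap23)
  interpret u: four_subspaces n a L1 L4 L3 L2 by (rule t.swap34)
  interpret w: four_subspaces n a L4 L1 L3 L2 by (rule u.swap12)
  interpret x: four_subspaces n a L4 L3 L1 L2 by (rule w.swap23)
  interpret y: four_subspaces n a L4 L3 L2 L1 by (rule x.swap34)
  show "v \<in> L1 \<Longrightarrow> v \<in> L2 \<Longrightarrow> v \<in> L4 \<Longrightarrow> v = 0" by (rule s.triple_zero)
  show "v \<in> L1 \<Longrightarrow> v \<in> L3 \<Longrightarrow> v \<in> L4 \<Longrightarrow> v = 0" by (rule u.triple_zero)
  show "v \<in> L2 \<Longrightarrow> v \<in> L3 \<Longrightarrow> v \<in> L4 \<Longrightarrow> v = 0" by (rule y.triple_zero)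
qed

text \<open>
  In a solution of cross ratio \<open>\<lambda>\<close> one can choose \<open>X\<close> and \<open>Y\<close> on the first two subspaces such that
  \<open>X + Y\<close> and \<open>X + \<lambda> Y\<close> lie on the other two. For fixed \<open>\<lambda>\<close> these are linear conditions on the
  pair \<open>(X, Y)\<close>.
\<close>

definition pencil_kernel :: "'k \<Rightarrow> (nat \<Rightarrow> 'k) \<Rightarrow> (nat \<Rightarrow> 'k) \<Rightarrow> bool" where
  "pencil_kernel c X Y \<longleftrightarrow> X \<in> L1 \<and> Y \<in> L2 \<and> X + Y \<in> L3 \<and> X + vscale c Y \<in> L4"

lemma pencil_kernel_comb:
  assumes "pencil_kernel c X Y" "pencil_kernel c X' Y'"
  shows "pencil_kernel c (vscale \<alpha> X + vscale \<beta> X') (vscale \<alpha> Y + vscale \<beta> Y')"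
proof -
  have "vscale \<alpha> X + vscale \<beta> X' + (vscale \<alpha> Y + vscale \<beta> Y') = vscale \<alpha> (X + Y) + vscale \<beta> (X' + Y')"
    "vscale \<alpha> X + vscale \<beta> X' + vscale c (vscale \<alpha> Y + vscale \<beta> Y') = vscale \<alpha> (X + vscale c Y) + vscale \<beta> (X' + vscale c Y')"
    by (auto simp: fun_eq_iff algebra_simps)
  then show ?thesis using assms sub unfolding pencil_kernel_def by (auto intro: subspace_comb)
qed

text \<open>
  Since \<open>c\<close> is neither \<open>0\<close> nor \<open>1\<close>, the four points \<open>X\<close>, \<open>Y\<close>, \<open>X + Y\<close>, \<open>X + c Y\<close> witness a solution; a
  dependency between \<open>X\<close> and \<open>Y\<close> would place a point on three of the subspaces.
\<close>

lemma pencil_kernel_line: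
  assumes K: "pencil_kernel c X Y" and ne: "X \<noteq> 0 \<or> Y \<noteq> 0" and c: "c \<noteq> 0" "c \<noteq> 1"
  shows "indep2 X Y" "line X Y \<in> Sol"
proof -
  have mem: "X \<in> L1" "Y \<in> L2" "X + Y \<in> L3" "X + vscale c Y \<in> L4" using K by (auto simp: pencil_kernel_def)
  show ind: "indep2 X Y"
  proof (rule ccontr)
    assume dep: "\<not> indep2 X Y"
    have "\<exists>v x y. v \<noteq> 0 \<and> X = vscale x v \<and> Y = vscale y v \<and> (x \<noteq> 0 \<or> y \<noteq> 0)"
    proof (cases "X = 0")
      case True
      then show ?thesis using ne by (intro exI[of _ Y] exI[of _ 0] exI[of _ 1]) (auto simp: fun_eq_iff)
    next
      case False
      obtain d where "Y = vscale d X" by (rule not_indep2[OF dep False])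
      then show ?thesis using False by (intro exI[of _ X] exI[of _ 1] exI[of _ d]) (auto simp: fun_eq_iff)
    qed
    then obtain v x y where v: "v \<noteq> 0" "X = vscale x v" "Y = vscale y v" "x \<noteq> 0 \<or> y \<noteq> 0" by (elim exE conjE)
    have canc: "v \<in> V" if "kvec.subspace V" "vscale z v \<in> V" "z \<noteq> 0" for V z
    proof -
      have "vscale (1 / z) (vscale z v) \<in> V" by (intro kvec.subspace_scale that)
      moreover have "vscale (1 / z) (vscale z v) = v" using that(3) by (simp add: fun_eq_iff)
      ultimately show ?thesis by simp
    qed
    have s: "X + Y = vscale (x + y) v" "X + vscale c Y = vscale (x + c * y) v"
      using v by (auto simp: fun_eq_iff algebra_simps)
    have 1: "x \<noteq> 0 \<Longrightarrow> v \<in> L1" by (rule canc[OF sub(1) mem(1)[unfolded v(2)]])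
    have 2: "y \<noteq> 0 \<Longrightarrow> v \<in> L2" by (rule canc[OF sub(2) mem(2)[unfolded v(3)]])
    have 3: "x + y \<noteq> 0 \<Longrightarrow> v \<in> L3" by (rule canc[OF sub(3) mem(3)[unfolded s(1)]])
    have 4: "x + c * y \<noteq> 0 \<Longrightarrow> v \<in> L4" by (rule canc[OF sub(4) mem(4)[unfolded s(2)]])
    consider "x = 0" "y \<noteq> 0" | "y = 0" "x \<noteq> 0" | "x \<noteq> 0" "y \<noteq> 0" "x + y = 0" | "x \<noteq> 0" "y \<noteq> 0" "x + y \<noteq> 0"
      using v(4) by blast
    then show False
    proof cases
      case 1
      then show False using 2 3 4 triples_zero(3) c v(1) by simp
    next
      case 2
      then show False using 1 3 4 triples_zero(2) v(1) by simp
    next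
      case 3
      then have "x = - y" by (simp add: eq_neg_iff_add_eq_0)
      then have "x + c * y = (c - 1) * y" by (simp add: algebra_simps)
      then have "x + c * y \<noteq> 0" using 3 c by simp
      then show False using 1 2 4 3 triples_zero(1) v(1) by simp
    next
      case 4
      then show False using 1 2 3 triple_zero v(1) by simp
    qed
  qed
  have z: "X + Y \<noteq> 0" "X + vscale c Y \<noteq> 0"
    using indep2D[OF ind, of 1 1] indep2D[OF ind, of 1 c] by (auto simp: vscale_def)
  show "line X Y \<in> Sol"
  proof (rule SolI[OF ind, of X Y "X + Y" "X + vscale c Y"])
    show "X + Y \<in> line X Y" by (rule in_lineI[of _ 1 _ 1]) (simp add: fun_eq_iff)
    show "X + vscale c Y \<in> line X Y" by (rule in_lineI[of _ 1 _ c]) (simp add: fun_eq_iff)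
  qed (use mem z coordL indep2_nz[OF ind] line_ends in auto)
qed

text \<open>
  A family of solutions over an infinite field with finitely many members takes one value twice, and
  that solution contains all four vectors.
\<close>

lemma Sol_family:
  assumes line_Sol: "\<And>t. line (X + vscale t X') (Y + vscale t Y') \<in> Sol"
  shows "\<exists>l\<in>Sol. X \<in> l \<and> Y \<in> l \<and> X' \<in> l \<and> Y' \<in> l"
proof -
  let ?P = "\<lambda>t. X + vscale t X'" and ?Q = "\<lambda>t. Y + vscale t Y'"
  have "range (\<lambda>t. line (?P t) (?Q t)) \<subseteq> Sol" using line_Sol by auto
  then have fr: "finite (range (\<lambda>t. line (?P t) (?Q t)))" using fin by (rule finite_subset)
  have "\<not> inj (\<lambda>t. line (?P t) (?Q t))"
  proof
    assume "inj (\<lambda>t. line (?P t) (?Q t))"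
    then have "finite (UNIV :: 'k set)" using fr by (rule finite_imageD[rotated])
    then show False using infinite_UNIV_alg_closed[where 'k = 'k] by contradiction
  qed
  then obtain t t' where t: "t \<noteq> t'" "line (?P t) (?Q t) = line (?P t') (?Q t')" unfolding inj_def by auto
  let ?l = "line (?P t) (?Q t)"
  have s: "kvec.subspace ?l" by (rule subspace_line)
  have PQ: "?P t \<in> ?l" "?Q t \<in> ?l" "?P t' \<in> ?l" "?Q t' \<in> ?l"
    unfolding atomize_conj by (intro conjI line_ends) (unfold t(2), (rule line_ends)+)
  have solve: "A \<in> ?l \<and> B \<in> ?l" if AB: "A + vscale t B \<in> ?l" "A + vscale t' B \<in> ?l" for A B
  proof -
    have "B = vscale (1 / (t - t')) (A + vscale t B) + vscale (- (1 / (t - t'))) (A + vscale t' B)"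
    proof
      fix i
      have "(vscale (1 / (t - t')) (A + vscale t B) + vscale (- (1 / (t - t'))) (A + vscale t' B)) i
        = (A i + t * B i) / (t - t') - (A i + t' * B i) / (t - t')" by simp
      also have "\<dots> = ((A i + t * B i) - (A i + t' * B i)) / (t - t')"
        by (rule diff_divide_distrib[symmetric])
      also have "(A i + t * B i) - (A i + t' * B i) = (t - t') * B i" by (simp add: algebra_simps)
      finally show "B i = (vscale (1 / (t - t')) (A + vscale t B) + vscale (- (1 / (t - t'))) (A + vscale t' B)) i"
        using t(1) by simp
    qed
    then have B: "B \<in> ?l" using subspace_comb[OF s AB] by metis
    have "vscale t B + vscale 1 A \<in> ?l" using AB(1) by (simp add: add.commute vscale_def)
    from subspace_comb_cancel[OF s this B] B show ?thesis by simp
  qed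
  have "X \<in> ?l \<and> X' \<in> ?l" by (rule solve[OF PQ(1,3)])
  moreover have "Y \<in> ?l \<and> Y' \<in> ?l" by (rule solve[OF PQ(2,4)])
  ultimately show ?thesis using line_Sol[of t] by (intro bexI[of _ ?l]) simp_all
qed

lemma pencil_kernel_2dim:
  assumes K: "pencil_kernel c X Y" "pencil_kernel c X' Y'" and c: "c \<noteq> 0" "c \<noteq> 1"
    and ind: "\<And>\<alpha> \<beta>. vscale \<alpha> X + vscale \<beta> X' = 0 \<Longrightarrow> vscale \<alpha> Y + vscale \<beta> Y' = 0 \<Longrightarrow> \<alpha> = 0 \<and> \<beta> = 0"
  shows "\<exists>l\<in>Sol. X \<in> l \<and> Y \<in> l \<and> X' \<in> l \<and> Y' \<in> l"
proof (rule Sol_family)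
  fix t
  have one: "vscale 1 Z = Z" for Z :: "nat \<Rightarrow> 'k" by (simp add: vscale_def)
  have "X + vscale t X' \<noteq> 0 \<or> Y + vscale t Y' \<noteq> 0"
  proof (rule ccontr)
    assume "\<not> ?thesis"
    then have "(1 :: 'k) = 0" using ind[of 1 t] unfolding one by blast
    then show False by simp
  qed
  from pencil_kernel_line(2)[OF pencil_kernel_comb[OF K, of 1 t, unfolded one] this c]
  show "line (X + vscale t X') (Y + vscale t Y') \<in> Sol" .
qed

text \<open>
  \<open>cross l w A B\<close>: the points of \<open>l\<close> on the four subspaces are \<open>w\<close> and \<open>p\<^sub>j w + q\<^sub>j h\<close>, \<open>j = 2, 3, 4\<close>,
  and their cross ratio is \<open>B / A = [14][23] / [13][24]\<close> in terms of the brackets of these vectors.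
\<close>

definition cross :: "(nat \<Rightarrow> 'k) set \<Rightarrow> (nat \<Rightarrow> 'k) \<Rightarrow> 'k \<Rightarrow> 'k \<Rightarrow> bool" where
  "cross l w A B \<longleftrightarrow> w \<in> L1 \<and> (\<exists>h p2 q2 p3 q3 p4 q4. indep2 w h \<and> l = line w h \<and>
     (p2 \<noteq> 0 \<or> q2 \<noteq> 0) \<and> vscale p2 w + vscale q2 h \<in> L2 \<and>
     (p3 \<noteq> 0 \<or> q3 \<noteq> 0) \<and> vscale p3 w + vscale q3 h \<in> L3 \<and>
     (p4 \<noteq> 0 \<or> q4 \<noteq> 0) \<and> vscale p4 w + vscale q4 h \<in> L4 \<and>
     A = q3 * (p2 * q4 - q2 * p4) \<and> B = q4 * (p2 * q3 - q2 * p3))"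

lemma cross_exists:
  assumes "l \<in> Sol" "w \<in> l" "w \<in> L1" "w \<noteq> 0" shows "\<exists>A B. cross l w A B"
proof -
  obtain h where h: "indep2 w h" "l = line w h" using line_through[OF Sol_line[OF assms(1)] assms(2,4)] by blast
  have pq: "\<exists>p q. (p \<noteq> 0 \<or> q \<noteq> 0) \<and> vscale p w + vscale q h \<in> V" if ex: "\<exists>v. v \<noteq> 0 \<and> v \<in> l \<and> v \<in> V" for V
  proof -
    obtain v p q where v: "v \<noteq> 0" "v \<in> V" "v = vscale p w + vscale q h" 
      using ex unfolding h(2) in_line_iff by (elim exE conjE)
    then have "p \<noteq> 0 \<or> q \<noteq> 0" by (auto simp: fun_eq_iff)
    with v show ?thesis by blast
  qed
  obtain p2 q2 where 2: "p2 \<noteq> 0 \<or> q2 \<noteq> 0" "vscale p2 w + vscale q2 h \<in> L2" using pq[OF Sol_meets(2)[OF assms(1)]] by blast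
  obtain p3 q3 where 3: "p3 \<noteq> 0 \<or> q3 \<noteq> 0" "vscale p3 w + vscale q3 h \<in> L3" using pq[OF Sol_meets(3)[OF assms(1)]] by blast
  obtain p4 q4 where 4: "p4 \<noteq> 0 \<or> q4 \<noteq> 0" "vscale p4 w + vscale q4 h \<in> L4" using pq[OF Sol_meets(4)[OF assms(1)]] by blast
  show ?thesis unfolding cross_def using assms(3) h 2 3 4 by blast
qed

lemma parallel:
  assumes "p \<noteq> 0 \<or> q \<noteq> 0" "p' \<noteq> 0 \<or> q' \<noteq> 0" "p * q' - q * p' = (0 :: 'k)"
  shows "\<exists>c. c \<noteq> 0 \<and> vscale p' w + vscale q' h = vscale c (vscale p w + vscale q h)"
proof -
  have "\<exists>c. c \<noteq> 0 \<and> p' = c * p \<and> q' = c * q"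
  proof (cases "p = 0")
    case True
    then have "q \<noteq> 0" "p' = 0" "q' \<noteq> 0" using assms by auto
    then show ?thesis using True by (intro exI[of _ "q' / q"]) simp
  next
    case False
    then have q: "q' = p' / p * q" using assms(3) by (simp add: field_simps)
    then have "p' \<noteq> 0" using assms(2) by auto
    then show ?thesis using False q by (intro exI[of _ "p' / p"]) simp
  qed
  then show ?thesis by (auto simp: fun_eq_iff algebra_simps)
qed

definition coincide :: "(nat \<Rightarrow> 'k) set \<Rightarrow> (nat \<Rightarrow> 'k) set \<Rightarrow> (nat \<Rightarrow> 'k) set \<Rightarrow> bool" where
  "coincide U V l \<longleftrightarrow> (\<exists>v. v \<noteq> 0 \<and> v \<in> l \<and> v \<in> U \<and> v \<in> V)"

lemma coincideI:
  assumes "indep2 w h" "l = line w h" "p \<noteq> 0 \<or> q \<noteq> 0" "p' \<noteq> 0 \<or> q' \<noteq> 0" "p * q' - q * p' = 0"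
    "vscale p w + vscale q h \<in> U" "vscale p' w + vscale q' h \<in> V" "kvec.subspace U"
  shows "coincide U V l"
proof -
  obtain c where c: "vscale p' w + vscale q' h = vscale c (vscale p w + vscale q h)"
    using parallel[OF assms(3-5), of w h] by (elim exE conjE)
  have "vscale p' w + vscale q' h \<in> U" unfolding c using assms(6,8) by (intro kvec.subspace_scale)
  moreover have "vscale p' w + vscale q' h \<noteq> 0" using indep2D[OF assms(1), of p' q'] assms(4) by blast
  moreover have "vscale p' w + vscale q' h \<in> l" unfolding assms(2) by (rule in_lineI[OF refl])
  ultimately show ?thesis using assms(7) unfolding coincide_def by (intro exI conjI)
qed

text \<open>The degenerate values of the cross ratio occur when two of the four points coincide.\<close>

lemma cross_cases:
  assumes "cross l w A B"
  shows "A = 0 \<Longrightarrow> coincide L1 L3 l \<or> coincide L2 L4 l"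
    "B = 0 \<Longrightarrow> coincide L1 L4 l \<or> coincide L2 L3 l"
    "A = B \<Longrightarrow> coincide L1 L2 l \<or> coincide L3 L4 l" "A \<noteq> 0 \<or> B \<noteq> 0"
proof -
  obtain h p2 q2 p3 q3 p4 q4 where w: "w \<in> L1" "indep2 w h" "l = line w h"
    and 2: "p2 \<noteq> 0 \<or> q2 \<noteq> 0" "vscale p2 w + vscale q2 h \<in> L2"
    and 3: "p3 \<noteq> 0 \<or> q3 \<noteq> 0" "vscale p3 w + vscale q3 h \<in> L3"
    and 4: "p4 \<noteq> 0 \<or> q4 \<noteq> 0" "vscale p4 w + vscale q4 h \<in> L4"
    and AB: "A = q3 * (p2 * q4 - q2 * p4)" "B = q4 * (p2 * q3 - q2 * p3)"
    using assms unfolding cross_def by blast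
  have 1: "(1::'k) \<noteq> 0 \<or> (0::'k) \<noteq> 0" "vscale 1 w + vscale 0 h \<in> L1" using w(1) by (auto simp: vscale_def plus_fun_def)
  note c = coincideI[OF w(2,3)]
  have 13: "q3 = 0 \<Longrightarrow> coincide L1 L3 l" using c[OF 1(1) 3(1) _ 1(2) 3(2) sub(1)] by simp
  have 14: "q4 = 0 \<Longrightarrow> coincide L1 L4 l" using c[OF 1(1) 4(1) _ 1(2) 4(2) sub(1)] by simp
  have 12: "q2 = 0 \<Longrightarrow> coincide L1 L2 l" using c[OF 1(1) 2(1) _ 1(2) 2(2) sub(1)] by simp
  have 24: "p2 * q4 - q2 * p4 = 0 \<Longrightarrow> coincide L2 L4 l" using c[OF 2(1) 4(1) _ 2(2) 4(2) sub(2)] by simp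
  have 23: "p2 * q3 - q2 * p3 = 0 \<Longrightarrow> coincide L2 L3 l" using c[OF 2(1) 3(1) _ 2(2) 3(2) sub(2)] by simp
  have 34: "p3 * q4 - q3 * p4 = 0 \<Longrightarrow> coincide L3 L4 l" using c[OF 3(1) 4(1) _ 3(2) 4(2) sub(3)] by simp
  show "A = 0 \<Longrightarrow> coincide L1 L3 l \<or> coincide L2 L4 l" using AB 13 24 by auto
  show "B = 0 \<Longrightarrow> coincide L1 L4 l \<or> coincide L2 L3 l" using AB 14 23 by auto
  have "A - B = q2 * (p3 * q4 - q3 * p4)" unfolding AB by (simp add: algebra_simps)
  then show "A = B \<Longrightarrow> coincide L1 L2 l \<or> coincide L3 L4 l" using 12 34 by auto
  show "A \<noteq> 0 \<or> B \<noteq> 0"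
  proof (rule ccontr)
    assume "\<not> ?thesis"
    then have z: "q3 * (p2 * q4 - q2 * p4) = 0" "q4 * (p2 * q3 - q2 * p3) = 0" using AB by auto
    have wz: "w \<noteq> 0" by (rule indep2_nz[OF w(2)])
    have only_w: "w \<in> V" if "kvec.subspace V" "vscale p w + vscale 0 h \<in> V" "p \<noteq> 0" for V p
    proof -
      have "vscale (1 / p) (vscale p w + vscale 0 h) \<in> V" by (intro kvec.subspace_scale that)
      moreover have "vscale (1 / p) (vscale p w + vscale 0 h) = w" using that(3) by (simp add: fun_eq_iff)
      ultimately show ?thesis by simp
    qed
    have w2: "q2 = 0 \<Longrightarrow> w \<in> L2" using only_w[OF sub(2), of p2] 2 by auto
    have w3: "q3 = 0 \<Longrightarrow> w \<in> L3" using only_w[OF sub(3), of p3] 3 by auto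
    have w4: "q4 = 0 \<Longrightarrow> w \<in> L4" using only_w[OF sub(4), of p4] 4 by auto
    have no: "\<not> (q2 = 0 \<and> q3 = 0)" "\<not> (q2 = 0 \<and> q4 = 0)" "\<not> (q3 = 0 \<and> q4 = 0)"
      using w2 w3 w4 w(1) wz triple_zero[of w] triples_zero[of w] by auto
    have "q3 \<noteq> 0"
    proof
      assume "q3 = 0"
      then have "q4 * (q2 * p3) = 0" "p3 \<noteq> 0" using z(2) 3 by auto
      then show False using no \<open>q3 = 0\<close> by auto
    qed
    then have z4: "p2 * q4 - q2 * p4 = 0" using z(1) by simp
    have "q4 \<noteq> 0"
    proof
      assume "q4 = 0"
      then have "q2 * p4 = 0" "p4 \<noteq> 0" using z4 4 by auto
      then show False using no \<open>q4 = 0\<close> by auto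
    qed
    then have z3: "p2 * q3 - q2 * p3 = 0" using z(2) by simp
    let ?w2 = "vscale p2 w + vscale q2 h"
    have canc: "?w2 \<in> V" if "kvec.subspace V" "vscale c ?w2 \<in> V" "c \<noteq> 0" for V c
    proof -
      have "vscale (1 / c) (vscale c ?w2) \<in> V" by (intro kvec.subspace_scale that)
      moreover have "vscale (1 / c) (vscale c ?w2) = ?w2" using that(3) by (auto simp: fun_eq_iff)
      ultimately show ?thesis by simp
    qed
    obtain c where "c \<noteq> 0" "vscale p3 w + vscale q3 h = vscale c ?w2" using parallel[OF 2(1) 3(1) z3, of w h] by (elim exE conjE)
    then have "?w2 \<in> L3" using canc[OF sub(3), of c] 3(2) by simp
    obtain d where "d \<noteq> 0" "vscale p4 w + vscale q4 h = vscale d ?w2" using parallel[OF 2(1) 4(1) z4, of w h] by (elim exE conjE)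
    then have "?w2 \<in> L4" using canc[OF sub(4), of d] 4(2) by simp
    have "?w2 = 0" by (rule triples_zero(3)) fact+
    then show False using indep2D[OF w(2), of p2 q2] 2(1) by blast
  qed
qed

end

context four_subspaces
begin

text \<open>
  Two solutions meeting \<open>L1 \<inter> L2\<close> and \<open>L3 \<inter> L4\<close>, respectively, are both met by the line joining
  these points, itself a solution.
\<close>

lemma coincide_12_34:
  assumes l: "l \<in> Sol" "l' \<in> Sol" and c: "coincide L1 L2 l" "coincide L3 L4 l'" shows "l = l'"
proof (rule ccontr)
  assume ne: "l \<noteq> l'"
  obtain x where x: "x \<noteq> 0" "x \<in> l" "x \<in> L1" "x \<in> L2" using c(1) unfolding coincide_def by (elim exE conjE)
  obtain y where y: "y \<noteq> 0" "y \<in> l'" "y \<in> L3" "y \<in> L4" using c(2) unfolding coincide_def by (elim exE conjE)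
  have ind: "indep2 x y"
  proof (rule ccontr)
    assume "\<not> indep2 x y"
    then obtain c where c: "y = vscale c x" using x(1) by (rule not_indep2)
    have "y \<in> l" unfolding c using x(2) subspace_grassmannian[OF Sol_line[OF l(1)]] by (intro kvec.subspace_scale)
    with Sol_disjoint[OF l _ y(2) y(1)] ne show False by simp
  qed
  have "line x y \<in> Sol"
    by (rule SolI[OF ind coordL(1)[OF x(3)] coordL(3)[OF y(3)] x(1) line_ends(1) x(3) x(1) line_ends(1) x(4)
        y(1) line_ends(2) y(3) y(1) line_ends(2) y(4)])
  then have "line x y = l" "line x y = l'"
    using Sol_disjoint[OF _ l(1) line_ends(1) x(2,1)] Sol_disjoint[OF _ l(2) line_ends(2) y(2,1)] by auto
  with ne show False by simp
qed

text \<open>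
  Let \<open>x\<close> and \<open>x'\<close> be the points of two such solutions on \<open>L1 \<inter> L2\<close>, with \<open>x = u + v\<close>, \<open>x' = u' + v'\<close>
  for \<open>u, u'\<close> on \<open>L3\<close> and \<open>v, v'\<close> on \<open>L4\<close>. For every \<open>t\<close> the line through \<open>x + t x'\<close> and \<open>u + t u'\<close> is a
  solution. Two of these agree, and then contain \<open>x\<close> and \<open>x'\<close>, which lie on disjoint solutions.
\<close>

lemma coincide_12_12:
  assumes l: "l \<in> Sol" "l' \<in> Sol" and c: "coincide L1 L2 l" "coincide L1 L2 l'" shows "l = l'"
proof (rule ccontr)
  assume ne: "l \<noteq> l'"
  have split: "\<exists>x u. x \<noteq> 0 \<and> x \<in> m \<and> x \<in> L1 \<and> x \<in> L2 \<and> u \<in> m \<and> u \<in> L3 \<and> x - u \<in> L4 \<and> u \<noteq> 0 \<and> indep2 x u"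
    if m: "m \<in> Sol" "coincide L1 L2 m" "\<not> coincide L3 L4 m" for m
  proof -
    obtain x where x: "x \<noteq> 0" "x \<in> m" "x \<in> L1" "x \<in> L2" using m(2) unfolding coincide_def by (elim exE conjE)
    obtain u where u: "u \<noteq> 0" "u \<in> m" "u \<in> L3" using Sol_meets(3)[OF m(1)] by (elim exE conjE)
    obtain v where v: "v \<noteq> 0" "v \<in> m" "v \<in> L4" using Sol_meets(4)[OF m(1)] by (elim exE conjE)
    have uv: "indep2 u v"
    proof (rule ccontr)
      assume "\<not> indep2 u v"
      then obtain c where "v = vscale c u" using u(1) by (rule not_indep2)
      then have "v \<in> L3" using kvec.subspace_scale[OF sub(3) u(3)] by simp
      then have "coincide L3 L4 m" using v unfolding coincide_def by (intro exI conjI)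
      with m(3) show False by simp
    qed
    have "m = line u v" using line_eqI[OF Sol_line[OF m(1)] uv u(2) v(2)] .
    then obtain \<alpha> \<beta> where xab: "x = vscale \<alpha> u + vscale \<beta> v" using x(2) by (auto simp: in_line_iff)
    have "\<alpha> \<noteq> 0"
    proof
      assume "\<alpha> = 0"
      then have "x = vscale \<beta> v" using xab by (simp add: fun_eq_iff)
      then have "x \<in> L4" using kvec.subspace_scale[OF sub(4) v(3)] by simp
      then show False using triples_zero(1) x by simp
    qed
    have "\<beta> \<noteq> 0"
    proof
      assume "\<beta> = 0"
      then have "x = vscale \<alpha> u" using xab by (simp add: fun_eq_iff)
      then have "x \<in> L3" using kvec.subspace_scale[OF sub(3) u(3)] by simp
      then show False using triple_zero x by simp
    qed
    have au: "vscale \<alpha> u \<noteq> 0" using u(1) \<open>\<alpha> \<noteq> 0\<close> by (auto simp: fun_eq_iff)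
    have ind: "indep2 x (vscale \<alpha> u)"
    proof (rule ccontr)
      assume "\<not> indep2 x (vscale \<alpha> u)"
      then obtain c where c: "vscale \<alpha> u = vscale c x" using x(1) by (rule not_indep2)
      then have "vscale \<alpha> u \<in> L1" "vscale \<alpha> u \<in> L2" using kvec.subspace_scale sub(1,2) x(3,4) by metis+
      then have "vscale \<alpha> u = 0" by (rule triple_zero) (intro kvec.subspace_scale sub u)
      then show False using au by simp
    qed
    have "x - vscale \<alpha> u = vscale \<beta> v" using xab by (simp add: fun_eq_iff)
    then have "x - vscale \<alpha> u \<in> L4" using kvec.subspace_scale[OF sub(4) v(3)] by simp
    moreover have "vscale \<alpha> u \<in> m" using subspace_grassmannian[OF Sol_line[OF m(1)]] u(2) by (intro kvec.subspace_scale)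
    moreover have "vscale \<alpha> u \<in> L3" by (intro kvec.subspace_scale sub u)
    ultimately show ?thesis using x au ind by (intro exI[of _ x] exI[of _ "vscale \<alpha> u"]) simp
  qed
  have no34: "\<not> coincide L3 L4 l" "\<not> coincide L3 L4 l'"
    using coincide_12_34[OF l(2,1) c(2)] coincide_12_34[OF l c(1)] ne by auto
  obtain x u where x: "x \<noteq> 0" "x \<in> l" "x \<in> L1" "x \<in> L2" "u \<in> l" "u \<in> L3" "x - u \<in> L4" "u \<noteq> 0" "indep2 x u"
    using split[OF l(1) c(1) no34(1)] by (elim exE conjE)
  obtain x' u' where x': "x' \<noteq> 0" "x' \<in> l'" "x' \<in> L1" "x' \<in> L2" "u' \<in> l'" "u' \<in> L3" "x' - u' \<in> L4" "u' \<noteq> 0" "indep2 x' u'"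
    using split[OF l(2) c(2) no34(2)] by (elim exE conjE)
  have sl: "kvec.subspace l" "kvec.subspace l'" using subspace_grassmannian Sol_line l by blast+
  have disj: "z = 0" if "z \<in> l" "z \<in> l'" for z using Sol_disjoint[OF l that] ne by auto
  have "line (x + vscale t x') (u + vscale t u') \<in> Sol" for t
  proof -
    let ?X = "x + vscale t x'" and ?U = "u + vscale t u'"
    have X: "?X \<in> L1" "?X \<in> L2" "?U \<in> L3" by (intro kvec.subspace_add kvec.subspace_scale sub x x')+
    have XU: "?X - ?U = (x - u) + vscale t (x' - u')" by (simp add: fun_eq_iff algebra_simps)
    have V: "?X - ?U \<in> L4" unfolding XU by (intro kvec.subspace_add kvec.subspace_scale sub x(7) x'(7))
    have ind: "indep2 ?X ?U" unfolding indep2_def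
    proof (intro allI impI)
      fix \<alpha> \<beta> assume z: "vscale \<alpha> ?X + vscale \<beta> ?U = 0"
      have "vscale \<alpha> x + vscale \<beta> u = vscale (- \<alpha> * t) x' + vscale (- \<beta> * t) u'"
      proof
        fix i
        have "(\<alpha> * x i + \<beta> * u i) + (\<alpha> * t * x' i + \<beta> * t * u' i) = 0"
          using fun_cong[OF z, of i] by (simp add: algebra_simps)
        then have "\<alpha> * x i + \<beta> * u i = - (\<alpha> * t * x' i + \<beta> * t * u' i)"
          by (simp only: eq_neg_iff_add_eq_0)
        then show "(vscale \<alpha> x + vscale \<beta> u) i = (vscale (- \<alpha> * t) x' + vscale (- \<beta> * t) u') i"
          by simp
      qed
      then have "vscale \<alpha> x + vscale \<beta> u \<in> l'" using subspace_comb[OF sl(2) x'(2,5)] by metis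
      then have "vscale \<alpha> x + vscale \<beta> u = 0" by (intro disj subspace_comb[OF sl(1) x(2,5)])
      then show "\<alpha> = 0 \<and> \<beta> = 0" by (rule indep2D[OF x(9)])
    qed
    have nz: "?X - ?U \<noteq> 0"
    proof
      assume "?X - ?U = 0"
      then have "vscale 1 ?X + vscale (- 1) ?U = 0" by (simp add: fun_eq_iff)
      from indep2D[OF ind this] show False by simp
    qed
    have W: "?X - ?U \<in> line ?X ?U" by (rule in_lineI[of _ 1 _ "- 1"]) (simp add: fun_eq_iff)
    show ?thesis
      by (rule SolI[OF ind coordL(1)[OF X(1)] coordL(3)[OF X(3)] indep2_nz(1)[OF ind] line_ends(1) X(1)
          indep2_nz(1)[OF ind] line_ends(1) X(2) indep2_nz(2)[OF ind] line_ends(2) X(3) nz W V])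
  qed
  then obtain m where m: "m \<in> Sol" "x \<in> m" "x' \<in> m" using Sol_family[of x x' u u'] by blast
  have "m = l" "m = l'" using Sol_disjoint[OF m(1) l(1) m(2) x(2,1)] Sol_disjoint[OF m(1) l(2) m(3) x'(2,1)] by auto
  with ne show False by simp
qed

lemma swap_pairs: "four_subspaces n a L3 L4 L1 L2"
proof -
  interpret s: four_subspaces n a L1 L3 L2 L4 by (rule swap23)
  interpret t: four_subspaces n a L3 L1 L2 L4 by (rule s.swap12)
  interpret u: four_subspaces n a L3 L1 L4 L2 by (rule t.swap34)
  show ?thesis by (rule u.swap23)
qed

lemma Sol_perm: "lines_meeting n {L1, L3, L2, L4} = Sol" "lines_meeting n {L1, L4, L2, L3} = Sol"
  "lines_meeting n {L3, L4, L1, L2} = Sol" "lines_meeting n {L2, L1, L3, L4} = Sol"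
  "lines_meeting n {L3, L1, L2, L4} = Sol" "lines_meeting n {L4, L1, L2, L3} = Sol"
  by (simp_all add: insert_commute)

lemma coincide_unique:
  assumes "l \<in> Sol" "l' \<in> Sol" "coincide L1 L2 l \<or> coincide L3 L4 l" "coincide L1 L2 l' \<or> coincide L3 L4 l'"
  shows "l = l'"
proof -
  interpret s: four_subspaces n a L3 L4 L1 L2 by (rule swap_pairs)
  show ?thesis
    using assms coincide_12_12[of l l'] coincide_12_34[of l l'] coincide_12_34[of l' l] s.coincide_12_12[of l l'] Sol_perm by auto
qed

text \<open>
  Two solutions with the same cross ratio span a whole family of solutions, so finiteness of the
  set of solutions makes the cross ratio injective.
\<close>

lemma cross_injective:
  assumes l: "l \<in> Sol" "l' \<in> Sol" and c: "cross l w A B" "cross l' w' A' B'" and eq: "A * B' = A' * B"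
  shows "l = l'"
proof -
  interpret s: four_subspaces n a L1 L3 L2 L4 by (rule swap23)
  interpret t: four_subspaces n a L1 L3 L4 L2 by (rule s.swap34)
  interpret u: four_subspaces n a L1 L4 L3 L2 by (rule t.swap23)
  interpret v: four_subspaces n a L1 L4 L2 L3 by (rule u.swap34)
  have cc: "coincide U V m = coincide V U m" for U V m unfolding coincide_def by blast
  note z = cross_cases[OF c(1)] and z' = cross_cases[OF c(2)]
  consider "A = 0" | "B = 0" | "A = B" "A \<noteq> 0" | "A \<noteq> 0" "B \<noteq> 0" "A \<noteq> B" by blast
  then show ?thesis
  proof cases
    case 1
    then have "A' = 0" using eq z(4) by auto
    then show ?thesis using s.coincide_unique[of l l'] z(1)[OF 1] z'(1) l Sol_perm by auto
  next
    case 2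
    then have "B' = 0" using eq z(4) by auto
    then show ?thesis using v.coincide_unique[of l l'] z(2)[OF 2] z'(2) l Sol_perm by auto
  next
    case 3
    then have "A' = B'" using eq by (simp add: mult.commute)
    then show ?thesis using coincide_unique[of l l'] z(3)[OF 3(1)] z'(3) l by auto
  next
    case 4
    have nz: "A' \<noteq> 0" "B' \<noteq> 0"
    proof -
      show "A' \<noteq> 0"
      proof
        assume "A' = 0"
        then have "A * B' = 0" using eq by simp
        then show False using 4 z'(4) \<open>A' = 0\<close> by simp
      qed
      then show "B' \<noteq> 0" using eq 4 by auto
    qed
    define r where "r = B / A"
    have r': "r = B' / A'" using eq 4 nz by (simp add: r_def field_simps)
    have r: "r \<noteq> 0" "r \<noteq> 1" using 4 by (auto simp: r_def)
    have ker: "\<exists>X Y. pencil_kernel (D / C) X Y \<and> X \<in> m \<and> Y \<in> m \<and> (X \<noteq> 0 \<or> Y \<noteq> 0)"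
      if m: "cross m y C D" "C \<noteq> 0" for m y C D
    proof -
      obtain h p2 q2 p3 q3 p4 q4 where w: "y \<in> L1" "indep2 y h" "m = line y h"
        and 2: "vscale p2 y + vscale q2 h \<in> L2"
        and 3: "vscale p3 y + vscale q3 h \<in> L3"
        and q4: "vscale p4 y + vscale q4 h \<in> L4" "p2 \<noteq> 0 \<or> q2 \<noteq> 0"
        and CD: "C = q3 * (p2 * q4 - q2 * p4)" "D = q4 * (p2 * q3 - q2 * p3)"
        using m(1) unfolding cross_def by (elim exE conjE)
      let ?X = "vscale (p2 * q3 - q2 * p3) y" and ?Y = "vscale (- q3) (vscale p2 y + vscale q2 h)"
      define k where "k = (p2 * q3 - q2 * p3) / (p2 * q4 - q2 * p4)"
      have q3: "q3 \<noteq> 0" "p2 * q4 - q2 * p4 \<noteq> 0" using m(2) CD by auto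
      have e3: "?X + ?Y = vscale (- q2) (vscale p3 y + vscale q3 h)"
        by (simp add: fun_eq_iff algebra_simps)
      have e4: "?X + vscale (D / C) ?Y = vscale (- (k * q2)) (vscale p4 y + vscale q4 h)"
      proof -
        have kk: "D / C * q3 = k * q4" "p2 * q3 - q2 * p3 = k * (p2 * q4 - q2 * p4)"
          using q3 CD by (simp_all add: k_def)
        show ?thesis
        proof
          fix i
          have "(?X + vscale (D / C) ?Y) i = (p2 * q3 - q2 * p3) * y i - (D / C * q3) * (p2 * y i + q2 * h i)"
            by (simp add: algebra_simps)
          also have "\<dots> = k * (p2 * q4 - q2 * p4) * y i - k * q4 * (p2 * y i + q2 * h i)"
            using kk by simp
          also have "\<dots> = (vscale (- (k * q2)) (vscale p4 y + vscale q4 h)) i"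
            by (simp add: algebra_simps)
          finally show "(?X + vscale (D / C) ?Y) i = (vscale (- (k * q2)) (vscale p4 y + vscale q4 h)) i" .
        qed
      qed
      have "pencil_kernel (D / C) ?X ?Y"
        unfolding pencil_kernel_def e3 e4 by (intro conjI kvec.subspace_scale sub w 2 3 q4)
      moreover have "?X \<in> m" unfolding w(3) by (intro kvec.subspace_scale subspace_line line_ends)
      moreover have "?Y \<in> m" unfolding w(3) by (intro kvec.subspace_scale subspace_line in_lineI[OF refl])
      moreover have "?Y \<noteq> 0"
      proof
        assume "?Y = 0"
        then have "vscale p2 y + vscale q2 h = 0" using q3 by (auto simp: fun_eq_iff)
        then show False using indep2D[OF w(2)] q4(2) by blast
      qed
      ultimately show ?thesis by blast
    qed
    obtain X Y where X: "pencil_kernel r X Y" "X \<in> l" "Y \<in> l" "X \<noteq> 0 \<or> Y \<noteq> 0"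
      using ker[OF c(1) 4(1)] unfolding r_def by (elim exE conjE)
    obtain X' Y' where X': "pencil_kernel r X' Y'" "X' \<in> l'" "Y' \<in> l'" "X' \<noteq> 0 \<or> Y' \<noteq> 0"
      using ker[OF c(2) nz(1)] unfolding r' by (elim exE conjE)
    have x0: "X \<noteq> 0" using indep2_nz(1)[OF pencil_kernel_line(1)[OF X(1,4) r]] .
    have x'0: "X' \<noteq> 0" using indep2_nz(1)[OF pencil_kernel_line(1)[OF X'(1,4) r]] .
    show ?thesis
    proof (rule ccontr)
      assume ne: "l \<noteq> l'"
      have sl: "kvec.subspace l" "kvec.subspace l'" using subspace_grassmannian[OF Sol_line] l by auto
      have ind: "\<alpha> = 0 \<and> \<beta> = 0" if "vscale \<alpha> X + vscale \<beta> X' = 0" for \<alpha> \<beta>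
      proof -
        have e: "vscale \<alpha> X = vscale (- \<beta>) X'" using that by (auto simp: fun_eq_iff eq_neg_iff_add_eq_0)
        have "vscale \<alpha> X \<in> l'" unfolding e by (intro kvec.subspace_scale sl X')
        moreover have "vscale \<alpha> X \<in> l" using kvec.subspace_scale[OF sl(1) X(2)] .
        ultimately have "vscale \<alpha> X = 0" using Sol_disjoint[OF l] ne by blast
        then have "\<alpha> = 0" using x0 by (auto simp: fun_eq_iff)
        moreover from this that have "vscale \<beta> X' = 0" by (simp add: fun_eq_iff)
        then have "\<beta> = 0" using x'0 by (auto simp: fun_eq_iff)
        ultimately show ?thesis by simp
      qed
      obtain m where m: "m \<in> Sol" "X \<in> m" "X' \<in> m" using pencil_kernel_2dim[OF X(1) X'(1) r ind] by auto
      have "m = l" "m = l'" using Sol_disjoint[OF m(1) l(1) m(2) X(2) x0] Sol_disjoint[OF m(1) l(2) m(3) X'(2) x'0] by auto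
      with ne show False by simp
    qed
  qed
qed

text \<open>
  The point \<open>w\<close> of a solution on \<open>L1\<close> can be moved along the solution: for a parameter other than
  the cross ratio the two linear conditions on \<open>(X, Y)\<close> restricted to the solution are independent,
  and have a unique solution with right-hand side \<open>(0, w)\<close>.
\<close>

lemma cross_solve:
  assumes "cross l w A B" "c * A \<noteq> B"
  shows "\<exists>Y. Y \<in> l \<and> Y \<in> L2 \<and> vscale (B / (B - c * A)) w + Y \<in> L3 \<and>
    vscale (B / (B - c * A)) w + vscale c Y - w \<in> L4"
proof -
  obtain h p2 q2 p3 q3 p4 q4 where w: "w \<in> L1" "indep2 w h" "l = line w h"
    and 2: "vscale p2 w + vscale q2 h \<in> L2"
    and 3: "vscale p3 w + vscale q3 h \<in> L3"
    and 4: "vscale p4 w + vscale q4 h \<in> L4"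
    and AB: "A = q3 * (p2 * q4 - q2 * p4)" "B = q4 * (p2 * q3 - q2 * p3)"
    using assms(1) unfolding cross_def by (elim exE conjE)
  let ?d = "B - c * A"
  let ?Y = "vscale (- (q3 * q4) / ?d) (vscale p2 w + vscale q2 h)"
  have d: "?d \<noteq> 0" using assms(2) by auto
  have e3: "vscale (B / ?d) w + ?Y = vscale (- (q2 * q4) / ?d) (vscale p3 w + vscale q3 h)"
  proof
    fix i
    have "(vscale (B / ?d) w + ?Y) i = (B * w i - q3 * q4 * (p2 * w i + q2 * h i)) / ?d"
      by (simp add: diff_divide_distrib)
    also have "B * w i - q3 * q4 * (p2 * w i + q2 * h i) = - (q2 * q4) * (p3 * w i + q3 * h i)"
      unfolding AB by (simp add: algebra_simps)
    finally show "(vscale (B / ?d) w + ?Y) i = (vscale (- (q2 * q4) / ?d) (vscale p3 w + vscale q3 h)) i" by simp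
  qed
  have e4: "vscale (B / ?d) w + vscale c ?Y - w = vscale (- (c * q2 * q3) / ?d) (vscale p4 w + vscale q4 h)"
  proof
    fix i
    have "(vscale (B / ?d) w + vscale c ?Y - w) i = (B * w i - c * q3 * q4 * (p2 * w i + q2 * h i)) / ?d - ?d * w i / ?d"
      using d by (simp add: diff_divide_distrib)
    also have "\<dots> = (B * w i - c * q3 * q4 * (p2 * w i + q2 * h i) - ?d * w i) / ?d"
      by (simp only: diff_divide_distrib)
    also have "B * w i - c * q3 * q4 * (p2 * w i + q2 * h i) - ?d * w i = - (c * q2 * q3) * (p4 * w i + q4 * h i)"
      unfolding AB by (simp add: algebra_simps)
    finally show "(vscale (B / ?d) w + vscale c ?Y - w) i = (vscale (- (c * q2 * q3) / ?d) (vscale p4 w + vscale q4 h)) i" by (simp add: mult.assoc)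
  qed
  have "?Y \<in> l" unfolding w(3) by (intro kvec.subspace_scale subspace_line in_lineI[OF refl])
  moreover have "?Y \<in> L2" by (intro kvec.subspace_scale sub 2)
  moreover have "vscale (B / ?d) w + ?Y \<in> L3" unfolding e3 by (intro kvec.subspace_scale sub 3)
  moreover have "vscale (B / ?d) w + vscale c ?Y - w \<in> L4" unfolding e4 by (intro kvec.subspace_scale sub 4)
  ultimately show ?thesis by blast
qed

end

text \<open>
  In matroid terms: \<open>J\<close> is a circuit of the family \<open>w\<close> in the quotient space by \<open>Z\<close>.
\<close>

definition minimal_relation ::
  "(nat \<Rightarrow> 'k::field) set \<Rightarrow> ('i \<Rightarrow> nat \<Rightarrow> 'k) \<Rightarrow> 'i set \<Rightarrow> ('i \<Rightarrow> 'k) \<Rightarrow> bool" where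
  "minimal_relation Z w J c \<longleftrightarrow> finite J \<and> J \<noteq> {} \<and> (\<forall>i\<in>J. c i \<noteq> 0) \<and> (\<Sum>i\<in>J. vscale (c i) (w i)) \<in> Z \<and>
     (\<forall>J'. \<forall>c'. J' \<subset> J \<longrightarrow> (\<Sum>i\<in>J'. vscale (c' i) (w i)) \<in> Z \<longrightarrow> (\<forall>i\<in>J'. c' i = 0))"

lemma minimal_relation_exists:
  assumes "finite F" "(\<Sum>i\<in>F. vscale (c i) (w i)) \<in> Z" "\<exists>i\<in>F. c i \<noteq> 0"
  shows "\<exists>J c'. J \<subseteq> F \<and> minimal_relation Z w J c'"
proof -
  let ?P = "\<lambda>J. J \<subseteq> F \<and> (\<exists>c'. (\<Sum>i\<in>J. vscale (c' i) (w i)) \<in> Z \<and> (\<exists>i\<in>J. c' i \<noteq> 0))"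
  have "?P F" using assms by auto
  then obtain J where J: "?P J" and min: "\<And>J'. ?P J' \<Longrightarrow> card J \<le> card J'"
    using ex_has_least_nat[of ?P F card] by blast
  then obtain c' where c': "J \<subseteq> F" "(\<Sum>i\<in>J. vscale (c' i) (w i)) \<in> Z" "\<exists>i\<in>J. c' i \<noteq> 0" by auto
  have fJ: "finite J" using c'(1) assms(1) finite_subset by blast
  have small: "\<forall>i\<in>J'. d i = 0" if J': "J' \<subset> J" "(\<Sum>i\<in>J'. vscale (d i) (w i)) \<in> Z" for J' d
  proof (rule ccontr)
    assume "\<not> ?thesis"
    then have "?P J'" using J' c'(1) by auto
    then have "card J \<le> card J'" by (rule min)
    then show False using psubset_card_mono[OF fJ J'(1)] by simp
  qed
  have nz: "c' i \<noteq> 0" if i: "i \<in> J" for i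
  proof
    assume z: "c' i = 0"
    have "(\<Sum>i\<in>J. vscale (c' i) (w i)) = vscale (c' i) (w i) + (\<Sum>i\<in>J - {i}. vscale (c' i) (w i))"
      using i fJ by (rule sum.remove[rotated])
    also have "vscale (c' i) (w i) = 0" using z by (simp add: fun_eq_iff)
    finally have eq: "(\<Sum>i\<in>J. vscale (c' i) (w i)) = 0 + (\<Sum>i\<in>J - {i}. vscale (c' i) (w i))" .
    have "(\<Sum>i\<in>J - {i}. vscale (c' i) (w i)) \<in> Z" using c'(2) unfolding eq by (simp only: add_0)
    then have "\<forall>j\<in>J - {i}. c' j = 0" using i by (intro small) auto
    then show False using c'(3) z by auto
  qed
  have "minimal_relation Z w J c'"
    unfolding minimal_relation_def using fJ c' nz small by auto
  then show ?thesis using c'(1) by blast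
qed

context four_subspaces
begin

text \<open>
  Moving every term of a relation among points of \<open>L1\<close> along its solution, simultaneously for a
  common parameter \<open>c\<close>. Cross ratios being distinct, the coefficients of the moved terms change by
  different factors, so the moved sum cannot vanish as well.
\<close>

lemma move_relation:
  assumes Z: "kvec.subspace Z" and rel: "minimal_relation Z w J g"
    and J: "\<And>l. l \<in> J \<Longrightarrow> l \<in> Sol \<and> cross l (w l) (A l) (B l)"
    and two: "\<exists>l\<in>J. \<exists>l'\<in>J. l \<noteq> l'" and c: "c \<noteq> 0" "\<And>l. l \<in> J \<Longrightarrow> c * A l \<noteq> B l"
  shows "\<exists>X Y. X \<in> L1 \<and> Y \<in> L2 \<and> X + Y \<in> L3 \<and> X + vscale c Y - (\<Sum>l\<in>J. vscale (g l) (w l)) \<in> L4 \<and> X \<notin> Z"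
proof -
  have fJ: "finite J" and gnz: "\<And>l. l \<in> J \<Longrightarrow> g l \<noteq> 0" and gZ: "(\<Sum>l\<in>J. vscale (g l) (w l)) \<in> Z"
    and small: "\<And>J' c'. J' \<subset> J \<Longrightarrow> (\<Sum>i\<in>J'. vscale (c' i) (w i)) \<in> Z \<Longrightarrow> \<forall>i\<in>J'. c' i = 0"
    using rel unfolding minimal_relation_def by auto
  define \<xi> where "\<xi> l = B l / (B l - c * A l)" for l
  have "\<forall>l. \<exists>Y. l \<in> J \<longrightarrow> Y \<in> l \<and> Y \<in> L2 \<and> vscale (\<xi> l) (w l) + Y \<in> L3 \<and> vscale (\<xi> l) (w l) + vscale c Y - w l \<in> L4"
    using cross_solve J c(2) unfolding \<xi>_def by meson
  from choice[OF this] obtain Y where Y: "\<And>l. l \<in> J \<Longrightarrow> Y l \<in> L2 \<and> vscale (\<xi> l) (w l) + Y l \<in> L3 \<and>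
      vscale (\<xi> l) (w l) + vscale c (Y l) - w l \<in> L4" by auto
  let ?X = "\<Sum>l\<in>J. vscale (g l) (vscale (\<xi> l) (w l))" and ?Y = "\<Sum>l\<in>J. vscale (g l) (Y l)"
  have wL1: "w l \<in> L1" if "l \<in> J" for l using J[OF that] unfolding cross_def by simp
  have X1: "?X \<in> L1" by (intro kvec.subspace_sum sub kvec.subspace_scale wL1)
  have Y2: "?Y \<in> L2" using Y by (intro kvec.subspace_sum sub kvec.subspace_scale) simp
  have "?X + ?Y = (\<Sum>l\<in>J. vscale (g l) (vscale (\<xi> l) (w l) + Y l))"
    unfolding sum.distrib[symmetric] by (intro sum.cong refl) (simp add: fun_eq_iff algebra_simps)
  also have "\<dots> \<in> L3" using Y by (intro kvec.subspace_sum sub kvec.subspace_scale) simp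
  finally have XY3: "?X + ?Y \<in> L3" .
  have "?X + vscale c ?Y - (\<Sum>l\<in>J. vscale (g l) (w l)) =
      (\<Sum>l\<in>J. vscale (g l) (vscale (\<xi> l) (w l) + vscale c (Y l) - w l))"
    by (rule ext) (simp add: sum_fun_apply' sum_distrib_left sum_subtractf[symmetric] sum.distrib[symmetric] algebra_simps)
  also have "\<dots> \<in> L4" using Y by (intro kvec.subspace_sum sub kvec.subspace_scale) simp
  finally have XY4: "?X + vscale c ?Y - (\<Sum>l\<in>J. vscale (g l) (w l)) \<in> L4" .
  have "?X \<notin> Z"
  proof
    assume XZ: "?X \<in> Z"
    obtain r m where rm: "r \<in> J" "m \<in> J" "r \<noteq> m" using two by blast
    let ?d = "\<lambda>l. g l * (\<xi> l - \<xi> r)"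
    have "(\<Sum>l\<in>J - {r}. vscale (?d l) (w l)) = (\<Sum>l\<in>J. vscale (?d l) (w l))"
      using fJ by (intro sum.mono_neutral_left) (auto simp: fun_eq_iff)
    also have "\<dots> = ?X - vscale (\<xi> r) (\<Sum>l\<in>J. vscale (g l) (w l))"
      by (rule ext) (simp add: sum_fun_apply' sum_distrib_left sum_subtractf[symmetric] algebra_simps)
    also have "\<dots> \<in> Z" by (intro kvec.subspace_diff Z XZ kvec.subspace_scale gZ)
    finally have "\<forall>l\<in>J - {r}. ?d l = 0" using rm(1) by (intro small) auto
    then have "\<xi> m = \<xi> r" using rm gnz[of m] by auto
    then have "B m * (B r - c * A r) = B r * (B m - c * A m)"
      using c(2)[of m] c(2)[of r] rm unfolding \<xi>_def by (simp add: frac_eq_eq)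
    then have "c * (B m * A r) = c * (B r * A m)" by (auto simp: algebra_simps)
    then have "B m * A r = B r * A m" using c(1) by (metis mult_cancel_left)
    then have "A r * B m = A m * B r" by (simp only: mult.commute)
    then have "r = m" using cross_injective[of r m "w r" "A r" "B r" "w m" "A m" "B m"] J rm by blast
    with rm show False by simp
  qed
  with X1 Y2 XY3 XY4 show ?thesis by blast
qed

text \<open>
  A minimal relation with a single term would put one of the points into \<open>Z\<close>.
\<close>

lemma two_in_relation:
  assumes rel: "minimal_relation Z w J g" and Z: "kvec.subspace Z" and "\<And>l. l \<in> J \<Longrightarrow> w l \<notin> Z"
  shows "\<exists>l\<in>J. \<exists>l'\<in>J. l \<noteq> l'"
proof (rule ccontr)
  assume no: "\<not> ?thesis"
  obtain l where l: "l \<in> J" using rel unfolding minimal_relation_def by auto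
  then have J: "J = {l}" using no by auto
  have "vscale (g l) (w l) \<in> Z" "g l \<noteq> 0" using rel unfolding minimal_relation_def J by auto
  moreover from this have "vscale (1 / g l) (vscale (g l) (w l)) = w l" by (simp add: fun_eq_iff)
  ultimately have "w l \<in> Z" using kvec.subspace_scale[OF Z, of "vscale (g l) (w l)" "1 / g l"] by metis
  then show False using assms(3)[OF l] by contradiction
qed

text \<open>
  The parameters \<open>0\<close> and \<open>1\<close> and the finitely many cross ratios have to be avoided.
\<close>

lemma generic_parameter:
  assumes "finite J" shows "finite {c :: 'k. c = 0 \<or> c = 1 \<or> (\<exists>l\<in>J. A l \<noteq> 0 \<and> c * A l = B l)}"
proof -
  have "{c. c = 0 \<or> c = 1 \<or> (\<exists>l\<in>J. A l \<noteq> 0 \<and> c * A l = B l)} \<subseteq> {0, 1} \<union> (\<lambda>l. B l / A l) ` J"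
  proof -
    have "c \<in> (\<lambda>l. B l / A l) ` J" if "l \<in> J" "A l \<noteq> 0" "c * A l = B l" for c l
      using that by (intro image_eqI[of _ _ l]) (auto simp: field_simps)
    then show ?thesis by blast
  qed
  then show ?thesis by (rule finite_subset) (use assms in simp)
qed

lemma crosses:
  assumes "\<And>l. l \<in> Sol \<Longrightarrow> w l \<in> l \<and> w l \<in> L1 \<and> w l \<noteq> 0"
  obtains A B where "\<And>l. l \<in> Sol \<Longrightarrow> cross l (w l) (A l) (B l)"
    "\<And>l c. l \<in> Sol \<Longrightarrow> \<not> (A l \<noteq> 0 \<and> c * A l = B l) \<Longrightarrow> c * A l \<noteq> B l"
proof -
  have "\<forall>l. \<exists>A B. l \<in> Sol \<longrightarrow> cross l (w l) A B" using cross_exists assms by meson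
  then obtain A B where AB: "\<And>l. l \<in> Sol \<Longrightarrow> cross l (w l) (A l) (B l)" by metis
  have "c * A l \<noteq> B l" if "l \<in> Sol" "\<not> (A l \<noteq> 0 \<and> c * A l = B l)" for l c
    using cross_cases(4)[OF AB[OF that(1)]] that(2) by auto
  with AB show ?thesis by (rule that)
qed

text \<open>
  If a solution \<open>l\<^sub>0\<close> lies in \<open>L1\<close>, the points of the other \<open>a - 1\<close> solutions on \<open>L1\<close> are dependent
  modulo \<open>l\<^sub>0\<close>. Moving this relation, and correcting it by the one-parameter family of pairs
  \<open>(X, Y)\<close> carried by \<open>l\<^sub>0\<close> itself, gives infinitely many solutions.
\<close>

lemma no_solution_inside:
  assumes card: "card Sol = a" and l0: "l0 \<in> Sol" shows "\<not> l0 \<subseteq> L1"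
proof
  assume l01: "l0 \<subseteq> L1"
  have sl0: "kvec.subspace l0" by (rule subspace_grassmannian[OF Sol_line[OF l0]])
  have "\<forall>l. \<exists>v. l \<in> Sol \<longrightarrow> v \<in> l \<and> v \<in> L1 \<and> v \<noteq> 0" using Sol_meets(1) by meson
  from choice[OF this] obtain w where w: "\<And>l. l \<in> Sol \<Longrightarrow> w l \<in> l \<and> w l \<in> L1 \<and> w l \<noteq> 0" by auto
  obtain A B where AB: "\<And>l. l \<in> Sol \<Longrightarrow> cross l (w l) (A l) (B l)"
    "\<And>l c. l \<in> Sol \<Longrightarrow> \<not> (A l \<noteq> 0 \<and> c * A l = B l) \<Longrightarrow> c * A l \<noteq> B l" by (rule crosses[of w]) (use w in auto)
  define F where "F = Sol - {l0}"
  have F: "finite F" "card F = a - 1" using fin card l0 by (auto simp: F_def)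
  obtain e where e: "bij_betw e {..<a - 1} F"
    using ex_bij_betw_nat_finite[OF F(1)] F(2) by (auto simp: atLeast0LessThan)
  obtain g h where gh: "indep2 g h" "l0 = line g h" using grassmannian_lineE[OF Sol_line[OF l0]] by blast
  define u where "u k = (if k < a - 1 then w (e k) else if k = a - 1 then g else h)" for k
  have uL1: "u k \<in> L1" for k
  proof -
    have lL: "line g h \<subseteq> L1" using l01 gh(2) by simp
    have "w (e k) \<in> L1" if k: "k < a - 1"
    proof -
      have "e k \<in> F" using bij_betwE[OF e] k by simp
      then have "e k \<in> Sol" by (simp add: F_def)
      from w[OF this] show ?thesis by simp
    qed
    moreover have "g \<in> L1" "h \<in> L1" by (rule subsetD[OF lL line_ends(1)], rule subsetD[OF lL line_ends(2)])
    ultimately show ?thesis by (simp add: u_def)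
  qed
  have "\<not> fam_indep (Suc a) u"
  proof
    assume "fam_indep (Suc a) u"
    then have "Suc a \<le> Suc (a - 1)" using uL1 by (rule grassmannian_indep_le[OF L1])
    then show False using a by simp
  qed
  then obtain c k where c: "lcomb (Suc a) c u = 0" and k: "k < Suc a" "c k \<noteq> 0" unfolding fam_indep_def by auto
  have sum2: "(\<Sum>k<a - 1. vscale (c k) (w (e k))) = - (vscale (c (a - 1)) g + vscale (c a) h)"
  proof -
    obtain b where b: "a = Suc b" using a by (cases a) auto
    have "lcomb (Suc a) c u = (\<Sum>k<a - 1. vscale (c k) (u k)) + vscale (c (a - 1)) (u (a - 1)) + vscale (c a) (u a)"
      unfolding lcomb_eq_sum b by simp
    also have "(\<Sum>k<a - 1. vscale (c k) (u k)) = (\<Sum>k<a - 1. vscale (c k) (w (e k)))"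
      by (intro sum.cong) (auto simp: u_def)
    finally have sum: "lcomb (Suc a) c u =
      (\<Sum>k<a - 1. vscale (c k) (w (e k))) + vscale (c (a - 1)) (u (a - 1)) + vscale (c a) (u a)" .
    have uu: "u (a - 1) = g" "u a = h" using a by (auto simp: u_def)
    have "(\<Sum>k<a - 1. vscale (c k) (w (e k))) + (vscale (c (a - 1)) g + vscale (c a) h) = 0"
      using c unfolding sum uu by (simp only: add.assoc)
    then show ?thesis by (rule eq_neg_iff_add_eq_0[THEN iffD2])
  qed
  define c' where "c' = c \<circ> the_inv_into {..<a - 1} e"
  have ei: "the_inv_into {..<a - 1} e (e k) = k" if "k < a - 1" for k
    using e that by (intro the_inv_into_f_f) (auto simp: bij_betw_def)
  have "(\<Sum>l\<in>F. vscale (c' l) (w l)) = (\<Sum>k<a - 1. vscale (c k) (w (e k)))"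
    unfolding sum.reindex_bij_betw[OF e, symmetric] by (intro sum.cong refl) (simp only: c'_def o_def ei lessThan_iff)
  also have "\<dots> \<in> l0" unfolding sum2 gh(2)
    by (intro kvec.subspace_neg subspace_line in_lineI[OF refl])
  finally have relF: "(\<Sum>l\<in>F. vscale (c' l) (w l)) \<in> l0" .
  have "\<exists>l\<in>F. c' l \<noteq> 0"
  proof (rule ccontr)
    assume "\<not> ?thesis"
    then have "c' (e k) = 0" if "k < a - 1" for k using bij_betwE[OF e] that by simp
    then have ck: "c k = 0" if "k < a - 1" for k using that by (simp only: c'_def o_def ei)
    then have "(\<Sum>k<a - 1. vscale (c k) (w (e k))) = 0" by (intro sum.neutral) (auto simp: fun_eq_iff)
    then have "vscale (c (a - 1)) g + vscale (c a) h = 0" using sum2 by (metis neg_equal_0_iff_equal)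
    from indep2D[OF gh(1) this] have "c (a - 1) = 0" "c a = 0" by simp_all
    moreover have "k < a - 1 \<or> k = a - 1 \<or> k = a" using k(1) by linarith
    ultimately show False using ck k(2) by blast
  qed
  from minimal_relation_exists[OF F(1) relF this] obtain J q where J: "J \<subseteq> F" "minimal_relation l0 w J q" by blast
  have JS: "l \<in> Sol" "l \<noteq> l0" if "l \<in> J" for l using that J(1) by (auto simp: F_def)
  have "w l \<notin> l0" if "l \<in> J" for l using Sol_disjoint[OF JS(1)[OF that] l0] w[OF JS(1)[OF that]] JS(2)[OF that] by blast
  from two_in_relation[OF J(2) sl0 this] have two: "\<exists>l\<in>J. \<exists>l'\<in>J. l \<noteq> l'" .
  have fJ: "finite J" using J(1) F(1) finite_subset by blast
  obtain d where d: "d \<noteq> 0" "d \<noteq> 1" "\<And>l. l \<in> J \<Longrightarrow> \<not> (A l \<noteq> 0 \<and> d * A l = B l)"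
    using ex_new_if_finite[OF infinite_UNIV_alg_closed generic_parameter[OF fJ, of A B]] by blast
  let ?s = "\<Sum>l\<in>J. vscale (q l) (w l)"
  have HJ: "l \<in> Sol \<and> cross l (w l) (A l) (B l)" "d * A l \<noteq> B l" if "l \<in> J" for l
    using AB(1)[OF JS(1)[OF that]] AB(2)[OF JS(1)[OF that] d(3)[OF that]] JS(1)[OF that] by auto
  have "\<exists>X Y. X \<in> L1 \<and> Y \<in> L2 \<and> X + Y \<in> L3 \<and> X + vscale d Y - ?s \<in> L4 \<and> X \<notin> l0"
    by (rule move_relation[OF sl0 J(2) HJ(1) two d(1) HJ(2)])
  then obtain X Y where XY: "X \<in> L1" "Y \<in> L2" "X + Y \<in> L3" "X + vscale d Y - ?s \<in> L4" "X \<notin> l0"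
    by (elim exE conjE)
  have s0: "?s \<in> l0" using J(2) unfolding minimal_relation_def by simp
  obtain p2 where p2: "p2 \<noteq> 0" "p2 \<in> l0" "p2 \<in> L2" using Sol_meets(2)[OF l0] by (elim exE conjE)
  obtain p3 where p3: "p3 \<noteq> 0" "p3 \<in> l0" "p3 \<in> L3" using Sol_meets(3)[OF l0] by (elim exE conjE)
  obtain p4 where p4: "p4 \<noteq> 0" "p4 \<in> l0" "p4 \<in> L4" using Sol_meets(4)[OF l0] by (elim exE conjE)
  have p1: "p2 \<in> L1" "p3 \<in> L1" "p4 \<in> L1" using p2 p3 p4 l01 by auto
  have i24: "indep2 p2 p4"
  proof (rule ccontr)
    assume "\<not> indep2 p2 p4"
    then obtain t where "p4 = vscale t p2" using p2(1) by (rule not_indep2)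
    then have "p4 \<in> L2" using kvec.subspace_scale[OF sub(2) p2(3)] by simp
    then show False using triples_zero(1) p1 p4 by blast
  qed
  have i34: "indep2 p3 p4"
  proof (rule ccontr)
    assume "\<not> indep2 p3 p4"
    then obtain t where "p4 = vscale t p3" using p3(1) by (rule not_indep2)
    then have "p4 \<in> L3" using kvec.subspace_scale[OF sub(3) p3(3)] by simp
    then show False using triples_zero(2) p1 p4 by blast
  qed
  obtain \<alpha> \<beta> where ab: "?s = vscale \<alpha> p2 + vscale \<beta> p4"
    using s0 line_eqI[OF Sol_line[OF l0] i24 p2(2) p4(2)] by (auto simp: in_line_iff)
  define \<tau> where "\<tau> = \<alpha> / (d - 1)"
  have \<tau>: "\<tau> * (d - 1) = \<alpha>" using d(2) by (simp add: \<tau>_def)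
  \<comment> \<open>the pair \<open>(- \<tau> p2, \<tau> p2)\<close> absorbs the component of the relation along \<open>p2\<close>\<close>
  have K1: "pencil_kernel d (X + vscale \<tau> p2) (Y + vscale (- \<tau>) p2)"
    unfolding pencil_kernel_def
  proof (intro conjI)
    show "X + vscale \<tau> p2 \<in> L1" "Y + vscale (- \<tau>) p2 \<in> L2"
      by (intro kvec.subspace_add kvec.subspace_scale sub XY p1 p2)+
    have e3: "X + vscale \<tau> p2 + (Y + vscale (- \<tau>) p2) = X + Y" by (simp add: fun_eq_iff)
    show "X + vscale \<tau> p2 + (Y + vscale (- \<tau>) p2) \<in> L3" unfolding e3 by (rule XY(3))
    have e4: "X + vscale \<tau> p2 + vscale d (Y + vscale (- \<tau>) p2) = (X + vscale d Y - ?s) + vscale \<beta> p4"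
    proof
      fix i
      have "?s i = \<tau> * (d - 1) * p2 i + \<beta> * p4 i" unfolding ab \<tau> by simp
      then show "(X + vscale \<tau> p2 + vscale d (Y + vscale (- \<tau>) p2)) i = ((X + vscale d Y - ?s) + vscale \<beta> p4) i"
        by (simp add: algebra_simps)
    qed
    show "X + vscale \<tau> p2 + vscale d (Y + vscale (- \<tau>) p2) \<in> L4"
      unfolding e4 by (intro kvec.subspace_add kvec.subspace_scale sub XY(4) p4(3))
  qed
  obtain \<sigma> \<rho> where sr: "p2 = vscale \<sigma> p3 + vscale \<rho> p4"
    using p2(2) line_eqI[OF Sol_line[OF l0] i34 p3(2) p4(2)] by (auto simp: in_line_iff)
  let ?X = "vscale ((1 - d) * \<sigma>) p3 - p2"
  have X0: "?X \<in> l0" by (intro kvec.subspace_diff kvec.subspace_scale sl0 p2 p3)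
  have K2: "pencil_kernel d ?X p2"
    unfolding pencil_kernel_def
  proof (intro conjI)
    show "?X \<in> L1" using X0 l01 by blast
    show "p2 \<in> L2" by fact
    have e3: "?X + p2 = vscale ((1 - d) * \<sigma>) p3" by (simp add: fun_eq_iff)
    show "?X + p2 \<in> L3" unfolding e3 by (intro kvec.subspace_scale sub p3)
    have e4: "?X + vscale d p2 = vscale (- ((1 - d) * \<rho>)) p4"
    proof
      fix i
      have "p2 i = \<sigma> * p3 i + \<rho> * p4 i" using fun_cong[OF sr, of i] by simp
      then show "(?X + vscale d p2) i = vscale (- ((1 - d) * \<rho>)) p4 i" by (simp add: algebra_simps)
    qed
    show "?X + vscale d p2 \<in> L4" unfolding e4 by (intro kvec.subspace_scale sub p4)
  qed
  have ind2: "indep2 ?X p2" by (rule pencil_kernel_line(1)[OF K2 _ d(1,2)]) (simp add: p2(1))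
  have Xn: "X + vscale \<tau> p2 \<notin> l0"
  proof
    assume "X + vscale \<tau> p2 \<in> l0"
    then have "X + vscale \<tau> p2 - vscale \<tau> p2 \<in> l0" by (intro kvec.subspace_diff kvec.subspace_scale sl0 p2)
    then show False using XY(5) by simp
  qed
  have ind: "\<alpha> = 0 \<and> \<beta> = 0" if "vscale \<alpha> (X + vscale \<tau> p2) + vscale \<beta> ?X = 0" for \<alpha> \<beta>
  proof -
    have "\<alpha> = 0"
    proof (rule ccontr)
      assume "\<alpha> \<noteq> 0"
      have z: "vscale \<beta> ?X + vscale \<alpha> (X + vscale \<tau> p2) = 0" using that by (simp only: add.commute)
      have "vscale \<beta> ?X + vscale \<alpha> (X + vscale \<tau> p2) \<in> l0" unfolding z by (rule kvec.subspace_0[OF sl0])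
      from subspace_comb_cancel[OF sl0 this X0 \<open>\<alpha> \<noteq> 0\<close>] Xn show False by simp
    qed
    moreover from this that have "vscale \<beta> ?X = 0" by (simp add: fun_eq_iff)
    then have "\<beta> = 0" using indep2_nz(1)[OF ind2] by (metis kvec.scale_eq_0_iff)
    ultimately show ?thesis by simp
  qed
  obtain m where m: "m \<in> Sol" "X + vscale \<tau> p2 \<in> m" "p2 \<in> m"
    using pencil_kernel_2dim[OF K1 K2 d(1,2) ind] by auto
  then have "m = l0" using Sol_disjoint[OF m(1) l0 m(3) p2(2,1)] by simp
  with m Xn show False by simp
qed

lemma no_solutions_inside:
  assumes "card Sol = a" "l0 \<in> Sol" shows "\<not> l0 \<subseteq> L1" "\<not> l0 \<subseteq> L2" "\<not> l0 \<subseteq> L3" "\<not> l0 \<subseteq> L4"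
proof -
  interpret s: four_subspaces n a L2 L1 L3 L4 by (rule swap12)
  interpret t: four_subspaces n a L3 L4 L1 L2 by (rule swap_pairs)
  interpret u: four_subspaces n a L4 L3 L1 L2 by (rule t.swap12)
  show "\<not> l0 \<subseteq> L1" by (rule no_solution_inside[OF assms])
  show "\<not> l0 \<subseteq> L2" using s.no_solution_inside assms Sol_perm by simp
  show "\<not> l0 \<subseteq> L3" using t.no_solution_inside assms Sol_perm by simp
  have "lines_meeting n {L4, L3, L1, L2} = Sol" by (simp add: insert_commute)
  then show "\<not> l0 \<subseteq> L4" using u.no_solution_inside assms by simp
qed

text \<open>
  A relation among the points on \<open>L1\<close> would move to a solution for almost every parameter, hence to
  the same solution for two different parameters, which are both its cross ratio.
\<close>

lemma solution_points_indep:
  assumes card: "card Sol = a" and w: "\<And>l. l \<in> Sol \<Longrightarrow> w l \<in> l \<and> w l \<in> L1 \<and> w l \<noteq> 0"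
    and rel: "(\<Sum>l\<in>Sol. vscale (c l) (w l)) = 0" and l: "l \<in> Sol"
  shows "c l = 0"
proof (rule ccontr)
  assume "c l \<noteq> 0"
  then have ex: "\<exists>l\<in>Sol. c l \<noteq> 0" using l by blast
  obtain A B where AB: "\<And>l. l \<in> Sol \<Longrightarrow> cross l (w l) (A l) (B l)"
    "\<And>l c. l \<in> Sol \<Longrightarrow> \<not> (A l \<noteq> 0 \<and> c * A l = B l) \<Longrightarrow> c * A l \<noteq> B l" by (rule crosses[of w]) (use w in auto)
  have sZ: "kvec.subspace {0}" by (rule kvec.subspace_single_0)
  have "(\<Sum>l\<in>Sol. vscale (c l) (w l)) \<in> {0}" using rel by simp
  from minimal_relation_exists[OF fin this ex] obtain J q where J: "J \<subseteq> Sol" "minimal_relation {0} w J q" by blast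
  have "w l \<notin> {0}" if "l \<in> J" for l using w that J(1) by blast
  from two_in_relation[OF J(2) sZ this] have two: "\<exists>l\<in>J. \<exists>l'\<in>J. l \<noteq> l'" .
  have fJ: "finite J" using J(1) fin finite_subset by blast
  have s0: "(\<Sum>l\<in>J. vscale (q l) (w l)) = 0" using J(2) unfolding minimal_relation_def by blast
  define T where "T = {d. d = 0 \<or> d = 1 \<or> (\<exists>l\<in>J. A l \<noteq> 0 \<and> d * A l = B l)}"
  have "\<forall>d. \<exists>X Y. d \<notin> T \<longrightarrow> pencil_kernel d X Y \<and> X \<noteq> 0"
  proof (rule allI)
    fix d
    show "\<exists>X Y. d \<notin> T \<longrightarrow> pencil_kernel d X Y \<and> X \<noteq> 0"
    proof (cases "d \<in> T")
      case False
      then have d: "d \<noteq> 0" "\<And>l. l \<in> J \<Longrightarrow> d * A l \<noteq> B l" using AB(2) J(1) by (auto simp: T_def)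
      have "\<And>l. l \<in> J \<Longrightarrow> l \<in> Sol \<and> cross l (w l) (A l) (B l)" using J(1) AB(1) by blast
      from move_relation[OF sZ J(2) this two d] obtain X Y where
        "X \<in> L1" "Y \<in> L2" "X + Y \<in> L3" "X + vscale d Y \<in> L4" "X \<noteq> 0" unfolding s0 by auto
      then show ?thesis unfolding pencil_kernel_def by blast
    qed simp
  qed
  then obtain X Y where XY: "\<And>d. d \<notin> T \<Longrightarrow> pencil_kernel d (X d) (Y d) \<and> X d \<noteq> 0" by metis
  have T01: "d \<noteq> 0" "d \<noteq> 1" if "d \<notin> T" for d using that by (auto simp: T_def)
  have ind: "indep2 (X d) (Y d)" and sol: "line (X d) (Y d) \<in> Sol" if "d \<notin> T" for d
    using pencil_kernel_line[of d "X d" "Y d"] XY[OF that] T01[OF that] by auto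
  have "finite T" unfolding T_def by (rule generic_parameter[OF fJ])
  then have inf: "infinite (- T)" 
    using Diff_infinite_finite[OF _ infinite_UNIV_alg_closed[where 'k = 'k], of T] by (simp add: Compl_eq_Diff_UNIV)
  have "(\<lambda>d. line (X d) (Y d)) ` (- T) \<subseteq> Sol" using sol by auto
  then have "finite ((\<lambda>d. line (X d) (Y d)) ` (- T))" using fin by (rule finite_subset)
  then have "\<not> inj_on (\<lambda>d. line (X d) (Y d)) (- T)" using inf finite_imageD[of _ "- T"] by auto
  then obtain d d' where dd: "d \<notin> T" "d' \<notin> T" "d \<noteq> d'" "line (X d) (Y d) = line (X d') (Y d')"
    unfolding inj_on_def by auto
  let ?m = "line (X d) (Y d)"
  have m: "?m \<in> Sol" using sol dd by simp
  have sm: "kvec.subspace ?m" by (rule subspace_line)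
  have mem: "X d \<in> ?m" "Y d \<in> ?m" "X d' \<in> ?m" "Y d' \<in> ?m"
    unfolding atomize_conj by (intro conjI line_ends) (unfold dd(4), (rule line_ends)+)
  note K = XY[OF dd(1), unfolded pencil_kernel_def] and K' = XY[OF dd(2), unfolded pencil_kernel_def]
  have par: "\<exists>t. y = vscale t x" if xy: "x \<in> ?m" "y \<in> ?m" "x \<in> V" "y \<in> V" "x \<noteq> 0" and V: "kvec.subspace V" "\<not> ?m \<subseteq> V" for x y V
  proof (rule ccontr)
    assume no: "\<not> ?thesis"
    have "indep2 x y"
    proof (rule ccontr)
      assume "\<not> indep2 x y"
      then obtain t where "y = vscale t x" using xy(5) by (rule not_indep2)
      then show False using no by blast
    qed
    then have "?m = line x y" using xy(1,2) by (rule line_eqI[OF Sol_line[OF m]])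
    then show False using line_subset[OF V(1) xy(3,4)] V(2) by blast
  qed
  note ni = no_solutions_inside[OF card m]
  obtain t1 where t1: "X d' = vscale t1 (X d)" using par[OF mem(1,3) _ _ _ sub(1) ni(1)] K K' by auto
  obtain t2 where t2: "Y d' = vscale t2 (Y d)"
    using par[OF mem(2,4) _ _ _ sub(2) ni(2)] K K' indep2_nz(2)[OF ind[OF dd(1)]] by auto
  have z3: "X d + Y d \<noteq> 0" using indep2D[OF ind[OF dd(1)], of 1 1] by (auto simp: vscale_def)
  have z4: "X d + vscale d (Y d) \<noteq> 0" using indep2D[OF ind[OF dd(1)], of 1 d] by (auto simp: vscale_def)
  have mm: "X d + Y d \<in> ?m" "X d' + Y d' \<in> ?m" "X d + vscale d (Y d) \<in> ?m" "X d' + vscale d' (Y d') \<in> ?m"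
    by (intro kvec.subspace_add kvec.subspace_scale sm mem)+
  obtain t3 where t3: "X d' + Y d' = vscale t3 (X d + Y d)"
    using par[OF mm(1,2) _ _ z3 sub(3) ni(3)] K K' by auto
  obtain t4 where t4: "X d' + vscale d' (Y d') = vscale t4 (X d + vscale d (Y d))"
    using par[OF mm(3,4) _ _ z4 sub(4) ni(4)] K K' by auto
  have e3: "vscale (t1 - t3) (X d) + vscale (t2 - t3) (Y d) = 0"
    using t3 unfolding t1 t2 by (simp add: fun_eq_iff algebra_simps)
  have e4: "vscale (t1 - t4) (X d) + vscale (d' * t2 - t4 * d) (Y d) = 0"
    using t4 unfolding t1 t2 by (simp add: fun_eq_iff algebra_simps)
  have "t1 = t3" "t2 = t3" using indep2D[OF ind[OF dd(1)] e3] by auto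
  moreover have "t1 = t4" "d' * t2 = t4 * d" using indep2D[OF ind[OF dd(1)] e4] by auto
  ultimately have "t1 = 0" using dd(3) by (auto simp: mult.commute)
  then have "X d' = 0" using t1 by (simp add: fun_eq_iff)
  with XY[OF dd(2)] show False by simp
qed

end

section \<open>An irreducible family of configurations\<close>

lemma line_span: "kvec.span (set [x, y]) = line x y"
proof -
  have "{..<2 :: nat} = {0, 1}" by auto
  then have "pair x y ` {..<2} = {x, y}" by (simp add: pair_def insert_commute)
  then show ?thesis using span_pair[of x y] by simp
qed

lemma ordered_basis_pair: "ordered_basis [x, y] (line x y) \<longleftrightarrow> indep2 x y"
proof -
  have "[0..<2] = [0, 1 :: nat]" by (simp add: numeral_2_eq_2)
  then have "map (pair x y) [0..<2] = [x, y]" by (simp add: pair_def)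
  then show ?thesis
    using ordered_basis_map[of "pair x y" 2 "line x y"] by (simp add: indep2_pair span_pair)
qed

lemma fam_indep_nonzero: assumes "fam_indep m v" "k < m" shows "v k \<noteq> 0"
proof
  assume z: "v k = 0"
  have "lcomb m (\<lambda>i. if i = k then 1 else 0) v = (\<Sum>i<m. if i = k then v k else 0)"
    unfolding lcomb_eq_sum by (intro sum.cong) (auto simp: fun_eq_iff)
  also have "\<dots> = 0" using z by simp
  finally show False using fam_indepD[OF assms(1) _ assms(2)] by fastforce
qed

text \<open>
  In both families of problems the general solution set is obtained by choosing the \<open>d\<close> lines
  first: the \<open>m\<close> subspaces of dimension \<open>d - 1\<close> are spanned by one point on each of the lines,
  and if \<open>ex\<close> holds, there is one more condition line which all lines are required to meet.
\<close>

locale configurations =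
  fixes a :: "nat list" and n d m :: nat and ex :: bool and K :: "'k::alg_closed_field itself"
  assumes n: "ambient_dim a = n" and d: "0 < d"
    and dims: "condition_dims a = replicate m (d - 1) @ (if ex then [1] else [])"
begin

definition Conf :: "(nat \<Rightarrow> 'k) set list set" where
  "Conf = {ls @ Ls | ls Ls. length ls = d \<and> ls @ Ls \<in> fiber_power a d \<and>
     (\<forall>j<m. \<exists>q. fam_indep d q \<and> (\<forall>k<d. q k \<in> ls ! k \<and> q k \<in> Ls ! j))}"

text \<open>
  The component \<open>g k\<close> is zero when the lines are required to meet the condition line spanned by \<open>e\<close>
  and \<open>f\<close>, and arbitrary otherwise; with it both families of problems have the same parameters.
\<close>

definition pt :: "(nat \<Rightarrow> 'k) \<Rightarrow> (nat \<Rightarrow> 'k) \<Rightarrow> (nat \<Rightarrow> 'k) \<Rightarrow> (nat \<Rightarrow> 'k) \<Rightarrow> (nat \<Rightarrow> nat \<Rightarrow> 'k) \<Rightarrow> nat \<Rightarrow> nat \<Rightarrow> 'k" where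
  "pt e f s r g k = vscale (s k) e + vscale (r k) f + g k"

definition cpt :: "(nat \<Rightarrow> nat \<Rightarrow> 'k) \<Rightarrow> (nat \<Rightarrow> nat \<Rightarrow> 'k) \<Rightarrow> (nat \<Rightarrow> 'k) \<Rightarrow> (nat \<Rightarrow> 'k) \<Rightarrow> nat \<Rightarrow> nat \<Rightarrow> 'k" where
  "cpt p h \<alpha> \<beta> k = vscale (\<alpha> k) (p k) + vscale (\<beta> k) (h k)"

text \<open>
  The \<open>k\<close>-th line is spanned by \<open>p k\<close> and \<open>h k\<close>, and the \<open>j\<close>-th condition subspace by one point on each
  line. The coefficients \<open>\<alpha>\<close> and \<open>\<beta>\<close> of these points are free parameters.
\<close>

definition conf_bases where
  "conf_bases e f p h \<alpha> \<beta> = map (\<lambda>k. [p k, h k]) [0..<d] @ map (\<lambda>j. map (cpt p h (\<alpha> j) (\<beta> j)) [0..<d]) [0..<m] @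
     (if ex then [[e, f]] else [])"

definition conf_of where
  "conf_of e f p h \<alpha> \<beta> = map (\<lambda>k. line (p k) (h k)) [0..<d] @
     map (\<lambda>j. kvec.span (cpt p h (\<alpha> j) (\<beta> j) ` {..<d})) [0..<m] @ (if ex then [line e f] else [])"

text \<open>
  The witness \<open>z\<close> of the distinctness of two lines is one of the two basis vectors of the second:
  in this form the condition is stable under small changes.
\<close>

definition apart where
  "apart x y u v \<longleftrightarrow> fam_indep 3 (\<lambda>i. if i = 0 then x else if i = 1 then y else u) \<or>
     fam_indep 3 (\<lambda>i. if i = 0 then x else if i = 1 then y else v)"

text \<open>
  Each condition is the nonvanishing of some minor, so it holds on an open set of parameters.
\<close>

definition conf_good where
  "conf_good e f p h \<alpha> \<beta> \<longleftrightarrow> (\<forall>k<d. indep2 (p k) (h k)) \<and> (\<forall>j<m. fam_indep d (cpt p h (\<alpha> j) (\<beta> j))) \<and>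
     (\<forall>k<d. \<forall>l<d. k \<noteq> l \<longrightarrow> apart (p k) (h k) (p l) (h l)) \<and> (ex \<longrightarrow> indep2 e f)"

lemma third_outside:
  assumes "fam_indep 3 (\<lambda>i. if i = 0 then x else if i = 1 then y else z)" shows "z \<notin> line x y"
proof
  assume "z \<in> line x y"
  then obtain \<alpha> \<beta> where z: "z = vscale \<alpha> x + vscale \<beta> y" unfolding in_line_iff by (elim exE)
  let ?c = "\<lambda>i :: nat. if i = 0 then \<alpha> else if i = 1 then \<beta> else - 1"
  have "lcomb 3 ?c (\<lambda>i. if i = 0 then x else if i = 1 then y else z) = 0"
    by (rule ext) (simp add: lcomb_def numeral_3_eq_3 z)
  from fam_indepD[OF assms this, of 2] show False by simp
qed

lemma apart_lines: "apart x y u v \<Longrightarrow> line x y \<noteq> line u v"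
  unfolding apart_def using third_outside[of x y u] third_outside[of x y v] line_ends(1)[of u v] line_ends(2)[of v u] by auto

lemma indep3I:
  assumes "indep2 x y" "z \<notin> line x y" shows "fam_indep 3 (\<lambda>i. if i = 0 then x else if i = 1 then y else z)"
  unfolding fam_indep_def
proof (intro allI impI)
  fix c and k :: nat
  assume "lcomb 3 c (\<lambda>i. if i = 0 then x else if i = 1 then y else z) = 0" and k: "k < 3"
  then have r: "vscale (c 0) x + vscale (c 1) y + vscale (c 2) z = 0"
    by (simp add: lcomb_def fun_eq_iff numeral_3_eq_3 numeral_2_eq_2)
  have c2: "c 2 = 0"
  proof (rule ccontr)
    assume c2: "c 2 \<noteq> 0"
    have "z = vscale (- c 0 / c 2) x + vscale (- c 1 / c 2) y"
    proof
      fix i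
      have "c 2 * z i + (c 0 * x i + c 1 * y i) = 0" using fun_cong[OF r, of i] by (simp add: add.commute)
      then have "c 2 * z i = - (c 0 * x i + c 1 * y i)" by (simp only: eq_neg_iff_add_eq_0)
      then have "z i = - (c 0 * x i + c 1 * y i) / c 2" using c2 by (metis nonzero_mult_div_cancel_left)
      then show "z i = (vscale (- c 0 / c 2) x + vscale (- c 1 / c 2) y) i"
        using c2 by (simp add: diff_divide_distrib add_divide_distrib)
    qed
    then show False using assms(2) in_lineI by blast
  qed
  then have "vscale (c 0) x + vscale (c 1) y = 0" using r by (simp add: fun_eq_iff)
  from indep2D[OF assms(1) this] c2 k show "c k = 0" by (auto simp: less_Suc_eq numeral_3_eq_3 numeral_2_eq_2)
qed

lemma apartI:
  assumes "indep2 x y" "indep2 u v" "line x y \<noteq> line u v" "x \<in> coord_space N" "y \<in> coord_space N"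
    "u \<in> coord_space N" "v \<in> coord_space N"
  shows "apart x y u v"
proof (rule ccontr)
  assume "\<not> apart x y u v"
  then have "u \<in> line x y" "v \<in> line x y" using indep3I[OF assms(1)] unfolding apart_def by blast+
  then have "line x y = line u v" by (rule line_eqI[OF line_grassmannian[OF assms(1,4,5)] assms(2)])
  with assms(3) show False by simp
qed

lemma conf_of_span: "conf_of e f p h \<alpha> \<beta> = map (\<lambda>bs. kvec.span (set bs)) (conf_bases e f p h \<alpha> \<beta>)"
proof -
  have "{0..<d} = {..<d}" by auto
  then show ?thesis by (auto simp: conf_of_def conf_bases_def line_span[simplified])
qed

lemma conf_good_bases:
  assumes "conf_good e f p h \<alpha> \<beta>" shows "list_all2 ordered_basis (conf_bases e f p h \<alpha> \<beta>) (conf_of e f p h \<alpha> \<beta>)"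
  unfolding conf_bases_def conf_of_def
  using assms unfolding conf_good_def
  by (intro list_all2_appendI)
     (auto simp: list_all2_conv_all_nth ordered_basis_pair ordered_basis_map simp del: upt_Suc)

lemma conf_good_in_Conf:
  assumes good: "conf_good e f p h \<alpha> \<beta>"
    and coord: "\<And>k. k < d \<Longrightarrow> p k \<in> coord_space n" "\<And>k. k < d \<Longrightarrow> h k \<in> coord_space n"
      "e \<in> coord_space n" "f \<in> coord_space n"
    and on: "\<And>k. ex \<Longrightarrow> k < d \<Longrightarrow> p k \<in> line e f"
  shows "conf_of e f p h \<alpha> \<beta> \<in> Conf"
proof -
  let ?ls = "map (\<lambda>k. line (p k) (h k)) [0..<d]"
  let ?L = "\<lambda>j. kvec.span (cpt p h (\<alpha> j) (\<beta> j) ` {..<d})"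
  let ?Ls = "map ?L [0..<m] @ (if ex then [line e f] else [])"
  have ind: "indep2 (p k) (h k)" if "k < d" for k using good that by (simp add: conf_good_def)
  have fam: "fam_indep d (cpt p h (\<alpha> j) (\<beta> j))" if "j < m" for j using good that by (simp add: conf_good_def)
  have inl: "cpt p h (\<alpha> j) (\<beta> j) k \<in> line (p k) (h k)" for j k unfolding cpt_def by (rule in_lineI[OF refl])
  have inL: "cpt p h (\<alpha> j) (\<beta> j) k \<in> ?L j" if "k < d" for j k using that by (intro kvec.span_base imageI) simp
  have lg: "line (p k) (h k) \<in> grassmannian 1 n" if "k < d" for k
    using line_grassmannian[OF ind coord(1,2)] that by blast
  have Lg: "?L j \<in> grassmannian (d - 1) n" if "j < m" for j
  proof -
    have "cpt p h (\<alpha> j) (\<beta> j) k \<in> coord_space n" if "k < d" for k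
      using coord_subspace[OF lg[OF that] inl] .
    then show ?thesis using span_family_grassmannian[of "d - 1" "cpt p h (\<alpha> j) (\<beta> j)" n] fam[OF that] d by simp
  qed
  have X: "?Ls \<in> schubert_X a"
    unfolding schubert_X_def multi_grassmannian_def dims n mem_Collect_eq
  proof (rule list_all2_appendI)
    show "list_all2 (\<lambda>V k. V \<in> grassmannian k n) (map ?L [0..<m]) (replicate m (d - 1))"
      using Lg by (simp add: list_all2_conv_all_nth)
    show "list_all2 (\<lambda>V k. V \<in> grassmannian k n) (if ex then [line e f] else []) (if ex then [1] else [])"
      using line_grassmannian[OF _ coord(3,4)] good by (simp add: conf_good_def)
  qed
  have W: "(line (p k) (h k), ?Ls) \<in> schubert_W a" if k: "k < d" for k
  proof -
    have "meets (line (p k) (h k)) L" if L: "L \<in> set ?Ls" for L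
    proof -
      consider j where "j < m" "L = ?L j" | "ex" "L = line e f" using L by (auto split: if_splits)
      then show ?thesis
      proof cases
        case 1
        then show ?thesis using fam_indep_nonzero[OF fam[OF 1(1)] k] inl inL[OF k] by (auto intro: meetsI)
      next
        case 2
        then show ?thesis using indep2_nz(1)[OF ind[OF k]] line_ends(1) on[OF _ k] by (auto intro: meetsI)
      qed
    qed
    then show ?thesis using X lg[OF k] by (simp add: schubert_W_def n)
  qed
  have dist: "distinct ?ls"
  proof -
    have "line (p k) (h k) \<noteq> line (p l) (h l)" if "k < d" "l < d" "k \<noteq> l" for k l
      using good that unfolding conf_good_def by (intro apart_lines) simp
    then have "inj_on (\<lambda>k. line (p k) (h k)) {0..<d}" unfolding inj_on_def by (metis atLeastLessThan_iff)
    then show ?thesis by (simp add: distinct_map)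
  qed
  have fp: "?ls @ ?Ls \<in> fiber_power a d"
    unfolding fiber_power_def using dist X W by (intro CollectI exI[of _ ?ls] exI[of _ ?Ls]) auto
  have pts: "\<exists>q. fam_indep d q \<and> (\<forall>k<d. q k \<in> ?ls ! k \<and> q k \<in> ?Ls ! j)" if j: "j < m" for j
    using fam[OF j] inl inL j by (intro exI[of _ "cpt p h (\<alpha> j) (\<beta> j)"]) (simp add: nth_append)
  have "conf_of e f p h \<alpha> \<beta> = ?ls @ ?Ls" by (simp add: conf_of_def)
  then show ?thesis unfolding Conf_def using fp pts by (intro CollectI exI[of _ ?ls] exI[of _ ?Ls]) simp
qed

text \<open>
  Every configuration arises from parameters that range over an affine space. The point \<open>p k\<close> is chosen
  on the condition line if there is one.
\<close>

lemma Conf_params: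
  assumes "x \<in> Conf"
  shows "\<exists>e f s r g h \<alpha> \<beta>. x = conf_of e f (pt e f s r g) h \<alpha> \<beta> \<and> conf_good e f (pt e f s r g) h \<alpha> \<beta> \<and>
    (\<forall>k. g k \<in> coord_space n) \<and> (\<forall>k. h k \<in> coord_space n) \<and> e \<in> coord_space n \<and> f \<in> coord_space n \<and>
    (ex \<longrightarrow> (\<forall>k. g k = 0))"
proof -
  obtain ls Ls where x: "x = ls @ Ls" "length ls = d" "ls @ Ls \<in> fiber_power a d"
    and pts: "\<forall>j<m. \<exists>q. fam_indep d q \<and> (\<forall>k<d. q k \<in> ls ! k \<and> q k \<in> Ls ! j)"
    using assms unfolding Conf_def by (elim CollectE exE conjE) blast
  have dist: "distinct ls" and X: "Ls \<in> schubert_X a" and W: "\<And>l. l \<in> set ls \<Longrightarrow> (l, Ls) \<in> schubert_W a"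
    using x(2,3) unfolding fiber_power_def by auto
  have Xg: "list_all2 (\<lambda>V k. V \<in> grassmannian k n) Ls (replicate m (d - 1) @ (if ex then [1] else []))"
    using X by (simp add: schubert_X_def multi_grassmannian_def n dims)
  have lenL: "length Ls = m + (if ex then 1 else 0)" using list_all2_lengthD[OF Xg] by simp
  have Lg: "Ls ! j \<in> grassmannian (d - 1) n" if "j < m" for j
    using list_all2_nthD2[OF Xg, of j] that by (simp add: nth_append)
  have Mg: "Ls ! m \<in> grassmannian 1 n" if "ex" using list_all2_nthD2[OF Xg, of m] that by (simp add: nth_append)
  have lg: "ls ! k \<in> grassmannian 1 n" if "k < d" for k
    using W[of "ls ! k"] that x(2) by (simp add: schubert_W_def n)
  have "\<exists>e f. e \<in> coord_space n \<and> f \<in> coord_space n \<and> (ex \<longrightarrow> indep2 e f \<and> Ls ! m = line e f)"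
  proof (cases ex)
    case True
    obtain e f where ef: "indep2 e f" "Ls ! m = line e f" using grassmannian_lineE[OF Mg[OF True]] by blast
    then have "e \<in> coord_space n" "f \<in> coord_space n" using coord_subspace[OF Mg[OF True]] line_ends(1)[of e f] line_ends(2)[of f e] by auto
    with ef show ?thesis by blast
  next
    case False
    then show ?thesis by (intro exI[of _ 0]) (simp add: coord_space_def)
  qed
  then obtain e f where ef: "e \<in> coord_space n" "f \<in> coord_space n" "ex \<Longrightarrow> indep2 e f" "ex \<Longrightarrow> Ls ! m = line e f" by blast
  have "\<exists>s r g h. (ex \<longrightarrow> g = 0) \<and> g \<in> coord_space n \<and> h \<in> coord_space n \<and>
      indep2 (vscale s e + vscale r f + g) h \<and> ls ! k = line (vscale s e + vscale r f + g) h" if k: "k < d" for k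
  proof (cases ex)
    case True
    have "meets (ls ! k) (Ls ! m)" using W[of "ls ! k"] k x(2) lenL True by (auto simp: schubert_W_def)
    then obtain v where v: "v \<noteq> 0" "v \<in> ls ! k" "v \<in> Ls ! m" unfolding meets_def by (elim exE conjE)
    obtain s r where "v = vscale s e + vscale r f" using v(3) unfolding ef(4)[OF True] in_line_iff by (elim exE)
    moreover obtain h where "h \<in> ls ! k" "indep2 v h" "ls ! k = line v h" using line_through[OF lg[OF k] v(2,1)] by blast
    ultimately show ?thesis using coord_subspace[OF lg[OF k]] True
      by (intro exI[of _ s] exI[of _ r] exI[of _ 0] exI[of _ h]) (auto simp: coord_space_def)
  next
    case False
    obtain g h where gh: "indep2 g h" "ls ! k = line g h" using grassmannian_lineE[OF lg[OF k]] by blast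
    have "vscale 0 e + vscale 0 f + g = g" by (simp add: fun_eq_iff)
    moreover have "g \<in> coord_space n" "h \<in> coord_space n" using coord_subspace[OF lg[OF k]] gh(2) line_ends(1)[of g h] line_ends(2)[of h g] by auto
    ultimately show ?thesis using gh False by (intro exI[of _ 0] exI[of _ 0] exI[of _ g] exI[of _ h]) simp
  qed
  then have "\<forall>k. \<exists>s r g h. k < d \<longrightarrow> (ex \<longrightarrow> g = 0) \<and> g \<in> coord_space n \<and> h \<in> coord_space n \<and>
      indep2 (vscale s e + vscale r f + g) h \<and> ls ! k = line (vscale s e + vscale r f + g) h" by blast
  then obtain s where "\<forall>k. \<exists>r g h. k < d \<longrightarrow> (ex \<longrightarrow> g = 0) \<and> g \<in> coord_space n \<and> h \<in> coord_space n \<and>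
      indep2 (vscale (s k) e + vscale r f + g) h \<and> ls ! k = line (vscale (s k) e + vscale r f + g) h" by (rule choice[THEN exE])
  then obtain r where "\<forall>k. \<exists>g h. k < d \<longrightarrow> (ex \<longrightarrow> g = 0) \<and> g \<in> coord_space n \<and> h \<in> coord_space n \<and>
      indep2 (vscale (s k) e + vscale (r k) f + g) h \<and> ls ! k = line (vscale (s k) e + vscale (r k) f + g) h" by (rule choice[THEN exE])
  then obtain g where "\<forall>k. \<exists>h. k < d \<longrightarrow> (ex \<longrightarrow> g k = 0) \<and> g k \<in> coord_space n \<and> h \<in> coord_space n \<and>
      indep2 (vscale (s k) e + vscale (r k) f + g k) h \<and> ls ! k = line (vscale (s k) e + vscale (r k) f + g k) h" by (rule choice[THEN exE])
  then obtain h where h: "\<forall>k. k < d \<longrightarrow> (ex \<longrightarrow> g k = 0) \<and> g k \<in> coord_space n \<and> h k \<in> coord_space n \<and>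
      indep2 (vscale (s k) e + vscale (r k) f + g k) (h k) \<and> ls ! k = line (vscale (s k) e + vscale (r k) f + g k) (h k)"
    by (rule choice[THEN exE])
  define g' where "g' k = (if k < d then g k else 0)" for k
  define h' where "h' k = (if k < d then h k else 0)" for k
  let ?p = "pt e f s r g'"
  have ph: "indep2 (?p k) (h' k)" "ls ! k = line (?p k) (h' k)" if "k < d" for k
    using h that by (auto simp: pt_def g'_def h'_def)
  have "\<forall>j. \<exists>\<alpha> \<beta>. j < m \<longrightarrow> fam_indep d (cpt ?p h' \<alpha> \<beta>) \<and> (\<forall>k<d. cpt ?p h' \<alpha> \<beta> k \<in> Ls ! j)"
  proof
    fix j
    show "\<exists>\<alpha> \<beta>. j < m \<longrightarrow> fam_indep d (cpt ?p h' \<alpha> \<beta>) \<and> (\<forall>k<d. cpt ?p h' \<alpha> \<beta> k \<in> Ls ! j)"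
    proof (cases "j < m")
      case True
      then obtain q where q: "fam_indep d q" "\<forall>k<d. q k \<in> ls ! k \<and> q k \<in> Ls ! j" using pts by blast
      have "\<forall>k. \<exists>\<alpha> \<beta>. k < d \<longrightarrow> q k = vscale \<alpha> (?p k) + vscale \<beta> (h' k)"
        using q(2) ph(2) in_line_iff by metis
      then obtain \<alpha> \<beta> where ab: "\<And>k. k < d \<Longrightarrow> q k = cpt ?p h' \<alpha> \<beta> k" unfolding cpt_def by metis
      have "lcomb d c q = lcomb d c (cpt ?p h' \<alpha> \<beta>)" for c unfolding lcomb_def by (intro ext sum.cong) (simp_all add: ab)
      then have "fam_indep d (cpt ?p h' \<alpha> \<beta>)" using q(1) by (simp add: fam_indep_def)
      moreover have "\<forall>k<d. cpt ?p h' \<alpha> \<beta> k \<in> Ls ! j" using q(2) ab by metis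
      ultimately show ?thesis by blast
    qed simp
  qed
  then obtain \<alpha> where "\<forall>j. \<exists>\<beta>. j < m \<longrightarrow> fam_indep d (cpt ?p h' (\<alpha> j) \<beta>) \<and> (\<forall>k<d. cpt ?p h' (\<alpha> j) \<beta> k \<in> Ls ! j)"
    by (rule choice[THEN exE])
  then obtain \<beta> where ab: "\<forall>j. j < m \<longrightarrow> fam_indep d (cpt ?p h' (\<alpha> j) (\<beta> j)) \<and> (\<forall>k<d. cpt ?p h' (\<alpha> j) (\<beta> j) k \<in> Ls ! j)"
    by (rule choice[THEN exE])
  have coord: "g' k \<in> coord_space n" "h' k \<in> coord_space n" for k
    using h by (auto simp: g'_def h'_def) (simp_all add: coord_space_def)
  have g0: "ex \<longrightarrow> (\<forall>k. g' k = 0)" using h by (auto simp: g'_def)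
  have pc: "?p k \<in> coord_space n" for k
    unfolding pt_def by (intro kvec.subspace_add kvec.subspace_scale subspace_coord_space ef coord)
  have Lspan: "Ls ! j = kvec.span (cpt ?p h' (\<alpha> j) (\<beta> j) ` {..<d})" if j: "j < m" for j
    using grassmannian_span_eq[OF Lg[OF j], of "cpt ?p h' (\<alpha> j) (\<beta> j)"] ab j d by simp
  have "ls = map (\<lambda>k. line (?p k) (h' k)) [0..<d]" using x(2) ph(2) by (intro nth_equalityI) auto
  moreover have "Ls = map (\<lambda>j. kvec.span (cpt ?p h' (\<alpha> j) (\<beta> j) ` {..<d})) [0..<m] @ (if ex then [line e f] else [])"
    using lenL Lspan ef(4) by (intro nth_equalityI) (auto simp: nth_append less_Suc_eq split: if_splits)
  ultimately have xe: "x = conf_of e f ?p h' \<alpha> \<beta>" unfolding x(1) conf_of_def by simp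
  have "apart (?p k) (h' k) (?p l) (h' l)" if kl: "k < d" "l < d" "k \<noteq> l" for k l
  proof (rule apartI[OF ph(1)[OF kl(1)] ph(1)[OF kl(2)] _ pc coord(2) pc coord(2)])
    show "line (?p k) (h' k) \<noteq> line (?p l) (h' l)"
      using dist kl x(2) ph(2) by (metis nth_eq_iff_index_eq)
  qed
  then have "conf_good e f ?p h' \<alpha> \<beta>" unfolding conf_good_def using ph(1) ab ef(3) by blast
  with xe coord g0 ef show ?thesis by blast
qed

definition mix :: "'k \<Rightarrow> 'k \<Rightarrow> 'k \<Rightarrow> 'k" where
  "mix x y t = (1 - t) * x + t * y"

definition vmix :: "(nat \<Rightarrow> 'k) \<Rightarrow> (nat \<Rightarrow> 'k) \<Rightarrow> 'k \<Rightarrow> nat \<Rightarrow> 'k" where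
  "vmix u w t = vscale (1 - t) u + vscale t w"

lemma pfun_mix: "pfun {\<lambda>t. t} (mix x y)"
  unfolding mix_def by (intro pfun.add pfun.mult pfun_diff pfun.const pfun.gen) simp_all

lemma pfun_vmix: "pfun {\<lambda>t. t} (\<lambda>t. vmix u w t z)"
  unfolding vmix_def by (simp, intro pfun.add pfun.mult pfun_diff pfun.const pfun.gen) simp_all

lemma mix_ends: "mix x y 0 = x" "mix x y 1 = y" "vmix u w 0 = u" "vmix u w 1 = w"
  by (simp_all add: mix_def vmix_def fun_eq_iff)

lemma vmix_coord: "u \<in> coord_space N \<Longrightarrow> w \<in> coord_space N \<Longrightarrow> vmix u w t \<in> coord_space N"
  unfolding vmix_def by (intro subspace_comb subspace_coord_space)

lemma pfun_pt:
  assumes "\<And>z. pfun G (\<lambda>t. e t z)" "\<And>z. pfun G (\<lambda>t. f t z)" "\<And>k. pfun G (\<lambda>t. s t k)" "\<And>k. pfun G (\<lambda>t. r t k)"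
    "\<And>k z. pfun G (\<lambda>t. g t k z)"
  shows "pfun G (\<lambda>t. pt (e t) (f t) (s t) (r t) (g t) k z)"
  unfolding pt_def by (simp, intro pfun.add pfun.mult assms)

lemma pfun_cpt:
  assumes "\<And>k z. pfun G (\<lambda>t. p t k z)" "\<And>k z. pfun G (\<lambda>t. h t k z)" "\<And>k. pfun G (\<lambda>t. \<alpha> t k)" "\<And>k. pfun G (\<lambda>t. \<beta> t k)"
  shows "pfun G (\<lambda>t. cpt (p t) (h t) (\<alpha> t) (\<beta> t) k z)"
  unfolding cpt_def by (simp, intro pfun.add pfun.mult assms)

lemma cofinite_indep2:
  assumes "\<And>z. pfun {\<lambda>t. t} (\<lambda>t. x t z)" "\<And>z. pfun {\<lambda>t. t} (\<lambda>t. y t z)" "indep2 (x t0) (y t0)"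
  shows "finite {t. \<not> indep2 (x t) (y t)}"
proof -
  have "pfun {\<lambda>t. t} (\<lambda>t. pair (x t) (y t) k z)" for k z
    using assms(1,2) by (cases "k = 0") (simp_all add: pair_def)
  from cofinite_indep[of 2 "\<lambda>t. pair (x t) (y t)", OF this] show ?thesis using assms(3) by (simp add: indep2_pair)
qed

lemma cofinite_apart:
  assumes "\<And>z. pfun {\<lambda>t. t} (\<lambda>t. x t z)" "\<And>z. pfun {\<lambda>t. t} (\<lambda>t. y t z)" "\<And>z. pfun {\<lambda>t. t} (\<lambda>t. u t z)"
    "\<And>z. pfun {\<lambda>t. t} (\<lambda>t. v t z)" "apart (x t0) (y t0) (u t0) (v t0)"
  shows "finite {t. \<not> apart (x t) (y t) (u t) (v t)}"
proof -
  let ?F = "\<lambda>w t (i::nat). if i = 0 then x t else if i = 1 then y t else w t"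
  have *: "finite {t. \<not> fam_indep 3 (?F w t)}"
    if w: "\<And>z. pfun {\<lambda>t. t} (\<lambda>t. w t z)" "fam_indep 3 (?F w t0)" for w
  proof (rule cofinite_indep[where v = "?F w", OF _ w(2)])
    show "pfun {\<lambda>t. t} (\<lambda>t. ?F w t k z)" for k z using assms(1,2) w(1) by (cases "k = 0"; cases "k = 1") simp_all
  qed
  from assms(5)[unfolded apart_def] show ?thesis
  proof
    assume "fam_indep 3 (?F u t0)"
    from *[OF assms(3) this] show ?thesis by (rule finite_subset[rotated]) (auto simp: apart_def)
  next
    assume "fam_indep 3 (?F v t0)"
    from *[OF assms(4) this] show ?thesis by (rule finite_subset[rotated]) (auto simp: apart_def)
  qed
qed

text \<open>
  Interpolating all parameters linearly gives a curve whose bases have polynomial entries. At both ends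
  the parameters are good, hence they are good for all but finitely many values.
\<close>

lemma Conf_curve:
  assumes x: "x \<in> Conf" and y: "y \<in> Conf"
  shows "\<exists>b. (\<forall>t. length (b t) = length (replicate d 1 @ condition_dims a) \<and>
      (\<forall>i<length (replicate d 1 @ condition_dims a). length (b t ! i) = (replicate d 1 @ condition_dims a) ! i + 1)) \<and>
    (\<forall>i<length (replicate d 1 @ condition_dims a). \<forall>r<(replicate d 1 @ condition_dims a) ! i + 1. \<forall>z.
        pfun {\<lambda>t. t} (\<lambda>t. (b t ! i ! r) z)) \<and>
    list_all2 ordered_basis (b 0) x \<and> list_all2 ordered_basis (b 1) y \<and>
    finite {t. map (\<lambda>bs. kvec.span (set bs)) (b t) \<notin> Conf}"
proof -
  obtain e f s r g h \<alpha> \<beta> where X: "x = conf_of e f (pt e f s r g) h \<alpha> \<beta>" "conf_good e f (pt e f s r g) h \<alpha> \<beta>"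
    "\<And>k. g k \<in> coord_space n" "\<And>k. h k \<in> coord_space n" "e \<in> coord_space n" "f \<in> coord_space n" "\<And>k. ex \<Longrightarrow> g k = 0"
    using Conf_params[OF x] by auto
  obtain e' f' s' r' g' h' \<alpha>' \<beta>' where Y: "y = conf_of e' f' (pt e' f' s' r' g') h' \<alpha>' \<beta>'" "conf_good e' f' (pt e' f' s' r' g') h' \<alpha>' \<beta>'"
    "\<And>k. g' k \<in> coord_space n" "\<And>k. h' k \<in> coord_space n" "e' \<in> coord_space n" "f' \<in> coord_space n" "\<And>k. ex \<Longrightarrow> g' k = 0"
    using Conf_params[OF y] by auto
  define ev fv where "ev = vmix e e'" and "fv = vmix f f'"
  define sv rv where "sv = (\<lambda>t k. mix (s k) (s' k) t)" and "rv = (\<lambda>t k. mix (r k) (r' k) t)"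
  define gv hv where "gv = (\<lambda>t k. vmix (g k) (g' k) t)" and "hv = (\<lambda>t k. vmix (h k) (h' k) t)"
  define av bv where "av = (\<lambda>t j k. mix (\<alpha> j k) (\<alpha>' j k) t)" and "bv = (\<lambda>t j k. mix (\<beta> j k) (\<beta>' j k) t)"
  define pv where "pv = (\<lambda>t. pt (ev t) (fv t) (sv t) (rv t) (gv t))"
  define b where "b t = conf_bases (ev t) (fv t) (pv t) (hv t) (av t) (bv t)" for t
  define c where "c t = conf_of (ev t) (fv t) (pv t) (hv t) (av t) (bv t)" for t
  let ?ks = "replicate d 1 @ condition_dims a"
  have pe: "pfun {\<lambda>t. t} (\<lambda>t. ev t z)" "pfun {\<lambda>t. t} (\<lambda>t. fv t z)" for z unfolding ev_def fv_def by (rule pfun_vmix)+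
  have pg: "pfun {\<lambda>t. t} (\<lambda>t. gv t k z)" "pfun {\<lambda>t. t} (\<lambda>t. hv t k z)" for k z unfolding gv_def hv_def by (rule pfun_vmix)+
  have ps: "pfun {\<lambda>t. t} (\<lambda>t. sv t k)" "pfun {\<lambda>t. t} (\<lambda>t. rv t k)" for k unfolding sv_def rv_def by (rule pfun_mix)+
  have pa: "pfun {\<lambda>t. t} (\<lambda>t. av t j k)" "pfun {\<lambda>t. t} (\<lambda>t. bv t j k)" for j k unfolding av_def bv_def by (rule pfun_mix)+
  have pp: "pfun {\<lambda>t. t} (\<lambda>t. pv t k z)" for k z unfolding pv_def by (rule pfun_pt[OF pe ps pg(1)])
  have pc: "pfun {\<lambda>t. t} (\<lambda>t. cpt (pv t) (hv t) (av t j) (bv t j) k z)" for j k z by (rule pfun_cpt[OF pp pg(2) pa])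
  have at0: "ev 0 = e" "fv 0 = f" "sv 0 = s" "rv 0 = r" "gv 0 = g" "hv 0 = h" "av 0 = \<alpha>" "bv 0 = \<beta>"
    by (simp_all add: ev_def fv_def sv_def rv_def gv_def hv_def av_def bv_def mix_ends)
  have at1: "ev 1 = e'" "fv 1 = f'" "sv 1 = s'" "rv 1 = r'" "gv 1 = g'" "hv 1 = h'" "av 1 = \<alpha>'" "bv 1 = \<beta>'"
    by (simp_all add: ev_def fv_def sv_def rv_def gv_def hv_def av_def bv_def mix_ends)
  have p01: "pv 0 = pt e f s r g" "pv 1 = pt e' f' s' r' g'" by (simp_all add: pv_def at0 at1)
  have b0: "list_all2 ordered_basis (b 0) x" unfolding b_def at0 p01 X(1) by (rule conf_good_bases[OF X(2)])
  have b1: "list_all2 ordered_basis (b 1) y" unfolding b_def at1 p01 Y(1) by (rule conf_good_bases[OF Y(2)])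
  have lb: "length (b t) = length ?ks" for t unfolding b_def conf_bases_def dims by simp
  have rows: "(i < d \<and> b t ! i = [pv t i, hv t i]) \<or>
      (\<exists>j<m. i = d + j \<and> b t ! i = map (cpt (pv t) (hv t) (av t j) (bv t j)) [0..<d]) \<or>
      (ex \<and> i = d + m \<and> b t ! i = [ev t, fv t])" if i: "i < length ?ks" for i t
  proof -
    have "i < d + m + (if ex then 1 else 0)" using i unfolding dims by (auto split: if_splits)
    then consider "i < d" | "d \<le> i" "i - d < m" | "ex" "i = d + m" 
    by (cases "i < d"; cases "i - d < m"; cases "i = d + m") (force split: if_splits)+
    then show ?thesis
    proof cases
      case 2
      then have "i = d + (i - d)" "i - d < m" by auto
      moreover have "b t ! i = map (cpt (pv t) (hv t) (av t (i - d)) (bv t (i - d))) [0..<d]"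
        using 2 unfolding b_def conf_bases_def by (simp add: nth_append)
      ultimately show ?thesis by blast
    next
      case 1
      then show ?thesis unfolding b_def conf_bases_def by (simp add: nth_append)
    next
      case 3
      then have "b t ! i = [ev t, fv t]" unfolding b_def conf_bases_def by (simp add: nth_append)
      then show ?thesis using 3 by simp
    qed
  qed
  have ks: "?ks ! i = (if i < d then 1 else if i < d + m then d - 1 else 1)" if i: "i < length ?ks" for i
    using i unfolding dims by (auto simp: nth_append split: if_splits)
  have lr: "length (b t ! i) = ?ks ! i + 1" if i: "i < length ?ks" for i t
    using rows[OF i, of t] ks[OF i] d by auto
  have poly: "pfun {\<lambda>t. t} (\<lambda>t. (b t ! i ! q) z)" if i: "i < length ?ks" "q < ?ks ! i + 1" for i q z
  proof -
    have "i < d + m + (if ex then 1 else 0)" using i unfolding dims by (auto split: if_splits)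
    then consider "i < d" | "d \<le> i" "i - d < m" | "ex" "i = d + m" 
    by (cases "i < d"; cases "i - d < m"; cases "i = d + m") (force split: if_splits)+
    then show ?thesis
    proof cases
      case 1
      then have "(\<lambda>t. (b t ! i ! q) z) = (\<lambda>t. if q = 0 then pv t i z else hv t i z)"
        using ks[OF i(1)] i(2) unfolding b_def conf_bases_def by (auto simp: nth_append less_Suc_eq)
      then show ?thesis using pp pg(2) by (cases "q = 0") simp_all
    next
      case 2
      then have "i < d + m" by linarith
      then have "q < d" using ks[OF i(1)] i(2) d 2(1) by simp
      then have "(\<lambda>t. (b t ! i ! q) z) = (\<lambda>t. cpt (pv t) (hv t) (av t (i - d)) (bv t (i - d)) q z)"
        using 2 unfolding b_def conf_bases_def by (auto simp: nth_append)
      then show ?thesis using pc by simp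
    next
      case 3
      then have "(\<lambda>t. (b t ! i ! q) z) = (\<lambda>t. if q = 0 then ev t z else fv t z)"
        using ks[OF i(1)] i(2) unfolding b_def conf_bases_def by (auto simp: nth_append less_Suc_eq)
      then show ?thesis using pe by (cases "q = 0") simp_all
    qed
  qed
  note good0 = X(2)[unfolded conf_good_def, folded p01(1) at0(6)]
  let ?bad = "(\<Union>k<d. {t. \<not> indep2 (pv t k) (hv t k)}) \<union> (\<Union>j<m. {t. \<not> fam_indep d (cpt (pv t) (hv t) (av t j) (bv t j))}) \<union>
    (\<Union>k<d. \<Union>l\<in>{..<d} - {k}. {t. \<not> apart (pv t k) (hv t k) (pv t l) (hv t l)}) \<union> {t. ex \<and> \<not> indep2 (ev t) (fv t)}"
  have fin: "finite ?bad"
  proof (intro finite_UnI finite_UN_I)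
    show "finite {t. \<not> indep2 (pv t k) (hv t k)}" if "k \<in> {..<d}" for k
      using good0 that by (intro cofinite_indep2[of _ _ 0] pp pg(2)) auto
    show "finite {t. \<not> fam_indep d (cpt (pv t) (hv t) (av t j) (bv t j))}" if "j \<in> {..<m}" for j
      using X(2) that unfolding conf_good_def
      by (intro cofinite_indep[where ?t0.0 = 0] pc) (simp add: at0 p01)
    show "finite {t. \<not> apart (pv t k) (hv t k) (pv t l) (hv t l)}" if "k \<in> {..<d}" "l \<in> {..<d} - {k}" for k l
      using good0 that by (intro cofinite_apart[where ?t0.0 = 0] pp pg(2)) auto
    show "finite {t. ex \<and> \<not> indep2 (ev t) (fv t)}"
    proof (cases ex)
      case True
      have "finite {t. \<not> indep2 (ev t) (fv t)}"
        using X(2) True unfolding conf_good_def by (intro cofinite_indep2[of _ _ 0] pe) (simp add: at0)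
      then show ?thesis by (rule finite_subset[rotated]) auto
    qed simp
  qed simp_all
  have stay: "c t \<in> Conf" if "t \<notin> ?bad" for t
    unfolding c_def
  proof (rule conf_good_in_Conf)
    show "conf_good (ev t) (fv t) (pv t) (hv t) (av t) (bv t)" unfolding conf_good_def using that by auto
    show hc: "hv t k \<in> coord_space n" for k unfolding hv_def by (intro vmix_coord X Y)
    show ec: "ev t \<in> coord_space n" and fc: "fv t \<in> coord_space n" unfolding ev_def fv_def by (intro vmix_coord X Y)+
    have gc: "gv t k \<in> coord_space n" for k unfolding gv_def by (intro vmix_coord X Y)
    show "pv t k \<in> coord_space n" for k
      unfolding pv_def pt_def by (intro kvec.subspace_add kvec.subspace_scale subspace_coord_space ec fc gc)
    show "pv t k \<in> line (ev t) (fv t)" if "ex" for k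
      unfolding pv_def pt_def by (rule in_lineI) (simp add: gv_def X(7)[OF that] Y(7)[OF that] vmix_def)
  qed
  have "map (\<lambda>bs. kvec.span (set bs)) (b t) = c t" for t unfolding b_def c_def conf_of_span ..
  then have eq: "{t. map (\<lambda>bs. kvec.span (set bs)) (b t) \<notin> Conf} = {t. c t \<notin> Conf}" by simp
  have "finite {t. map (\<lambda>bs. kvec.span (set bs)) (b t) \<notin> Conf}"
    unfolding eq
  proof (rule finite_subset[OF _ fin], rule subsetI, rule ccontr)
    fix t assume "t \<in> {t. c t \<notin> Conf}" "t \<notin> ?bad"
    then show False using stay by blast
  qed
  with lb lr poly b0 b1 show ?thesis by blast
qed

lemma Conf_irreducible:
  assumes "Conf \<noteq> {}" shows "irreducible_in (fiber_power_space a d) Conf"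
proof -
  let ?ks = "replicate d 1 @ condition_dims a"
  let ?Q = "\<lambda>x y b. (\<forall>t. length (b t) = length ?ks \<and> (\<forall>i<length ?ks. length (b t ! i) = ?ks ! i + 1)) \<and>
    (\<forall>i<length ?ks. \<forall>r<?ks ! i + 1. \<forall>z. pfun {\<lambda>t. t} (\<lambda>t. (b t ! i ! r) z)) \<and>
    list_all2 ordered_basis (b 0) x \<and> list_all2 ordered_basis (b 1) y \<and>
    finite {t. map (\<lambda>bs. kvec.span (set bs)) (b t) \<notin> Conf}"
  define b where "b x y = (SOME b. ?Q x y b)" for x y
  have Q: "?Q x y (b x y)" if "x \<in> Conf" "y \<in> Conf" for x y
    unfolding b_def by (rule someI_ex[OF Conf_curve[OF that]])
  have len: "length (b x y t) = length ?ks" "i < length ?ks \<Longrightarrow> length (b x y t ! i) = ?ks ! i + 1"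
    and poly: "i < length ?ks \<Longrightarrow> r < ?ks ! i + 1 \<Longrightarrow> pfun {\<lambda>t. t} (\<lambda>t. (b x y t ! i ! r) z)"
    and ends: "list_all2 ordered_basis (b x y 0) x" "list_all2 ordered_basis (b x y 1) y"
    and fin: "finite {t. map (\<lambda>bs. kvec.span (set bs)) (b x y t) \<notin> Conf}"
    if "x \<in> Conf" "y \<in> Conf" for x y t i r z
    using Q[OF that] by simp_all
  show ?thesis
    by (rule irreducible_in_fiber_power[where bss = b, OF _ assms len poly ends fin]) (auto simp: Conf_def)
qed

end

section \<open>Common transversals of a line and subspaces of codimension two\<close>

definition lin_on :: "nat \<Rightarrow> ((nat \<Rightarrow> 'k::field) \<Rightarrow> 'k) \<Rightarrow> bool" where
  "lin_on n \<phi> \<longleftrightarrow> (\<forall>x\<in>coord_space n. \<forall>y\<in>coord_space n. \<forall>\<alpha> \<beta>. \<phi> (vscale \<alpha> x + vscale \<beta> y) = \<alpha> * \<phi> x + \<beta> * \<phi> y)"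

definition cut_out :: "nat \<Rightarrow> (nat \<Rightarrow> 'k::field) set \<Rightarrow> ((nat \<Rightarrow> 'k) \<Rightarrow> 'k) \<Rightarrow> ((nat \<Rightarrow> 'k) \<Rightarrow> 'k) \<Rightarrow> bool" where
  "cut_out n V \<phi> \<psi> \<longleftrightarrow> lin_on n \<phi> \<and> lin_on n \<psi> \<and> V = {v \<in> coord_space n. \<phi> v = 0 \<and> \<psi> v = 0}"

lemma cut_out_exists:
  fixes V :: "(nat \<Rightarrow> 'k::field) set"
  assumes V: "V \<in> grassmannian (n - 2) n" and n: "2 \<le> n" shows "\<exists>\<phi> \<psi>. cut_out n V \<phi> \<psi>"
proof -
  have "Suc (n - 2) = n - 1" using n by simp
  then obtain v where v: "fam_indep (n - 1) v" "kvec.span (v ` {..<n - 1}) = V" using grassmannian_basis[OF V] by metis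
  let ?B = "v ` {..<n - 1}"
  have B: "kvec.independent ?B" "card ?B = n - 1" "finite ?B" using v(1) by (auto simp: fam_indep_iff card_image)
  have BV: "?B \<subseteq> V" using kvec.span_superset[of ?B] v(2) by simp
  have Bc: "?B \<subseteq> coord_space n" using BV coord_subspace[OF V] by blast
  obtain C where C: "?B \<subseteq> C" "C \<subseteq> coord_space n" "kvec.independent C" "coord_space n \<subseteq> kvec.span C"
    using kvec.maximal_independent_subset_extend[OF Bc B(1)] by blast
  have "card C = kvec.dim (coord_space n :: (nat \<Rightarrow> 'k) set)" using kvec.basis_card_eq_dim[OF C(2,4,3)] .
  also have "\<dots> = n + 1" using coord_space_grassmannian[where 'k = 'k, of n] by (auto simp: grassmannian_def)
  finally have cC: "card C = n + 1" .
  then have fC: "finite C" using card.infinite by force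
  have "card (C - ?B) = 2" using C(1) cC B fC n by (simp add: card_Diff_subset)
  then obtain b1 b2 where b: "C - ?B = {b1, b2}" "b1 \<noteq> b2" by (auto simp: card_2_iff)
  let ?\<phi> = "\<lambda>v b. kvec.representation C v b"
  have lin: "lin_on n (\<lambda>v. ?\<phi> v b)" for b
    unfolding lin_on_def
  proof (intro ballI allI)
    fix x y :: "nat \<Rightarrow> 'k" and \<alpha> \<beta> assume "x \<in> coord_space n" "y \<in> coord_space n"
    then have xy: "x \<in> kvec.span C" "y \<in> kvec.span C" using C(4) by auto
    show "?\<phi> (vscale \<alpha> x + vscale \<beta> y) b = \<alpha> * ?\<phi> x b + \<beta> * ?\<phi> y b"
      using kvec.representation_add[OF C(3), of "vscale \<beta> y" "vscale \<alpha> x"]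
        kvec.representation_scale[OF C(3) xy(1), of \<alpha>] kvec.representation_scale[OF C(3) xy(2), of \<beta>]
        kvec.span_scale[OF xy(1), of \<alpha>] kvec.span_scale[OF xy(2), of \<beta>] by simp
  qed
  have "V = {v \<in> coord_space n. ?\<phi> v b1 = 0 \<and> ?\<phi> v b2 = 0}"
  proof (intro equalityI subsetI)
    fix x assume x: "x \<in> V"
    then have xB: "x \<in> kvec.span ?B" using v(2) by simp
    have "kvec.representation C x = kvec.representation ?B x"
      by (rule kvec.representation_extend[OF C(3) xB C(1)])
    then have "?\<phi> x b = 0" if "b \<notin> ?B" for b using kvec.representation_ne_zero[of ?B x b] that by metis
    then show "x \<in> {v \<in> coord_space n. ?\<phi> v b1 = 0 \<and> ?\<phi> v b2 = 0}"
      using b(1) coord_subspace[OF V x] by auto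
  next
    fix x assume "x \<in> {v \<in> coord_space n. ?\<phi> v b1 = 0 \<and> ?\<phi> v b2 = 0}"
    then have x: "x \<in> coord_space n" "?\<phi> x b1 = 0" "?\<phi> x b2 = 0" by auto
    have "x = (\<Sum>b\<in>C. vscale (?\<phi> x b) b)"
      using kvec.sum_representation_eq[OF C(3) _ fC, of x] x(1) C(4) by auto
    also have "\<dots> = (\<Sum>b\<in>?B. vscale (?\<phi> x b) b)"
      using b(1) x C(1) fC by (intro sum.mono_neutral_right) (auto simp: fun_eq_iff)
    also have "\<dots> \<in> V" unfolding v(2)[symmetric] by (intro kvec.span_sum kvec.span_scale kvec.span_base)
    finally show "x \<in> V" .
  qed
  then show ?thesis unfolding cut_out_def using lin by blast
qed

text \<open>
  A combination of \<open>x\<close> and \<open>y\<close> in \<open>V\<close> is a solution of a homogeneous system of two linear equations in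
  two unknowns, whose determinant is the right-hand side.
\<close>

lemma cut_out_meets:
  assumes cut: "cut_out n V \<phi> \<psi>" and xy: "x \<in> coord_space n" "y \<in> coord_space n" "indep2 x y"
  shows "meets (line x y) V \<longleftrightarrow> \<phi> x * \<psi> y - \<phi> y * \<psi> x = 0"
proof -
  have lin: "\<phi> (vscale \<alpha> x + vscale \<beta> y) = \<alpha> * \<phi> x + \<beta> * \<phi> y" "\<psi> (vscale \<alpha> x + vscale \<beta> y) = \<alpha> * \<psi> x + \<beta> * \<psi> y" for \<alpha> \<beta>
    using cut xy unfolding cut_out_def lin_on_def by auto
  have inV: "vscale \<alpha> x + vscale \<beta> y \<in> V \<longleftrightarrow> \<alpha> * \<phi> x + \<beta> * \<phi> y = 0 \<and> \<alpha> * \<psi> x + \<beta> * \<psi> y = 0" for \<alpha> \<beta>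
    using cut subspace_comb[OF subspace_coord_space xy(1,2)] lin unfolding cut_out_def by auto
  show ?thesis
  proof
    assume "meets (line x y) V"
    then obtain \<alpha> \<beta> where v: "vscale \<alpha> x + vscale \<beta> y \<noteq> 0" "vscale \<alpha> x + vscale \<beta> y \<in> V"
      unfolding meets_def in_line_iff by (elim exE conjE) simp
    then have e: "\<alpha> * \<phi> x + \<beta> * \<phi> y = 0" "\<alpha> * \<psi> x + \<beta> * \<psi> y = 0" using inV by auto
    have "\<alpha> * (\<phi> x * \<psi> y - \<phi> y * \<psi> x) = (\<alpha> * \<phi> x + \<beta> * \<phi> y) * \<psi> y - (\<alpha> * \<psi> x + \<beta> * \<psi> y) * \<phi> y"
      "\<beta> * (\<phi> x * \<psi> y - \<phi> y * \<psi> x) = (\<alpha> * \<psi> x + \<beta> * \<psi> y) * \<phi> x - (\<alpha> * \<phi> x + \<beta> * \<phi> y) * \<psi> x"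
      by (simp_all add: algebra_simps)
    moreover have "\<alpha> \<noteq> 0 \<or> \<beta> \<noteq> 0" using v(1) by (auto simp: fun_eq_iff)
    ultimately show "\<phi> x * \<psi> y - \<phi> y * \<psi> x = 0" using e by auto
  next
    assume z: "\<phi> x * \<psi> y - \<phi> y * \<psi> x = 0"
    have "\<exists>\<alpha> \<beta>. (\<alpha> \<noteq> 0 \<or> \<beta> \<noteq> 0) \<and> \<alpha> * \<phi> x + \<beta> * \<phi> y = 0 \<and> \<alpha> * \<psi> x + \<beta> * \<psi> y = 0"
    proof (cases "\<phi> x = 0 \<and> \<phi> y = 0")
      case True
      show ?thesis
      proof (cases "\<psi> x = 0 \<and> \<psi> y = 0")
        case True
        then show ?thesis using \<open>\<phi> x = 0 \<and> \<phi> y = 0\<close> by (intro exI[of _ 1] exI[of _ 0]) simp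
      next
        case False
        then show ?thesis using True by (intro exI[of _ "\<psi> y"] exI[of _ "- \<psi> x"]) (auto simp: algebra_simps)
      qed
    next
      case False
      then show ?thesis using z by (intro exI[of _ "\<phi> y"] exI[of _ "- \<phi> x"]) (auto simp: algebra_simps)
    qed
    then obtain \<alpha> \<beta> where ab: "\<alpha> \<noteq> 0 \<or> \<beta> \<noteq> 0" "vscale \<alpha> x + vscale \<beta> y \<in> V" using inV by auto
    then show "meets (line x y) V"
      using indep2D[OF xy(3), of \<alpha> \<beta>] by (intro meetsI[OF _ in_lineI[OF refl] ab(2)]) blast
  qed
qed

text \<open>
  The condition of meeting a subspace cut out by two linear forms is bilinear and alternating in two
  points spanning the line, which makes the solutions through a given point of \<open>M\<close> a linear system.
\<close>

locale codim_two =
  fixes n :: nat and \<Lambda> :: "nat \<Rightarrow> (nat \<Rightarrow> 'k::alg_closed_field) set" and M :: "(nat \<Rightarrow> 'k) set"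
  assumes n: "3 \<le> n" and \<Lambda>: "\<And>i. i < n \<Longrightarrow> \<Lambda> i \<in> grassmannian (n - 2) n" and M: "M \<in> grassmannian 1 n"
    and fin: "finite (lines_meeting n (insert M (\<Lambda> ` {..<n})))"
    and card: "card (lines_meeting n (insert M (\<Lambda> ` {..<n}))) = n - 1"
begin

abbreviation "Sol \<equiv> lines_meeting n (insert M (\<Lambda> ` {..<n}))"

definition forms where
  "forms = (SOME fs. \<forall>i<n. cut_out n (\<Lambda> i) (fst fs i) (snd fs i))"

definition \<omega> :: "nat \<Rightarrow> (nat \<Rightarrow> 'k) \<Rightarrow> (nat \<Rightarrow> 'k) \<Rightarrow> 'k" where
  "\<omega> i x y = fst forms i x * snd forms i y - fst forms i y * snd forms i x"

lemma forms: "i < n \<Longrightarrow> cut_out n (\<Lambda> i) (fst forms i) (snd forms i)"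
proof -
  have "\<exists>\<phi> \<psi>. cut_out n (\<Lambda> i) \<phi> \<psi>" if "i < n" for i using cut_out_exists[OF \<Lambda>[OF that]] n by simp
  then have "\<forall>i. \<exists>\<phi> \<psi>. i < n \<longrightarrow> cut_out n (\<Lambda> i) \<phi> \<psi>" by blast
  then obtain \<phi> \<psi> where "\<forall>i. i < n \<longrightarrow> cut_out n (\<Lambda> i) (\<phi> i) (\<psi> i)" by metis
  then have "\<exists>fs. \<forall>i<n. cut_out n (\<Lambda> i) (fst fs i) (snd fs i)" by (intro exI[of _ "(\<phi>, \<psi>)"]) simp
  then have "\<forall>i<n. cut_out n (\<Lambda> i) (fst forms i) (snd forms i)" unfolding forms_def by (rule someI_ex)
  then show "i < n \<Longrightarrow> cut_out n (\<Lambda> i) (fst forms i) (snd forms i)" by blast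
qed

lemma \<omega>_alt: "\<omega> i x y = - \<omega> i y x" "\<omega> i x x = 0" by (simp_all add: \<omega>_def)

lemma \<omega>_comb:
  assumes "i < n" "x \<in> coord_space n" "y \<in> coord_space n"
  shows "\<omega> i z (vscale \<alpha> x + vscale \<beta> y) = \<alpha> * \<omega> i z x + \<beta> * \<omega> i z y"
  using forms[OF assms(1)] assms(2,3) unfolding cut_out_def lin_on_def \<omega>_def by (simp add: algebra_simps)

lemma \<omega>_sum:
  assumes "i < n" "finite J" "\<And>k. k \<in> J \<Longrightarrow> u k \<in> coord_space n"
  shows "\<omega> i z (\<Sum>k\<in>J. vscale (c k) (u k)) = (\<Sum>k\<in>J. c k * \<omega> i z (u k))"
  using assms(2,3)
proof (induction J rule: finite_induct)
  case empty
  have "\<omega> i z (vscale 0 0 + vscale 0 0) = 0 * \<omega> i z 0 + 0 * \<omega> i z 0"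
    by (rule \<omega>_comb[OF assms(1)]) (simp_all add: coord_space_def)
  then show ?case by (simp add: fun_eq_iff[symmetric] plus_fun_def zero_fun_def)
next
  case (insert k J)
  have s: "(\<Sum>k\<in>J. vscale (c k) (u k)) \<in> coord_space n"
    using insert.prems by (intro kvec.subspace_sum subspace_coord_space kvec.subspace_scale) auto
  have "\<omega> i z (vscale (c k) (u k) + vscale 1 (\<Sum>k\<in>J. vscale (c k) (u k))) =
      c k * \<omega> i z (u k) + 1 * \<omega> i z (\<Sum>k\<in>J. vscale (c k) (u k))"
    using insert.prems s by (intro \<omega>_comb[OF assms(1)]) auto
  moreover have one: "vscale 1 v = v" for v :: "nat \<Rightarrow> 'k" by (simp add: vscale_def)
  ultimately have eq: "\<omega> i z (vscale (c k) (u k) + (\<Sum>k\<in>J. vscale (c k) (u k))) =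
      c k * \<omega> i z (u k) + \<omega> i z (\<Sum>k\<in>J. vscale (c k) (u k))" unfolding one by simp
  have IH: "\<omega> i z (\<Sum>k\<in>J. vscale (c k) (u k)) = (\<Sum>k\<in>J. c k * \<omega> i z (u k))" using insert.prems by (intro insert.IH) auto
  show ?case unfolding sum.insert[OF insert.hyps(1,2)] eq IH by (rule refl)
qed

lemma Sol_line: "l \<in> Sol \<Longrightarrow> l \<in> grassmannian 1 n"
  by (simp add: lines_meeting_def)

lemma sub: "kvec.subspace M" "i < n \<Longrightarrow> kvec.subspace (\<Lambda> i)"
  using M \<Lambda> by (auto simp: grassmannian_def)

lemma Sol_disjoint: "l \<in> Sol \<Longrightarrow> l' \<in> Sol \<Longrightarrow> v \<in> l \<Longrightarrow> v \<in> l' \<Longrightarrow> v \<noteq> 0 \<Longrightarrow> l = l'"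
proof (rule ccontr)
  assume a: "l \<in> Sol" "l' \<in> Sol" "v \<in> l" "v \<in> l'" "v \<noteq> 0" "l \<noteq> l'"
  have "v = 0"
    by (rule finite_solutions_disjoint[OF infinite_UNIV_alg_closed fin _ a(1,2,6,3,4)]) (auto simp: sub)
  with a show False by simp
qed

lemma M_coord: "x \<in> M \<Longrightarrow> x \<in> coord_space n" by (rule coord_subspace[OF M])

lemma line_Sol_iff:
  assumes "indep2 p u" "p \<in> M" "u \<in> coord_space n"
  shows "line p u \<in> Sol \<longleftrightarrow> (\<forall>i<n. \<omega> i p u = 0)"
proof -
  have m: "meets (line p u) M" using indep2_nz(1)[OF assms(1)] line_ends(1) assms(2) by (rule meetsI)
  have g: "line p u \<in> grassmannian 1 n" by (rule line_grassmannian[OF assms(1) M_coord[OF assms(2)] assms(3)])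
  have "meets (line p u) (\<Lambda> i) \<longleftrightarrow> \<omega> i p u = 0" if "i < n" for i
    unfolding \<omega>_def by (rule cut_out_meets[OF forms[OF that] M_coord[OF assms(2)] assms(3,1)])
  then show ?thesis using m g by (auto simp: lines_meeting_def)
qed

text \<open>Every solution meets \<open>M\<close>, so \<open>M\<close> itself cannot be one of several disjoint solutions.\<close>

lemma M_not_Sol: "M \<notin> Sol"
proof
  assume MS: "M \<in> Sol"
  have "\<not> Sol \<subseteq> {M}"
  proof
    assume "Sol \<subseteq> {M}"
    then have "card Sol \<le> 1" using card_mono[of "{M}" Sol] by simp
    then show False using n card by simp
  qed
  then obtain l where l: "l \<in> Sol" "l \<noteq> M" by blast
  then have "meets l M" by (simp add: lines_meeting_def)
  then obtain v where "v \<noteq> 0" "v \<in> l" "v \<in> M" unfolding meets_def by (elim exE conjE)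
  then show False using Sol_disjoint[OF l(1) MS] l(2) by simp
qed

text \<open>
  The line through \<open>f + s e\<close> and \<open>w\<close> would be a solution for almost every \<open>s\<close>. These solutions are
  distinct, since two of them agree only if they contain \<open>M\<close>, which is not a solution.
\<close>

lemma no_infinite_family:
  assumes ef: "indep2 e f" "M = line e f" and F: "finite F"
    and w: "\<And>s. s \<notin> F \<Longrightarrow> \<exists>w. w \<in> coord_space n \<and> w \<notin> M \<and> (\<forall>i<n. \<omega> i (f + vscale s e) w = 0)"
  shows False
proof -
  let ?p = "\<lambda>s. f + vscale s e"
  have pM: "?p s \<in> M" for s unfolding ef(2) by (rule in_lineI[of _ s _ 1]) (simp add: fun_eq_iff)
  have p0: "?p s \<noteq> 0" for s
  proof
    assume "?p s = 0"
    then have "vscale s e + vscale 1 f = 0" by (simp add: fun_eq_iff add.commute)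
    then show False using indep2D[OF ef(1)] by fastforce
  qed
  have "\<forall>s. \<exists>w. s \<notin> F \<longrightarrow> w \<in> coord_space n \<and> w \<notin> M \<and> (\<forall>i<n. \<omega> i (?p s) w = 0)" using w by blast
  then obtain w where w: "\<forall>s. s \<notin> F \<longrightarrow> w s \<in> coord_space n \<and> w s \<notin> M \<and> (\<forall>i<n. \<omega> i (?p s) (w s) = 0)"
    by (rule choice[THEN exE])
  have ind: "indep2 (?p s) (w s)" if "s \<notin> F" for s
  proof (rule ccontr)
    assume "\<not> indep2 (?p s) (w s)"
    then obtain c where "w s = vscale c (?p s)" using p0 by (rule not_indep2)
    then have "w s \<in> M" using kvec.subspace_scale[OF sub(1) pM] by metis
    then show False using w that by blast
  qed
  have sol: "line (?p s) (w s) \<in> Sol" if "s \<notin> F" for s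
    using line_Sol_iff[OF ind[OF that] pM] w that by blast
  have "inj_on (\<lambda>s. line (?p s) (w s)) (- F)"
  proof (rule inj_onI, rule ccontr)
    fix s t assume st: "s \<in> - F" "t \<in> - F" "line (?p s) (w s) = line (?p t) (w t)" "s \<noteq> t"
    have i: "indep2 (?p s) (?p t)" unfolding indep2_def
    proof (intro allI impI)
      fix \<alpha> \<beta> assume "vscale \<alpha> (?p s) + vscale \<beta> (?p t) = 0"
      then have "vscale (\<alpha> * s + \<beta> * t) e + vscale (\<alpha> + \<beta>) f = 0" by (simp add: fun_eq_iff algebra_simps)
      from indep2D[OF ef(1) this] have "\<alpha> * s + \<beta> * t = 0" "\<alpha> + \<beta> = 0" by auto
      then have "\<beta> = - \<alpha>" by (simp add: eq_neg_iff_add_eq_0 add.commute)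
      then have "\<alpha> * (s - t) = 0" using \<open>\<alpha> * s + \<beta> * t = 0\<close> by (simp add: algebra_simps)
      then show "\<alpha> = 0 \<and> \<beta> = 0" using st(4) \<open>\<beta> = - \<alpha>\<close> by simp
    qed
    have g: "line (?p s) (w s) \<in> grassmannian 1 n" using Sol_line sol st(1) by simp
    have "?p t \<in> line (?p s) (w s)" unfolding st(3) by (rule line_ends(1))
    then have "line (?p s) (w s) = M" by (rule line_unique[OF g M i line_ends(1) _ pM pM])
    then show False using sol[of s] st(1) M_not_Sol by simp
  qed
  moreover have "finite ((\<lambda>s. line (?p s) (w s)) ` (- F))"
    using fin by (rule finite_subset[rotated]) (use sol in auto)
  ultimately have "finite (- F)" by (rule finite_imageD[rotated])
  then show False
    using Diff_infinite_finite[OF F infinite_UNIV_alg_closed[where 'k = 'k]] by (simp add: Compl_eq_Diff_UNIV)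
qed

text \<open>
  The solutions \<open>\<langle>p\<^sub>k, u\<^sub>k\<rangle>\<close> with \<open>p\<^sub>k = f + s\<^sub>k e\<close> on \<open>M\<close> are independent modulo \<open>M\<close>: from a relation
  \<open>\<Sum> c\<^sub>k u\<^sub>k = x f + y e\<close> one obtains, for every other point \<open>p = f + s e\<close> of \<open>M\<close>, the solution spanned by
  \<open>p\<close> and \<open>\<Sum> c\<^sub>k / (s - s\<^sub>k) u\<^sub>k + x e\<close>.
\<close>

lemma indep_mod_M:
  assumes ef: "indep2 e f" "M = line e f" and J: "finite J"
    and u: "\<And>k. k \<in> J \<Longrightarrow> u k \<in> coord_space n \<and> u k \<notin> M"
    and s: "inj_on s J" and \<omega>0: "\<And>k i. k \<in> J \<Longrightarrow> i < n \<Longrightarrow> \<omega> i (f + vscale (s k) e) (u k) = 0"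
    and rel: "(\<Sum>k\<in>J. vscale (c k) (u k)) \<in> M" and k: "k \<in> J"
  shows "c k = 0"
proof (rule ccontr)
  assume "c k \<noteq> 0"
  then have "\<exists>k\<in>J. c k \<noteq> 0" using k by blast
  from minimal_relation_exists[OF J rel this] obtain J' g where J': "J' \<subseteq> J" "minimal_relation M u J' g" by blast
  have fJ: "finite J'" and gnz: "\<And>k. k \<in> J' \<Longrightarrow> g k \<noteq> 0" and gM: "(\<Sum>k\<in>J'. vscale (g k) (u k)) \<in> M" and ne: "J' \<noteq> {}"
    and small: "\<And>J'' c'. J'' \<subset> J' \<Longrightarrow> (\<Sum>i\<in>J''. vscale (c' i) (u i)) \<in> M \<Longrightarrow> \<forall>i\<in>J''. c' i = 0"
    using J'(2) unfolding minimal_relation_def by auto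
  have ec: "e \<in> coord_space n" "f \<in> coord_space n" using M_coord ef(2) line_ends(1)[of e f] line_ends(2)[of f e] by auto
  have uc: "u k \<in> coord_space n" if "k \<in> J'" for k using u J'(1) that by blast
  obtain y x where xy: "(\<Sum>k\<in>J'. vscale (g k) (u k)) = vscale y e + vscale x f"
    using gM unfolding ef(2) in_line_iff by (elim exE)
  show False
  proof (rule no_infinite_family[OF ef, of "s ` J'"])
    show "finite (s ` J')" using fJ by simp
    fix t assume t: "t \<notin> s ` J'"
    let ?v = "\<Sum>k\<in>J'. vscale (g k / (t - s k)) (u k)"
    let ?w = "?v + vscale x e"
    have ts: "t - s k \<noteq> 0" if "k \<in> J'" for k using t that by auto
    have vc: "?v \<in> coord_space n" by (intro kvec.subspace_sum subspace_coord_space kvec.subspace_scale uc)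
    have "?v \<notin> M"
    proof
      assume vM: "?v \<in> M"
      obtain r where r: "r \<in> J'" using ne by blast
      let ?d = "\<lambda>k. g k / (t - s k) - g k / (t - s r)"
      have "(\<Sum>k\<in>J' - {r}. vscale (?d k) (u k)) = (\<Sum>k\<in>J'. vscale (?d k) (u k))"
        using fJ by (intro sum.mono_neutral_left) (auto simp: fun_eq_iff)
      also have "\<dots> = ?v - vscale (1 / (t - s r)) (\<Sum>k\<in>J'. vscale (g k) (u k))"
        by (rule ext) (simp add: sum_fun_apply' sum_distrib_left sum_subtractf[symmetric] algebra_simps sum_divide_distrib)
      also have "\<dots> \<in> M" by (intro kvec.subspace_diff sub vM kvec.subspace_scale gM)
      finally have z: "\<forall>k\<in>J' - {r}. ?d k = 0" using r by (intro small) auto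
      have "J' = {r}"
      proof (rule ccontr)
        assume "J' \<noteq> {r}"
        then obtain k where k: "k \<in> J'" "k \<noteq> r" using r by blast
        then have "g k / (t - s k) = g k / (t - s r)" using z by simp
        then have "s k = s r" using gnz[OF k(1)] ts[OF k(1)] ts[OF r] by (simp add: frac_eq_eq)
        then show False using s k r J'(1) by (auto simp: inj_on_def)
      qed
      then have "vscale (g r) (u r) \<in> M" using gM by simp
      then have "vscale (1 / g r) (vscale (g r) (u r)) \<in> M" by (rule kvec.subspace_scale[OF sub(1)])
      moreover have "vscale (1 / g r) (vscale (g r) (u r)) = u r" using gnz[OF r] by (simp add: fun_eq_iff)
      ultimately show False using u r J'(1) by auto
    qed
    have eM: "e \<in> M" unfolding ef(2) by (rule line_ends(1))
    have "?w \<notin> M"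
    proof
      assume "?w \<in> M"
      then have "?w - vscale x e \<in> M" by (intro kvec.subspace_diff sub kvec.subspace_scale eM)
      then show False using \<open>?v \<notin> M\<close> by simp
    qed
    moreover have "?w \<in> coord_space n" by (intro kvec.subspace_add subspace_coord_space vc kvec.subspace_scale ec)
    moreover have "\<omega> i (f + vscale t e) ?w = 0" if i: "i < n" for i
    proof -
      let ?p = "f + vscale t e"
      have pk: "\<omega> i ?p (u k) = (t - s k) * \<omega> i e (u k)" if k: "k \<in> J'" for k
      proof -
        have "\<omega> i (u k) (vscale 1 f + vscale (s k) e) = 0"
          using \<omega>0[of k i] k J'(1) i \<omega>_alt(1)[of i "u k"] by (auto simp: vscale_def)
        then have a: "\<omega> i (u k) f + s k * \<omega> i (u k) e = 0" using \<omega>_comb[OF i ec(2,1), of "u k" 1 "s k"] by simp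
        have "\<omega> i (u k) (vscale 1 f + vscale t e) = \<omega> i (u k) f + t * \<omega> i (u k) e" using \<omega>_comb[OF i ec(2,1), of "u k" 1 t] by simp
        also have "\<dots> = (t - s k) * \<omega> i (u k) e + (\<omega> i (u k) f + s k * \<omega> i (u k) e)" by (simp add: algebra_simps)
        finally have "\<omega> i (u k) ?p = (t - s k) * \<omega> i (u k) e" using a by (simp add: vscale_def)
        then show ?thesis using \<omega>_alt(1)[of i "u k"] by simp
      qed
      have v1: "\<omega> i ?p ?v = \<omega> i e (\<Sum>k\<in>J'. vscale (g k) (u k))"
      proof -
        have "\<omega> i ?p ?v = (\<Sum>k\<in>J'. g k / (t - s k) * \<omega> i ?p (u k))" by (rule \<omega>_sum[OF i fJ uc])
        also have "\<dots> = (\<Sum>k\<in>J'. g k * \<omega> i e (u k))" using pk ts by (intro sum.cong) auto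
        also have "\<dots> = \<omega> i e (\<Sum>k\<in>J'. vscale (g k) (u k))" by (rule \<omega>_sum[OF i fJ uc, symmetric])
        finally show ?thesis .
      qed
      have v2: "\<omega> i e (\<Sum>k\<in>J'. vscale (g k) (u k)) = x * \<omega> i e f"
        unfolding xy using \<omega>_comb[OF i ec, of e y x] by (simp add: \<omega>_alt(2))
      have v3: "\<omega> i ?p e = - \<omega> i e f"
        using \<omega>_comb[OF i ec(2,1), of e 1 t] \<omega>_alt(1)[of i ?p e] by (simp add: \<omega>_alt(2) vscale_def)
      have "\<omega> i ?p ?w = \<omega> i ?p (vscale 1 ?v + vscale x e)" by (simp add: vscale_def)
      also have "\<dots> = \<omega> i ?p ?v + x * \<omega> i ?p e" using \<omega>_comb[OF i vc ec(1), of ?p 1 x] by simp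
      finally show ?thesis using v1 v2 v3 by simp
    qed
    ultimately show "\<exists>w. w \<in> coord_space n \<and> w \<notin> M \<and> (\<forall>i<n. \<omega> i (f + vscale t e) w = 0)" by blast
  qed
qed

end

context codim_two
begin

text \<open>
  Choosing \<open>e\<close> different from finitely many points of \<open>M\<close> makes them affine points \<open>f + s e\<close>.
\<close>

lemma coordinates_on_M:
  assumes F: "finite F" and p: "\<And>k. k \<in> F \<Longrightarrow> p k \<in> M \<and> p k \<noteq> 0"
  shows "\<exists>e f s r. indep2 e f \<and> M = line e f \<and> (\<forall>k\<in>F. r k \<noteq> 0 \<and> p k = vscale (r k) (f + vscale (s k) e))"
proof -
  obtain e0 f where ef0: "indep2 e0 f" "M = line e0 f" using grassmannian_lineE[OF M] by blast
  have "\<forall>k. \<exists>\<alpha> \<beta>. k \<in> F \<longrightarrow> p k = vscale \<alpha> e0 + vscale \<beta> f" using p unfolding ef0(2) in_line_iff by blast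
  then obtain \<alpha> \<beta> where ab: "\<And>k. k \<in> F \<Longrightarrow> p k = vscale (\<alpha> k) e0 + vscale (\<beta> k) f" by metis
  \<comment> \<open>the new basis vector \<open>e\<close> avoids the finitely many points\<close>
  have "finite ((\<lambda>k. \<beta> k / \<alpha> k) ` F)" using F by simp
  then obtain c where c: "c \<notin> (\<lambda>k. \<beta> k / \<alpha> k) ` F"
    using ex_new_if_finite[OF infinite_UNIV_alg_closed[where 'k = 'k]] by blast
  define e where "e = e0 + vscale c f"
  define r where "r k = \<beta> k - c * \<alpha> k" for k
  define s where "s k = \<alpha> k / r k" for k
  have r0: "r k \<noteq> 0" if k: "k \<in> F" for k
  proof
    assume z: "r k = 0"
    show False
    proof (cases "\<alpha> k = 0")
      case True
      then have "\<beta> k = 0" using z by (simp add: r_def)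
      then have "p k = 0" using ab[OF k] True by (simp add: fun_eq_iff)
      then show False using p[OF k] by simp
    next
      case False
      then have "c = \<beta> k / \<alpha> k" using z by (simp add: r_def field_simps)
      then show False using c k by blast
    qed
  qed
  have pk: "p k = vscale (r k) (f + vscale (s k) e)" if k: "k \<in> F" for k
  proof
    fix i
    have "r k * s k = \<alpha> k" using r0[OF k] by (simp add: s_def)
    then have "vscale (r k) (f + vscale (s k) e) i = r k * f i + \<alpha> k * (e0 i + c * f i)"
      by (simp add: e_def algebra_simps)
    also have "\<dots> = p k i" using ab[OF k] by (simp add: r_def algebra_simps)
    finally show "p k i = vscale (r k) (f + vscale (s k) e) i" by simp
  qed
  have ind: "indep2 e f" unfolding indep2_def
  proof (intro allI impI)
    fix x y assume "vscale x e + vscale y f = 0"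
    then have "vscale x e0 + vscale (x * c + y) f = 0" by (simp add: e_def fun_eq_iff algebra_simps)
    from indep2D[OF ef0(1) this] show "x = 0 \<and> y = 0" by auto
  qed
  have "e \<in> M" "f \<in> M" unfolding ef0(2) by (rule in_lineI[of _ 1 _ c], simp add: e_def fun_eq_iff, rule line_ends(2))
  then have "M = line e f" by (rule line_eqI[OF M ind])
  with ind pk r0 show ?thesis by blast
qed

text \<open>
  Write the points as \<open>q\<^sub>k = \<alpha>\<^sub>k p\<^sub>k + \<beta>\<^sub>k u\<^sub>k\<close> with \<open>p\<^sub>k\<close> on \<open>M\<close>. In a relation the terms with
  \<open>\<beta>\<^sub>k \<noteq> 0\<close> cannot occur, as the \<open>u\<^sub>k\<close> are independent modulo \<open>M\<close>; the others are points of \<open>M\<close> in \<open>\<Lambda> i\<close>,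
  so that at most one of them occurs unless \<open>M \<subseteq> \<Lambda> i\<close>. In that exceptional case the \<open>i\<close>-th of the \<open>n\<close>
  equations on the \<open>n\<close>-dimensional span of \<open>e\<close> and the \<open>u\<^sub>k\<close> is void, for every point of \<open>M\<close>, and a
  nontrivial solution through every point of \<open>M\<close> contradicts finiteness.
\<close>

lemma solution_points_indep:
  assumes ws: "length ws = n - 1" "distinct ws" "set ws = Sol" and i: "i < n"
  shows "\<exists>q. fam_indep (n - 1) q \<and> (\<forall>k<n - 1. q k \<in> ws ! k \<and> q k \<in> \<Lambda> i)"
proof -
  let ?d = "n - 1"
  have wS: "ws ! k \<in> Sol" if "k < ?d" for k using ws that nth_mem by metis
  have wne: "ws ! k \<noteq> ws ! l" if "k < ?d" "l < ?d" "k \<noteq> l" for k l using ws that by (simp add: nth_eq_iff_index_eq)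
  have "\<exists>v. v \<noteq> 0 \<and> v \<in> ws ! k \<and> v \<in> M" if "k < ?d" for k
    using wS[OF that] by (simp add: lines_meeting_def meets_def)
  then have "\<forall>k. \<exists>v. k < ?d \<longrightarrow> v \<noteq> 0 \<and> v \<in> ws ! k \<and> v \<in> M" by blast
  then obtain p where p: "\<And>k. k < ?d \<Longrightarrow> p k \<noteq> 0 \<and> p k \<in> ws ! k \<and> p k \<in> M" by metis
  have "\<exists>u. indep2 (p k) u \<and> ws ! k = line (p k) u" if "k < ?d" for k
    using line_through[OF Sol_line[OF wS[OF that]], of "p k"] p[OF that] by metis
  then have "\<forall>k. \<exists>u. k < ?d \<longrightarrow> indep2 (p k) u \<and> ws ! k = line (p k) u" by blast
  then obtain u where u: "\<And>k. k < ?d \<Longrightarrow> indep2 (p k) (u k) \<and> ws ! k = line (p k) (u k)" by metis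
  have uc: "u k \<in> coord_space n" if "k < ?d" for k
    using coord_subspace[OF Sol_line[OF wS[OF that]]] u[OF that] line_ends(2)[of "u k" "p k"] by simp
  have uM: "u k \<notin> M" if k: "k < ?d" for k
  proof
    assume "u k \<in> M"
    then have "M = ws ! k" using line_eqI[OF M, of "p k" "u k"] u[OF k] p[OF k] by simp
    then show False using M_not_Sol wS[OF k] by simp
  qed
  have par: "k = l" if "k < ?d" "l < ?d" "x \<noteq> 0" "x \<in> ws ! k" "x \<in> ws ! l" for k l x
    using Sol_disjoint[OF wS[OF that(1)] wS[OF that(2)] that(4,5,3)] wne[OF that(1,2)] by blast
  have "\<exists>e f s r. indep2 e f \<and> M = line e f \<and> (\<forall>k\<in>{..<?d}. r k \<noteq> 0 \<and> p k = vscale (r k) (f + vscale (s k) e))"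
    by (rule coordinates_on_M) (use p in auto)
  then obtain e f s r where ef: "indep2 e f" "M = line e f"
    and pr0: "\<forall>k\<in>{..<?d}. r k \<noteq> 0 \<and> p k = vscale (r k) (f + vscale (s k) e)"
    by (elim exE conjE)
  have pr: "r k \<noteq> 0 \<and> p k = vscale (r k) (f + vscale (s k) e)" if "k \<in> {..<?d}" for k
    using pr0 that by (rule bspec)
  let ?P = "\<lambda>t. f + vscale t e"
  have Pw: "?P (s k) \<in> ws ! k" if "k < ?d" for k
  proof -
    have "vscale (1 / r k) (p k) = ?P (s k)" using pr[of k] that by (simp add: fun_eq_iff)
    moreover have "vscale (1 / r k) (p k) \<in> ws ! k"
      using p[OF that] by (intro kvec.subspace_scale subspace_grassmannian[OF Sol_line[OF wS[OF that]]]) simp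
    ultimately show ?thesis by simp
  qed
  have P0: "?P t \<noteq> 0" for t
  proof
    assume "?P t = 0"
    then have "vscale t e + vscale 1 f = 0" by (simp add: fun_eq_iff add.commute)
    then show False using indep2D[OF ef(1)] by fastforce
  qed
  have PM: "?P t \<in> M" for t unfolding ef(2) by (rule in_lineI[of _ t _ 1]) (simp add: fun_eq_iff)
  have sinj: "inj_on s {..<?d}"
  proof (rule inj_onI)
    fix k l assume kl: "k \<in> {..<?d}" "l \<in> {..<?d}" "s k = s l"
    then have "?P (s k) \<in> ws ! l" using Pw[of l] by simp
    with kl Pw[of k] P0 show "k = l" by (intro par[of k l "?P (s k)"]) auto
  qed
  have \<omega>0: "\<omega> i (?P (s k)) (u k) = 0" if k: "k < ?d" and i: "i < n" for k i
  proof -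
    have "line (p k) (u k) \<in> Sol" using wS[OF k] u[OF k] by simp
    then have "\<omega> i (p k) (u k) = 0" using line_Sol_iff[of "p k" "u k"] u[OF k] p[OF k] uc[OF k] i by simp
    then have "\<omega> i (u k) (vscale (r k) (?P (s k)) + vscale 0 (?P (s k))) = 0"
      using \<omega>_alt(1)[of i "u k" "p k"] pr[of k] k by (simp add: vscale_def plus_fun_def)
    then have "r k * \<omega> i (u k) (?P (s k)) = 0"
      using \<omega>_comb[OF i M_coord[OF PM] M_coord[OF PM], of "u k" "r k" "s k" 0 "s k"] by simp
    then have "\<omega> i (u k) (?P (s k)) = 0" using pr[of k] k by simp
    then show ?thesis using \<omega>_alt(1)[of i "?P (s k)" "u k"] by simp
  qed
  have indM: "c k = 0" if "(\<Sum>k<?d. vscale (c k) (u k)) \<in> M" "k < ?d" for c k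
    by (rule indep_mod_M[OF ef finite_lessThan[of ?d] _ sinj _ that(1)]) (use uc uM \<omega>0 that in auto)
  have MnL: "\<not> M \<subseteq> \<Lambda> i"
  proof
    assume Mi: "M \<subseteq> \<Lambda> i"
    show False
    proof (rule no_infinite_family[OF ef finite.emptyI])
      fix t :: 'k
      \<comment> \<open>the \<open>i\<close>-th of the \<open>n\<close> equations on the \<open>n\<close> coefficients of \<open>w\<close> is trivial\<close>
      define b where "b j = (if j = 0 then e else u (j - 1))" for j
      have ec: "e \<in> coord_space n" using M_coord ef(2) line_ends(1)[of e f] by simp
      have bc: "b j \<in> coord_space n" if "j < n" for j using uc[of "j - 1"] ec that by (auto simp: b_def)
      have cut: "cut_out n (\<Lambda> i) (fst forms i) (snd forms i)" by (rule forms[OF i])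
      have triv: "\<omega> i (?P t) x = 0" for x using PM[of t] Mi cut unfolding \<omega>_def cut_out_def by auto
      then have "det (mat n n (\<lambda>(j, k). \<omega> j (?P t) (b k))) = 0"
      proof -
        have "det (mat n n (\<lambda>(k, j). \<omega> j (?P t) (b k))) = 0"
          unfolding det_zero_iff_kernel using i triv
          by (intro exI[of _ "\<lambda>j. if j = i then 1 else 0"]) (auto simp: if_distrib cong: if_cong)
        moreover have "transpose_mat (mat n n (\<lambda>(k, j). \<omega> j (?P t) (b k))) = mat n n (\<lambda>(j, k). \<omega> j (?P t) (b k))"
          by (intro eq_matI) auto
        ultimately show ?thesis using det_transpose[of "mat n n (\<lambda>(k, j). \<omega> j (?P t) (b k))" n] by simp
      qed
      then obtain c where c: "\<exists>j<n. c j \<noteq> 0" "\<And>j. j < n \<Longrightarrow> (\<Sum>k<n. \<omega> j (?P t) (b k) * c k) = 0"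
        unfolding det_zero_iff_kernel by auto
      let ?w = "\<Sum>k<n. vscale (c k) (b k)"
      have wc: "?w \<in> coord_space n" using bc by (intro kvec.subspace_sum subspace_coord_space kvec.subspace_scale) simp
      have \<omega>w: "\<omega> j (?P t) ?w = 0" if "j < n" for j
        using \<omega>_sum[OF that finite_lessThan[of n], of b "?P t" c] bc c(2)[OF that] by (simp add: mult.commute)
      have split: "?w = vscale (c 0) e + (\<Sum>k<?d. vscale (c (Suc k)) (u k))"
      proof -
        obtain d where d: "n = Suc d" using n by (cases n) auto
        show ?thesis unfolding d by (simp add: sum.lessThan_Suc_shift b_def del: sum.lessThan_Suc)
      qed
      have eM: "e \<in> M" unfolding ef(2) by (rule line_ends(1))
      have "?w \<notin> M"
      proof
        assume "?w \<in> M"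
        then have "?w - vscale (c 0) e \<in> M" by (intro kvec.subspace_diff kvec.subspace_scale sub eM)
        then have "(\<Sum>k<?d. vscale (c (Suc k)) (u k)) \<in> M" unfolding split by simp
        then have cS: "c (Suc k) = 0" if "k < ?d" for k using indM[of "\<lambda>k. c (Suc k)"] that by simp
        have c0: "c 0 \<noteq> 0"
        proof
          assume "c 0 = 0"
          moreover obtain j where j: "j < n" "c j \<noteq> 0" using c(1) by blast
          ultimately obtain k where "j = Suc k" by (cases j) auto
          with j cS[of k] show False by simp
        qed
        have "(\<Sum>k<?d. vscale (c (Suc k)) (u k)) = 0" using cS by (intro sum.neutral) (simp add: fun_eq_iff)
        then have w: "?w = vscale (c 0) e" using split by simp
        have \<omega>e: "\<omega> j (?P t) e = 0" if j: "j < n" for j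
        proof -
          have "\<omega> j (?P t) (vscale (c 0) e + vscale 0 e) = 0" using \<omega>w[OF j] unfolding w by (simp add: vscale_def plus_fun_def)
          then show ?thesis using \<omega>_comb[OF j ec ec, of "?P t" "c 0" 0] c0 by simp
        qed
        have ind: "indep2 (?P t) e" unfolding indep2_def
        proof (intro allI impI)
          fix x y assume "vscale x (?P t) + vscale y e = 0"
          then have "vscale (x * t + y) e + vscale x f = 0" by (simp add: fun_eq_iff algebra_simps)
          from indep2D[OF ef(1) this] show "x = 0 \<and> y = 0" by auto
        qed
        have "line (?P t) e \<in> Sol" using line_Sol_iff[OF ind PM ec] \<omega>e by blast
        moreover have "M = line (?P t) e" by (rule line_eqI[OF M ind PM eM])
        ultimately show False using M_not_Sol by simp
      qed
      then show "\<exists>w. w \<in> coord_space n \<and> w \<notin> M \<and> (\<forall>i<n. \<omega> i (?P t) w = 0)" using wc \<omega>w by blast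
    qed
  qed
  have "\<exists>v. v \<noteq> 0 \<and> v \<in> ws ! k \<and> v \<in> \<Lambda> i" if "k < ?d" for k
    using wS[OF that] i by (simp add: lines_meeting_def meets_def)
  then have "\<forall>k. \<exists>v. k < ?d \<longrightarrow> v \<noteq> 0 \<and> v \<in> ws ! k \<and> v \<in> \<Lambda> i" by blast
  then obtain q where q: "\<And>k. k < ?d \<Longrightarrow> q k \<noteq> 0 \<and> q k \<in> ws ! k \<and> q k \<in> \<Lambda> i" by metis
  have "\<forall>k. \<exists>\<alpha> \<beta>. k < ?d \<longrightarrow> q k = vscale \<alpha> (p k) + vscale \<beta> (u k)"
    using q u in_line_iff by metis
  then obtain \<alpha> \<beta> where ab: "\<And>k. k < ?d \<Longrightarrow> q k = vscale (\<alpha> k) (p k) + vscale (\<beta> k) (u k)" by metis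
  have "fam_indep ?d q" unfolding fam_indep_def
  proof (intro allI impI, rule ccontr)
    fix c l assume c: "lcomb ?d c q = 0" and l: "l < ?d" "c l \<noteq> 0"
    have sum0: "(\<Sum>k<?d. vscale (c k * \<alpha> k) (p k)) + (\<Sum>k<?d. vscale (c k * \<beta> k) (u k)) = 0"
    proof -
      have "lcomb ?d c q = (\<Sum>k<?d. vscale (c k * \<alpha> k) (p k) + vscale (c k * \<beta> k) (u k))"
        unfolding lcomb_eq_sum using ab by (intro sum.cong) (auto simp: fun_eq_iff algebra_simps)
      then show ?thesis using c by (simp only: sum.distrib)
    qed
    have pM: "(\<Sum>k<?d. vscale (c k * \<alpha> k) (p k)) \<in> M" using p by (intro kvec.subspace_sum sub kvec.subspace_scale) simp
    have "(\<Sum>k<?d. vscale (c k * \<beta> k) (u k)) = - (\<Sum>k<?d. vscale (c k * \<alpha> k) (p k))"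
      using sum0 by (simp only: eq_neg_iff_add_eq_0 add.commute)
    then have "(\<Sum>k<?d. vscale (c k * \<beta> k) (u k)) \<in> M" using kvec.subspace_neg[OF sub(1) pM] by simp
    then have cb: "c k * \<beta> k = 0" if "k < ?d" for k using indM[of "\<lambda>k. c k * \<beta> k"] that by simp
    have onp: "q k = vscale (\<alpha> k) (p k)" "\<alpha> k \<noteq> 0" "p k \<in> \<Lambda> i" if k: "k < ?d" "c k \<noteq> 0" for k
    proof -
      have b0: "\<beta> k = 0" using cb[OF k(1)] k(2) by simp
      then show qk: "q k = vscale (\<alpha> k) (p k)" using ab[OF k(1)] by (simp add: fun_eq_iff)
      then show a0: "\<alpha> k \<noteq> 0" using q[OF k(1)] by (auto simp: fun_eq_iff)
      have "vscale (1 / \<alpha> k) (q k) \<in> \<Lambda> i" using q[OF k(1)] by (intro kvec.subspace_scale sub i) simp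
      moreover have "vscale (1 / \<alpha> k) (q k) = p k" unfolding qk using a0 by (simp add: fun_eq_iff)
      ultimately show "p k \<in> \<Lambda> i" by simp
    qed
    have only: "c k = 0" if k: "k < ?d" "k \<noteq> l" for k
    proof (rule ccontr)
      assume ck: "c k \<noteq> 0"
      have i2: "indep2 (p l) (p k)"
      proof (rule ccontr)
        assume "\<not> indep2 (p l) (p k)"
        then obtain x where x: "p k = vscale x (p l)" by (rule not_indep2) (use p[OF l(1)] in simp)
        have "p k \<in> ws ! l" unfolding x
          using p[OF l(1)] by (intro kvec.subspace_scale subspace_grassmannian[OF Sol_line[OF wS[OF l(1)]]]) simp
        then show False using par[OF k(1) l(1), of "p k"] p[OF k(1)] k(2) by simp
      qed
      have "M = line (p l) (p k)" using line_eqI[OF M i2] p[OF l(1)] p[OF k(1)] by simp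
      also have "\<dots> \<subseteq> \<Lambda> i" by (rule line_subset[OF sub(2)[OF i] onp(3)[OF l] onp(3)[OF k(1) ck]])
      finally show False using MnL by simp
    qed
    have "lcomb ?d c q = (\<Sum>k<?d. if k = l then vscale (c l) (q l) else 0)"
      unfolding lcomb_eq_sum using only by (intro sum.cong) (auto simp: fun_eq_iff)
    also have "\<dots> = vscale (c l) (q l)" using l(1) by simp
    finally have "vscale (c l) (q l) = 0" using c by simp
    then show False using l(2) q[OF l(1)] unfolding kvec.scale_eq_0_iff by simp
  qed
  with q show ?thesis by blast
qed

end

section \<open>Counting solutions by eigenvalues of a pencil\<close>

lemma solutions_lines_meeting:
  assumes "Ls \<in> schubert_X a" shows "solutions a Ls = lines_meeting (ambient_dim a) (set Ls)"
  using assms by (auto simp: solutions_def schubert_W_def lines_meeting_def)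

lemma enumeration_in_fiber_power:
  assumes "enumerates_fiber a d Ls ws" shows "ws @ Ls \<in> fiber_power a d"
  using assms unfolding enumerates_fiber_def fiber_power_def solutions_def by auto

text \<open>
  A vector is determined by its entries in the pivot columns, which are its coefficients in the
  normalized basis.
\<close>

lemma chart_mem:
  assumes V: "V \<in> grassmannian k n" and b: "ordered_basis bs V" "length bs = k + 1"
    and norm: "\<And>r c. r \<le> k \<Longrightarrow> c \<le> k \<Longrightarrow> (bs ! r) (I ! c) = (if r = c then 1 else 0 :: 'k::field)"
  shows "v \<in> V \<longleftrightarrow> v \<in> coord_space n \<and> (\<forall>x\<le>n. v x = (\<Sum>r<k + 1. v (I ! r) * (bs ! r) x))"
proof
  assume v: "v \<in> V"
  have "V = kvec.span ((\<lambda>r. bs ! r) ` {..<k + 1})" using b by (simp add: ordered_basis_iff)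
  then obtain c where c: "v = lcomb (k + 1) c (\<lambda>r. bs ! r)" using v unfolding span_family by auto
  have "v (I ! r) = c r" if r: "r < k + 1" for r
  proof -
    have "v (I ! r) = (\<Sum>j<k + 1. if j = r then c j else 0)"
      unfolding c lcomb_def using norm r by (intro sum.cong) auto
    then show ?thesis using r by simp
  qed
  then have "v x = (\<Sum>r<k + 1. v (I ! r) * (bs ! r) x)" for x
    by (subst c) (simp add: lcomb_def)
  then show "v \<in> coord_space n \<and> (\<forall>x\<le>n. v x = (\<Sum>r<k + 1. v (I ! r) * (bs ! r) x))"
    using coord_subspace[OF V v] by blast
next
  assume v: "v \<in> coord_space n \<and> (\<forall>x\<le>n. v x = (\<Sum>r<k + 1. v (I ! r) * (bs ! r) x))"
  have bV: "bs ! r \<in> V" if "r < k + 1" for r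
    using b that kvec.span_base[of "bs ! r" "(\<lambda>r. bs ! r) ` {..<k + 1}"] by (simp add: ordered_basis_iff)
  have "v = lcomb (k + 1) (\<lambda>r. v (I ! r)) (\<lambda>r. bs ! r)"
  proof
    fix x
    show "v x = lcomb (k + 1) (\<lambda>r. v (I ! r)) (\<lambda>r. bs ! r) x"
    proof (cases "x \<le> n")
      case True
      then show ?thesis using v by (simp add: lcomb_def)
    next
      case False
      then have "(bs ! r) x = 0" if "r < k + 1" for r
        using coord_subspace[OF V bV[OF that]] by (simp add: coord_space_def)
      then show ?thesis using v False by (simp add: lcomb_def coord_space_def)
    qed
  qed
  also have "\<dots> \<in> V" using bV by (intro lcomb_in_subspace subspace_grassmannian[OF V])
  finally show "v \<in> V" .
qed

definition eigenpair :: "nat \<Rightarrow> (nat \<Rightarrow> nat \<Rightarrow> 'k::field) \<Rightarrow> (nat \<Rightarrow> nat \<Rightarrow> 'k) \<Rightarrow> 'k \<Rightarrow> (nat \<Rightarrow> 'k) \<Rightarrow> bool" where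
  "eigenpair d Q R c w \<longleftrightarrow> (\<exists>i<d. w i \<noteq> 0) \<and> (\<forall>i<d. (\<Sum>j<d. Q i j * w j) = c * (\<Sum>j<d. R i j * w j))"

text \<open>
  Stated for an arbitrary parametrization \<open>f\<close> of \<open>S\<close> by eigenpairs, so that it covers both families of
  problems; distinct solutions belong to distinct eigenvalues.
\<close>

lemma eigenline_count:
  fixes f :: "'k::field \<Rightarrow> (nat \<Rightarrow> 'k) \<Rightarrow> 'b"
  assumes P: "\<exists>s v. simple_pencil d Q R s v"
    and S: "S = {f c w | c w. eigenpair d Q R c w}"
    and scale: "\<And>c w w' t. t \<noteq> 0 \<Longrightarrow> (\<And>i. i < d \<Longrightarrow> w i = t * w' i) \<Longrightarrow> eigenpair d Q R c w \<Longrightarrow> f c w = f c w'"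
    and inj: "\<And>c w c' w'. eigenpair d Q R c w \<Longrightarrow> eigenpair d Q R c' w' \<Longrightarrow> f c w = f c' w' \<Longrightarrow> c = c'"
  shows "finite S \<and> card S = d"
proof -
  obtain s v where P: "simple_pencil d Q R s v" using P by blast
  have eig: "eigenpair d Q R (s k) (v k)" if "k < d" for k
    using P that unfolding simple_pencil_def eigenpair_def by blast
  have "S = (\<lambda>k. f (s k) (v k)) ` {..<d}"
  proof (intro equalityI subsetI)
    fix x assume "x \<in> S"
    then obtain c w where x: "x = f c w" and cw: "eigenpair d Q R c w" unfolding S by auto
    then have "\<exists>k<d. c = s k \<and> (\<exists>t. t \<noteq> 0 \<and> (\<forall>i<d. w i = t * v k i))"
      unfolding eigenpair_def by (intro simple_pencil_unique[OF P]) blast+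
    then obtain k t where k: "k < d" "c = s k" "t \<noteq> 0" "\<And>i. i < d \<Longrightarrow> w i = t * v k i" by auto
    have "f c w = f c (v k)" by (rule scale[OF k(3,4) cw])
    then show "x \<in> (\<lambda>k. f (s k) (v k)) ` {..<d}" using x k by auto
  next
    fix x assume "x \<in> (\<lambda>k. f (s k) (v k)) ` {..<d}"
    then show "x \<in> S" unfolding S using eig by auto
  qed
  moreover have "inj_on (\<lambda>k. f (s k) (v k)) {..<d}"
  proof (rule inj_onI)
    fix k l assume kl: "k \<in> {..<d}" "l \<in> {..<d}" "f (s k) (v k) = f (s l) (v l)"
    then have "s k = s l" using inj[OF eig eig] by simp
    then show "k = l" using P kl unfolding simple_pencil_def inj_on_def by blast
  qed
  ultimately show ?thesis by (simp add: card_image)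
qed

lemma proportional_cancel:
  fixes a b x y e f :: "'k::field"
  assumes "b * x = a * y"
  shows "x * (a * e + b * f) + - a * (x * e + y * f) = 0" "y * (a * e + b * f) + - b * (x * e + y * f) = 0"
proof -
  have "x * (a * e + b * f) + - a * (x * e + y * f) = (b * x - a * y) * f"
    "y * (a * e + b * f) + - b * (x * e + y * f) = - (b * x - a * y) * e" by (simp_all add: algebra_simps)
  then show "x * (a * e + b * f) + - a * (x * e + y * f) = 0" "y * (a * e + b * f) + - b * (x * e + y * f) = 0"
    using assms by simp_all
qed

lemma simple_pencil_injective:
  "\<exists>s v. simple_pencil d Q R s v \<Longrightarrow> (\<And>i. i < d \<Longrightarrow> (\<Sum>j<d. R i j * w j) = 0) \<Longrightarrow> \<forall>i<d. w i = 0"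
  unfolding simple_pencil_def by blast

text \<open>
  Functions of the bases are used as coordinates on the chart in which the condition line projects onto
  the first two coordinates and the other subspaces onto the last \<open>n - 1\<close>.
\<close>

locale first_problem =
  fixes n :: nat and K :: "'k::alg_closed_field itself"
  assumes n: "3 \<le> n"
begin

definition Is :: "nat \<Rightarrow> nat list" where
  "Is i = (if i < n then [2..<n + 1] else [0, 1])"

definition ks :: "nat list" where
  "ks = replicate n (n - 2) @ [1]"

text \<open>
  For \<open>c < 2\<close> these are the two linear forms that cut out the \<open>i\<close>-th subspace with normalized basis \<open>bss ! i\<close>.
\<close>

definition \<phi> :: "(nat \<Rightarrow> 'k) list list \<Rightarrow> nat \<Rightarrow> nat \<Rightarrow> (nat \<Rightarrow> 'k) \<Rightarrow> 'k" where
  "\<phi> bss i c v = v c - (\<Sum>r<n - 1. v (r + 2) * (bss ! i ! r) c)"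

definition om where
  "om bss i x y = \<phi> bss i 0 x * \<phi> bss i 1 y - \<phi> bss i 0 y * \<phi> bss i 1 x"

definition E where "E bss = bss ! n ! 0"
definition F where "F bss = bss ! n ! 1"
definition kap where "kap bss i = om bss i (F bss) (E bss)"

text \<open>
  The solution through the point \<open>f + s e\<close> of the condition line is spanned by \<open>v + c e\<close> with \<open>v\<close> in
  the span of the last \<open>n - 1\<close> coordinate vectors. The last of the \<open>n\<close> equations determines \<open>c\<close>;
  eliminating it from the others gives the pencil \<open>Q v = s R v\<close>.
\<close>

definition Q where
  "Q bss i k = kap bss (n - 1) * om bss i (F bss) (unitv (k + 2)) - kap bss i * om bss (n - 1) (F bss) (unitv (k + 2))"
definition R where
  "R bss i k = kap bss i * om bss (n - 1) (E bss) (unitv (k + 2)) - kap bss (n - 1) * om bss i (E bss) (unitv (k + 2))"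

definition P where
  "P bss = kap bss (n - 1) * (det (mat (n - 1) (n - 1) (\<lambda>(i, j). - R bss i j)) * disc (n - 1) (pencil_poly (n - 1) (Q bss) (R bss)))"

lemma Is_ok: "i < length ks \<Longrightarrow> length (Is i) = ks ! i + 1 \<and> sorted_wrt (<) (Is i) \<and> set (Is i) \<subseteq> {..n}"
  using n by (auto simp: Is_def ks_def nth_append simp del: upt_Suc)

lemma pfun_entry: "i < n \<Longrightarrow> r < n - 1 \<Longrightarrow> x \<le> n \<Longrightarrow> pfun (entries n ks) (\<lambda>bss. (bss ! i ! r) x)"
  "r < 2 \<Longrightarrow> x \<le> n \<Longrightarrow> pfun (entries n ks) (\<lambda>bss. (bss ! n ! r) x)"
proof -
  assume a: "i < n" "r < n - 1" "x \<le> n"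
  then have "i < length ks" "r \<le> ks ! i" by (auto simp: ks_def nth_append)
  then show "pfun (entries n ks) (\<lambda>bss. (bss ! i ! r) x)"
    using a(3) by (intro pfun.gen) (auto simp: entries_def)
next
  assume a: "r < 2" "x \<le> n"
  then have "n < length ks" "r \<le> ks ! n" by (auto simp: ks_def nth_append)
  then show "pfun (entries n ks) (\<lambda>bss. (bss ! n ! r) x)"
    using a(2) by (intro pfun.gen) (auto simp: entries_def)
qed

lemma pfun_om:
  assumes "\<And>z. z \<le> n \<Longrightarrow> pfun (entries n ks) (\<lambda>bss. x bss z)" "\<And>z. z \<le> n \<Longrightarrow> pfun (entries n ks) (\<lambda>bss. y bss z)" "i < n"
  shows "pfun (entries n ks) (\<lambda>bss. om bss i (x bss) (y bss))"
proof -
  have "pfun (entries n ks) (\<lambda>bss. \<phi> bss i c (u bss))"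
    if "\<And>z. z \<le> n \<Longrightarrow> pfun (entries n ks) (\<lambda>bss. u bss z)" "c < 2" for u c
    unfolding \<phi>_def using assms(3) that(2) n by (intro pfun_diff pfun_sum pfun.mult that(1) pfun_entry) auto
  then show ?thesis unfolding om_def using assms by (intro pfun_diff pfun.mult) auto
qed

lemma pfun_P: "pfun (entries n ks) P"
proof -
  have e: "pfun (entries n ks) (\<lambda>bss. E bss z)" "pfun (entries n ks) (\<lambda>bss. F bss z)" if "z \<le> n" for z
    unfolding E_def F_def using that by (auto intro: pfun_entry(2))
  have kap: "pfun (entries n ks) (\<lambda>bss. kap bss i)" if "i < n" for i
    unfolding kap_def by (intro pfun_om e that)
  have om: "pfun (entries n ks) (\<lambda>bss. om bss i (F bss) (unitv k))" "pfun (entries n ks) (\<lambda>bss. om bss i (E bss) (unitv k))"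
    if "i < n" for i k by (rule pfun_om; (rule e that pfun.const; assumption?))+
  have "pfun (entries n ks) (\<lambda>bss. Q bss i k)" "pfun (entries n ks) (\<lambda>bss. R bss i k)" if "i < n - 1" for i k
    unfolding Q_def R_def using that n by (intro pfun_diff pfun.mult kap om; simp)+
  then show ?thesis unfolding P_def using n
    by (intro pfun.mult kap pfun_pencil) auto
qed

lemma \<phi>_comb: "\<phi> bss i c (vscale \<alpha> y + vscale \<beta> z) = \<alpha> * \<phi> bss i c y + \<beta> * \<phi> bss i c z"
  unfolding \<phi>_def by (simp add: algebra_simps sum.distrib sum_distrib_left)

lemma \<phi>_lcomb: "\<phi> bss i c (lcomb m v u) = (\<Sum>k<m. v k * \<phi> bss i c (u k))"
proof (induction m)
  case 0
  have "lcomb 0 v u = 0" by (simp add: lcomb_def fun_eq_iff)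
  then show ?case by (simp add: \<phi>_def)
next
  case (Suc m)
  have s: "lcomb (Suc m) v u = vscale 1 (lcomb m v u) + vscale (v m) (u m)" by (simp add: lcomb_def fun_eq_iff)
  show ?case unfolding s \<phi>_comb Suc by simp
qed

text \<open>
  A solution is spanned by a point of the condition line and a further vector, and the conditions
  \<open>om i = 0\<close> on the two are linear in each of them. After normalization, a nonzero multiple of the
  point is \<open>f + t e\<close>, which fails only if \<open>R\<close> has a kernel, and the second vector \<open>w y + c e\<close> is
  determined up to scaling by the eigenvector \<open>y\<close>.
\<close>

lemma count_first:
  fixes bss :: "(nat \<Rightarrow> 'k) list list"
  assumes V: "Vs \<in> multi_grassmannian n ks" and b: "list_all2 ordered_basis bss Vs"
    and nm: "normalized ks Is bss" and P: "P bss \<noteq> 0"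
  shows "finite (lines_meeting n (set Vs)) \<and> card (lines_meeting n (set Vs)) = n - 1"
proof -
  let ?d = "n - 1" and ?e = "E bss" and ?f = "F bss"
  note len = multi_grassmannian_lengths[OF V b]
  have lV: "length Vs = Suc n" using V by (auto simp: multi_grassmannian_def ks_def dest: list_all2_lengthD)
  have Lg: "Vs ! i \<in> grassmannian (n - 2) n" if "i < n" for i
    using V that by (auto simp: multi_grassmannian_def ks_def list_all2_conv_all_nth nth_append split: if_splits)
  have Mg: "Vs ! n \<in> grassmannian 1 n"
    using V by (auto simp: multi_grassmannian_def ks_def list_all2_conv_all_nth nth_append split: if_splits)
  have bV: "ordered_basis (bss ! i) (Vs ! i)" if "i \<le> n" for i using b lV that by (auto simp: list_all2_conv_all_nth)
  have lb: "length (bss ! n) = 2" "\<And>i. i < n \<Longrightarrow> length (bss ! i) = n - 2 + 1"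
    using len(2)[of n] len(2) by (auto simp: ks_def nth_append)
  have bn: "bss ! n = [?e, ?f]" using lb(1) by (intro nth_equalityI) (auto simp: E_def F_def less_2_cases_iff)
  have M: "Vs ! n = line ?e ?f" "indep2 ?e ?f"
    using bV[of n] unfolding bn ordered_basis_def using line_span[of ?e ?f] bV[of n] ordered_basis_pair[of ?e ?f] bn by auto
  have ef01: "?e 0 = 1" "?e 1 = 0" "?f 0 = 0" "?f 1 = 1"
  proof -
    have "(bss ! n ! r) (Is n ! c) = (if r = c then 1 else 0)" if "r \<le> 1" "c \<le> 1" for r c
      using nm that unfolding normalized_def by (auto simp: ks_def nth_append)
    from this[of 0 0] this[of 0 1] this[of 1 0] this[of 1 1]
    show "?e 0 = 1" "?e 1 = 0" "?f 0 = 0" "?f 1 = 1" by (simp_all add: Is_def E_def F_def)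
  qed
  have ec: "?e \<in> coord_space n" "?f \<in> coord_space n"
    using coord_subspace[OF Mg] M(1) line_ends(1)[of ?e ?f] line_ends(2)[of ?f ?e] by auto
  have cut: "cut_out n (Vs ! i) (\<phi> bss i 0) (\<phi> bss i 1)" if i: "i < n" for i
  proof -
    have lin: "lin_on n (\<phi> bss i c)" for c unfolding lin_on_def \<phi>_comb by simp
    have norm: "(bss ! i ! r) (Is i ! c) = (if r = c then 1 else 0)" if "r \<le> n - 2" "c \<le> n - 2" for r c
      using nm i that unfolding normalized_def by (auto simp: ks_def nth_append)
    have Isi: "Is i ! r = r + 2" if "r \<le> n - 2" for r using i that n by (simp add: Is_def del: upt_Suc)
    have n1: "n - 2 + 1 = n - 1" using n by simp
    have mem: "v \<in> Vs ! i \<longleftrightarrow> v \<in> coord_space n \<and> (\<forall>x\<le>n. v x = (\<Sum>r<n - 1. v (r + 2) * (bss ! i ! r) x))" for v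
    proof -
      have "(\<Sum>r<n - 2 + 1. v (Is i ! r) * (bss ! i ! r) x) = (\<Sum>r<n - 1. v (r + 2) * (bss ! i ! r) x)" for x
        unfolding n1 using Isi by (intro sum.cong) auto
      then show ?thesis using chart_mem[OF Lg[OF i] bV lb(2)[OF i] norm, of v] i by simp
    qed
    have auto_eq: "v (c + 2) = (\<Sum>r<n - 1. v (r + 2) * (bss ! i ! r) (c + 2))" if c: "c \<le> n - 2" for v :: "nat \<Rightarrow> 'k" and c
    proof -
      have "(\<Sum>r<n - 1. v (r + 2) * (bss ! i ! r) (c + 2)) = (\<Sum>r<n - 1. if r = c then v (c + 2) else 0)"
        using norm[OF _ c] Isi[OF c] by (intro sum.cong) auto
      then show ?thesis using c n by simp
    qed
    have "v \<in> Vs ! i \<longleftrightarrow> v \<in> coord_space n \<and> \<phi> bss i 0 v = 0 \<and> \<phi> bss i 1 v = 0" for v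
    proof -
      have "(\<forall>x\<le>n. v x = (\<Sum>r<n - 1. v (r + 2) * (bss ! i ! r) x)) \<longleftrightarrow> \<phi> bss i 0 v = 0 \<and> \<phi> bss i 1 v = 0"
      proof
        assume "\<phi> bss i 0 v = 0 \<and> \<phi> bss i 1 v = 0"
        then have z: "v 0 = (\<Sum>r<n - 1. v (r + 2) * (bss ! i ! r) 0)" "v 1 = (\<Sum>r<n - 1. v (r + 2) * (bss ! i ! r) 1)"
          by (auto simp: \<phi>_def)
        show "\<forall>x\<le>n. v x = (\<Sum>r<n - 1. v (r + 2) * (bss ! i ! r) x)"
        proof (intro allI impI)
          fix x assume x: "x \<le> n"
          consider "x = 0" | "x = 1" | "x = (x - 2) + 2" "x - 2 \<le> n - 2" using x by linarith
          then show "v x = (\<Sum>r<n - 1. v (r + 2) * (bss ! i ! r) x)"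
            using z auto_eq[of "x - 2" v] by cases auto
        qed
      qed (use n in \<open>auto simp: \<phi>_def\<close>)
      then show ?thesis using mem[of v] by blast
    qed
    then show ?thesis unfolding cut_out_def using lin by blast
  qed
  have lin: "om bss i x (vscale \<alpha> y + vscale \<beta> z) = \<alpha> * om bss i x y + \<beta> * om bss i x z"
    "om bss i (vscale \<alpha> y + vscale \<beta> z) x = \<alpha> * om bss i y x + \<beta> * om bss i z x" for i x y z \<alpha> \<beta>
    unfolding om_def \<phi>_comb by (simp_all add: algebra_simps)
  have anti: "om bss i y x = - om bss i x y" "om bss i x x = 0" for i x y by (simp_all add: om_def)
  define w where "w v = lcomb ?d v (\<lambda>k. unitv (k + 2))" for v :: "nat \<Rightarrow> 'k"
  have omw: "om bss i x (w v) = (\<Sum>k<?d. om bss i x (unitv (k + 2)) * v k)" for i x v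
  proof -
    show ?thesis unfolding om_def w_def \<phi>_lcomb sum_distrib_left sum_distrib_right sum_subtractf[symmetric]
      by (intro sum.cong) (simp_all add: algebra_simps)
  qed
  have w01: "w v 0 = 0" "w v 1 = 0" for v by (simp_all add: w_def lcomb_def unitv_def)
  have wk: "w v (k + 2) = v k" if "k < ?d" for v k
  proof -
    have "w v (k + 2) = (\<Sum>j<?d. if j = k then v k else 0)" unfolding w_def lcomb_def unitv_def by (intro sum.cong) auto
    then show ?thesis using that by simp
  qed
  have wc: "w v \<in> coord_space n" for v
  proof -
    have "unitv (k + 2) \<in> coord_space n" if "k < ?d" for k using that by (auto simp: coord_space_def unitv_def)
    then show ?thesis unfolding w_def by (intro lcomb_in_subspace subspace_coord_space)
  qed
  have \<kappa>: "kap bss ?d \<noteq> 0" and dR: "det (mat ?d ?d (\<lambda>(i, j). - R bss i j)) \<noteq> 0" and dd: "disc ?d (pencil_poly ?d (Q bss) (R bss)) \<noteq> 0"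
    using P by (auto simp: P_def)
  have d0: "0 < ?d" using n by simp
  have sp: "\<exists>s v. simple_pencil ?d (Q bss) (R bss) s v" by (rule pencil_disc_imp_simple[OF d0 dR dd])
  define c where "c t y = - (om bss ?d ?f (w y) + t * om bss ?d ?e (w y)) / kap bss ?d" for t y
  define f where "f t y = line (vscale t ?e + vscale 1 ?f) (vscale (c t y) ?e + vscale 1 (w y))" for t y
  let ?S = "lines_meeting n (set Vs)"
  have omline: "om bss i (vscale t ?e + vscale 1 ?f) (vscale x ?e + vscale 1 (w y)) =
      om bss i ?f (w y) + t * om bss i ?e (w y) + x * kap bss i" for i t x y
    unfolding lin by (simp add: anti(2) kap_def algebra_simps)
  have cc: "om bss ?d ?f (w y) + t * om bss ?d ?e (w y) + c t y * kap bss ?d = 0" for t y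
    using \<kappa> by (simp add: c_def)
  have eq: "kap bss ?d * (om bss i ?f (w y) + t * om bss i ?e (w y) + c t y * kap bss i) =
      (\<Sum>k<?d. Q bss i k * y k) - t * (\<Sum>k<?d. R bss i k * y k)" for i t y
  proof -
    have q: "(\<Sum>k<?d. Q bss i k * y k) = kap bss ?d * om bss i ?f (w y) - kap bss i * om bss ?d ?f (w y)"
      unfolding Q_def omw by (simp add: left_diff_distrib sum_subtractf sum_distrib_left mult.assoc)
    have r: "(\<Sum>k<?d. R bss i k * y k) = kap bss i * om bss ?d ?e (w y) - kap bss ?d * om bss i ?e (w y)"
      unfolding R_def omw by (simp add: left_diff_distrib sum_subtractf sum_distrib_left mult.assoc)
    have "c t y * kap bss ?d = - (om bss ?d ?f (w y) + t * om bss ?d ?e (w y))" using \<kappa> by (simp add: c_def)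
    then have k: "kap bss ?d * (c t y * kap bss i) = - (om bss ?d ?f (w y) + t * om bss ?d ?e (w y)) * kap bss i"
      by (metis mult.assoc mult.commute)
    show ?thesis unfolding q r distrib_left k by (simp add: algebra_simps)
  qed
  have ind: "indep2 (vscale t ?e + vscale 1 ?f) (vscale x ?e + vscale 1 (w y))" if y: "\<exists>k<?d. y k \<noteq> 0" for t x y
    unfolding indep2_def
  proof (intro allI impI)
    fix \<alpha> \<beta> assume z: "vscale \<alpha> (vscale t ?e + vscale 1 ?f) + vscale \<beta> (vscale x ?e + vscale 1 (w y)) = 0"
    have "\<alpha> = 0" using fun_cong[OF z, of 1] ef01 w01 by simp
    moreover have "\<beta> * x = 0" using fun_cong[OF z, of 0] ef01 w01 \<open>\<alpha> = 0\<close> by simp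
    obtain k where k: "k < ?d" "y k \<noteq> 0" using y by blast
    have "\<beta> * y k = 0" using fun_cong[OF z, of "k + 2"] \<open>\<alpha> = 0\<close> \<open>\<beta> * x = 0\<close> wk[OF k(1), of y]
      by (simp add: distrib_left mult.assoc[symmetric])
    then show "\<alpha> = 0 \<and> \<beta> = 0" using k \<open>\<alpha> = 0\<close> by simp
  qed
  have pM: "vscale t ?e + vscale 1 ?f \<in> Vs ! n" for t unfolding M(1) by (rule in_lineI[OF refl])
  have yc: "vscale x ?e + vscale 1 (w y) \<in> coord_space n" for x y by (intro subspace_comb subspace_coord_space ec wc)
  have setV: "set Vs = insert (Vs ! n) ((\<lambda>i. Vs ! i) ` {..<n})"
    unfolding set_conv_image_nth lV lessThan_Suc by simp
  have sol_iff: "line p u \<in> ?S \<longleftrightarrow> (\<forall>i<n. om bss i p u = 0)"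
    if pu: "indep2 p u" "p \<in> Vs ! n" "u \<in> coord_space n" for p u
  proof -
    have pc: "p \<in> coord_space n" by (rule coord_subspace[OF Mg pu(2)])
    have m: "meets (line p u) (Vs ! n)" using indep2_nz(1)[OF pu(1)] line_ends(1) pu(2) by (rule meetsI)
    have "meets (line p u) (Vs ! i) \<longleftrightarrow> om bss i p u = 0" if "i < n" for i
      unfolding om_def by (rule cut_out_meets[OF cut[OF that] pc pu(3,1)])
    then show ?thesis
      using m line_grassmannian[OF pu(1) pc pu(3)] unfolding setV lines_meeting_def by auto
  qed
  show ?thesis
  proof (rule eigenline_count[OF sp, where f = f])
    show "?S = {f t y | t y. eigenpair ?d (Q bss) (R bss) t y}"
    proof (intro equalityI subsetI)
      fix l assume "l \<in> {f t y | t y. eigenpair ?d (Q bss) (R bss) t y}"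
      then obtain t y where l: "l = f t y" "eigenpair ?d (Q bss) (R bss) t y" by auto
      have y: "\<exists>k<?d. y k \<noteq> 0" using l(2) by (simp add: eigenpair_def)
      have "om bss i ?f (w y) + t * om bss i ?e (w y) + c t y * kap bss i = 0" if i: "i < n" for i
      proof (cases "i = ?d")
        case True
        then show ?thesis using cc by simp
      next
        case False
        then have "i < ?d" using i by simp
        then have "kap bss ?d * (om bss i ?f (w y) + t * om bss i ?e (w y) + c t y * kap bss i) = 0"
          using l(2) unfolding eq eigenpair_def by simp
        then show ?thesis using \<kappa> by simp
      qed
      then show "l \<in> ?S" unfolding l(1) f_def using sol_iff[OF ind[OF y] pM yc] omline by simp
    next
      fix l assume l: "l \<in> ?S"
      have lg: "l \<in> grassmannian 1 n" using l by (simp add: lines_meeting_def)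
      have "meets l (Vs ! n)" using l unfolding lines_meeting_def setV by simp
      then obtain p where p: "p \<noteq> 0" "p \<in> l" "p \<in> Vs ! n" unfolding meets_def by (elim exE conjE)
      obtain u where u: "u \<in> l" "indep2 p u" "l = line p u" using line_through[OF lg p(2,1)] by blast
      have uc: "u \<in> coord_space n" by (rule coord_subspace[OF lg u(1)])
      have om0: "om bss i p u = 0" if "i < n" for i using sol_iff[OF u(2) p(3) uc] l u(3) that by simp
      obtain \<alpha> \<beta> where pe: "p = vscale \<alpha> ?e + vscale \<beta> ?f" using p(3) unfolding M(1) in_line_iff by (elim exE)
      let ?y = "\<lambda>k. u (k + 2) - u 0 * ?e (k + 2) - u 1 * ?f (k + 2)"
      have ue: "u = vscale (u 0) ?e + vscale (u 1) ?f + w ?y"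
      proof
        fix x
        consider "x = 0" | "x = 1" | "x = (x - 2) + 2" "x - 2 < ?d" | "n < x" by linarith
        then show "u x = (vscale (u 0) ?e + vscale (u 1) ?f + w ?y) x"
        proof cases
          case 3
          then show ?thesis using wk[OF 3(2), of ?y] by simp
        next
          case 4
          then show ?thesis using uc ec wc[of ?y] by (simp add: coord_space_def)
        qed (use ef01 w01 in simp_all)
      qed
      have uu: "u = vscale 1 (vscale (u 0) ?e + vscale (u 1) ?f) + vscale 1 (w ?y)" unfolding kvec.scale_one by (rule ue)
      have omu: "om bss i p u = (\<beta> * u 0 - \<alpha> * u 1) * kap bss i + \<alpha> * om bss i ?e (w ?y) + \<beta> * om bss i ?f (w ?y)" for i
      proof -
        have "om bss i p u = om bss i p (vscale 1 (vscale (u 0) ?e + vscale (u 1) ?f) + vscale 1 (w ?y))" using uu by simp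
        also have "\<dots> = (\<beta> * u 0 - \<alpha> * u 1) * kap bss i + \<alpha> * om bss i ?e (w ?y) + \<beta> * om bss i ?f (w ?y)"
          unfolding pe lin using anti(1)[of i ?f ?e] by (simp add: anti(2) kap_def algebra_simps)
        finally show ?thesis .
      qed
      have y0: "\<exists>k<?d. ?y k \<noteq> 0"
      proof (rule ccontr)
        assume "\<not> ?thesis"
        then have "w ?y = 0" unfolding w_def lcomb_def by (intro ext) (auto intro: sum.neutral)
        then have ul: "u = vscale (u 0) ?e + vscale (u 1) ?f" using ue by simp
        have "(\<beta> * u 0 - \<alpha> * u 1) * kap bss ?d = 0" using om0[of ?d] omu[of ?d] n \<open>w ?y = 0\<close> by (simp add: om_def \<phi>_def)
        then have "\<beta> * u 0 = \<alpha> * u 1" using \<kappa> by simp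
        then have bu: "\<beta> * u 0 = \<alpha> * u 1" .
        have pt: "u x = u 0 * ?e x + u 1 * ?f x" "p x = \<alpha> * ?e x + \<beta> * ?f x" for x
          using fun_cong[OF ul, of x] fun_cong[OF pe, of x] by simp_all
        have "u 0 * p x + - \<alpha> * u x = 0" "u 1 * p x + - \<beta> * u x = 0" for x
          unfolding pt(2) by (subst pt(1), rule proportional_cancel[OF bu])+
        then have "vscale (u 0) p + vscale (- \<alpha>) u = 0" "vscale (u 1) p + vscale (- \<beta>) u = 0"
          unfolding fun_eq_iff plus_fun_apply vscale_apply zero_fun_apply by blast+
        from indep2D[OF u(2) this(1)] indep2D[OF u(2) this(2)] have "u 0 = 0" "u 1 = 0" by simp_all
        then have "u x = 0" for x using pt(1)[of x] by simp
        then have "u = 0" by (simp add: fun_eq_iff)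
        then show False using indep2_nz(2)[OF u(2)] by simp
      qed
      have b0: "\<beta> \<noteq> 0"
      proof
        assume b: "\<beta> = 0"
        have "\<alpha> \<noteq> 0" using p(1) pe b by (auto simp: fun_eq_iff)
        have z: "om bss i ?e (w ?y) = u 1 * kap bss i" if "i < n" for i
          using om0[OF that] omu[of i] b \<open>\<alpha> \<noteq> 0\<close> by (simp add: algebra_simps)
        have "(\<Sum>k<?d. R bss i k * ?y k) = 0" if "i < ?d" for i
        proof -
          have "(\<Sum>k<?d. R bss i k * ?y k) = kap bss i * om bss ?d ?e (w ?y) - kap bss ?d * om bss i ?e (w ?y)"
            unfolding R_def omw[of _ _ ?y] by (simp add: left_diff_distrib sum_subtractf sum_distrib_left mult.assoc)
          also have "\<dots> = 0" using z[of i] z[of ?d] that n by simp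
          finally show ?thesis .
        qed
        then show False using simple_pencil_injective[OF sp, of ?y] y0 by blast
      qed
      let ?t = "\<alpha> / \<beta>" and ?x = "u 0 - \<alpha> / \<beta> * u 1"
      have om1: "om bss i ?f (w ?y) + ?t * om bss i ?e (w ?y) + ?x * kap bss i = 0" if "i < n" for i
      proof -
        have "\<beta> * (om bss i ?f (w ?y) + ?t * om bss i ?e (w ?y) + ?x * kap bss i) = om bss i p u"
          unfolding omu using b0 by (simp add: algebra_simps)
        then show ?thesis using om0[OF that] b0 by simp
      qed
      have xc: "?x = c ?t ?y"
      proof -
        have "om bss ?d ?f (w ?y) + ?t * om bss ?d ?e (w ?y) + ?x * kap bss ?d = om bss ?d ?f (w ?y) + ?t * om bss ?d ?e (w ?y) + c ?t ?y * kap bss ?d"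
          unfolding cc by (rule om1) (use n in simp)
        then have "?x * kap bss ?d = c ?t ?y * kap bss ?d" by (rule add_left_imp_eq)
        then show ?thesis using \<kappa> by simp
      qed
      have eig: "eigenpair ?d (Q bss) (R bss) ?t ?y" unfolding eigenpair_def
      proof (intro conjI allI impI y0)
        fix i assume "i < ?d"
        then have "kap bss ?d * (om bss i ?f (w ?y) + ?t * om bss i ?e (w ?y) + c ?t ?y * kap bss i) = 0"
          using om1[of i] unfolding xc by simp
        then show "(\<Sum>j<?d. Q bss i j * ?y j) = ?t * (\<Sum>j<?d. R bss i j * ?y j)" unfolding eq by simp
      qed
      have sl: "kvec.subspace l" by (rule subspace_grassmannian[OF lg])
      have m1: "vscale ?t ?e + vscale 1 ?f \<in> l"
      proof -
        have "vscale ?t ?e + vscale 1 ?f = vscale (1 / \<beta>) p" using pe b0 by (simp add: fun_eq_iff field_simps)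
        then show ?thesis using kvec.subspace_scale[OF sl p(2)] by simp
      qed
      have m2: "vscale (c ?t ?y) ?e + vscale 1 (w ?y) \<in> l"
      proof -
        have "vscale ?x ?e + vscale 1 (w ?y) = vscale 1 u + vscale (- u 1 / \<beta>) p"
        proof
          fix z
          have "u z = u 0 * ?e z + u 1 * ?f z + w ?y z" using fun_cong[OF ue, of z] by simp
          moreover have "p z = \<alpha> * ?e z + \<beta> * ?f z" using pe by simp
          ultimately show "(vscale ?x ?e + vscale 1 (w ?y)) z = (vscale 1 u + vscale (- u 1 / \<beta>) p) z"
            using b0 by (simp add: field_simps)
        qed
        then show ?thesis using subspace_comb[OF sl u(1) p(2), of 1 "- u 1 / \<beta>"] unfolding xc by simp
      qed
      have "l = f ?t ?y" unfolding f_def by (rule line_eqI[OF lg ind[OF y0] m1 m2])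
      with eig show "l \<in> {f t y | t y. eigenpair ?d (Q bss) (R bss) t y}" by blast
    qed
  next
    fix t y y' r assume r: "r \<noteq> 0" "\<And>i. i < ?d \<Longrightarrow> y i = r * y' i" and eig: "eigenpair ?d (Q bss) (R bss) t y"
    have "\<exists>k<?d. y k \<noteq> 0" using eig by (simp add: eigenpair_def)
    then have y': "\<exists>k<?d. y' k \<noteq> 0" using r by auto
    have ww: "w y = vscale r (w y') + vscale 0 0"
      unfolding w_def lcomb_def using r by (auto simp: fun_eq_iff sum_distrib_left mult.assoc intro!: sum.cong)
    have cr: "c t y = r * c t y'" unfolding c_def ww lin by (simp add: algebra_simps add_divide_distrib diff_divide_distrib)
    let ?l = "f t y'"
    have lg: "?l \<in> grassmannian 1 n" unfolding f_def
      by (rule line_grassmannian[OF ind[OF y'] coord_subspace[OF Mg pM] yc])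
    have "vscale (c t y) ?e + vscale 1 (w y) = vscale r (vscale (c t y') ?e + vscale 1 (w y'))"
      unfolding cr ww by (simp add: fun_eq_iff algebra_simps)
    then have m: "vscale (c t y) ?e + vscale 1 (w y) \<in> ?l"
      unfolding f_def using kvec.subspace_scale[OF subspace_line line_ends(2)] by metis
    have "\<exists>k<?d. y k \<noteq> 0" using eig by (simp add: eigenpair_def)
    from line_eqI[OF lg ind[OF this] _ m] show "f t y = f t y'" unfolding f_def using line_ends(1) by metis
  next
    fix t y t' y' assume e1: "eigenpair ?d (Q bss) (R bss) t y" and e2: "eigenpair ?d (Q bss) (R bss) t' y'" and eqf: "f t y = f t' y'"
    have y: "\<exists>k<?d. y k \<noteq> 0" using e1 by (simp add: eigenpair_def)
    have "vscale t' ?e + vscale 1 ?f \<in> f t y" unfolding eqf unfolding f_def by (rule line_ends(1))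
    then obtain \<alpha> \<beta> where ab: "vscale t' ?e + vscale 1 ?f = vscale \<alpha> (vscale t ?e + vscale 1 ?f) + vscale \<beta> (vscale (c t y) ?e + vscale 1 (w y))"
      unfolding f_def in_line_iff by (elim exE)
    have a1: "\<alpha> = 1" using fun_cong[OF ab, of 1] ef01 w01 by simp
    have a2: "t' = t + \<beta> * c t y" using fun_cong[OF ab, of 0] ef01 w01 a1 by simp
    obtain k where k: "k < ?d" "y k \<noteq> 0" using y by blast
    have "\<beta> * y k = 0" using fun_cong[OF ab, of "k + 2"] a1 a2 wk[OF k(1), of y] by (simp add: algebra_simps)
    then show "t = t'" using a2 k(2) by simp
  qed
qed

end

section \<open>The Galois group of the first problem\<close>

lemma injective_sequence_avoiding:
  fixes A :: "'k::alg_closed_field set"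
  assumes "finite A"
  obtains t :: "nat \<Rightarrow> 'k" where "inj t" "\<And>i. t i \<notin> A"
proof -
  have "infinite (UNIV - A)" using infinite_UNIV_alg_closed assms by (rule Diff_infinite_finite[rotated])
  then obtain t :: "nat \<Rightarrow> 'k" where t: "inj t" "range t \<subseteq> UNIV - A"
    using infinite_countable_subset by (metis (no_types))
  then have "t i \<notin> A" for i by blast
  with t(1) show ?thesis by (rule that)
qed

lemma diagonal_pencil:
  fixes q r :: "nat \<Rightarrow> 'k::field"
  assumes Q: "\<And>i k. i < d \<Longrightarrow> k < d \<Longrightarrow> Q i k = (if i = k then q i else 0)"
    and R: "\<And>i k. i < d \<Longrightarrow> k < d \<Longrightarrow> R i k = (if i = k then r i else 0)"
    and r: "\<And>i. i < d \<Longrightarrow> r i \<noteq> 0" and inj: "inj_on (\<lambda>i. q i / r i) {..<d}"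
  shows "simple_pencil d Q R (\<lambda>k. q k / r k) (\<lambda>k i. if i = k then 1 else 0)"
proof -
  have Rw: "(\<Sum>j<d. R i j * w j) = r i * w i" "(\<Sum>j<d. Q i j * w j) = q i * w i" if "i < d" for i w
  proof -
    have "(\<Sum>j<d. R i j * w j) = (\<Sum>j<d. if j = i then r i * w i else 0)"
      "(\<Sum>j<d. Q i j * w j) = (\<Sum>j<d. if j = i then q i * w i else 0)"
      by (intro sum.cong; simp add: Q R that)+
    then show "(\<Sum>j<d. R i j * w j) = r i * w i" "(\<Sum>j<d. Q i j * w j) = q i * w i" using that by simp_all
  qed
  show ?thesis unfolding simple_pencil_def using inj r by (auto simp: Rw)
qed

text \<open>The bases are normalized, so they are independent and define a point of the chart.\<close>

lemma chart_locus_nonempty: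
  fixes bas :: "nat \<Rightarrow> nat \<Rightarrow> nat \<Rightarrow> 'k::field"
  assumes coord: "\<And>i r. i < length ks \<Longrightarrow> r \<le> ks ! i \<Longrightarrow> bas i r \<in> coord_space n"
    and norm: "\<And>i r c. i < length ks \<Longrightarrow> r \<le> ks ! i \<Longrightarrow> c \<le> ks ! i \<Longrightarrow> bas i r (Is i ! c) = (if r = c then 1 else 0)"
    and P: "P (map (\<lambda>i. map (bas i) [0..<ks ! i + 1]) [0..<length ks]) \<noteq> 0"
  shows "chart_locus n ks Is P \<noteq> {}"
proof -
  let ?V = "\<lambda>i. kvec.span (bas i ` {..<ks ! i + 1})"
  let ?bss = "map (\<lambda>i. map (bas i) [0..<ks ! i + 1]) [0..<length ks]"
  have ind: "fam_indep (ks ! i + 1) (bas i)" if "i < length ks" for i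
  proof (rule minor_imp_indep[where I = "Is i"])
    have "mat (ks ! i + 1) (ks ! i + 1) (\<lambda>(r, c). bas i r (Is i ! c)) = 1\<^sub>m (ks ! i + 1)"
      using norm[OF that] by (intro eq_matI) auto
    then show "det (mat (ks ! i + 1) (ks ! i + 1) (\<lambda>(r, c). bas i r (Is i ! c))) \<noteq> 0" by simp
  qed
  have "?V i \<in> grassmannian (ks ! i) n" if "i < length ks" for i
    using span_family_grassmannian[of "ks ! i" "bas i" n] ind[OF that] coord[OF that] by simp
  then have "map ?V [0..<length ks] \<in> multi_grassmannian n ks"
    by (auto simp: multi_grassmannian_def list_all2_conv_all_nth)
  moreover have "ordered_basis (map (bas i) [0..<ks ! i + 1]) (?V i)" if "i < length ks" for i
    unfolding ordered_basis_map using ind[OF that] by blast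
  then have "list_all2 ordered_basis ?bss (map ?V [0..<length ks])"
    by (auto simp: list_all2_conv_all_nth simp del: upt_Suc)
  moreover have "normalized ks Is ?bss"
    unfolding normalized_def using norm by (auto simp: nth_append simp del: upt_Suc)
  ultimately show ?thesis unfolding chart_locus_def using P by blast
qed

context configurations
begin

text \<open>
  The two facts on which both parts rest are the hypotheses: the number of solutions on an open set, and
  the independence of the points in which the \<open>d\<close> solutions meet a condition subspace, the latter for
  every instance with exactly \<open>d\<close> solutions and not only for general ones.
\<close>

lemma galois_group_of_configurations:
  assumes U: "openin (zariski n (condition_dims a)) U" "U \<noteq> {}" "U \<subseteq> multi_grassmannian n (condition_dims a)"
    and count: "\<And>Ls :: (nat \<Rightarrow> 'k) set list. Ls \<in> U \<Longrightarrow> finite (lines_meeting n (set Ls)) \<and> card (lines_meeting n (set Ls)) = d"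
    and indep: "\<And>(Ls :: (nat \<Rightarrow> 'k) set list) ws j. Ls \<in> multi_grassmannian n (condition_dims a) \<Longrightarrow> length ws = d \<Longrightarrow> distinct ws \<Longrightarrow>
      set ws = lines_meeting n (set Ls) \<Longrightarrow> j < m \<Longrightarrow> \<exists>q. fam_indep d q \<and> (\<forall>k<d. q k \<in> ws ! k \<and> q k \<in> Ls ! j)"
  shows "full_symmetric_galois_group K a"
proof -
  have X: "schubert_X a = (multi_grassmannian n (condition_dims a) :: (nat \<Rightarrow> 'k) set list set)"
    by (simp add: schubert_X_def n)
  have "general_solution_count K a d"
    unfolding general_solution_count_def n
  proof (intro exI[of _ U] conjI ballI U)
    fix Ls assume L: "Ls \<in> U"
    then have "Ls \<in> schubert_X a" using U(3) X by blast
    from solutions_lines_meeting[OF this] count[OF L]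
    show "finite (solutions a Ls)" "card (solutions a Ls) = d" by (simp_all add: n)
  qed
  moreover have enum: "ws @ Ls \<in> Conf" if e: "enumerates_fiber a d Ls ws" for ws Ls
  proof -
    have L: "Ls \<in> schubert_X a" and ws: "length ws = d" "distinct ws" "set ws = solutions a Ls"
      using e by (auto simp: enumerates_fiber_def)
    have s: "set ws = lines_meeting n (set Ls)" using ws(3) solutions_lines_meeting[OF L] by (simp add: n)
    have "\<forall>j<m. \<exists>q. fam_indep d q \<and> (\<forall>k<d. q k \<in> ws ! k \<and> q k \<in> Ls ! j)"
      using indep[OF L[unfolded X] ws(1,2) s] by blast
    then show ?thesis
      unfolding Conf_def using enumeration_in_fiber_power[OF e] ws(1) by blast
  qed
  moreover have "galois_group a Ls ws = {\<sigma>. \<sigma> permutes {..<d}}" if e: "enumerates_fiber a d Ls ws" for ws and Ls :: "(nat \<Rightarrow> 'k) set list"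
  proof (rule galois_group_full[OF _ _ e])
    show "irreducible_in (fiber_power_space a d) Conf" using Conf_irreducible enum[OF e] by blast
  qed (rule enum)
  ultimately show ?thesis unfolding full_symmetric_galois_group_def by blast
qed

end

context first_problem
begin

text \<open>
  With \<open>t\<close> injective, the subspaces below lead to the diagonal pencil with eigenvalues \<open>t k\<close>. The last
  of the \<open>n\<close> subspaces of codimension two is the span of the last \<open>n - 1\<close> coordinate vectors.
\<close>

lemma chart_first_nonempty: "chart_locus n ks Is P \<noteq> {}"
proof -
  obtain t :: "nat \<Rightarrow> 'k" where t: "inj t" by (rule injective_sequence_avoiding[OF finite.emptyI])
  define bas where "bas i r = (if i = n then unitv r
      else if i = r then unitv (r + 2) + vscale (t r) (unitv 0) + unitv 1 else unitv (r + 2))" for i r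
  define bss where "bss = map (\<lambda>i. map (bas i) [0..<ks ! i + 1]) [0..<length ks]"
  have len: "length ks = Suc n" by (simp add: ks_def)
  have ksi: "ks ! i = (if i < n then n - 2 else 1)" if "i \<le> n" for i using that by (auto simp: ks_def nth_append)
  have b: "bss ! i ! r = bas i r" if "i \<le> n" "r \<le> ks ! i" for i r
    using that len unfolding bss_def by (simp del: upt_Suc)
  have bi: "bss ! i ! r = bas i r" if "i < n" "r < n - 1" for i r using that by (intro b) (auto simp: ksi)
  have EF: "E bss = unitv 0" "F bss = unitv 1" unfolding E_def F_def by (simp_all add: b ksi) (simp_all add: bas_def)
  have b0: "(bss ! i ! r) 0 = (if i = r then t r else 0)" "(bss ! i ! r) 1 = (if i = r then 1 else 0)"
    if "i < n" "r < n - 1" for i r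
    using that by (simp_all add: bi) (simp_all add: bas_def unitv_def)
  have \<phi>EF: "\<phi> bss i 0 (E bss) = 1" "\<phi> bss i 1 (E bss) = 0" "\<phi> bss i 0 (F bss) = 0" "\<phi> bss i 1 (F bss) = 1" for i
    unfolding \<phi>_def EF by (simp_all add: unitv_def)
  have \<phi>u: "\<phi> bss i c (unitv (k + 2)) = - (bss ! i ! k) c" if "k < n - 1" "c < 2" for i k c
  proof -
    have "(\<Sum>r<n - 1. unitv (k + 2) (r + 2) * (bss ! i ! r) c) = (\<Sum>r<n - 1. if r = k then (bss ! i ! k) c else 0)"
      by (intro sum.cong) (auto simp: unitv_def)
    then show ?thesis using that by (simp add: \<phi>_def unitv_def)
  qed
  have lt2: "(0::nat) < 2" "(1::nat) < 2" by simp_all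
  have kap: "kap bss i = - 1" for i unfolding kap_def om_def \<phi>EF by simp
  have omF: "om bss i (F bss) (unitv (k + 2)) = (if i = k then t k else 0)"
    and omE: "om bss i (E bss) (unitv (k + 2)) = (if i = k then - 1 else 0)" if "i < n" "k < n - 1" for i k
    unfolding om_def \<phi>EF \<phi>u[OF that(2) lt2(1)] \<phi>u[OF that(2) lt2(2)] b0[OF that]
    by simp_all
  have QR: "Q bss i k = (if i = k then - t i else 0)" "R bss i k = (if i = k then - 1 else 0)" if "i < n - 1" "k < n - 1" for i k
    unfolding Q_def R_def kap using omF[of i k] omF[of "n - 1" k] omE[of i k] omE[of "n - 1" k] that by auto
  have "simple_pencil (n - 1) (Q bss) (R bss) (\<lambda>k. - t k / - 1) (\<lambda>k i. if i = k then 1 else 0)"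
    by (rule diagonal_pencil[OF QR]) (use t in \<open>auto simp: inj_on_def inj_def\<close>)
  from simple_pencil_imp_disc[OF _ this] n have "P bss \<noteq> 0" unfolding P_def kap by simp
  then show ?thesis unfolding bss_def
  proof (rule chart_locus_nonempty[rotated 2])
    fix i r assume ir: "i < length ks" "r \<le> ks ! i"
    then have i: "i \<le> n" using len by simp
    show "bas i r \<in> coord_space n"
      using ir n ksi[OF i] by (auto simp: bas_def coord_space_def unitv_def split: if_splits)
    fix c assume c: "c \<le> ks ! i"
    have "Is i ! c = (if i = n then c else c + 2)"
      using i c ksi[OF i] n by (cases c) (auto simp: Is_def simp del: upt_Suc split: if_splits)
    then show "bas i r (Is i ! c) = (if r = c then 1 else 0)"
      using ir c ksi[OF i] by (auto simp: bas_def unitv_def split: if_splits)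
  qed
qed

lemma full_symmetric_first: "full_symmetric_galois_group K (replicate n 1 @ [n - 2])"
proof -
  let ?a = "replicate n 1 @ [n - 2]"
  have amb: "ambient_dim ?a = n" using n by (simp add: ambient_dim_def sum_list_replicate)
  have cd: "condition_dims ?a = ks" unfolding condition_dims_def amb ks_def using n by simp
  interpret configurations ?a n "n - 1" n True K
    by unfold_locales (use n amb cd in \<open>simp_all add: ks_def\<close>)
  show ?thesis
  proof (rule galois_group_of_configurations[where U = "chart_locus n ks Is P", unfolded cd])
    show "openin (zariski n ks) (chart_locus n ks Is P)" by (rule openin_chart_locus[OF Is_ok pfun_P])
    show "chart_locus n ks Is P \<noteq> {}" by (rule chart_first_nonempty)
    show "chart_locus n ks Is P \<subseteq> multi_grassmannian n ks" by (auto simp: chart_locus_def)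
  next
    fix Ls assume "Ls \<in> chart_locus n ks Is P"
    then show "finite (lines_meeting n (set Ls)) \<and> card (lines_meeting n (set Ls)) = n - 1"
      unfolding chart_locus_def using count_first by blast
  next
    fix Ls :: "(nat \<Rightarrow> 'k) set list" and ws j
    assume L: "Ls \<in> multi_grassmannian n ks" and ws: "length ws = n - 1" "distinct ws" "set ws = lines_meeting n (set Ls)" and j: "j < n"
    have len: "length Ls = Suc n" using L by (auto simp: multi_grassmannian_def ks_def dest: list_all2_lengthD)
    have setL: "set Ls = insert (Ls ! n) ((\<lambda>i. Ls ! i) ` {..<n})"
      unfolding set_conv_image_nth len lessThan_Suc by simp
    have Lg: "Ls ! i \<in> grassmannian (n - 2) n" if "i < n" for i
      using L that by (auto simp: multi_grassmannian_def ks_def list_all2_conv_all_nth nth_append split: if_splits)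
    have Mg: "Ls ! n \<in> grassmannian 1 n"
      using L by (auto simp: multi_grassmannian_def ks_def list_all2_conv_all_nth nth_append split: if_splits)
    have "finite (set ws)" "card (set ws) = n - 1" using ws(1) distinct_card[OF ws(2)] by simp_all
    then interpret codim_two n "\<lambda>i. Ls ! i" "Ls ! n"
      using first_problem_axioms Lg Mg ws(3) unfolding setL first_problem_def by unfold_locales simp_all
    show "\<exists>q. fam_indep (n - 1) q \<and> (\<forall>k<n - 1. q k \<in> ws ! k \<and> q k \<in> Ls ! j)"
      by (rule solution_points_indep[OF ws(1,2) _ j]) (use ws(3) setL in simp)
  qed
qed

end

section \<open>The Galois group of the second problem\<close>

definition mat_apply :: "nat \<Rightarrow> (nat \<Rightarrow> nat \<Rightarrow> 'k::field) \<Rightarrow> (nat \<Rightarrow> 'k) \<Rightarrow> nat \<Rightarrow> 'k" where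
  "mat_apply d A y i = (\<Sum>j<d. A i j * y j)"

definition mat_compose :: "nat \<Rightarrow> (nat \<Rightarrow> nat \<Rightarrow> 'k::field) \<Rightarrow> (nat \<Rightarrow> nat \<Rightarrow> 'k) \<Rightarrow> nat \<Rightarrow> nat \<Rightarrow> 'k" where
  "mat_compose d A B i j = (\<Sum>k<d. A i k * B k j)"

text \<open>The adjugate matrix replaces the inverse, whose entries are not polynomial.\<close>

definition adjugate :: "nat \<Rightarrow> (nat \<Rightarrow> nat \<Rightarrow> 'k::field) \<Rightarrow> nat \<Rightarrow> nat \<Rightarrow> 'k" where
  "adjugate d A k l = (- 1) ^ (l + k) *
     det (mat (d - 1) (d - 1) (\<lambda>(p, q). A (if p < l then p else Suc p) (if q < k then q else Suc q)))"

lemma mat_apply_cong: "(\<And>j. j < d \<Longrightarrow> y j = z j) \<Longrightarrow> mat_apply d A y i = mat_apply d A z i"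
  by (simp add: mat_apply_def)

lemma mat_apply_comb: "mat_apply d A (vscale \<alpha> y + vscale \<beta> z) i = \<alpha> * mat_apply d A y i + \<beta> * mat_apply d A z i"
  by (simp add: mat_apply_def sum_distrib_left sum.distrib algebra_simps)

lemma mat_apply_scale: "mat_apply d A (vscale c y) i = c * mat_apply d A y i"
  by (simp add: mat_apply_def sum_distrib_left algebra_simps)

lemma mat_apply_compose: "mat_apply d (mat_compose d A B) y i = mat_apply d A (mat_apply d B y) i"
proof -
  have "mat_apply d (mat_compose d A B) y i = (\<Sum>j<d. \<Sum>k<d. A i k * (B k j * y j))"
    by (simp add: mat_apply_def mat_compose_def sum_distrib_right mult.assoc)
  also have "\<dots> = (\<Sum>k<d. \<Sum>j<d. A i k * (B k j * y j))" by (rule sum.swap)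
  also have "\<dots> = mat_apply d A (mat_apply d B y) i" by (simp add: mat_apply_def sum_distrib_left)
  finally show ?thesis .
qed

lemma mat_apply_injective:
  assumes "det (mat d d (\<lambda>(i, j). A i j)) \<noteq> 0" "\<And>i. i < d \<Longrightarrow> mat_apply d A y i = 0" "j < d"
  shows "y j = 0"
  using assms unfolding det_zero_iff_kernel mat_apply_def by blast

lemma mat_apply_adjugate:
  fixes A :: "nat \<Rightarrow> nat \<Rightarrow> 'k::field"
  assumes i: "i < d" shows "mat_apply d A (mat_apply d (adjugate d A) z) i = det (mat d d (\<lambda>(i, j). A i j)) * z i"
proof -
  let ?A = "mat d d (\<lambda>(i, j). A i j)"
  have A: "?A \<in> carrier_mat d d" by simp
  have adj: "adj_mat ?A $$ (k, l) = adjugate d A k l" if "k < d" "l < d" for k l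
  proof -
    have "mat_delete ?A l k = mat (d - 1) (d - 1) (\<lambda>(p, q). A (if p < l then p else Suc p) (if q < k then q else Suc q))"
      unfolding mat_delete_def using that by (intro eq_matI) auto
    then show ?thesis using that by (simp add: adj_mat_def cofactor_def adjugate_def)
  qed
  have c: "mat_compose d A (adjugate d A) i l = (if l = i then det ?A else 0)" if l: "l < d" for l
  proof -
    have "(?A * adj_mat ?A) $$ (i, l) = (\<Sum>k<d. A i k * adjugate d A k l)"
      using i l adj_mat(1)[OF A] adj by (auto simp: scalar_prod_def atLeast0LessThan intro!: sum.cong)
    then show ?thesis unfolding adj_mat(2)[OF A] mat_compose_def using i l by auto
  qed
  have "mat_apply d (mat_compose d A (adjugate d A)) z i = (\<Sum>l<d. if l = i then det ?A * z i else 0)"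
    unfolding mat_apply_def using c by (intro sum.cong) auto
  then have "mat_apply d A (mat_apply d (adjugate d A) z) i = (\<Sum>l<d. if l = i then det ?A * z i else 0)"
    unfolding mat_apply_compose .
  then show ?thesis using i by simp
qed

lemma pfun_adjugate:
  assumes "\<And>i j. i < d \<Longrightarrow> j < d \<Longrightarrow> pfun G (\<lambda>x. A x i j)" "k < d" "l < d"
  shows "pfun G (\<lambda>x. adjugate d (A x) k l)"
  unfolding adjugate_def using assms(2,3) by (intro pfun.mult pfun.const pfun_det assms(1)) auto

lemma pfun_mat_compose:
  assumes "\<And>i j. i < d \<Longrightarrow> j < d \<Longrightarrow> pfun G (\<lambda>x. A x i j)" "\<And>i j. i < d \<Longrightarrow> j < d \<Longrightarrow> pfun G (\<lambda>x. B x i j)" "k < d" "l < d"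
  shows "pfun G (\<lambda>x. mat_compose d (A x) (B x) k l)"
  unfolding mat_compose_def using assms(3,4) by (intro pfun_sum pfun.mult assms(1,2)) auto

text \<open>
  On the chart, the four subspaces are the graphs of linear maps \<open>M j\<close> between two spaces of dimension
  \<open>a\<close>. Two of the graphs are disjoint iff the difference \<open>D k l\<close> of the maps is invertible.
\<close>

locale second_problem =
  fixes a n :: nat and K :: "'k::alg_closed_field itself"
  assumes a: "2 \<le> a" and n: "n = 2 * a - 1"
begin

definition Is :: "nat \<Rightarrow> nat list" where "Is i = [0..<a]"

definition ks :: "nat list" where "ks = replicate 4 (a - 1)"

definition M :: "(nat \<Rightarrow> 'k) list list \<Rightarrow> nat \<Rightarrow> nat \<Rightarrow> nat \<Rightarrow> 'k" where
  "M bss j i r = (bss ! j ! r) (a + i)"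

definition D where "D bss k l i r = M bss k i r - M bss l i r"
definition dt where "dt bss k l = det (mat a a (\<lambda>(i, j). D bss k l i j))"

text \<open>
  The line through the points of the graphs over \<open>x\<close> and \<open>y\<close> of the first two maps meets the third graph
  in the sum of these points iff \<open>D 2 0 x + D 2 1 y = 0\<close>, and the fourth one in the combination with
  coefficients \<open>1\<close> and \<open>t\<close> iff \<open>D 3 0 x + t D 3 1 y = 0\<close>. Eliminating \<open>x\<close> gives the pencil \<open>Q y = t R y\<close>.
\<close>

definition Q where "Q bss = mat_compose a (D bss 3 0) (mat_compose a (adjugate a (D bss 2 0)) (D bss 2 1))"
definition R where "R bss i j = dt bss 2 0 * D bss 3 1 i j"

definition P where
  "P bss = dt bss 1 0 * dt bss 2 0 * dt bss 3 0 * dt bss 2 1 * dt bss 3 1 *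
     (det (mat a a (\<lambda>(i, j). - R bss i j)) * disc a (pencil_poly a (Q bss) (R bss)))"

lemma Is_ok: "i < length ks \<Longrightarrow> length (Is i) = ks ! i + 1 \<and> sorted_wrt (<) (Is i) \<and> set (Is i) \<subseteq> {..n}"
  using a n by (auto simp: Is_def ks_def)

lemma pfun_P: "pfun (entries n ks) P"
proof -
  have D: "pfun (entries n ks) (\<lambda>bss. D bss k l i j)" if "k < 4" "l < 4" "i < a" "j < a" for k l i j
  proof -
    have "(\<lambda>bss. M bss k i j) \<in> entries n ks" if "k < 4" "i < a" "j < a" for k i j
      unfolding entries_def M_def
      by (rule CollectI, rule exI[of _ k], rule exI[of _ j], rule exI[of _ "a + i"]) (use that n in \<open>simp add: ks_def, linarith\<close>)
    then show ?thesis unfolding D_def using that by (intro pfun_diff pfun.gen)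
  qed
  have dt: "pfun (entries n ks) (\<lambda>bss. dt bss k l)" if "k < 4" "l < 4" for k l
    unfolding dt_def using that by (intro pfun_det D)
  have Q: "pfun (entries n ks) (\<lambda>bss. Q bss i j)" if "i < a" "j < a" for i j
    unfolding Q_def using that by (intro pfun_mat_compose pfun_adjugate D) auto
  have R: "pfun (entries n ks) (\<lambda>bss. R bss i j)" if "i < a" "j < a" for i j
    unfolding R_def using that by (intro pfun.mult dt D) auto
  show ?thesis unfolding P_def by (intro pfun.mult dt pfun_pencil[where Q = Q and R = R and d = a, OF Q R]) auto
qed

text \<open>
  As the first graph is disjoint from the second, and both are disjoint from the third and the fourth,
  the points of a solution on the first two graphs can be rescaled such that their sum lies on the
  third. The eigenvalue is then the cross ratio of the four points.
\<close>

lemma count_second: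
  fixes bss :: "(nat \<Rightarrow> 'k) list list"
  assumes V: "Vs \<in> multi_grassmannian n ks" and b: "list_all2 ordered_basis bss Vs"
    and nm: "normalized ks Is bss" and P: "P bss \<noteq> 0"
  shows "finite (lines_meeting n (set Vs)) \<and> card (lines_meeting n (set Vs)) = a"
proof -
  let ?S = "lines_meeting n (set Vs)"
  have lk: "length ks = 4" "ks ! i = a - 1" if "i < 4" for i using that by (simp_all add: ks_def)
  have lV: "length Vs = 4" using V lk(1)[of 0] by (auto simp: multi_grassmannian_def dest: list_all2_lengthD)
  have Vg: "Vs ! i \<in> grassmannian (a - 1) n" if "i < 4" for i
    using V that lk by (auto simp: multi_grassmannian_def list_all2_conv_all_nth)
  have setV: "set Vs = {Vs ! 0, Vs ! 1, Vs ! 2, Vs ! 3}"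
    unfolding set_conv_image_nth lV by (auto simp: numeral_eq_Suc less_Suc_eq)
  have Vs: "kvec.subspace (Vs ! i)" if "i < 4" for i by (rule subspace_grassmannian[OF Vg[OF that]])
  have graph: "v \<in> Vs ! i \<longleftrightarrow> v \<in> coord_space n \<and> (\<forall>x<a. v (a + x) = mat_apply a (M bss i) v x)" if i: "i < 4" for i v
  proof -
    have norm: "(bss ! i ! r) (Is i ! c) = (if r = c then 1 else 0)" if "r \<le> a - 1" "c \<le> a - 1" for r c
      using nm lk i that unfolding normalized_def by simp
    have a1: "a - 1 + 1 = a" using a by simp
    have Isr: "Is i ! r = r" if "r < a" for r using that by (simp add: Is_def)
    have bV: "ordered_basis (bss ! i) (Vs ! i)" "length (bss ! i) = a - 1 + 1"
      using b lV i multi_grassmannian_lengths[OF V b] lk by (auto simp: list_all2_conv_all_nth)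
    have s: "(\<Sum>r<a - 1 + 1. v (Is i ! r) * (bss ! i ! r) x) = (\<Sum>r<a. v r * (bss ! i ! r) x)" for x
      unfolding a1 using Isr by (intro sum.cong) auto
    have low: "v x = (\<Sum>r<a. v r * (bss ! i ! r) x)" if x: "x < a" for x
    proof -
      have "(\<Sum>r<a. v r * (bss ! i ! r) x) = (\<Sum>r<a. if r = x then v x else 0)"
        using norm[of _ x] Isr[OF x] x by (intro sum.cong) auto
      then show ?thesis using x by simp
    qed
    have "(\<forall>x\<le>n. v x = (\<Sum>r<a. v r * (bss ! i ! r) x)) \<longleftrightarrow> (\<forall>x<a. v (a + x) = (\<Sum>r<a. v r * (bss ! i ! r) (a + x)))"
    proof (intro iffI allI impI)
      fix x assume h: "\<forall>x<a. v (a + x) = (\<Sum>r<a. v r * (bss ! i ! r) (a + x))" and x: "x \<le> n"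
      show "v x = (\<Sum>r<a. v r * (bss ! i ! r) x)"
      proof (cases "x < a")
        case False
        then have "x - a < a" "a + (x - a) = x" using x n a by auto
        then show ?thesis using h by metis
      qed (rule low)
    qed (use n in auto)
    then show ?thesis using chart_mem[OF Vg[OF i] bV norm, of v] unfolding s by (simp add: mat_apply_def M_def mult.commute)
  qed
  have nz: "dt bss 1 0 \<noteq> 0" "dt bss 2 0 \<noteq> 0" "dt bss 3 0 \<noteq> 0" "dt bss 2 1 \<noteq> 0" "dt bss 3 1 \<noteq> 0"
    and dR: "det (mat a a (\<lambda>(i, j). - R bss i j)) \<noteq> 0" and dd: "disc a (pencil_poly a (Q bss) (R bss)) \<noteq> 0"
    using P by (auto simp: P_def)
  have a0: "0 < a" using a by simp
  have sp: "\<exists>s v. simple_pencil a (Q bss) (R bss) s v" by (rule pencil_disc_imp_simple[OF a0 dR dd])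
  have apD: "mat_apply a (D bss k l) v i = mat_apply a (M bss k) v i - mat_apply a (M bss l) v i" for k l v i
    unfolding mat_apply_def D_def by (simp add: left_diff_distrib sum_subtractf)
  have zero: "v = 0" if "i < 4" "v \<in> Vs ! i" "\<And>x. x < a \<Longrightarrow> v x = 0" for i v
  proof
    fix x
    have v: "v \<in> coord_space n" "\<And>x. x < a \<Longrightarrow> v (a + x) = mat_apply a (M bss i) v x" using that(2) graph[OF that(1)] by auto
    have z: "mat_apply a (M bss i) v x = 0" for x using that(3) by (simp add: mat_apply_def)
    consider "x < a" | "x - a < a" "a + (x - a) = x" | "n < x" using n a by linarith
    then show "v x = 0 x"
    proof cases
      case 2
      then show ?thesis using v(2)[OF 2(1)] z by simp
    qed (use that(3) v(1) in \<open>simp_all add: coord_space_def\<close>)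
  qed
  have disj: "v = 0" if kl: "k < 4" "l < 4" "dt bss k l \<noteq> 0" and v: "v \<in> Vs ! k" "v \<in> Vs ! l" for k l v
  proof (rule zero[OF kl(1) v(1)])
    fix x assume x: "x < a"
    have "mat_apply a (D bss k l) v i = 0" if "i < a" for i
      using v that unfolding graph[OF kl(1)] graph[OF kl(2)] apD by simp
    then show "v x = 0" using mat_apply_injective[OF kl(3)[unfolded dt_def] _ x] by blast
  qed
  have inV: "vscale \<alpha> X + vscale \<beta> Y \<in> Vs ! k \<longleftrightarrow> (\<forall>i<a. \<alpha> * mat_apply a (D bss k 0) X i + \<beta> * mat_apply a (D bss k 1) Y i = 0)"
    if k: "k < 4" and X: "X \<in> Vs ! 0" and Y: "Y \<in> Vs ! 1" for k X Y \<alpha> \<beta>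
  proof -
    have X': "X \<in> coord_space n" "\<And>i. i < a \<Longrightarrow> X (a + i) = mat_apply a (M bss 0) X i"
      and Y': "Y \<in> coord_space n" "\<And>i. i < a \<Longrightarrow> Y (a + i) = mat_apply a (M bss 1) Y i" using X Y by (auto simp: graph)
    have c: "vscale \<alpha> X + vscale \<beta> Y \<in> coord_space n" by (rule subspace_comb[OF subspace_coord_space X'(1) Y'(1)])
    have e: "(vscale \<alpha> X + vscale \<beta> Y) (a + i) = mat_apply a (M bss k) (vscale \<alpha> X + vscale \<beta> Y) i \<longleftrightarrow>
      \<alpha> * mat_apply a (D bss k 0) X i + \<beta> * mat_apply a (D bss k 1) Y i = 0" if "i < a" for i
      unfolding mat_apply_comb apD using X'(2)[OF that] Y'(2)[OF that] by (auto simp: algebra_simps)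
    show ?thesis unfolding graph[OF k] using c e by blast
  qed
  define g where "g j y = (\<lambda>x. if x < a then y x else if x \<le> n then mat_apply a (M bss j) y (x - a) else 0)" for j y
  have gV: "g j y \<in> Vs ! j" if "j < 4" for j y
  proof -
    have "mat_apply a (M bss j) (g j y) x = mat_apply a (M bss j) y x" for x by (rule mat_apply_cong) (simp add: g_def)
    then show ?thesis unfolding graph[OF that] using n by (auto simp: g_def coord_space_def)
  qed
  have glow: "g j y x = y x" if "x < a" for j y x using that by (simp add: g_def)
  have g_id: "g j y = X" if j: "j < 4" and X: "X \<in> Vs ! j" and y: "\<And>i. i < a \<Longrightarrow> y i = X i" for j y X
  proof -
    have "vscale 1 (g j y) + vscale (- 1) X = 0"
    proof (rule zero[OF j])
      show "vscale 1 (g j y) + vscale (- 1) X \<in> Vs ! j" by (rule subspace_comb[OF Vs[OF j] gV[OF j] X])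
      show "(vscale 1 (g j y) + vscale (- 1) X) x = 0" if "x < a" for x using glow[OF that, of j y] y[OF that] by simp
    qed
    then show ?thesis by (simp add: fun_eq_iff)
  qed
  have apg: "mat_apply a A (g j y) i = mat_apply a A y i" for A j y i by (rule mat_apply_cong) (rule glow)
  have gs: "g j y = vscale r (g j y')" if "\<And>i. i < a \<Longrightarrow> y i = r * y' i" for j r y y'
  proof
    fix x
    have "mat_apply a (M bss j) y i = mat_apply a (M bss j) (vscale r y') i" for i using that by (intro mat_apply_cong) simp
    then have "mat_apply a (M bss j) y i = r * mat_apply a (M bss j) y' i" for i unfolding mat_apply_scale .
    then show "g j y x = vscale r (g j y') x" using that by (simp add: g_def)
  qed
  define xi where "xi y = vscale (- 1 / dt bss 2 0) (mat_apply a (adjugate a (D bss 2 0)) (mat_apply a (D bss 2 1) y))" for y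
  have xi: "mat_apply a (D bss 2 0) (xi y) i = - mat_apply a (D bss 2 1) y i" if "i < a" for y i
    unfolding xi_def mat_apply_scale mat_apply_adjugate[OF that] dt_def[symmetric] using nz(2) by simp
  have Qxi: "mat_apply a (Q bss) y i = - dt bss 2 0 * mat_apply a (D bss 3 0) (xi y) i" for y i
    unfolding xi_def mat_apply_scale Q_def mat_apply_compose using nz(2)
    by (simp add: mat_apply_cong[OF mat_apply_compose])
  have Rap: "mat_apply a (R bss) y i = dt bss 2 0 * mat_apply a (D bss 3 1) y i" for y i
    by (simp add: mat_apply_def R_def sum_distrib_left mult.assoc)
  have eig_iff: "eigenpair a (Q bss) (R bss) t y \<longleftrightarrow>
      (\<exists>i<a. y i \<noteq> 0) \<and> (\<forall>i<a. mat_apply a (D bss 3 0) (xi y) i + t * mat_apply a (D bss 3 1) y i = 0)" for t y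
  proof -
    have "eigenpair a (Q bss) (R bss) t y \<longleftrightarrow> (\<exists>i<a. y i \<noteq> 0) \<and> (\<forall>i<a. mat_apply a (Q bss) y i = t * mat_apply a (R bss) y i)"
      unfolding eigenpair_def mat_apply_def ..
    moreover have "mat_apply a (Q bss) y i = t * mat_apply a (R bss) y i \<longleftrightarrow> mat_apply a (D bss 3 0) (xi y) i + t * mat_apply a (D bss 3 1) y i = 0" for i
    proof -
      have "mat_apply a (Q bss) y i - t * mat_apply a (R bss) y i = - dt bss 2 0 * (mat_apply a (D bss 3 0) (xi y) i + t * mat_apply a (D bss 3 1) y i)"
        unfolding Qxi Rap by (simp add: algebra_simps)
      then show ?thesis using nz(2) by (metis eq_iff_diff_eq_0 mult_eq_0_iff neg_equal_0_iff_equal)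
    qed
    ultimately show ?thesis by simp
  qed
  define f where "f (t :: 'k) y = line (g 0 (xi y)) (g 1 y)" for t y
  have V01: "indep2 X Y" if XY: "X \<in> Vs ! 0" "Y \<in> Vs ! 1" "X \<noteq> 0" "Y \<noteq> 0" for X Y
  proof (rule ccontr)
    assume "\<not> indep2 X Y"
    then obtain c where c: "Y = vscale c X" using XY(3) by (rule not_indep2)
    have "Y \<in> Vs ! 0" unfolding c by (rule kvec.subspace_scale[OF Vs XY(1)]) simp
    then show False using disj[of 1 0 Y] nz(1) XY(2,4) by simp
  qed
  have gnz: "g 1 y \<noteq> 0" "g 0 (xi y) \<noteq> 0" if y: "\<exists>i<a. y i \<noteq> 0" for y
  proof -
    show "g 1 y \<noteq> 0" using y glow[of _ 1 y] by (metis zero_fun_apply)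
    show "g 0 (xi y) \<noteq> 0"
    proof
      assume "g 0 (xi y) = 0"
      then have "xi y i = 0" if "i < a" for i using glow[OF that, of 0 "xi y"] by simp
      then have "mat_apply a (D bss 2 0) (xi y) i = 0" for i by (simp add: mat_apply_def)
      then have "mat_apply a (D bss 2 1) y i = 0" if "i < a" for i using xi[OF that, of y] by simp
      then have "y i = 0" if "i < a" for i using mat_apply_injective[OF nz(4)[unfolded dt_def] _ that] by blast
      then show False using y by blast
    qed
  qed
  have find: "indep2 (g 0 (xi y)) (g 1 y)" if "\<exists>i<a. y i \<noteq> 0" for y
    by (rule V01[OF gV gV gnz(2)[OF that] gnz(1)[OF that]]) simp_all
  have fg: "f t y \<in> grassmannian 1 n" if "\<exists>i<a. y i \<noteq> 0" for t y
    unfolding f_def by (rule line_grassmannian[OF find[OF that] coord_subspace[OF Vg gV] coord_subspace[OF Vg gV]]) simp_all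
  show ?thesis
  proof (rule eigenline_count[OF sp, where f = f])
    show "?S = {f t y | t y. eigenpair a (Q bss) (R bss) t y}"
    proof (intro equalityI subsetI)
      fix l assume "l \<in> {f t y | t y. eigenpair a (Q bss) (R bss) t y}"
      then obtain t y where l: "l = f t y" and e: "eigenpair a (Q bss) (R bss) t y" by auto
      have y: "\<exists>i<a. y i \<noteq> 0" using e by (simp add: eigenpair_def)
      let ?X = "g 0 (xi y)" and ?Y = "g 1 y"
      have "vscale 1 ?X + vscale 1 ?Y \<in> Vs ! 2"
        by (subst inV[OF _ gV gV]) (use xi in \<open>simp_all add: apg\<close>)
      moreover have "vscale 1 ?X + vscale t ?Y \<in> Vs ! 3"
        by (subst inV[OF _ gV gV]) (use e[unfolded eig_iff] in \<open>simp_all add: apg\<close>)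
      moreover have "vscale 1 ?X + vscale s ?Y \<noteq> 0" for s using indep2D[OF find[OF y], of 1 s] by auto
      moreover have "vscale 1 ?X + vscale s ?Y \<in> l" for s unfolding l f_def by (rule in_lineI[OF refl])
      ultimately have "meets l (Vs ! 2)" "meets l (Vs ! 3)" using meetsI by blast+
      moreover have "meets l (Vs ! 0)" "meets l (Vs ! 1)" unfolding l f_def
        by (rule meetsI[OF gnz(2)[OF y] line_ends(1) gV], simp) (rule meetsI[OF gnz(1)[OF y] line_ends(2) gV], simp)
      ultimately show "l \<in> ?S" unfolding lines_meeting_def setV using fg[OF y] l by simp
    next
      fix l assume "l \<in> ?S"
      then have lg: "l \<in> grassmannian 1 n" and m: "meets l (Vs ! 0)" "meets l (Vs ! 1)" "meets l (Vs ! 2)" "meets l (Vs ! 3)"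
        unfolding lines_meeting_def setV by auto
      obtain X where X: "X \<noteq> 0" "X \<in> l" "X \<in> Vs ! 0" using m(1) unfolding meets_def by (elim exE conjE)
      obtain Y where Y: "Y \<noteq> 0" "Y \<in> l" "Y \<in> Vs ! 1" using m(2) unfolding meets_def by (elim exE conjE)
      obtain Z where Z: "Z \<noteq> 0" "Z \<in> l" "Z \<in> Vs ! 2" using m(3) unfolding meets_def by (elim exE conjE)
      obtain W where W: "W \<noteq> 0" "W \<in> l" "W \<in> Vs ! 3" using m(4) unfolding meets_def by (elim exE conjE)
      have ind: "indep2 X Y" by (rule V01[OF X(3) Y(3) X(1) Y(1)])
      have lXY: "l = line X Y" by (rule line_eqI[OF lg ind X(2) Y(2)])
      have nonzero: "p \<noteq> 0 \<and> q \<noteq> 0" if pq: "T = vscale p X + vscale q Y" and T: "T \<noteq> 0" "T \<in> Vs ! k" and k: "k = 2 \<or> k = 3" for T p q k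
      proof (intro conjI notI)
        assume "p = 0"
        then have "T = vscale q Y" using pq by (simp add: fun_eq_iff)
        then have "T \<in> Vs ! 1" using kvec.subspace_scale[OF Vs Y(3)] by simp
        then show False using disj[of k 1 T] T k nz by auto
      next
        assume "q = 0"
        then have "T = vscale p X" using pq by (simp add: fun_eq_iff)
        then have "T \<in> Vs ! 0" using kvec.subspace_scale[OF Vs X(3)] by simp
        then show False using disj[of k 0 T] T k nz by auto
      qed
      obtain \<alpha> \<beta> where Zab: "Z = vscale \<alpha> X + vscale \<beta> Y" using Z(2) unfolding lXY in_line_iff by (elim exE)
      obtain \<gamma> \<delta> where Wab: "W = vscale \<gamma> X + vscale \<delta> Y" using W(2) unfolding lXY in_line_iff by (elim exE)
      have ab: "\<alpha> \<noteq> 0" "\<beta> \<noteq> 0" using nonzero[OF Zab Z(1,3)] by simp_all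
      have cd: "\<gamma> \<noteq> 0" "\<delta> \<noteq> 0" using nonzero[OF Wab W(1,3)] by simp_all
      \<comment> \<open>rescale so that the sum of the two points lies on the third subspace\<close>
      let ?X = "vscale \<alpha> X" and ?Y = "vscale \<beta> Y" and ?t = "\<delta> * \<alpha> / (\<gamma> * \<beta>)"
      have XY: "?X \<in> Vs ! 0" "?Y \<in> Vs ! 1" "?X \<in> l" "?Y \<in> l"
        using kvec.subspace_scale[OF Vs X(3)] kvec.subspace_scale[OF Vs Y(3)] kvec.subspace_scale[OF subspace_grassmannian[OF lg] X(2)]
          kvec.subspace_scale[OF subspace_grassmannian[OF lg] Y(2)] by simp_all
      have z: "mat_apply a (D bss 2 0) ?X i + mat_apply a (D bss 2 1) ?Y i = 0" if "i < a" for i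
      proof -
        have "vscale 1 ?X + vscale 1 ?Y \<in> Vs ! 2" using Z(3) unfolding Zab kvec.scale_one .
        then show ?thesis using inV[of 2 ?X ?Y 1 1] XY that by simp
      qed
      have w: "mat_apply a (D bss 3 0) ?X i + ?t * mat_apply a (D bss 3 1) ?Y i = 0" if "i < a" for i
      proof -
        have "vscale 1 ?X + vscale ?t ?Y = vscale (\<alpha> / \<gamma>) W" unfolding Wab using ab cd by (simp add: fun_eq_iff field_simps)
        also have "\<dots> \<in> Vs ! 3" by (rule kvec.subspace_scale[OF Vs W(3)]) simp
        finally show ?thesis using inV[of 3 ?X ?Y 1 ?t] XY that by simp
      qed
      have Xxi: "?X i = xi ?Y i" if i: "i < a" for i
      proof -
        have "mat_apply a (D bss 2 0) (vscale 1 ?X + vscale (- 1) (xi ?Y)) j = 0" if "j < a" for j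
          unfolding mat_apply_comb using z[OF that] xi[OF that, of ?Y] by simp
        from mat_apply_injective[OF nz(2)[unfolded dt_def] this i] show ?thesis by simp
      qed
      have XY0: "?X \<noteq> 0" "?Y \<noteq> 0" using X(1) Y(1) ab by simp_all
      have gX: "g 0 (xi ?Y) = ?X" by (rule g_id[OF _ XY(1)]) (simp_all only: Xxi zero_less_numeral)
      have gY: "g 1 ?Y = ?Y" by (rule g_id[OF _ XY(2)]) simp_all
      have y0: "\<exists>i<a. ?Y i \<noteq> 0" using zero[of 1 ?Y] XY(2) XY0(2) by auto
      have "mat_apply a (D bss 3 0) (xi ?Y) i = mat_apply a (D bss 3 0) ?X i" for i by (rule mat_apply_cong) (simp only: Xxi)
      then have "eigenpair a (Q bss) (R bss) ?t ?Y" unfolding eig_iff using w y0 by simp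
      moreover have "l = f ?t ?Y" unfolding f_def gX gY by (rule line_eqI[OF lg V01[OF XY(1,2) XY0] XY(3,4)])
      ultimately show "l \<in> {f t y | t y. eigenpair a (Q bss) (R bss) t y}" by blast
    qed
  next
    fix t y y' r assume r: "r \<noteq> 0" "\<And>i. i < a \<Longrightarrow> y i = r * y' i" and e: "eigenpair a (Q bss) (R bss) t y"
    have y: "\<exists>i<a. y i \<noteq> 0" using e by (simp add: eigenpair_def)
    then have y': "\<exists>i<a. y' i \<noteq> 0" using r by auto
    have 1: "g 1 y = vscale r (g 1 y')" by (rule gs[OF r(2)])
    have "mat_apply a A y i = r * mat_apply a A y' i" for A i unfolding mat_apply_scale[symmetric] by (rule mat_apply_cong) (simp add: r(2))
    then have e21: "mat_apply a (D bss 2 1) y = vscale r (mat_apply a (D bss 2 1) y')" by (simp add: fun_eq_iff)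
    have "xi y = vscale r (xi y')" unfolding xi_def e21 by (simp add: fun_eq_iff mat_apply_scale)
    then have 2: "g 0 (xi y) = vscale r (g 0 (xi y'))" by (intro gs) simp
    have l: "f t y' \<in> grassmannian 1 n" by (rule fg[OF y'])
    have "g 0 (xi y) \<in> f t y'" "g 1 y \<in> f t y'"
      unfolding 1 2 f_def by (intro kvec.subspace_scale subspace_line line_ends)+
    then show "f t y = f t y'" using line_eqI[OF l find[OF y]] by (simp add: f_def)
  next
    fix t y t' y' assume e1: "eigenpair a (Q bss) (R bss) t y" and e2: "eigenpair a (Q bss) (R bss) t' y'" and eqf: "f t y = f t' y'"
    have y: "\<exists>i<a. y i \<noteq> 0" and y': "\<exists>i<a. y' i \<noteq> 0" using e1 e2 by (simp_all add: eigenpair_def)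
    have "g 1 y' \<in> f t y" unfolding eqf unfolding f_def by (rule line_ends(2))
    then obtain p q where pq: "g 1 y' = vscale p (g 0 (xi y)) + vscale q (g 1 y)" unfolding f_def in_line_iff by (elim exE)
    have "p = 0"
    proof (rule ccontr)
      assume p: "p \<noteq> 0"
      have "g 1 y \<in> Vs ! 1" "g 1 y' \<in> Vs ! 1" by (simp_all add: gV)
      have "vscale q (g 1 y) + vscale p (g 0 (xi y)) \<in> Vs ! 1" using \<open>g 1 y' \<in> Vs ! 1\<close> unfolding pq by (simp add: add.commute)
      then have "g 0 (xi y) \<in> Vs ! 1" using subspace_comb_cancel[OF Vs _ \<open>g 1 y \<in> Vs ! 1\<close> p] by simp
      then show False using disj[of 1 0 "g 0 (xi y)"] nz(1) gV[of 0 "xi y"] gnz(2)[OF y] by simp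
    qed
    then have yq: "y' i = q * y i" if "i < a" for i using fun_cong[OF pq, of i] glow[OF that] by simp
    then have q: "q \<noteq> 0" using y' by auto
    have apq: "mat_apply a A y' i = q * mat_apply a A y i" for A i unfolding mat_apply_scale[symmetric] by (rule mat_apply_cong) (simp add: yq)
    have "\<exists>i<a. mat_apply a (R bss) y i \<noteq> 0" using simple_pencil_injective[OF sp, of y] y unfolding mat_apply_def by blast
    then obtain i where i: "i < a" "mat_apply a (R bss) y i \<noteq> 0" by blast
    have "mat_apply a (Q bss) y i = t * mat_apply a (R bss) y i" "mat_apply a (Q bss) y' i = t' * mat_apply a (R bss) y' i"
      using e1 e2 i(1) unfolding eigenpair_def mat_apply_def by blast+
    then have "q * (t * mat_apply a (R bss) y i) = q * (t' * mat_apply a (R bss) y i)" unfolding apq by (simp add: algebra_simps)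
    then show "t = t'" using q i(2) by simp
  qed
qed

end

context four_subspaces
begin

lemma enumerated_points_indep:
  assumes ws: "length ws = a" "distinct ws" "set ws = Sol"
  shows "\<exists>q. fam_indep a q \<and> (\<forall>k<a. q k \<in> ws ! k \<and> q k \<in> L1)"
proof -
  have card: "card Sol = a" using distinct_card[OF ws(2)] ws(1,3) by simp
  have "\<forall>l\<in>Sol. \<exists>v. v \<in> l \<and> v \<in> L1 \<and> v \<noteq> 0"
    by (auto simp: lines_meeting_def meets_def)
  then obtain w where w: "\<And>l. l \<in> Sol \<Longrightarrow> w l \<in> l \<and> w l \<in> L1 \<and> w l \<noteq> 0" by metis
  have bij: "bij_betw (\<lambda>k. ws ! k) {..<a} Sol" using bij_betw_nth[OF ws(2), of "{..<a}" Sol] ws(1,3) by simp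
  have wS: "ws ! k \<in> Sol" if "k < a" for k using that ws(1,3) nth_mem[of k ws] by simp
  have "fam_indep a (\<lambda>k. w (ws ! k))" unfolding fam_indep_def
  proof (intro allI impI)
    fix c k assume c: "lcomb a c (\<lambda>k. w (ws ! k)) = 0" and k: "k < a"
    let ?c = "\<lambda>l. c (the_inv_into {..<a} (\<lambda>k. ws ! k) l)"
    have inv: "?c (ws ! j) = c j" if "j < a" for j
      using the_inv_into_f_f[OF bij_betw_imp_inj_on[OF bij]] that by simp
    have "(\<Sum>l\<in>Sol. vscale (?c l) (w l)) = (\<Sum>j<a. vscale (?c (ws ! j)) (w (ws ! j)))"
      by (rule sum.reindex_bij_betw[OF bij, symmetric])
    also have "\<dots> = (\<Sum>j<a. vscale (c j) (w (ws ! j)))" using inv by (intro sum.cong) simp_all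
    also have "\<dots> = 0" using c unfolding lcomb_eq_sum .
    finally have rel: "(\<Sum>l\<in>Sol. vscale (?c l) (w l)) = 0" .
    have "?c (ws ! k) = 0" by (rule solution_points_indep[where c = ?c and w = w and l = "ws ! k", OF card w rel wS[OF k]])
    then show "c k = 0" using inv[OF k] by simp
  qed
  then show ?thesis using w wS by blast
qed

end

context second_problem
begin

text \<open>
  Four diagonal maps with entries \<open>0\<close>, \<open>1\<close>, \<open>c\<close> and \<open>t r\<close>. The solutions are then the lines over the
  coordinate axes, with the cross ratios of \<open>0, 1, c, t r\<close>, which are distinct for injective \<open>t\<close>.
\<close>

lemma chart_second_nonempty: "chart_locus n ks Is P \<noteq> {}"
proof -
  obtain c0 :: "nat \<Rightarrow> 'k" where c0: "\<And>i. c0 i \<notin> {0, 1}" using injective_sequence_avoiding[of "{0, 1}"] by blast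
  define c where "c = c0 0"
  have c: "c \<noteq> 0" "c \<noteq> 1" using c0[of 0] by (auto simp: c_def)
  obtain t :: "nat \<Rightarrow> 'k" where t: "inj t" "\<And>i. t i \<notin> {0, 1}" using injective_sequence_avoiding[of "{0, 1}"] by blast
  have t01: "t i \<noteq> 0" "t i \<noteq> 1" for i using t(2)[of i] by auto
  define m where "m j r = (if j = 0 then 0 else if j = 1 then 1 else if j = 2 then c else t r)" for j r :: nat
  define bas where "bas j r = unitv r + vscale (m j r) (unitv (a + r))" for j r
  define bss where "bss = map (\<lambda>i. map (bas i) [0..<ks ! i + 1]) [0..<length ks]"
  have lk: "length ks = 4" "ks ! i = a - 1" if "i < 4" for i using that by (simp_all add: ks_def)
  have M: "M bss j i r = (if i = r then m j r else 0)" if "j < 4" "i < a" "r < a" for j i r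
  proof -
    have "bss ! j ! r = bas j r" using that lk unfolding bss_def by (simp del: upt_Suc)
    then show ?thesis using that by (simp add: M_def bas_def unitv_def)
  qed
  have D: "D bss k l i r = (if i = r then m k r - m l r else 0)" if "k < 4" "l < 4" "i < a" "r < a" for k l i r
    using that by (simp add: D_def M)
  have apD: "mat_apply a (D bss k l) y i = (m k i - m l i) * y i" if "k < 4" "l < 4" "i < a" for k l y i
  proof -
    have "mat_apply a (D bss k l) y i = (\<Sum>j<a. if j = i then (m k i - m l i) * y i else 0)"
      unfolding mat_apply_def using D that by (intro sum.cong) auto
    then show ?thesis using that by simp
  qed
  have dt: "dt bss k l \<noteq> 0" if "k < 4" "l < 4" "\<And>r. m k r \<noteq> m l r" for k l
    unfolding dt_def det_zero_iff_kernel using apD[OF that(1,2)] that(3) by (auto simp: mat_apply_def)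
  have dts: "dt bss 1 0 \<noteq> 0" "dt bss 2 0 \<noteq> 0" "dt bss 3 0 \<noteq> 0" "dt bss 2 1 \<noteq> 0" "dt bss 3 1 \<noteq> 0"
    by (rule dt; use c t01 in \<open>simp add: m_def\<close>)+
  let ?d = "dt bss 2 0"
  have adj: "adjugate a (D bss 2 0) i l = (if i = l then ?d / c else 0)" if "i < a" "l < a" for i l
  proof -
    have "mat_apply a (adjugate a (D bss 2 0)) (unitv l) i = (\<Sum>j<a. if j = l then adjugate a (D bss 2 0) i l else 0)"
      unfolding mat_apply_def unitv_def by (intro sum.cong) auto
    then have e: "mat_apply a (adjugate a (D bss 2 0)) (unitv l) i = adjugate a (D bss 2 0) i l" using that by simp
    have "c * mat_apply a (adjugate a (D bss 2 0)) (unitv l) i = ?d * unitv l i"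
      using mat_apply_adjugate[OF that(1), of "D bss 2 0" "unitv l"] apD[of 2 0 i] that(1) by (simp add: m_def dt_def)
    then show ?thesis unfolding e using c(1) by (auto simp: unitv_def field_simps split: if_splits)
  qed
  have comp: "mat_compose a A B i j = (if i = j then p i * q i else 0)"
    if "\<And>i k. i < a \<Longrightarrow> k < a \<Longrightarrow> A i k = (if i = k then p i else 0)" "\<And>i k. i < a \<Longrightarrow> k < a \<Longrightarrow> B i k = (if i = k then q i else 0)"
      "i < a" "j < a" for A B i j and p q :: "nat \<Rightarrow> 'k"
  proof -
    have "mat_compose a A B i j = (\<Sum>k<a. if k = i then p i * B i j else 0)" unfolding mat_compose_def using that(1,3) by (intro sum.cong) auto
    then show ?thesis using that(2)[OF that(3,4)] that(3) by simp
  qed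
  have D': "D bss 3 0 i k = (if i = k then t i else 0)" "D bss 2 1 i k = (if i = k then c - 1 else 0)"
    "D bss 3 1 i k = (if i = k then t i - 1 else 0)" if "i < a" "k < a" for i k
    using that by (simp_all add: D) (simp_all add: m_def)
  have Q: "Q bss i k = (if i = k then t i * (?d / c * (c - 1)) else 0)" if "i < a" "k < a" for i k
    unfolding Q_def by (rule comp[OF D'(1) comp[OF adj D'(2)] that])
  have R: "R bss i k = (if i = k then ?d * (t i - 1) else 0)" if "i < a" "k < a" for i k
    unfolding R_def D'(3)[OF that] by simp
  have "inj_on (\<lambda>i. t i * (?d / c * (c - 1)) / (?d * (t i - 1))) {..<a}"
  proof (rule inj_onI)
    fix i j assume e: "t i * (?d / c * (c - 1)) / (?d * (t i - 1)) = t j * (?d / c * (c - 1)) / (?d * (t j - 1))"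
    have "t x * (?d / c * (c - 1)) / (?d * (t x - 1)) = (c - 1) / c * (t x / (t x - 1))" for x
      using dts(2) c t01[of x] by (simp add: field_simps)
    then have "(c - 1) / c * (t i / (t i - 1)) = (c - 1) / c * (t j / (t j - 1))" using e by simp
    moreover have "(c - 1) / c \<noteq> 0" using c by simp
    ultimately have "t i / (t i - 1) = t j / (t j - 1)" using mult_left_cancel by blast
    moreover have "t i - 1 \<noteq> 0" "t j - 1 \<noteq> 0" using t01 by simp_all
    ultimately have "t i * (t j - 1) = t j * (t i - 1)" by (simp add: frac_eq_eq)
    then have "t i = t j" by (simp add: algebra_simps)
    then show "i = j" using t(1) by (simp add: inj_def)
  qed
  then have "simple_pencil a (Q bss) (R bss) (\<lambda>k. t k * (?d / c * (c - 1)) / (?d * (t k - 1))) (\<lambda>k i. if i = k then 1 else 0)"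
    by (rule diagonal_pencil[OF Q R, rotated 5]) (use dts(2) t01 in simp_all)
  from simple_pencil_imp_disc[OF _ this] a dts have "P bss \<noteq> 0" unfolding P_def by simp
  then show ?thesis unfolding bss_def
  proof (rule chart_locus_nonempty[rotated 2])
    fix i r assume ir: "i < length ks" "r \<le> ks ! i"
    then have i: "i < 4" "r < a" using lk[of 0] lk[of i] a by auto
    show "bas i r \<in> coord_space n" using i n by (auto simp: bas_def coord_space_def unitv_def)
    fix c assume c: "c \<le> ks ! i"
    then have "c < a" using lk(2)[OF i(1)] a by simp
    then show "bas i r (Is i ! c) = (if r = c then 1 else 0)" using i by (simp add: Is_def bas_def unitv_def)
  qed
qed

lemma full_symmetric_second: "full_symmetric_galois_group K [a - 1, a - 1, a - 1, a - 1]"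
proof -
  let ?a = "[a - 1, a - 1, a - 1, a - 1]"
  have amb: "ambient_dim ?a = n" using a n by (simp add: ambient_dim_def)
  have cd: "condition_dims ?a = ks" unfolding condition_dims_def amb ks_def using a n by (simp add: numeral_eq_Suc)
  interpret configurations ?a n a 4 False K
    by unfold_locales (use a amb cd in \<open>simp_all add: ks_def\<close>)
  show ?thesis
  proof (rule galois_group_of_configurations[where U = "chart_locus n ks Is P", unfolded cd])
    show "openin (zariski n ks) (chart_locus n ks Is P)" by (rule openin_chart_locus[OF Is_ok pfun_P])
    show "chart_locus n ks Is P \<noteq> {}" by (rule chart_second_nonempty)
    show "chart_locus n ks Is P \<subseteq> multi_grassmannian n ks" by (auto simp: chart_locus_def)
  next
    fix Ls assume "Ls \<in> chart_locus n ks Is P"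
    then show "finite (lines_meeting n (set Ls)) \<and> card (lines_meeting n (set Ls)) = a"
      unfolding chart_locus_def using count_second by blast
  next
    fix Ls :: "(nat \<Rightarrow> 'k) set list" and ws and j :: nat
    assume L: "Ls \<in> multi_grassmannian n ks" and ws: "length ws = a" "distinct ws" "set ws = lines_meeting n (set Ls)" and j: "j < 4"
    have len: "length Ls = 4" using L by (auto simp: multi_grassmannian_def ks_def dest: list_all2_lengthD)
    have setL: "set Ls = {Ls ! 0, Ls ! 1, Ls ! 2, Ls ! 3}"
      unfolding set_conv_image_nth len by (auto simp: numeral_eq_Suc less_Suc_eq)
    have Lg: "Ls ! i \<in> grassmannian (a - 1) n" if "i < 4" for i
      using L that by (auto simp: multi_grassmannian_def ks_def list_all2_conv_all_nth)
    have fin: "finite (lines_meeting n (set Ls))" unfolding ws(3)[symmetric] by simp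
    have main: "\<exists>q. fam_indep a q \<and> (\<forall>k<a. q k \<in> ws ! k \<and> q k \<in> Ls ! j)"
      if p: "p < 4" "q < 4" "r < 4" and s: "set Ls = {Ls ! j, Ls ! p, Ls ! q, Ls ! r}" for p q r
    proof -
      interpret four_subspaces n a "Ls ! j" "Ls ! p" "Ls ! q" "Ls ! r"
        using second_problem_axioms Lg[OF j] Lg[OF p(1)] Lg[OF p(2)] Lg[OF p(3)] fin unfolding s second_problem_def
        by unfold_locales simp_all
      show ?thesis by (rule enumerated_points_indep[OF ws(1,2)]) (use ws(3) s in simp)
    qed
    consider "j = 0" | "j = 1" | "j = 2" | "j = 3" using j by linarith
    then show "\<exists>q. fam_indep a q \<and> (\<forall>k<a. q k \<in> ws ! k \<and> q k \<in> Ls ! j)"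
    proof cases
      case 1 show ?thesis by (rule main[of 1 2 3]) (use setL 1 in \<open>simp_all add: insert_commute\<close>)
    next
      case 2 show ?thesis by (rule main[of 0 2 3]) (use setL 2 in \<open>simp_all add: insert_commute\<close>)
    next
      case 3 show ?thesis by (rule main[of 0 1 3]) (use setL 3 in \<open>simp_all add: insert_commute\<close>)
    next
      case 4 show ?thesis by (rule main[of 0 1 2]) (use setL 4 in \<open>simp_all add: insert_commute\<close>)
    qed
  qed
qed

end

theorem mainTheorem2:
  fixes K :: "'k::alg_closed_field itself"
  shows "(\<forall>n::nat. 3 \<le> n \<longrightarrow>
            valid_problem (replicate n 1 @ [n - 2]) \<and>
            ambient_dim (replicate n 1 @ [n - 2]) = n \<and>
            full_symmetric_galois_group K (replicate n 1 @ [n - 2])) \<and>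
         (\<forall>a::nat. 2 \<le> a \<longrightarrow>
            valid_problem [a - 1, a - 1, a - 1, a - 1] \<and>
            ambient_dim [a - 1, a - 1, a - 1, a - 1] = 2 * a - 1 \<and>
            full_symmetric_galois_group K [a - 1, a - 1, a - 1, a - 1])"
proof (intro conjI allI impI)
  fix n :: nat assume n: "3 \<le> n"
  interpret first_problem n K by unfold_locales (rule n)
  show amb: "ambient_dim (replicate n 1 @ [n - 2]) = n" using n by (simp add: ambient_dim_def sum_list_replicate)
  have "even (sum_list (replicate n 1 @ [n - 2]))" using n by (simp add: sum_list_replicate)
  then show "valid_problem (replicate n 1 @ [n - 2])"
    unfolding valid_problem_def schubert_problem_def amb using n by auto
  show "full_symmetric_galois_group K (replicate n 1 @ [n - 2])" by (rule full_symmetric_first)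
next
  fix a :: nat assume a: "2 \<le> a"
  interpret second_problem a "2 * a - 1" K by unfold_locales (use a in simp_all)
  show amb: "ambient_dim [a - 1, a - 1, a - 1, a - 1] = 2 * a - 1" using a by (simp add: ambient_dim_def)
  show "valid_problem [a - 1, a - 1, a - 1, a - 1]"
    unfolding valid_problem_def schubert_problem_def amb using a by auto
  show "full_symmetric_galois_group K [a - 1, a - 1, a - 1, a - 1]" by (rule full_symmetric_second)
qed

end
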